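(* Let $\Lambda$ be a ring with involution over which the rank of finitely generated free modules is well-defined, and let $n\ge 0$. The function $$\Phi:M_{(-1)^n}(\Lambda)\to L_{2n+1}(\Lambda);\quad \alpha\mapsto\Phi_k(\alpha)\quad(\alpha\in U_{(-1)^n,k}(\Lambda))$$ is an isomorphism of groups, where for $\alpha=\begin{pmatrix}\gamma&\tilde\gamma\\\mu&\tilde\mu\end{pmatrix}$ the class $\Phi_k(\alpha)$ is that of the $(-1)^n$-quadratic formation $$\Phi_k(\alpha)=\Big(H_{(-1)^n}(\Lambda^k);\Lambda^k,\mathrm{im}\big(\tbinom{\gamma}{\mu}:\Lambda^k\to\Lambda^k\oplus(\Lambda^k)^*\big)\Big).$$
   Context: Rings and duals: $\Lambda$ is an associative ring with $1$ and an involution $a\mapsto\bar a$ (additive, $\overline{ab}=\bar b\,\bar a$, $\bar{\bar a}=a$, $\bar 1=1$). Modules are left modules. $K^*=\mathrm{Hom}_\Lambda(K,\Lambda)$ is a left module by $(af)(x)=f(x)\bar a$; $f^*$ is the dual of $f$; $K^{**}=K$ for $K$ f.g. projective via $x\mapsto(f\mapsto\overline{f(x)})$. $(\Lambda^k)^*$ is identified with $\Lambda^k$ in the standard way, so that $f\mapsto f^*$ is conjugate transposition of matrices. Forms ($\epsilon=\pm1$): $S(K)=\mathrm{Hom}_\Lambda(K,K^* )$, $\psi(x,y)=\psi(x)(y)$, with $\psi(ax,by)=b\psi(x,y)\bar a$; $Q_\epsilon(K)=S(K)/\{\chi-\epsilon\chi^*\}$; $Q_\epsilon(\Lambda)=\Lambda/\{a-\epsilon\bar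 a\}$. An $\epsilon$-quadratic form $(K,\lambda,\mu)$: $\lambda\in S(K)$ with $\lambda(x,y)=\epsilon\overline{\lambda(y,x)}$ and $\mu:K\to Q_\epsilon(\Lambda)$ with $\mu(x+y)-\mu(x)-\mu(y)=\lambda(x,y)\in Q_\epsilon(\Lambda)$, $\mu(x)+\epsilon\overline{\mu(x)}=\lambda(x,x)$, $\mu(ax)=a\mu(x)\bar a$; equivalently a class $\phi\in Q_\epsilon(K)$ via $\lambda=\phi+\epsilon\phi^*$, $\mu(x)=\phi(x,x)$. Nonsingular: $\lambda:K\to K^*$ an isomorphism. Isomorphisms preserve $\lambda,\mu$. $H_\epsilon(L)$ is the form on $L\oplus L^*$ with $\lambda((x,f),(y,g))=f(y)+\epsilon\overline{g(x)}$, $\mu(x,f)=f(x)$. A lagrangian of a nonsingular form is a direct summand $L$ with $\mu(L)=0$ and $L=L^\perp$ (orthogonal for $\lambda$). Unitary groups: $U_{\epsilon,k}(\Lambda)$ is the group of automorphisms of the form $H_\epsilon(\Lambda^k)$, written as $2k\times2k$ matrices with respect to $\Lambda^k\oplus(\Lambda^k)^*$. $EU_{\epsilon,k}(\Lambda)$ is the normal subgroup of $U_{\epsilon,k}(\Lambda)$ generated by the elements $\begin{pmatrix}\alpha&0\\0&\alpha^{*-1}\end{pmatrix}$ ($\alpha\in GL_k(\Lambda)$) and $\begin{pmatrix}1&0\\\theta-\epsilon\theta^*&1\end{pmatrix}$ ($\theta\in S(\Lambda^k)$). Stabilization $U_{\epsilon,k}(\Lambda)\to U_{\epsilon,k+1}(\Lambda)$,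 $f\mapsto f\oplus1$, uses $H_\epsilon(\Lambda^{k+1})=H_\epsilon(\Lambda^k)\oplus H_\epsilon(\Lambda)$. $U_\epsilon(\Lambda)=\bigcup_kU_{\epsilon,k}(\Lambda)$, $EU_\epsilon(\Lambda)=\bigcup_kEU_{\epsilon,k}(\Lambda)$, and $M_\epsilon(\Lambda)=U_\epsilon(\Lambda)/\{EU_\epsilon(\Lambda),\sigma_\epsilon\}$ is the quotient by the normal subgroup generated by $EU_\epsilon(\Lambda)$ and $\sigma_\epsilon=\begin{pmatrix}0&1\\\epsilon&0\end{pmatrix}\in U_{\epsilon,1}(\Lambda)$. Formations: an $\epsilon$-quadratic formation $(Q,\phi;F,G)$ is a nonsingular $\epsilon$-quadratic form with an ordered pair of lagrangians, $Q,F,G$ f.g. free. Isomorphisms are isomorphisms of forms carrying $F$ to $F'$, $G$ to $G'$. Trivial: isomorphic to $(H_\epsilon(L);L,L^* )$, $L$ f.g. free. Stable isomorphism: isomorphism after adding trivial formations to both sides. The boundary of a (possibly singular) $(-\epsilon)$-quadratic form $(K,\lambda,\mu)$, $K$ f.g. free, is $\partial(K,\lambda,\mu)=(H_\epsilon(K);K,\{(x,\lambda(x)):x\in K\})$. $L_{2n+1}(\Lambda)$ is identified with the abelian group of equivalence classes of $(-1)^n$-quadratic formations over $\Lambda$, where $(Q,\phi;F,G)\sim(Q',\phi';F',G')$ if $(Q,\phi;F,G)\oplus(Q',-\phi';F',G')$ is stably isomorphic to $\partial(K,\lambda,\mu)$ for some $(-1)^{n+1}$-quadratic form $(K,\lambda,\mu)$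 with $K$ f.g. free; addition is $\oplus$ and $-(Q,\phi;F,G)=(Q,-\phi;F,G)$. *)

theory Defs
  imports "HOL-Algebra.Module" "HOL-Algebra.AbelCoset" "HOL-Algebra.Bij"
begin

section \<open>Rings with involution and left modules\<close>

class involution_ring = ring_1 +
  fixes bar :: "'a \<Rightarrow> 'a"
  assumes bar_add: "bar (a + b) = bar a + bar b"
    and bar_mult: "bar (a * b) = bar b * bar a"
    and bar_bar: "bar (bar a) = a"
    and bar_one: "bar 1 = 1"

text \<open>
  The locale \<^locale>\<open>module\<close> of HOL-Algebra requires a commutative ring, so left modules over a
  type-class ring are introduced here on top of the same record and \<^locale>\<open>abelian_group\<close>.
  The fields \<^const>\<open>mult\<close> and \<^const>\<open>one\<close> which the record inherits from rings are never used.
\<close>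

definition mk_module ::
  "'m set \<Rightarrow> 'm \<Rightarrow> ('m \<Rightarrow> 'm \<Rightarrow> 'm) \<Rightarrow> ('a \<Rightarrow> 'm \<Rightarrow> 'm) \<Rightarrow> ('a, 'm) module" where
  "mk_module C z p s =
     \<lparr>carrier = C, mult = undefined, one = undefined, zero = z, add = p, smult = s\<rparr>"

locale left_module = abelian_group M for M :: "('a::ring_1, 'm) module" (structure) +
  assumes smult_closed: "x \<in> carrier M \<Longrightarrow> a \<odot> x \<in> carrier M"
    and smult_l_distr: "x \<in> carrier M \<Longrightarrow> (a + b) \<odot> x = (a \<odot> x) \<oplus> (b \<odot> x)"
    and smult_r_distr: "\<lbrakk>x \<in> carrier M; y \<in> carrier M\<rbrakk> \<Longrightarrow> a \<odot> (x \<oplus> y) = (a \<odot> x) \<oplus> (a \<odot> y)"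
    and smult_assoc: "x \<in> carrier M \<Longrightarrow> (a * b) \<odot> x = a \<odot> (b \<odot> x)"
    and smult_one: "x \<in> carrier M \<Longrightarrow> 1 \<odot> x = x"

text \<open>Homomorphisms are extensional functions, so that Hom-sets are honest sets of maps.\<close>

definition lhom :: "('a, 'm) module \<Rightarrow> ('a, 'n) module \<Rightarrow> ('m \<Rightarrow> 'n) set" where
  "lhom M N = {f \<in> carrier M \<rightarrow>\<^sub>E carrier N.
     (\<forall>x \<in> carrier M. \<forall>y \<in> carrier M. f (x \<oplus>\<^bsub>M\<^esub> y) = f x \<oplus>\<^bsub>N\<^esub> f y) \<and>
     (\<forall>a. \<forall>x \<in> carrier M. f (a \<odot>\<^bsub>M\<^esub> x) = a \<odot>\<^bsub>N\<^esub> f x)}"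

definition liso :: "('a, 'm) module \<Rightarrow> ('a, 'n) module \<Rightarrow> ('m \<Rightarrow> 'n) set" where
  "liso M N = {f \<in> lhom M N. bij_betw f (carrier M) (carrier N)}"

definition ring_module :: "('a::ring_1, 'a) module" where
  "ring_module = mk_module UNIV 0 (+) (*)"

definition free_module :: "nat \<Rightarrow> ('a::ring_1, nat \<Rightarrow> 'a) module" where
  "free_module k = mk_module {x. \<forall>i\<ge>k. x i = 0} (\<lambda>_. 0) (\<lambda>x y i. x i + y i) (\<lambda>a x i. a * x i)"

definition unit_vec :: "nat \<Rightarrow> nat \<Rightarrow> 'a::ring_1" where
  "unit_vec i = (\<lambda>j. if j = i then 1 else 0)"

definition free_of_rank :: "nat \<Rightarrow> ('a::ring_1, 'm) module \<Rightarrow> bool" where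
  "free_of_rank k M \<longleftrightarrow> left_module M \<and> liso (free_module k) M \<noteq> {}"

definition fg_free :: "('a::ring_1, 'm) module \<Rightarrow> bool" where
  "fg_free M \<longleftrightarrow> (\<exists>k. free_of_rank k M)"

text \<open>
  Quantifiers over all finitely generated free modules are rendered by quantifying over all
  modules whose carrier is a set of functions \<^typ>\<open>nat \<Rightarrow> 'a\<close>: every finitely generated free
  module, on whatever type, is isomorphic to one of these, for instance to some
  \<^term>\<open>free_module k\<close>. The same universe serves for forms and formations below.
\<close>

definition rank_well_defined :: "'a::ring_1 itself \<Rightarrow> bool" where
  "rank_well_defined _ \<longleftrightarrow>
     (\<forall>(M :: ('a, nat \<Rightarrow> 'a) module) k l. free_of_rank k M \<and> free_of_rank l M \<longrightarrow> k = l)"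

definition direct_sum :: "('a, 'm) module \<Rightarrow> ('a, 'n) module \<Rightarrow> ('a, 'm \<times> 'n) module" where
  "direct_sum M N = mk_module (carrier M \<times> carrier N) (\<zero>\<^bsub>M\<^esub>, \<zero>\<^bsub>N\<^esub>)
     (\<lambda>(x, x') (y, y'). (x \<oplus>\<^bsub>M\<^esub> y, x' \<oplus>\<^bsub>N\<^esub> y'))
     (\<lambda>a (x, x'). (a \<odot>\<^bsub>M\<^esub> x, a \<odot>\<^bsub>N\<^esub> x'))"

definition left_submodule :: "'m set \<Rightarrow> ('a::ring_1, 'm) module \<Rightarrow> bool" where
  "left_submodule L M \<longleftrightarrow> L \<subseteq> carrier M \<and> left_module (M\<lparr>carrier := L\<rparr>)"

definition direct_summand :: "'m set \<Rightarrow> ('a::ring_1, 'm) module \<Rightarrow> bool" where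
  "direct_summand L M \<longleftrightarrow> left_submodule L M \<and>
     (\<exists>N. left_submodule N M \<and> L \<inter> N = {\<zero>\<^bsub>M\<^esub>} \<and> set_add M L N = carrier M)"


section \<open>Duality\<close>

definition dual :: "('a::involution_ring, 'm) module \<Rightarrow> ('a, 'm \<Rightarrow> 'a) module" where
  "dual K = mk_module (lhom K ring_module) (\<lambda>x \<in> carrier K. 0)
     (\<lambda>f g. \<lambda>x \<in> carrier K. f x + g x)
     (\<lambda>a f. \<lambda>x \<in> carrier K. f x * bar a)"

definition dual_map :: "('a, 'm) module \<Rightarrow> ('a, 'n) module \<Rightarrow> ('m \<Rightarrow> 'n) \<Rightarrow> ('n \<Rightarrow> 'a::involution_ring) \<Rightarrow> 'm \<Rightarrow> 'a"
  where "dual_map K L f = (\<lambda>g \<in> carrier (dual L). \<lambda>x \<in> carrier K. g (f x))"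

definition double_dual :: "('a::involution_ring, 'm) module \<Rightarrow> 'm \<Rightarrow> ('m \<Rightarrow> 'a) \<Rightarrow> 'a" where
  "double_dual K = (\<lambda>x \<in> carrier K. \<lambda>f \<in> carrier (dual K). bar (f x))"

text \<open>The group \<open>S(K)\<close>; a pairing \<open>\<psi>(x, y)\<close> is written \<open>\<psi> x y\<close>.\<close>

definition pairings :: "('a::involution_ring, 'm) module \<Rightarrow> ('m \<Rightarrow> 'm \<Rightarrow> 'a) set" where
  "pairings K = lhom K (dual K)"

text \<open>The dual of \<open>\<psi> : K \<rightarrow> K\<^sup>*\<close>, regarded again as a map \<open>K \<rightarrow> K\<^sup>*\<close> by means of \<open>K \<rightarrow> K\<^sup>*\<^sup>*\<close>.\<close>

definition pairing_dual ::
  "('a::involution_ring, 'm) module \<Rightarrow> ('m \<Rightarrow> 'm \<Rightarrow> 'a) \<Rightarrow> 'm \<Rightarrow> 'm \<Rightarrow> 'a" where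
  "pairing_dual K \<psi> = (\<lambda>x \<in> carrier K. dual_map K (dual K) \<psi> (double_dual K x))"

text \<open>
  The standard identification of \<open>\<Lambda>\<^sup>k\<close> with its dual sends \<open>a\<close> to
  \<open>x \<mapsto> \<Sum>\<^sub>i x\<^sub>i \<cdot> bar a\<^sub>i\<close>; this is linear for the left module structure on the dual.
\<close>

definition vec_to_dual :: "nat \<Rightarrow> (nat \<Rightarrow> 'a::involution_ring) \<Rightarrow> (nat \<Rightarrow> 'a) \<Rightarrow> 'a" where
  "vec_to_dual k =
     (\<lambda>a \<in> carrier (free_module k). \<lambda>x \<in> carrier (free_module k). \<Sum>i<k. x i * bar (a i))"

definition dual_to_vec :: "nat \<Rightarrow> ((nat \<Rightarrow> 'a::involution_ring) \<Rightarrow> 'a) \<Rightarrow> nat \<Rightarrow> 'a" where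
  "dual_to_vec k = inv_into (carrier (free_module k)) (vec_to_dual k)"


section \<open>Quadratic forms\<close>

text \<open>
  The class of \<open>a\<close> in \<open>Q\<^sub>\<epsilon>(\<Lambda>) = \<Lambda> / {b - \<epsilon> bar b}\<close>, as a coset. The conditions on a
  \<open>Q\<^sub>\<epsilon>(\<Lambda>)\<close>-valued function \<open>\<mu>\<close> are expressed through arbitrary representatives of its values.
  The sign \<open>\<epsilon> = \<plusminus>1\<close> is an element of the ring throughout.
\<close>

definition qclass :: "'a::involution_ring \<Rightarrow> 'a \<Rightarrow> 'a set" where
  "qclass \<epsilon> a = {a + (b - \<epsilon> * bar b) |b. True}"

record ('a, 'm) qform =
  qmodule :: "('a, 'm) module"
  qlam :: "'m \<Rightarrow> 'm \<Rightarrow> 'a"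
  qmu :: "'m \<Rightarrow> 'a set"

definition quadratic_form :: "'a::involution_ring \<Rightarrow> ('a, 'm) qform \<Rightarrow> bool" where
  "quadratic_form \<epsilon> \<phi> \<longleftrightarrow>
     (let K = qmodule \<phi>; l = qlam \<phi>; m = qmu \<phi> in
        left_module K \<and>
        l \<in> pairings K \<and>
        (\<forall>x \<in> carrier K. \<forall>y \<in> carrier K. l x y = \<epsilon> * bar (l y x)) \<and>
        m ` carrier K \<subseteq> range (qclass \<epsilon>) \<and>
        (\<forall>x \<in> carrier K. \<forall>y \<in> carrier K. \<forall>r \<in> m (x \<oplus>\<^bsub>K\<^esub> y). \<forall>p \<in> m x. \<forall>q \<in> m y.
           qclass \<epsilon> (r - p - q) = qclass \<epsilon> (l x y)) \<and>
        (\<forall>x \<in> carrier K. \<forall>p \<in> m x. p + \<epsilon> * bar p = l x x) \<and>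
        (\<forall>a. \<forall>x \<in> carrier K. \<forall>p \<in> m x. m (a \<odot>\<^bsub>K\<^esub> x) = qclass \<epsilon> (a * p * bar a)))"

definition nonsingular :: "('a::involution_ring, 'm) qform \<Rightarrow> bool" where
  "nonsingular \<phi> \<longleftrightarrow> qlam \<phi> \<in> liso (qmodule \<phi>) (dual (qmodule \<phi>))"

definition qform_iso :: "('a, 'm) qform \<Rightarrow> ('a, 'n) qform \<Rightarrow> ('m \<Rightarrow> 'n) set" where
  "qform_iso \<phi> \<phi>' = {h \<in> liso (qmodule \<phi>) (qmodule \<phi>').
     (\<forall>x \<in> carrier (qmodule \<phi>). \<forall>y \<in> carrier (qmodule \<phi>). qlam \<phi>' (h x) (h y) = qlam \<phi> x y) \<and>
     (\<forall>x \<in> carrier (qmodule \<phi>). qmu \<phi>' (h x) = qmu \<phi> x)}"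

definition qform_sum ::
  "('a::involution_ring, 'm) qform \<Rightarrow> ('a, 'n) qform \<Rightarrow> ('a, 'm \<times> 'n) qform" where
  "qform_sum \<phi> \<phi>' =
     (let K = direct_sum (qmodule \<phi>) (qmodule \<phi>') in
      \<lparr>qmodule = K,
       qlam = (\<lambda>(x, x') \<in> carrier K. \<lambda>(y, y') \<in> carrier K. qlam \<phi> x y + qlam \<phi>' x' y'),
       qmu = (\<lambda>(x, x'). {p + p' |p p'. p \<in> qmu \<phi> x \<and> p' \<in> qmu \<phi>' x'})\<rparr>)"

definition qform_neg :: "('a::involution_ring, 'm) qform \<Rightarrow> ('a, 'm) qform" where
  "qform_neg \<phi> =
     \<lparr>qmodule = qmodule \<phi>,
      qlam = (\<lambda>x \<in> carrier (qmodule \<phi>). \<lambda>y \<in> carrier (qmodule \<phi>). - qlam \<phi> x y),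
      qmu = (\<lambda>x. uminus ` qmu \<phi> x)\<rparr>"

definition hyperbolic_module ::
  "('a::involution_ring, 'm) module \<Rightarrow> ('a, 'm \<times> ('m \<Rightarrow> 'a)) module" where
  "hyperbolic_module L = direct_sum L (dual L)"

definition hyperbolic ::
  "'a::involution_ring \<Rightarrow> ('a, 'm) module \<Rightarrow> ('a, 'm \<times> ('m \<Rightarrow> 'a)) qform" where
  "hyperbolic \<epsilon> L =
     \<lparr>qmodule = hyperbolic_module L,
      qlam = (\<lambda>(x, f) \<in> carrier (hyperbolic_module L). \<lambda>(y, g) \<in> carrier (hyperbolic_module L).
                f y + \<epsilon> * bar (g x)),
      qmu = (\<lambda>(x, f). qclass \<epsilon> (f x))\<rparr>"

definition lagrangian :: "'a::involution_ring \<Rightarrow> ('a, 'm) qform \<Rightarrow> 'm set \<Rightarrow> bool" where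
  "lagrangian \<epsilon> \<phi> L \<longleftrightarrow>
     direct_summand L (qmodule \<phi>) \<and>
     (\<forall>x \<in> L. qmu \<phi> x = qclass \<epsilon> 0) \<and>
     L = {x \<in> carrier (qmodule \<phi>). \<forall>y \<in> L. qlam \<phi> x y = 0}"


section \<open>Formations and the odd-dimensional L-group\<close>

record ('a, 'm) formation =
  fform :: "('a, 'm) qform"
  flag1 :: "'m set"
  flag2 :: "'m set"

definition is_formation :: "'a::involution_ring \<Rightarrow> ('a, 'm) formation \<Rightarrow> bool" where
  "is_formation \<epsilon> X \<longleftrightarrow>
     quadratic_form \<epsilon> (fform X) \<and> nonsingular (fform X) \<and> fg_free (qmodule (fform X)) \<and>
     lagrangian \<epsilon> (fform X) (flag1 X) \<and> fg_free (qmodule (fform X)\<lparr>carrier := flag1 X\<rparr>) \<and>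
     lagrangian \<epsilon> (fform X) (flag2 X) \<and> fg_free (qmodule (fform X)\<lparr>carrier := flag2 X\<rparr>)"

definition isomorphic_formations :: "('a, 'm) formation \<Rightarrow> ('a, 'n) formation \<Rightarrow> bool" where
  "isomorphic_formations X Y \<longleftrightarrow>
     (\<exists>h \<in> qform_iso (fform X) (fform Y). h ` flag1 X = flag1 Y \<and> h ` flag2 X = flag2 Y)"

definition formation_sum ::
  "('a::involution_ring, 'm) formation \<Rightarrow> ('a, 'n) formation \<Rightarrow> ('a, 'm \<times> 'n) formation" where
  "formation_sum X Y =
     \<lparr>fform = qform_sum (fform X) (fform Y),
      flag1 = flag1 X \<times> flag1 Y, flag2 = flag2 X \<times> flag2 Y\<rparr>"

definition formation_neg :: "('a::involution_ring, 'm) formation \<Rightarrow> ('a, 'm) formation" where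
  "formation_neg X = \<lparr>fform = qform_neg (fform X), flag1 = flag1 X, flag2 = flag2 X\<rparr>"

definition hyperbolic_formation ::
  "'a::involution_ring \<Rightarrow> ('a, 'm) module \<Rightarrow> ('a, 'm \<times> ('m \<Rightarrow> 'a)) formation" where
  "hyperbolic_formation \<epsilon> L =
     \<lparr>fform = hyperbolic \<epsilon> L,
      flag1 = carrier L \<times> {\<zero>\<^bsub>dual L\<^esub>}, flag2 = {\<zero>\<^bsub>L\<^esub>} \<times> carrier (dual L)\<rparr>"

definition trivial_formation :: "'a::involution_ring \<Rightarrow> ('a, 'm) formation \<Rightarrow> bool" where
  "trivial_formation \<epsilon> X \<longleftrightarrow> is_formation \<epsilon> X \<and>
     (\<exists>L :: ('a, nat \<Rightarrow> 'a) module.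
        fg_free L \<and> isomorphic_formations X (hyperbolic_formation \<epsilon> L))"

definition stably_isomorphic ::
  "'a::involution_ring \<Rightarrow> ('a, 'm) formation \<Rightarrow> ('a, 'n) formation \<Rightarrow> bool" where
  "stably_isomorphic \<epsilon> X Y \<longleftrightarrow>
     (\<exists>(T :: ('a, nat \<Rightarrow> 'a) formation) (T' :: ('a, nat \<Rightarrow> 'a) formation).
        trivial_formation \<epsilon> T \<and> trivial_formation \<epsilon> T' \<and>
        isomorphic_formations (formation_sum X T) (formation_sum Y T'))"

text \<open>The \<open>\<epsilon>\<close>-quadratic boundary formation of a \<open>(-\<epsilon>)\<close>-quadratic form.\<close>

definition boundary ::
  "'a::involution_ring \<Rightarrow> ('a, 'm) qform \<Rightarrow> ('a, 'm \<times> ('m \<Rightarrow> 'a)) formation" where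
  "boundary \<epsilon> \<psi> =
     \<lparr>fform = hyperbolic \<epsilon> (qmodule \<psi>),
      flag1 = carrier (qmodule \<psi>) \<times> {\<zero>\<^bsub>dual (qmodule \<psi>)\<^esub>},
      flag2 = {(x, qlam \<psi> x) |x. x \<in> carrier (qmodule \<psi>)}\<rparr>"

definition equivalent_formations ::
  "'a::involution_ring \<Rightarrow> ('a, 'm) formation \<Rightarrow> ('a, 'n) formation \<Rightarrow> bool" where
  "equivalent_formations \<epsilon> X X' \<longleftrightarrow> is_formation \<epsilon> X \<and> is_formation \<epsilon> X' \<and>
     (\<exists>\<psi> :: ('a, nat \<Rightarrow> 'a) qform.
        quadratic_form (- \<epsilon>) \<psi> \<and> fg_free (qmodule \<psi>) \<and>
        stably_isomorphic \<epsilon> (formation_sum X (formation_neg X')) (boundary \<epsilon> \<psi>))"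

text \<open>
  The class of a formation living on any type, as a set of formations in the universe
  \<^typ>\<open>nat \<Rightarrow> 'a\<close>. That \<open>X\<close> need not live in this universe matters, because direct sums and
  hyperbolic forms change the underlying type.
\<close>

definition formation_class ::
  "'a::involution_ring \<Rightarrow> ('a, 'm) formation \<Rightarrow> ('a, nat \<Rightarrow> 'a) formation set" where
  "formation_class \<epsilon> X = {Y. equivalent_formations \<epsilon> Y X}"

text \<open>\<open>L\<^sub>2\<^sub>n\<^sub>+\<^sub>1(\<Lambda>)\<close> is the case \<open>\<epsilon> = (-1)\<^sup>n\<close>.\<close>

definition L_odd :: "'a::involution_ring \<Rightarrow> ('a, nat \<Rightarrow> 'a) formation set monoid" where
  "L_odd \<epsilon> =
     \<lparr>carrier = {formation_class \<epsilon> X |X :: ('a, nat \<Rightarrow> 'a) formation. is_formation \<epsilon> X},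
      mult = (\<lambda>A B. \<Union>X \<in> A. \<Union>Y \<in> B. formation_class \<epsilon> (formation_sum X Y)),
      one = formation_class \<epsilon> (hyperbolic_formation \<epsilon> (free_module 0))\<rparr>"


section \<open>Unitary groups\<close>

definition normal_closure :: "('g, 'b) monoid_scheme \<Rightarrow> 'g set \<Rightarrow> 'g set" where
  "normal_closure G S = \<Inter>{N. N \<lhd> G \<and> S \<subseteq> N}"

text \<open>
  Automorphisms of \<open>H\<^sub>\<epsilon>(\<Lambda>\<^sup>k)\<close> are kept as maps on \<open>\<Lambda>\<^sup>k \<oplus> (\<Lambda>\<^sup>k)\<^sup>*\<close>; block matrices are read as
  descriptions of such maps.
\<close>

type_synonym 'a hyp = "(nat \<Rightarrow> 'a) \<times> ((nat \<Rightarrow> 'a) \<Rightarrow> 'a)"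

definition unitary_group :: "'a::involution_ring \<Rightarrow> nat \<Rightarrow> ('a hyp \<Rightarrow> 'a hyp) monoid" where
  "unitary_group \<epsilon> k =
     (let H = hyperbolic \<epsilon> (free_module k)
      in BijGroup (carrier (qmodule H))\<lparr>carrier := qform_iso H H\<rparr>)"

text \<open>The automorphism with diagonal blocks \<open>\<alpha>\<close> and \<open>\<alpha>\<^sup>*\<^sup>-\<^sup>1\<close>.\<close>

definition diagonal_auto ::
  "('a::involution_ring, 'm) module \<Rightarrow> ('m \<Rightarrow> 'm) \<Rightarrow> 'm \<times> ('m \<Rightarrow> 'a) \<Rightarrow> 'm \<times> ('m \<Rightarrow> 'a)" where
  "diagonal_auto L \<alpha> = (\<lambda>(x, f) \<in> carrier (hyperbolic_module L).
     (\<alpha> x, inv_into (carrier (dual L)) (dual_map L L \<alpha>) f))"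

text \<open>The lower triangular automorphism with lower left block \<open>\<theta> - \<epsilon> \<theta>\<^sup>*\<close>.\<close>

definition shear_auto ::
  "'a::involution_ring \<Rightarrow> ('a, 'm) module \<Rightarrow> ('m \<Rightarrow> 'm \<Rightarrow> 'a) \<Rightarrow> 'm \<times> ('m \<Rightarrow> 'a) \<Rightarrow> 'm \<times> ('m \<Rightarrow> 'a)"
  where
  "shear_auto \<epsilon> L \<theta> = (\<lambda>(x, f) \<in> carrier (hyperbolic_module L).
     (x, f \<oplus>\<^bsub>dual L\<^esub> (\<lambda>y \<in> carrier L. \<theta> x y - \<epsilon> * pairing_dual L \<theta> x y)))"

definition elementary_subgroup :: "'a::involution_ring \<Rightarrow> nat \<Rightarrow> ('a hyp \<Rightarrow> 'a hyp) set" where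
  "elementary_subgroup \<epsilon> k =
     normal_closure (unitary_group \<epsilon> k)
       (diagonal_auto (free_module k) ` liso (free_module k) (free_module k) \<union>
        shear_auto \<epsilon> (free_module k) ` pairings (free_module k))"

text \<open>The element \<open>\<sigma>\<^sub>\<epsilon>\<close>, for which \<open>\<Lambda>\<close> and \<open>\<Lambda>\<^sup>*\<close> are identified in the standard way.\<close>

definition sigma_auto :: "'a::involution_ring \<Rightarrow> 'a hyp \<Rightarrow> 'a hyp" where
  "sigma_auto \<epsilon> = (\<lambda>(x, f) \<in> carrier (hyperbolic_module (free_module 1)).
     (dual_to_vec 1 f, \<epsilon> \<odot>\<^bsub>dual (free_module 1)\<^esub> vec_to_dual 1 x))"

text \<open>
  The stabilization \<open>\<alpha> \<mapsto> \<alpha> \<oplus> 1\<close>. Under \<open>H\<^sub>\<epsilon>(\<Lambda>\<^sup>k\<^sup>+\<^sup>1) = H\<^sub>\<epsilon>(\<Lambda>\<^sup>k) \<oplus> H\<^sub>\<epsilon>(\<Lambda>)\<close> the component of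
  \<open>(x, f)\<close> in \<open>H\<^sub>\<epsilon>(\<Lambda>\<^sup>k)\<close> is obtained by deleting the last coordinate of \<open>x\<close> and restricting \<open>f\<close>
  to \<open>\<Lambda>\<^sup>k\<close>, while its component in \<open>H\<^sub>\<epsilon>(\<Lambda>)\<close> is given by \<open>x\<^sub>k\<close> and the value \<open>f(e\<^sub>k)\<close>
  (coordinates are numbered from 0).
\<close>

definition stabilize :: "nat \<Rightarrow> ('a::involution_ring hyp \<Rightarrow> 'a hyp) \<Rightarrow> 'a hyp \<Rightarrow> 'a hyp" where
  "stabilize k \<alpha> = (\<lambda>(x, f) \<in> carrier (hyperbolic_module (free_module (Suc k))).
     let (y, g) = \<alpha> (x(k := 0), restrict f (carrier (free_module k)))
     in (y(k := x k),
         \<lambda>z \<in> carrier (free_module (Suc k)). g (z(k := 0)) + z k * f (unit_vec k)))"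

primrec stabilize_by ::
  "nat \<Rightarrow> nat \<Rightarrow> ('a::involution_ring hyp \<Rightarrow> 'a hyp) \<Rightarrow> 'a hyp \<Rightarrow> 'a hyp" where
  "stabilize_by k 0 \<alpha> = \<alpha>"
| "stabilize_by k (Suc j) \<alpha> = stabilize (k + j) (stabilize_by k j \<alpha>)"

text \<open>
  The union \<open>U\<^sub>\<epsilon>(\<Lambda>)\<close> of the groups \<open>U\<^sub>\<epsilon>\<^sub>,\<^sub>k(\<Lambda>)\<close> is the direct limit along stabilization: its
  elements are classes of pairs \<open>(k, \<alpha>)\<close> with \<open>\<alpha> \<in> U\<^sub>\<epsilon>\<^sub>,\<^sub>k(\<Lambda>)\<close>.
\<close>

definition stable_class ::
  "'a::involution_ring \<Rightarrow> nat \<Rightarrow> ('a hyp \<Rightarrow> 'a hyp) \<Rightarrow> (nat \<times> ('a hyp \<Rightarrow> 'a hyp)) set" where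
  "stable_class \<epsilon> k \<alpha> = {(l, \<beta>). \<beta> \<in> carrier (unitary_group \<epsilon> l) \<and>
     (\<exists>i j. k + i = l + j \<and> stabilize_by k i \<alpha> = stabilize_by l j \<beta>)}"

definition stable_unitary_group ::
  "'a::involution_ring \<Rightarrow> (nat \<times> ('a hyp \<Rightarrow> 'a hyp)) set monoid" where
  "stable_unitary_group \<epsilon> =
     \<lparr>carrier = {stable_class \<epsilon> k \<alpha> |k \<alpha>. \<alpha> \<in> carrier (unitary_group \<epsilon> k)},
      mult = (\<lambda>A B. \<Union>(k, \<alpha>) \<in> A. \<Union>(l, \<beta>) \<in> B.
        stable_class \<epsilon> (k + l)
          (stabilize_by k l \<alpha> \<otimes>\<^bsub>unitary_group \<epsilon> (k + l)\<^esub> stabilize_by l k \<beta>)),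
      one = stable_class \<epsilon> 0 \<one>\<^bsub>unitary_group \<epsilon> 0\<^esub>\<rparr>"

definition stable_elementary_subgroup ::
  "'a::involution_ring \<Rightarrow> (nat \<times> ('a hyp \<Rightarrow> 'a hyp)) set set" where
  "stable_elementary_subgroup \<epsilon> =
     {stable_class \<epsilon> k \<alpha> |k \<alpha>. \<alpha> \<in> elementary_subgroup \<epsilon> k}"

definition M_kernel :: "'a::involution_ring \<Rightarrow> (nat \<times> ('a hyp \<Rightarrow> 'a hyp)) set set" where
  "M_kernel \<epsilon> = normal_closure (stable_unitary_group \<epsilon>)
     (stable_elementary_subgroup \<epsilon> \<union> {stable_class \<epsilon> 1 (sigma_auto \<epsilon>)})"

definition M_group :: "'a::involution_ring \<Rightarrow> (nat \<times> ('a hyp \<Rightarrow> 'a hyp)) set set monoid" where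
  "M_group \<epsilon> = stable_unitary_group \<epsilon> Mod M_kernel \<epsilon>"

definition M_class ::
  "'a::involution_ring \<Rightarrow> nat \<Rightarrow> ('a hyp \<Rightarrow> 'a hyp) \<Rightarrow> (nat \<times> ('a hyp \<Rightarrow> 'a hyp)) set set" where
  "M_class \<epsilon> k \<alpha> = M_kernel \<epsilon> #>\<^bsub>stable_unitary_group \<epsilon>\<^esub> stable_class \<epsilon> k \<alpha>"


section \<open>The formation of a unitary automorphism\<close>

text \<open>The blocks \<open>\<gamma> : \<Lambda>\<^sup>k \<rightarrow> \<Lambda>\<^sup>k\<close> and \<open>\<mu> : \<Lambda>\<^sup>k \<rightarrow> (\<Lambda>\<^sup>k)\<^sup>*\<close> of the first column of \<open>\<alpha>\<close>.\<close>

definition block_gamma ::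
  "nat \<Rightarrow> ('a::involution_ring hyp \<Rightarrow> 'a hyp) \<Rightarrow> (nat \<Rightarrow> 'a) \<Rightarrow> nat \<Rightarrow> 'a" where
  "block_gamma k \<alpha> x = fst (\<alpha> (x, \<zero>\<^bsub>dual (free_module k)\<^esub>))"

definition block_mu ::
  "nat \<Rightarrow> ('a::involution_ring hyp \<Rightarrow> 'a hyp) \<Rightarrow> (nat \<Rightarrow> 'a) \<Rightarrow> (nat \<Rightarrow> 'a) \<Rightarrow> 'a" where
  "block_mu k \<alpha> x = snd (\<alpha> (x, \<zero>\<^bsub>dual (free_module k)\<^esub>))"

definition Phi_formation ::
  "'a::involution_ring \<Rightarrow> nat \<Rightarrow> ('a hyp \<Rightarrow> 'a hyp) \<Rightarrow> ('a, 'a hyp) formation" where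
  "Phi_formation \<epsilon> k \<alpha> =
     \<lparr>fform = hyperbolic \<epsilon> (free_module k),
      flag1 = carrier (free_module k) \<times> {\<zero>\<^bsub>dual (free_module k)\<^esub>},
      flag2 = (\<lambda>x. (block_gamma k \<alpha> x, block_mu k \<alpha> x)) ` carrier (free_module k)\<rparr>"

end

theory Submission
  imports Defs "HOL-Library.Function_Algebras" "HOL-Library.Product_Plus"
begin

text \<open>
  Call two lagrangians \<open>F\<close>, \<open>G\<close> of a form \<open>Q\<close> stably equivalent if \<open>F \<oplus> \<Lambda>\<^sup>m\<close> and \<open>G \<oplus> (\<Lambda>\<^sup>m)\<^sup>*\<close>
  have a common lagrangian complement in \<open>Q \<oplus> H(\<Lambda>\<^sup>m)\<close> for some \<open>m\<close>. In \<open>H(K)\<close> the lagrangians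
  complementary to \<open>K\<^sup>*\<close> are the graphs of even forms, so \<open>F\<close> and \<open>G\<close> are stably equivalent iff
  \<open>(Q; F, G)\<close> is stably a boundary. Since \<open>(Q; F, G)\<close> with \<open>F\<close>, \<open>G\<close> free of equal rank is of the
  form \<open>(H(\<Lambda>\<^sup>k); \<Lambda>\<^sup>k, g \<Lambda>\<^sup>k)\<close> with \<open>g\<close> unitary, everything is reduced to showing that
  \<open>\<Lambda>\<^sup>k\<close> and \<open>g \<Lambda>\<^sup>k\<close> are stably equivalent iff \<open>g\<close> lies in the kernel of \<open>U \<rightarrow> M\<close>.

  If they have a common complement, then \<open>g\<close> is a product of automorphisms preserving \<open>\<Lambda>\<^sup>k\<close>,
  automorphisms fixing \<open>(\<Lambda>\<^sup>k)\<^sup>*\<close> and sums of copies of \<open>\<sigma>\<close>, all of which are in the kernel.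
  Conversely, stable equivalence is an equivalence relation invariant under isometries, and if
  \<open>L\<close> is stably equivalent to \<open>g L\<close> for one lagrangian \<open>L\<close>, then so is every other lagrangian
  to its image under \<open>g\<close>. Hence the \<open>g\<close> with this property form a normal subgroup of the stable
  unitary group, and this subgroup contains the generators of the kernel.
\<close>

text \<open>The obstacle is transitivity: having a common complement after stabilization is not
  visibly transitive, and two composable witnesses only yield a chain of four complementary pairs.
  In \<open>P \<oplus> -P \<oplus> P\<close> the ends of such a chain acquire a common complement,
  because the diagonal of \<open>P \<oplus> -P\<close> is complementary to
  \<open>A \<times> B\<close> for every complementary pair \<open>A\<close>, \<open>B\<close> at
  once. The same diagonal gives independence of the base lagrangian, and shows that the negative of
  a formation is its inverse. The rank hypothesis serves to see that the two lagrangians of a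
  formation have bases of equal length, so that a unitary \<open>g\<close> carries one to the other.
  That equivalence of formations is an equivalence relation is not proved beforehand: formations are
  represented by elements of the stable unitary group, equivalence becomes equality of cosets, and
  the group axioms of \<open>L\<close> are inherited from that group. Calculations take place on
  pairs of sequences, one type for every rank, so that the direct limit becomes an ascending union
  of sets of maps.\<close>

lemma bar_zero [simp]: "bar (0::'a::involution_ring) = 0"
  using bar_add[of "0::'a" 0] by simp

lemma bar_minus: "bar (- a) = - bar (a::'a::involution_ring)"
  using bar_add[of a "- a"] by (simp add: eq_neg_iff_add_eq_0 add.commute)

lemma bar_diff: "bar (a - b) = bar a - bar (b::'a::involution_ring)"
  using bar_add[of a "- b"] by (simp add: bar_minus)

lemma bar_sum: "bar (sum f A) = (\<Sum>i\<in>A. bar (f i :: 'a::involution_ring))"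
  by (induction A rule: infinite_finite_induct) (simp_all add: bar_add)

declare bar_bar [simp] bar_one [simp]

section \<open>Modules inside additive types\<close>

type_synonym 'a vec = "nat \<Rightarrow> 'a"

definition smul :: "'a::ring_1 \<Rightarrow> 'a vec \<Rightarrow> 'a vec" where
  "smul a x = (\<lambda>i. a * x i)"

text \<open>Vectors of all lengths share one type of sequences, so \<open>fr k\<close> is literally
  contained in \<open>fr (k + l)\<close> and stabilization needs no change of type.\<close>

definition fr :: "nat \<Rightarrow> 'a::ring_1 vec set" where
  "fr k = {x. \<forall>i\<ge>k. x i = 0}"

definition lsub :: "('a::ring_1 \<Rightarrow> 'm::ab_group_add \<Rightarrow> 'm) \<Rightarrow> 'm set \<Rightarrow> bool" where
  "lsub s A \<longleftrightarrow> 0 \<in> A \<and> (\<forall>x\<in>A. \<forall>y\<in>A. x + y \<in> A) \<and> (\<forall>a. \<forall>x\<in>A. s a x \<in> A)"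

definition lmod :: "('a::ring_1 \<Rightarrow> 'm::ab_group_add \<Rightarrow> 'm) \<Rightarrow> 'm set \<Rightarrow> bool" where
  "lmod s C \<longleftrightarrow> lsub s C \<and> (\<forall>a b. \<forall>x\<in>C. s (a + b) x = s a x + s b x) \<and>
     (\<forall>a. \<forall>x\<in>C. \<forall>y\<in>C. s a (x + y) = s a x + s a y) \<and>
     (\<forall>a b. \<forall>x\<in>C. s (a * b) x = s a (s b x)) \<and> (\<forall>x\<in>C. s 1 x = x)"

text \<open>Linearity is asked on \<open>C\<close> only; values outside are arbitrary, unlike for
  the maps in \<open>lhom\<close>. Extensionality is restored by \<open>restrict\<close> where a map
  has to become a homomorphism of module records.\<close>

definition lin ::
  "('a \<Rightarrow> 'm::plus \<Rightarrow> 'm) \<Rightarrow> 'm set \<Rightarrow> ('a \<Rightarrow> 'n::plus \<Rightarrow> 'n) \<Rightarrow> ('m \<Rightarrow> 'n) \<Rightarrow> bool" where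
  "lin s C t h \<longleftrightarrow> (\<forall>x\<in>C. \<forall>y\<in>C. h (x + y) = h x + h y) \<and> (\<forall>a. \<forall>x\<in>C. h (s a x) = t a (h x))"

definition free_on :: "nat \<Rightarrow> ('a::ring_1 \<Rightarrow> 'm::ab_group_add \<Rightarrow> 'm) \<Rightarrow> 'm set \<Rightarrow> ('a vec \<Rightarrow> 'm) \<Rightarrow> bool" where
  "free_on k s A j \<longleftrightarrow> lin smul (fr k) s j \<and> bij_betw j (fr k) A"

definition isfree :: "('a::ring_1 \<Rightarrow> 'm::ab_group_add \<Rightarrow> 'm) \<Rightarrow> 'm set \<Rightarrow> bool" where
  "isfree s A \<longleftrightarrow> (\<exists>k j. free_on k s A j)"

lemma lsubD:
  assumes "lsub s A"
  shows "0 \<in> A" "x \<in> A \<Longrightarrow> y \<in> A \<Longrightarrow> x + y \<in> A" "x \<in> A \<Longrightarrow> s a x \<in> A"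
  using assms unfolding lsub_def by auto

lemma lmodD:
  assumes "lmod s C"
  shows "lsub s C" "x \<in> C \<Longrightarrow> s (a + b) x = s a x + s b x"
    "x \<in> C \<Longrightarrow> y \<in> C \<Longrightarrow> s a (x + y) = s a x + s a y"
    "x \<in> C \<Longrightarrow> s (a * b) x = s a (s b x)" "x \<in> C \<Longrightarrow> s 1 x = x"
  using assms unfolding lmod_def by blast+

lemma linD:
  assumes "lin s C t h"
  shows "x \<in> C \<Longrightarrow> y \<in> C \<Longrightarrow> h (x + y) = h x + h y" "x \<in> C \<Longrightarrow> h (s a x) = t a (h x)"
  using assms unfolding lin_def by blast+

lemma lmod_scale_zero: "lmod s C \<Longrightarrow> x \<in> C \<Longrightarrow> s 0 x = 0"
  using lmodD(2)[of s C x 0 0] by simp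

lemma lmod_scale_neg: "lmod s C \<Longrightarrow> x \<in> C \<Longrightarrow> s (- 1) x = - x"
  using lmodD(2)[of s C x 1 "- 1"] lmodD(5)[of s C x] lmod_scale_zero[of s C x]
  by (simp add: eq_neg_iff_add_eq_0 add.commute)

lemma lsub_uminus:
  assumes "lmod s C" "lsub s A" "A \<subseteq> C" "x \<in> A" shows "- x \<in> A"
  using lmod_scale_neg[OF assms(1), of x] lsubD(3)[OF assms(2,4), of "- 1"] assms(3,4) by auto

lemma lsub_diff:
  assumes "lmod s C" "lsub s A" "A \<subseteq> C" "x \<in> A" "y \<in> A" shows "x - y \<in> A"
  using lsubD(2)[OF assms(2,4) lsub_uminus[OF assms(1,2,3,5)]] by simp

lemma lmod_uminus: "lmod s C \<Longrightarrow> x \<in> C \<Longrightarrow> - x \<in> C"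
  using lsub_uminus[of s C C x] lmodD(1) by blast

lemma lmod_diff: "lmod s C \<Longrightarrow> x \<in> C \<Longrightarrow> y \<in> C \<Longrightarrow> x - y \<in> C"
  using lsub_diff[of s C C x y] lmodD(1) by blast

lemma lmod_sum:
  assumes "lmod s C" "finite I" "\<And>i. i \<in> I \<Longrightarrow> f i \<in> C" shows "sum f I \<in> C"
  using assms(2,3) by (induction I rule: finite_induct) (auto simp: lsubD[OF lmodD(1)[OF assms(1)]])

lemma lin_zero: "lin s C t h \<Longrightarrow> (0::'m::ab_group_add) \<in> C \<Longrightarrow> h 0 = (0::'n::ab_group_add)"
  using linD(1)[of s C t h 0 0] by simp

lemma lin_sum:
  fixes h :: "'m::ab_group_add \<Rightarrow> 'n::ab_group_add"
  assumes "lmod s C" "lin s C t h" "finite I" "\<And>i. i \<in> I \<Longrightarrow> f i \<in> C"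
  shows "h (sum f I) = (\<Sum>i\<in>I. h (f i))"
  using assms(3,4)
proof (induction I rule: finite_induct)
  case empty
  then show ?case using lin_zero[OF assms(2)] lsubD(1)[OF lmodD(1)[OF assms(1)]] by simp
next
  case (insert x F)
  then show ?case using linD(1)[OF assms(2), of "f x" "sum f F"] lmod_sum[OF assms(1), of F f] by simp
qed

lemma lin_comp:
  assumes "lin s C t h" "lin t D u g" "\<And>x. x \<in> C \<Longrightarrow> h x \<in> D" shows "lin s C u (\<lambda>x. g (h x))"
  using assms unfolding lin_def by simp

lemma lin_inv_into:
  assumes "lmod s C" "lin s C t h" "bij_betw h C D"
  shows "lin t D s (inv_into C h)"
proof -
  note i = bij_betw_inv_into_left[OF assms(3)] bij_betw_inv_into_right[OF assms(3)]
  have m: "\<And>y. y \<in> D \<Longrightarrow> inv_into C h y \<in> C"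
    using assms(3) by (metis bij_betw_imp_surj_on inv_into_into)
  show ?thesis
    unfolding lin_def
    by (smt (verit, best) i m linD[OF assms(2)] lsubD[OF lmodD(1)[OF assms(1)]])
qed

lemma lmod_fr: "lmod smul (fr k :: 'a::ring_1 vec set)"
  unfolding lmod_def lsub_def fr_def smul_def by (auto simp: algebra_simps fun_eq_iff)

lemma unit_vec_fr: "i < k \<Longrightarrow> unit_vec i \<in> fr k"
  by (auto simp: fr_def unit_vec_def)

lemma sum_fun_apply: "(sum f I) x = (\<Sum>i\<in>I. f i x)"
  by (induction I rule: infinite_finite_induct) simp_all

lemma smul_unit_sum: "x \<in> fr k \<Longrightarrow> x = (\<Sum>i<k. smul (x i) (unit_vec i))"
proof (rule ext)
  fix j assume x: "x \<in> fr k"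
  have "(\<Sum>i<k. smul (x i) (unit_vec i)) j = (\<Sum>i<k. if i = j then x j else 0)"
    unfolding sum_fun_apply smul_def unit_vec_def by (rule sum.cong) auto
  then show "x j = (\<Sum>i<k. smul (x i) (unit_vec i)) j"
    using x by (auto simp: fr_def)
qed

lemma lin_expand:
  fixes h :: "'a::ring_1 vec \<Rightarrow> 'n::ab_group_add"
  assumes "lin smul (fr k) t h" "x \<in> fr k"
  shows "h x = (\<Sum>i<k. t (x i) (h (unit_vec i)))"
proof -
  have "h (\<Sum>i<k. smul (x i) (unit_vec i)) = (\<Sum>i<k. h (smul (x i) (unit_vec i)))"
    by (rule lin_sum[OF lmod_fr assms(1)]) (auto intro!: lsubD(3)[OF lmodD(1)[OF lmod_fr]] unit_vec_fr)
  also have "\<dots> = (\<Sum>i<k. t (x i) (h (unit_vec i)))"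
    by (rule sum.cong) (auto intro!: linD(2)[OF assms(1)] unit_vec_fr)
  finally show ?thesis using smul_unit_sum[OF assms(2)] by simp
qed

lemma lmod_scale_sum:
  assumes "lmod s C" "finite I" "\<And>i. i \<in> I \<Longrightarrow> f i \<in> C"
  shows "s a (sum f I) = (\<Sum>i\<in>I. s a (f i))"
  using assms(2,3)
proof (induction I rule: finite_induct)
  case empty
  have "s a 0 = s a 0 + s a 0"
    using lmodD(3)[OF assms(1), of 0 0 a] lsubD(1)[OF lmodD(1)[OF assms(1)]] by simp
  then show ?case by simp
next
  case (insert x F)
  then show ?case using lmodD(3)[OF assms(1), of "f x" "sum f F"] lmod_sum[OF assms(1), of F f] by simp
qed

lemma lin_combination:
  assumes "lmod s C" "\<And>i. i < k \<Longrightarrow> y i \<in> C"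
  shows "lin smul (fr k) s (\<lambda>x. \<Sum>i<k. s (x i) (y i))"
  unfolding lin_def
proof (intro conjI ballI allI)
  note s = lsubD(3)[OF lmodD(1)[OF assms(1)] assms(2)]
  fix a and x z :: "'a vec"
  show "(\<Sum>i<k. s ((x + z) i) (y i)) = (\<Sum>i<k. s (x i) (y i)) + (\<Sum>i<k. s (z i) (y i))"
    using assms(2) by (simp add: lmodD(2)[OF assms(1)] sum.distrib)
  have "s a (\<Sum>i<k. s (x i) (y i)) = (\<Sum>i<k. s a (s (x i) (y i)))"
    by (rule lmod_scale_sum[OF assms(1)]) (use s lsubD(1)[OF lmodD(1)[OF assms(1)]] in auto)
  then show "(\<Sum>i<k. s (smul a x i) (y i)) = s a (\<Sum>i<k. s (x i) (y i))"
    using assms(2) by (simp add: smul_def lmodD(4)[OF assms(1)])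
qed

text \<open>The value at \<open>x\<close> of the functional that \<open>vec_to_dual\<close> attaches
  to \<open>a\<close>: linear in \<open>x\<close>, conjugate linear in \<open>a\<close>. Through it,
  dual modules are replaced by coordinate vectors.\<close>

definition ip :: "nat \<Rightarrow> 'a::involution_ring vec \<Rightarrow> 'a vec \<Rightarrow> 'a" where
  "ip k x a = (\<Sum>i<k. x i * bar (a i))"

lemma ip_simps:
  "ip k (x + y) a = ip k x a + ip k y a" "ip k x (a + b) = ip k x a + ip k x b"
  "ip k (smul c x) a = c * ip k x a" "ip k x (smul c a) = ip k x a * bar c"
  "ip k 0 a = 0" "ip k x 0 = 0" "ip k (- x) a = - ip k x a" "ip k x (- a) = - ip k x a"
  by (simp_all add: ip_def smul_def algebra_simps bar_add bar_mult bar_minus sum.distrib sum_distrib_left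
      sum_distrib_right sum_negf)

lemma ip_unit_vec: "i < k \<Longrightarrow> ip k (unit_vec i) a = bar (a i)" "i < k \<Longrightarrow> ip k x (unit_vec i) = x i"
proof -
  assume i: "i < k"
  have "ip k (unit_vec i) a = (\<Sum>j<k. if j = i then bar (a i) else 0)"
    unfolding ip_def unit_vec_def by (rule sum.cong) auto
  then show "ip k (unit_vec i) a = bar (a i)" using i by simp
  have "ip k x (unit_vec i) = (\<Sum>j<k. if j = i then x i else 0)"
    unfolding ip_def unit_vec_def by (rule sum.cong) auto
  then show "ip k x (unit_vec i) = x i" using i by simp
qed

lemma ip_functional:
  assumes "lin smul (fr k) (*) \<phi>"
  shows "\<exists>a\<in>fr k. \<forall>x\<in>fr k. \<phi> x = ip k x a"
proof
  \<comment> \<open>The conjugate appears because \<open>ip\<close> conjugates its second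
    argument.\<close>
  let ?a = "\<lambda>i. if i < k then bar (\<phi> (unit_vec i)) else 0"
  show "?a \<in> fr k" by (simp add: fr_def)
  show "\<forall>x\<in>fr k. \<phi> x = ip k x ?a"
    unfolding ip_def by (simp add: lin_expand[OF assms])
qed

lemma ip_eq_zero:
  assumes "a \<in> fr k" "\<And>x. x \<in> fr k \<Longrightarrow> ip k x a = 0" shows "a = 0"
proof
  fix i show "a i = 0 i"
  proof (cases "i < k")
    case True
    then have "bar (a i) = 0" using assms(2)[OF unit_vec_fr[OF True]] by (simp add: ip_unit_vec)
    then have "bar (bar (a i)) = 0" by (simp only: bar_zero)
    then show ?thesis by simp
  next
    case False
    then show ?thesis using assms(1) by (simp add: fr_def)
  qed
qed

lemma direct_sum_projection:
  fixes s :: "'a::ring_1 \<Rightarrow> 'm::ab_group_add \<Rightarrow> 'm"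
  assumes C: "lmod s C" and A: "lsub s A" "A \<subseteq> C" and B: "lsub s B" "B \<subseteq> C"
    and int: "\<And>x. x \<in> A \<Longrightarrow> x \<in> B \<Longrightarrow> x = 0" and ex: "\<And>x. x \<in> C \<Longrightarrow> \<exists>a\<in>A. \<exists>b\<in>B. x = a + b"
  obtains p where "lin s C s p" "\<And>x. x \<in> C \<Longrightarrow> p x \<in> A" "\<And>x. x \<in> C \<Longrightarrow> x - p x \<in> B"
    "\<And>x. x \<in> A \<Longrightarrow> p x = x" "\<And>x. x \<in> B \<Longrightarrow> p x = 0"
proof -
  have "\<exists>a. a \<in> A \<and> x - a \<in> B" if "x \<in> C" for x
    using ex[OF that] by auto
  then obtain p where p: "\<And>x. x \<in> C \<Longrightarrow> p x \<in> A \<and> x - p x \<in> B" by metis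
  \<comment> \<open>The \<open>A\<close>-component is determined by lying in \<open>A\<close> and
    differing from \<open>x\<close> by an element of \<open>B\<close>. Linearity of \<open>p\<close>
    follows, since \<open>p x + p y\<close> and \<open>s a (p x)\<close> have this property for
    \<open>x + y\<close> and \<open>s a x\<close>.\<close>
  have u: "p x = a" if "x \<in> C" "a \<in> A" "x - a \<in> B" for x a
  proof -
    have "p x - a \<in> A" using lsub_diff[OF C A] p that by blast
    moreover have "(x - a) - (x - p x) \<in> B" using lsub_diff[OF C B] p that by blast
    ultimately have "p x - a = 0" by (intro int) simp_all
    then show ?thesis by simp
  qed
  show ?thesis
  proof (rule that[of p])
    show "lin s C s p"
      unfolding lin_def
    proof (intro conjI ballI allI)
      fix x y assume xy: "x \<in> C" "y \<in> C"
      have "x + y - (p x + p y) = (x - p x) + (y - p y)" by simp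
      also have "\<dots> \<in> B" using p xy lsubD(2)[OF B(1)] by blast
      finally show "p (x + y) = p x + p y"
        using p xy lsubD(2)[OF A(1)] lsubD(2)[OF lmodD(1)[OF C]] by (intro u) simp_all
    next
      fix a x assume x: "x \<in> C"
      have "s a (x - p x + p x) = s a (x - p x) + s a (p x)"
        using p[OF x] A B by (intro lmodD(3)[OF C]) auto
      then have "s a x - s a (p x) = s a (x - p x)" by simp
      then show "p (s a x) = s a (p x)"
        using p x lsubD(3)[OF A(1)] lsubD(3)[OF B(1)] lsubD(3)[OF lmodD(1)[OF C]] by (intro u) simp_all
    qed
    show "\<And>x. x \<in> A \<Longrightarrow> p x = x" using u A B lsubD(1)[OF B(1)] by auto
    show "\<And>x. x \<in> B \<Longrightarrow> p x = 0" using u A B lsubD(1)[OF A(1)] by auto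
  qed (use p in auto)
qed

section \<open>Quadratic spaces\<close>

text \<open>The value of \<open>\<mu>\<close> at \<open>x\<close> is the class of the representative \<open>quad x\<close>.\<close>

record ('a, 'm) space =
  carr :: "'m set"
  scl :: "'a \<Rightarrow> 'm \<Rightarrow> 'm"
  lam :: "'m \<Rightarrow> 'm \<Rightarrow> 'a"
  quad :: "'m \<Rightarrow> 'a"

text \<open>A sign is central, fixed by the involution and its own inverse; these facts stand in for
  commutativity when \<open>\<epsilon>\<close> is moved through products.\<close>

locale signed =
  fixes \<epsilon> :: "'a::involution_ring"
  assumes eps: "\<epsilon> = 1 \<or> \<epsilon> = - 1"
begin

lemma eps_central: "a * \<epsilon> = \<epsilon> * a"
  using eps by auto

lemma eps_left: "a * (\<epsilon> * b) = \<epsilon> * (a * b)"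
  using eps by auto

lemma eps_simps [simp]: "bar \<epsilon> = \<epsilon>" "\<epsilon> * \<epsilon> = 1" "\<epsilon> * (\<epsilon> * a) = a"
  using eps by (auto simp: bar_minus)

text \<open>Equality of classes in \<open>Q\<^sub>\<epsilon>(\<Lambda>)\<close>, written on
  representatives, so that quadratic functions can be handled as ring-valued functions whose laws
  hold up to \<open>qeq\<close>.\<close>

definition qeq :: "'a \<Rightarrow> 'a \<Rightarrow> bool" where
  "qeq a b \<longleftrightarrow> (\<exists>c. a - b = c - \<epsilon> * bar c)"

lemma qeq_refl [simp, intro]: "qeq a a"
  unfolding qeq_def by (rule exI[of _ 0]) simp

lemma qeq_minus: assumes "qeq a b" shows "qeq (- a) (- b)"
proof -
  from assms obtain c where "a - b = c - \<epsilon> * bar c" unfolding qeq_def by blast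
  then have "- a - - b = (- c) - \<epsilon> * bar (- c)" by (simp add: bar_minus algebra_simps)
  then show ?thesis unfolding qeq_def by blast
qed

lemma qeq_add: assumes "qeq a b" "qeq c d" shows "qeq (a + c) (b + d)"
proof -
  from assms obtain e f where "a - b = e - \<epsilon> * bar e" "c - d = f - \<epsilon> * bar f" unfolding qeq_def by blast
  then have "a + c - (b + d) = (e + f) - \<epsilon> * bar (e + f)"
    by (simp add: bar_add algebra_simps)
  then show ?thesis unfolding qeq_def by blast
qed

lemma qeq_diff_iff: "qeq a b \<longleftrightarrow> qeq (a - b) 0"
  unfolding qeq_def by simp

lemma qeq_sym: "qeq a b \<Longrightarrow> qeq b a"
  using qeq_minus[of "a - b" 0] qeq_diff_iff[of a b] qeq_diff_iff[of b a] by simp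

lemma qeq_trans [trans]: "qeq a b \<Longrightarrow> qeq b c \<Longrightarrow> qeq a c"
  using qeq_add[of "a - b" 0 "b - c" 0] qeq_diff_iff[of a b] qeq_diff_iff[of b c] qeq_diff_iff[of a c] by simp

lemma qeq_diff: "qeq a b \<Longrightarrow> qeq c d \<Longrightarrow> qeq (a - c) (b - d)"
  using qeq_add[of a b "- c" "- d"] qeq_minus[of c d] by simp

text \<open>Since \<open>a - \<epsilon> * bar a\<close> is divided out, a mixed term that comes
  conjugated and with the sign may be replaced by the plain one once classes are taken.\<close>

lemma qeq_swap: "qeq (\<epsilon> * bar a) a"
  by (rule qeq_sym) (auto simp: qeq_def)

text \<open>Conjugation by \<open>a\<close> carries \<open>e - \<epsilon> * bar e\<close> to the
  same expression in \<open>a * e * bar a\<close>, because \<open>\<epsilon>\<close> is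
  central.\<close>

lemma qeq_conj: assumes "qeq b c" shows "qeq (a * b * bar a) (a * c * bar a)"
proof -
  from assms obtain e where e: "b - c = e - \<epsilon> * bar e" unfolding qeq_def by blast
  have "a * b * bar a - a * c * bar a = a * (b - c) * bar a" by (simp add: algebra_simps)
  also have "\<dots> = (a * e * bar a) - (a * \<epsilon>) * bar e * bar a" unfolding e by (simp add: algebra_simps)
  also have "\<dots> = (a * e * bar a) - \<epsilon> * bar (a * e * bar a)"
    unfolding eps_central by (simp add: bar_mult mult.assoc)
  finally show ?thesis unfolding qeq_def by blast
qed

lemma qclass_eq_iff: "qclass \<epsilon> a = qclass \<epsilon> b \<longleftrightarrow> qeq a b"
proof
  assume h: "qclass \<epsilon> a = qclass \<epsilon> b"
  have "a + (0 - \<epsilon> * bar 0) \<in> qclass \<epsilon> a" unfolding qclass_def by blast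
  then have "a \<in> qclass \<epsilon> b" using h by simp
  then show "qeq a b" unfolding qclass_def qeq_def by (auto simp: algebra_simps)
next
  have m: "x \<in> qclass \<epsilon> y \<longleftrightarrow> qeq x y" for x y
    unfolding qclass_def qeq_def by (auto simp: algebra_simps)
  assume h: "qeq a b"
  show "qclass \<epsilon> a = qclass \<epsilon> b"
    unfolding set_eq_iff m using qeq_trans[of _ a b, OF _ h] qeq_trans[of _ b a, OF _ qeq_sym[OF h]] by blast
qed

lemma qclass_mem: "x \<in> qclass \<epsilon> y \<longleftrightarrow> qeq x y"
  unfolding qclass_def qeq_def by (auto simp: algebra_simps)

text \<open>The last two clauses say that the adjoint map to the dual is onto and has trivial
  kernel, that is, the form is nonsingular. Linearity is required in one argument; hermitian
  symmetry gives the other in \<open>lam_left\<close>.\<close>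

definition qspace :: "('a, 'm::ab_group_add) space \<Rightarrow> bool" where
  "qspace Q \<longleftrightarrow> lmod (scl Q) (carr Q) \<and>
     (\<forall>x\<in>carr Q. \<forall>y\<in>carr Q. \<forall>z\<in>carr Q. lam Q x (y + z) = lam Q x y + lam Q x z) \<and>
     (\<forall>a. \<forall>x\<in>carr Q. \<forall>y\<in>carr Q. lam Q x (scl Q a y) = a * lam Q x y) \<and>
     (\<forall>x\<in>carr Q. \<forall>y\<in>carr Q. lam Q x y = \<epsilon> * bar (lam Q y x)) \<and>
     (\<forall>x\<in>carr Q. \<forall>y\<in>carr Q. qeq (quad Q (x + y)) (quad Q x + quad Q y + lam Q x y)) \<and>
     (\<forall>x\<in>carr Q. quad Q x + \<epsilon> * bar (quad Q x) = lam Q x x) \<and>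
     (\<forall>a. \<forall>x\<in>carr Q. qeq (quad Q (scl Q a x)) (a * quad Q x * bar a)) \<and>
     (\<forall>\<phi>. lin (scl Q) (carr Q) (*) \<phi> \<longrightarrow> (\<exists>x\<in>carr Q. \<forall>y\<in>carr Q. lam Q x y = \<phi> y)) \<and>
     (\<forall>x\<in>carr Q. (\<forall>y\<in>carr Q. lam Q x y = 0) \<longrightarrow> x = 0)"

definition siso :: "('a, 'm::ab_group_add) space \<Rightarrow> ('a, 'n::ab_group_add) space \<Rightarrow> ('m \<Rightarrow> 'n) \<Rightarrow> bool" where
  "siso Q R h \<longleftrightarrow> bij_betw h (carr Q) (carr R) \<and> lin (scl Q) (carr Q) (scl R) h \<and>
     (\<forall>x\<in>carr Q. \<forall>y\<in>carr Q. lam R (h x) (h y) = lam Q x y) \<and>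
     (\<forall>x\<in>carr Q. qeq (quad R (h x)) (quad Q x))"

definition isot :: "('a, 'm::ab_group_add) space \<Rightarrow> 'm set \<Rightarrow> bool" where
  "isot Q A \<longleftrightarrow> A \<subseteq> carr Q \<and> lsub (scl Q) A \<and> (\<forall>x\<in>A. \<forall>y\<in>A. lam Q x y = 0) \<and> (\<forall>x\<in>A. qeq (quad Q x) 0)"

text \<open>In a nonsingular form, complementary isotropic submodules are automatically lagrangians.\<close>

definition cmp :: "('a, 'm::ab_group_add) space \<Rightarrow> 'm set \<Rightarrow> 'm set \<Rightarrow> bool" where
  "cmp Q A B \<longleftrightarrow> isot Q A \<and> isot Q B \<and> (\<forall>x\<in>A. x \<in> B \<longrightarrow> x = 0) \<and> (\<forall>x\<in>carr Q. \<exists>a\<in>A. \<exists>b\<in>B. x = a + b)"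

text \<open>The form \<open>H\<^sub>\<epsilon>(\<Lambda>\<^sup>k)\<close> with each functional
  \<open>f\<close> replaced by the vector \<open>a\<close> such that
  \<open>f y = ip k y a\<close>.\<close>

definition hyp :: "nat \<Rightarrow> ('a, 'a vec \<times> 'a vec) space" where
  "hyp k = \<lparr>carr = fr k \<times> fr k, scl = (\<lambda>a (x, y). (smul a x, smul a y)),
     lam = (\<lambda>(x, a) (y, b). ip k y a + \<epsilon> * bar (ip k x b)), quad = (\<lambda>(x, a). ip k x a)\<rparr>"

definition sp_sum :: "('a, 'm) space \<Rightarrow> ('a, 'n) space \<Rightarrow> ('a, 'm \<times> 'n) space" where
  "sp_sum Q R = \<lparr>carr = carr Q \<times> carr R, scl = (\<lambda>a (x, y). (scl Q a x, scl R a y)),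
     lam = (\<lambda>(x, x') (y, y'). lam Q x y + lam R x' y'), quad = (\<lambda>(x, x'). quad Q x + quad R x')\<rparr>"

definition sp_neg :: "('a, 'm) space \<Rightarrow> ('a, 'm) space" where
  "sp_neg Q = \<lparr>carr = carr Q, scl = scl Q, lam = (\<lambda>x y. - lam Q x y), quad = (\<lambda>x. - quad Q x)\<rparr>"

lemma sp_sum_simps [simp]:
  "carr (sp_sum Q R) = carr Q \<times> carr R" "scl (sp_sum Q R) a (x, y) = (scl Q a x, scl R a y)"
  "lam (sp_sum Q R) (x, y) (x', y') = lam Q x x' + lam R y y'"
  "quad (sp_sum Q R) (x, y) = quad Q x + quad R y"
  by (simp_all add: sp_sum_def)

lemma sp_neg_simps [simp]:
  "carr (sp_neg Q) = carr Q" "scl (sp_neg Q) = scl Q"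
  "lam (sp_neg Q) x y = - lam Q x y" "quad (sp_neg Q) x = - quad Q x"
  by (simp_all add: sp_neg_def)

lemma hyp_simps [simp]:
  "carr (hyp k) = fr k \<times> fr k" "scl (hyp k) c (x, y) = (smul c x, smul c y)"
  "lam (hyp k) (x, a) (y, b) = ip k y a + \<epsilon> * bar (ip k x b)" "quad (hyp k) (x, a) = ip k x a"
  by (simp_all add: hyp_def)

lemma qspaceD:
  assumes "qspace Q"
  shows "lmod (scl Q) (carr Q)"
    "x \<in> carr Q \<Longrightarrow> y \<in> carr Q \<Longrightarrow> z \<in> carr Q \<Longrightarrow> lam Q x (y + z) = lam Q x y + lam Q x z"
    "x \<in> carr Q \<Longrightarrow> y \<in> carr Q \<Longrightarrow> lam Q x (scl Q a y) = a * lam Q x y"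
    "x \<in> carr Q \<Longrightarrow> y \<in> carr Q \<Longrightarrow> lam Q x y = \<epsilon> * bar (lam Q y x)"
    "x \<in> carr Q \<Longrightarrow> y \<in> carr Q \<Longrightarrow> qeq (quad Q (x + y)) (quad Q x + quad Q y + lam Q x y)"
    "x \<in> carr Q \<Longrightarrow> quad Q x + \<epsilon> * bar (quad Q x) = lam Q x x"
    "x \<in> carr Q \<Longrightarrow> qeq (quad Q (scl Q a x)) (a * quad Q x * bar a)"
    "lin (scl Q) (carr Q) (*) \<phi> \<Longrightarrow> \<exists>x\<in>carr Q. \<forall>y\<in>carr Q. lam Q x y = \<phi> y"
    "x \<in> carr Q \<Longrightarrow> (\<And>y. y \<in> carr Q \<Longrightarrow> lam Q x y = 0) \<Longrightarrow> x = 0"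
  using assms unfolding qspace_def by blast+

lemma qspaceI:
  assumes "lmod (scl Q) (carr Q)"
    "\<And>x y z. x \<in> carr Q \<Longrightarrow> y \<in> carr Q \<Longrightarrow> z \<in> carr Q \<Longrightarrow> lam Q x (y + z) = lam Q x y + lam Q x z"
    "\<And>a x y. x \<in> carr Q \<Longrightarrow> y \<in> carr Q \<Longrightarrow> lam Q x (scl Q a y) = a * lam Q x y"
    "\<And>x y. x \<in> carr Q \<Longrightarrow> y \<in> carr Q \<Longrightarrow> lam Q x y = \<epsilon> * bar (lam Q y x)"
    "\<And>x y. x \<in> carr Q \<Longrightarrow> y \<in> carr Q \<Longrightarrow> qeq (quad Q (x + y)) (quad Q x + quad Q y + lam Q x y)"
    "\<And>x. x \<in> carr Q \<Longrightarrow> quad Q x + \<epsilon> * bar (quad Q x) = lam Q x x"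
    "\<And>a x. x \<in> carr Q \<Longrightarrow> qeq (quad Q (scl Q a x)) (a * quad Q x * bar a)"
    "\<And>\<phi>. lin (scl Q) (carr Q) (*) \<phi> \<Longrightarrow> \<exists>x\<in>carr Q. \<forall>y\<in>carr Q. lam Q x y = \<phi> y"
    "\<And>x. x \<in> carr Q \<Longrightarrow> (\<And>y. y \<in> carr Q \<Longrightarrow> lam Q x y = 0) \<Longrightarrow> x = 0"
  shows "qspace Q"
  unfolding qspace_def by (intro conjI ballI allI impI; (rule assms; (assumption | blast)))

lemma qspace_mod:
  assumes "qspace Q"
  shows "0 \<in> carr Q" "x \<in> carr Q \<Longrightarrow> y \<in> carr Q \<Longrightarrow> x + y \<in> carr Q" "x \<in> carr Q \<Longrightarrow> scl Q a x \<in> carr Q"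
    "x \<in> carr Q \<Longrightarrow> - x \<in> carr Q" "x \<in> carr Q \<Longrightarrow> y \<in> carr Q \<Longrightarrow> x - y \<in> carr Q"
  by (fact lsubD(1)[OF lmodD(1)[OF qspaceD(1)[OF assms]]], erule (1) lsubD(2)[OF lmodD(1)[OF qspaceD(1)[OF assms]]],
      erule lsubD(3)[OF lmodD(1)[OF qspaceD(1)[OF assms]]], erule lmod_uminus[OF qspaceD(1)[OF assms]],
      erule (1) lmod_diff[OF qspaceD(1)[OF assms]])

lemma lam_left:
  assumes Q: "qspace Q"
  shows "x \<in> carr Q \<Longrightarrow> y \<in> carr Q \<Longrightarrow> z \<in> carr Q \<Longrightarrow> lam Q (y + z) x = lam Q y x + lam Q z x"
    "x \<in> carr Q \<Longrightarrow> y \<in> carr Q \<Longrightarrow> lam Q (scl Q a y) x = lam Q y x * bar a"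
proof -
  assume "x \<in> carr Q" "y \<in> carr Q" "z \<in> carr Q"
  then show "lam Q (y + z) x = lam Q y x + lam Q z x"
    using qspaceD(4)[OF Q, of "y + z" x] qspaceD(4)[OF Q, of y x] qspaceD(4)[OF Q, of z x]
    by (simp add: qspaceD(2)[OF Q] qspace_mod[OF Q] bar_add distrib_left)
next
  assume "x \<in> carr Q" "y \<in> carr Q"
  then show "lam Q (scl Q a y) x = lam Q y x * bar a"
    using qspaceD(4)[OF Q, of "scl Q a y" x] qspaceD(4)[OF Q, of y x]
    by (simp add: qspaceD(3)[OF Q] qspace_mod[OF Q] bar_mult mult.assoc)
qed

lemma lam_lin_right: "qspace Q \<Longrightarrow> x \<in> carr Q \<Longrightarrow> lin (scl Q) (carr Q) (*) (lam Q x)"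
  unfolding lin_def by (simp add: qspaceD(2,3))

lemma lam_diff:
  assumes Q: "qspace Q" and x: "x \<in> carr Q" "y \<in> carr Q" "z \<in> carr Q"
  shows "lam Q (y - z) x = lam Q y x - lam Q z x" "lam Q x (y - z) = lam Q x y - lam Q x z"
  using lam_left(1)[OF Q x(1), of "y - z" z] qspaceD(2)[OF Q x(1), of "y - z" z] x
  by (simp_all add: qspace_mod[OF Q])

lemma lam_zero:
  assumes Q: "qspace Q" and x: "x \<in> carr Q"
  shows "lam Q 0 x = 0" "lam Q x 0 = 0"
  using lam_diff[OF Q x, of 0 0] qspace_mod(1)[OF Q] by simp_all

lemma qspace_sp_sum:
  assumes Q: "qspace Q" and R: "qspace R" shows "qspace (sp_sum Q R)"
proof (rule qspaceI)
  show "lmod (scl (sp_sum Q R)) (carr (sp_sum Q R))"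
    using qspaceD(1)[OF Q] qspaceD(1)[OF R] unfolding lmod_def lsub_def by (auto simp: zero_prod_def)
  show "\<exists>x\<in>carr (sp_sum Q R). \<forall>y\<in>carr (sp_sum Q R). lam (sp_sum Q R) x y = \<phi> y"
    if p: "lin (scl (sp_sum Q R)) (carr (sp_sum Q R)) (*) \<phi>" for \<phi>
  proof -
    have s0: "scl Q a 0 = 0" "scl R a 0 = 0" for a
      using lmod_scale_sum[OF qspaceD(1)[OF Q], of "{}"] lmod_scale_sum[OF qspaceD(1)[OF R], of "{}"] by auto
    have "lin (scl Q) (carr Q) (*) (\<lambda>x. \<phi> (x, 0))" "lin (scl R) (carr R) (*) (\<lambda>y. \<phi> (0, y))"
      using linD(1)[OF p] linD(2)[OF p] s0 qspace_mod(1)[OF Q] qspace_mod(1)[OF R] unfolding lin_def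
      by (metis (no_types, lifting) SigmaI add_0 add_Pair sp_sum_simps(1,2))+
    then obtain x y where x: "x \<in> carr Q" "\<And>z. z \<in> carr Q \<Longrightarrow> lam Q x z = \<phi> (z, 0)"
      and y: "y \<in> carr R" "\<And>z. z \<in> carr R \<Longrightarrow> lam R y z = \<phi> (0, z)"
      using qspaceD(8)[OF Q] qspaceD(8)[OF R] by metis
    have "\<phi> (u, v) = \<phi> (u, 0) + \<phi> (0, v)" if "u \<in> carr Q" "v \<in> carr R" for u v
      using linD(1)[OF p, of "(u, 0)" "(0, v)"] that qspace_mod(1)[OF Q] qspace_mod(1)[OF R] by simp
    then show ?thesis using x y by (intro bexI[of _ "(x, y)"]) auto
  qed
  show "w = 0" if w: "w \<in> carr (sp_sum Q R)"
    and l: "\<And>u. u \<in> carr (sp_sum Q R) \<Longrightarrow> lam (sp_sum Q R) w u = 0" for w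
  proof -
    obtain x y where xy: "w = (x, y)" and x: "x \<in> carr Q" and y: "y \<in> carr R" using w by auto
    have "lam Q x z = 0" if z: "z \<in> carr Q" for z
      using l[of "(z, 0)"] z qspace_mod(1)[OF R] lam_zero(2)[OF R y] xy by simp
    moreover have "lam R y z = 0" if z: "z \<in> carr R" for z
      using l[of "(0, z)"] z qspace_mod(1)[OF Q] lam_zero(2)[OF Q x] xy by simp
    ultimately show ?thesis using qspaceD(9)[OF Q x] qspaceD(9)[OF R y] xy by (simp add: zero_prod_def)
  qed
  show "qeq (quad (sp_sum Q R) (u + v)) (quad (sp_sum Q R) u + quad (sp_sum Q R) v + lam (sp_sum Q R) u v)"
    if "u \<in> carr (sp_sum Q R)" "v \<in> carr (sp_sum Q R)" for u v
    using qeq_add[OF qspaceD(5)[OF Q, of "fst u" "fst v"] qspaceD(5)[OF R, of "snd u" "snd v"]] that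
    by (auto simp: algebra_simps)
  show "qeq (quad (sp_sum Q R) (scl (sp_sum Q R) a u)) (a * quad (sp_sum Q R) u * bar a)"
    if "u \<in> carr (sp_sum Q R)" for u a
    using qeq_add[OF qspaceD(7)[OF Q, of "fst u" a] qspaceD(7)[OF R, of "snd u" a]] that
    by (auto simp: algebra_simps)
  show "lam (sp_sum Q R) u v = \<epsilon> * bar (lam (sp_sum Q R) v u)"
    if "u \<in> carr (sp_sum Q R)" "v \<in> carr (sp_sum Q R)" for u v
    using arg_cong2[OF qspaceD(4)[OF Q, of "fst u" "fst v"] qspaceD(4)[OF R, of "snd u" "snd v"], of "(+)"] that
    by (cases u, cases v) (simp add: bar_add distrib_left)
  show "quad (sp_sum Q R) u + \<epsilon> * bar (quad (sp_sum Q R) u) = lam (sp_sum Q R) u u"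
    if "u \<in> carr (sp_sum Q R)" for u
    using qspaceD(6)[OF Q, of "fst u"] qspaceD(6)[OF R, of "snd u"] that
    by (cases u) (simp add: bar_add distrib_left flip: qspaceD(6)[OF Q] qspaceD(6)[OF R])
  show "lam (sp_sum Q R) u (v + w) = lam (sp_sum Q R) u v + lam (sp_sum Q R) u w"
    if "u \<in> carr (sp_sum Q R)" "v \<in> carr (sp_sum Q R)" "w \<in> carr (sp_sum Q R)" for u v w
    using that by (auto simp: qspaceD(2)[OF Q] qspaceD(2)[OF R])
  show "lam (sp_sum Q R) u (scl (sp_sum Q R) a v) = a * lam (sp_sum Q R) u v"
    if "u \<in> carr (sp_sum Q R)" "v \<in> carr (sp_sum Q R)" for a u v
    using that by (auto simp: qspaceD(3)[OF Q] qspaceD(3)[OF R] distrib_left)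
qed

lemma lin_negate: "lin s C (*) \<phi> \<Longrightarrow> lin s C (*) (\<lambda>x. - \<phi> x :: 'a)"
  unfolding lin_def by (auto simp: add.commute)

lemma qspace_sp_neg: assumes Q: "qspace Q" shows "qspace (sp_neg Q)"
proof (rule qspaceI; unfold sp_neg_simps)
  show "\<exists>x\<in>carr Q. \<forall>y\<in>carr Q. - lam Q x y = \<phi> y" if "lin (scl Q) (carr Q) (*) \<phi>" for \<phi>
    using qspaceD(8)[OF Q lin_negate[OF that]] by (metis minus_minus)
  show "qeq (- quad Q (x + y)) (- quad Q x + - quad Q y + - lam Q x y)" if "x \<in> carr Q" "y \<in> carr Q" for x y
    using qeq_minus[OF qspaceD(5)[OF Q that]] by (simp add: algebra_simps)
  show "qeq (- quad Q (scl Q a x)) (a * (- quad Q x) * bar a)" if "x \<in> carr Q" for a x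
    using qeq_minus[OF qspaceD(7)[OF Q that]] by simp
  show "- quad Q x + \<epsilon> * bar (- quad Q x) = - lam Q x x" if "x \<in> carr Q" for x
    using arg_cong[OF qspaceD(6)[OF Q that], of uminus] by (simp add: bar_minus)
  show "- lam Q x y = \<epsilon> * bar (- lam Q y x)" if "x \<in> carr Q" "y \<in> carr Q" for x y
    using qspaceD(4)[OF Q that] by (simp add: bar_minus)
  show "x = 0" if "x \<in> carr Q" "\<And>y. y \<in> carr Q \<Longrightarrow> - lam Q x y = 0" for x
    using qspaceD(9)[OF Q that(1)] that(2) by simp
qed (simp_all add: qspaceD(1-3)[OF Q])

lemma qspace_hyp: "qspace (hyp k)"
proof (rule qspaceI)
  show "lmod (scl (hyp k)) (carr (hyp k))"
    using lmod_fr[of k] unfolding lmod_def lsub_def by (auto simp: zero_prod_def)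
  have s0: "smul a 0 = (0::'a vec)" for a by (simp add: smul_def fun_eq_iff)
  have z: "(0::'a vec) \<in> fr k" by (simp add: fr_def)
  show "\<exists>x\<in>carr (hyp k). \<forall>y\<in>carr (hyp k). lam (hyp k) x y = \<phi> y"
    if p: "lin (scl (hyp k)) (carr (hyp k)) (*) \<phi>" for \<phi>
  proof -
    have l: "lin smul (fr k) (*) (\<lambda>x. \<phi> (x, 0))" "lin smul (fr k) (*) (\<lambda>y. \<phi> (0, y))"
      using linD(1)[OF p] linD(2)[OF p] s0 z unfolding lin_def
      by (metis (no_types, lifting) SigmaI add_0 add_Pair hyp_simps(1,2))+
    obtain a where a: "a \<in> fr k" "\<And>x. x \<in> fr k \<Longrightarrow> \<phi> (x, 0) = ip k x a" using ip_functional[OF l(1)] by blast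
    obtain b where b: "b \<in> fr k" "\<And>x. x \<in> fr k \<Longrightarrow> \<phi> (0, x) = ip k x b" using ip_functional[OF l(2)] by blast
    \<comment> \<open>In the second summand of \<open>lam\<close> the conjugation exchanges the
      arguments of \<open>ip\<close>, and scaling by \<open>\<epsilon>\<close> cancels the sign.
      This dictates the representing vector \<open>(smul \<epsilon> b, a)\<close>.\<close>
    have e: "\<epsilon> * bar (ip k (smul \<epsilon> b) v) = ip k v b" for v
      using eps by (elim disjE) (simp_all add: ip_def smul_def bar_sum bar_mult bar_minus sum_negf)
    have "\<phi> (u, v) = \<phi> (u, 0) + \<phi> (0, v)" if "u \<in> fr k" "v \<in> fr k" for u v
      using linD(1)[OF p, of "(u, 0)" "(0, v)"] that z by simp
    then show ?thesis using a b e lsubD(3)[OF lmodD(1)[OF lmod_fr] b(1), of \<epsilon>]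
      by (intro bexI[of _ "(smul \<epsilon> b, a)"]) auto
  qed
  show "w = 0" if w: "w \<in> carr (hyp k)"
    and l: "\<And>u. u \<in> carr (hyp k) \<Longrightarrow> lam (hyp k) w u = 0" for w
  proof -
    obtain x a where xa: "w = (x, a)" and x: "x \<in> fr k" and a: "a \<in> fr k" using w by auto
    have "a = 0"
      using l[of "(y, 0)" for y] z xa by (intro ip_eq_zero[OF a]) (simp add: ip_simps)
    moreover have "x i = 0" if i: "i < k" for i
    proof -
      have "\<epsilon> * bar (x i) = 0"
        using l[of "(0, unit_vec i)"] z unit_vec_fr[OF i] i xa by (simp add: ip_simps ip_unit_vec)
      then have "\<epsilon> * (\<epsilon> * bar (x i)) = 0" by simp
      then have "bar (bar (x i)) = 0" by (simp only: eps_simps bar_zero)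
      then show ?thesis by simp
    qed
    ultimately show ?thesis using x xa by (auto simp: fr_def zero_prod_def fun_eq_iff not_less[symmetric])
  qed
  show "qeq (quad (hyp k) (u + v)) (quad (hyp k) u + quad (hyp k) v + lam (hyp k) u v)" for u v
  proof -
    obtain x a y b where uv: "u = (x, a)" "v = (y, b)" by (cases u, cases v)
    have "qeq (ip k x a + ip k y b + ip k y a + ip k x b) (ip k x a + ip k y b + ip k y a + \<epsilon> * bar (ip k x b))"
      by (rule qeq_add[OF qeq_refl qeq_sym[OF qeq_swap]])
    then show ?thesis by (simp add: uv ip_simps algebra_simps)
  qed
  show "qeq (quad (hyp k) (scl (hyp k) c u)) (c * quad (hyp k) u * bar c)" for u c
    by (cases u) (simp add: ip_simps mult.assoc)
  show "lam (hyp k) u v = \<epsilon> * bar (lam (hyp k) v u)" for u v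
    by (cases u, cases v) (simp add: bar_add bar_mult distrib_left eps_central add.commute)
  show "lam (hyp k) u (v + w) = lam (hyp k) u v + lam (hyp k) u w" for u v w
    by (cases u, cases v, cases w) (simp add: ip_simps bar_add algebra_simps)
  show "lam (hyp k) u (scl (hyp k) c v) = c * lam (hyp k) u v" for u v c
    by (cases u, cases v) (simp add: ip_simps bar_mult distrib_left eps_left)
  show "quad (hyp k) u + \<epsilon> * bar (quad (hyp k) u) = lam (hyp k) u u" for u
    by (cases u) simp
qed

lemma isotD:
  assumes "isot Q A"
  shows "A \<subseteq> carr Q" "lsub (scl Q) A" "x \<in> A \<Longrightarrow> y \<in> A \<Longrightarrow> lam Q x y = 0" "x \<in> A \<Longrightarrow> qeq (quad Q x) 0"
    "x \<in> A \<Longrightarrow> x \<in> carr Q"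
  using assms unfolding isot_def by blast+

lemma cmpD:
  assumes "cmp Q A B"
  shows "isot Q A" "isot Q B" "x \<in> A \<Longrightarrow> x \<in> B \<Longrightarrow> x = 0" "x \<in> carr Q \<Longrightarrow> \<exists>a\<in>A. \<exists>b\<in>B. x = a + b"
  using assms unfolding cmp_def by blast+

lemma cmp_sym: "cmp Q A B \<Longrightarrow> cmp Q B A"
  unfolding cmp_def by (metis add.commute)

text \<open>Such a \<open>b\<close> pairs trivially with \<open>A\<close> by assumption and with
  \<open>B\<close> by isotropy, hence with the whole nonsingular space.\<close>

lemma cmp_unique:
  assumes Q: "qspace Q" and AB: "cmp Q A B" and b: "b \<in> B" "\<And>a. a \<in> A \<Longrightarrow> lam Q b a = 0"
  shows "b = 0"
proof (rule qspaceD(9)[OF Q])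
  show "b \<in> carr Q" using isotD(5)[OF cmpD(2)[OF AB]] b by blast
  fix y assume "y \<in> carr Q"
  then obtain u v where "u \<in> A" "v \<in> B" "y = u + v" using cmpD(4)[OF AB] by blast
  then show "lam Q b y = 0"
    using b isotD(3)[OF cmpD(2)[OF AB] b(1)] qspaceD(2)[OF Q] isotD(5)[OF cmpD(2)[OF AB]] isotD(5)[OF cmpD(1)[OF AB]]
    by simp
qed

section \<open>Standard lagrangians and hyperbolic coordinates\<close>

definition Lg :: "nat \<Rightarrow> ('a vec \<times> 'a vec) set" where "Lg k = fr k \<times> {0}"
definition Ld :: "nat \<Rightarrow> ('a vec \<times> 'a vec) set" where "Ld k = {0} \<times> fr k"

lemma fr_mod [simp, intro]:
  "(0::'a vec) \<in> fr k" "x \<in> fr k \<Longrightarrow> y \<in> fr k \<Longrightarrow> x + y \<in> (fr k :: 'a vec set)"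
  "x \<in> (fr k :: 'a vec set) \<Longrightarrow> smul a x \<in> fr k" "x \<in> (fr k :: 'a vec set) \<Longrightarrow> - x \<in> fr k"
  "x \<in> fr k \<Longrightarrow> y \<in> fr k \<Longrightarrow> x - y \<in> (fr k :: 'a vec set)"
  by (auto simp: fr_def smul_def)

lemma smul_zero [simp]: "smul a 0 = (0 :: 'a vec)"
  by (auto simp: smul_def fun_eq_iff)

lemma cmp_hyp: "cmp (hyp k) (Lg k) (Ld k)"
proof -
  have "\<exists>u\<in>Lg k. \<exists>v\<in>Ld k. w = u + v" if "w \<in> fr k \<times> fr k" for w
    using that by (cases w) (force simp: Lg_def Ld_def)
  then show ?thesis
    unfolding cmp_def isot_def lsub_def by (auto simp: Lg_def Ld_def ip_simps zero_prod_def)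
qed

text \<open>The form identifies \<open>B\<close> with the dual of \<open>A\<close>, so a basis
  \<open>j\<close> of \<open>A\<close> has a dual basis in \<open>B\<close>, and the two together
  are hyperbolic coordinates. Some later uses depend on the isometry being prescribed on
  \<open>Lg k\<close> by \<open>j\<close>.\<close>

lemma cmp_imp_hyp_iso:
  assumes Q: "qspace Q" and AB: "cmp Q A B" and j: "free_on k (scl Q) A j"
  obtains h where "siso (hyp k) Q h" "h ` Lg k = A" "h ` Ld k = B" "\<And>x. x \<in> fr k \<Longrightarrow> h (x, 0) = j x"
proof -
  note A = isotD[OF cmpD(1)[OF AB]] and B = isotD[OF cmpD(2)[OF AB]]
  note QD = qspaceD[OF Q] and QM = qspace_mod[OF Q] and LL = lam_left[OF Q]
  have jl: "lin smul (fr k) (scl Q) j" and jb: "bij_betw j (fr k) A" using j by (auto simp: free_on_def)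
  have jA: "j x \<in> A" if "x \<in> fr k" for x using jb that by (auto simp: bij_betw_def)
  have jC: "j x \<in> carr Q" if "x \<in> fr k" for x using jA that A by blast
  obtain p where p: "lin (scl Q) (carr Q) (scl Q) p" "\<And>x. x \<in> carr Q \<Longrightarrow> p x \<in> A"
    "\<And>x. x \<in> carr Q \<Longrightarrow> x - p x \<in> B" "\<And>x. x \<in> A \<Longrightarrow> p x = x" "\<And>x. x \<in> B \<Longrightarrow> p x = 0"
    by (rule direct_sum_projection[OF QD(1) A(2,1) B(2,1)])
      (erule (1) cmpD(3)[OF AB], erule cmpD(4)[OF AB], (rule that; assumption))
  have jinv: "lin (scl Q) A smul (inv_into (fr k) j)"
    by (rule lin_inv_into[OF lmod_fr jl jb])
  have "\<exists>b. b \<in> B \<and> (\<forall>x\<in>fr k. lam Q b (j x) = ip k x a)" for a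
  proof -
    \<comment> \<open>The functional with coordinates \<open>a\<close> on \<open>A\<close>, extended
      by zero on \<open>B\<close>. Nonsingularity represents it by some \<open>y\<close>, and the
      \<open>A\<close>-component of \<open>y\<close> may be dropped because \<open>A\<close> is
      isotropic.\<close>
    let ?\<phi> = "\<lambda>z. ip k (inv_into (fr k) j (p z)) a"
    have "lin (scl Q) (carr Q) smul (\<lambda>z. inv_into (fr k) j (p z))"
      by (rule lin_comp[OF p(1) jinv p(2)])
    then have "lin (scl Q) (carr Q) (*) ?\<phi>"
      unfolding lin_def by (simp add: ip_simps)
    then obtain y where y: "y \<in> carr Q" "\<And>z. z \<in> carr Q \<Longrightarrow> lam Q y z = ?\<phi> z" using QD(8) by blast
    obtain u b where ub: "u \<in> A" "b \<in> B" "y = u + b" using cmpD(4)[OF AB y(1)] by blast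
    have "lam Q b (j x) = ip k x a" if x: "x \<in> fr k" for x
    proof -
      have "lam Q u (j x) + lam Q b (j x) = lam Q y (j x)"
        unfolding ub(3) using LL(1) jC[OF x] ub A(5) B(5) by simp
      also have "\<dots> = ip k x a" using y(2) jC[OF x] p(4) jA[OF x] bij_betw_inv_into_left[OF jb x] by simp
      finally show ?thesis using A(3)[OF ub(1) jA[OF x]] by simp
    qed
    then show ?thesis using ub by blast
  qed
  then obtain g where g: "\<And>a. g a \<in> B" "\<And>a x. x \<in> fr k \<Longrightarrow> lam Q (g a) (j x) = ip k x a" by metis
  have u: "b = g a" if "b \<in> B" "\<And>x. x \<in> fr k \<Longrightarrow> lam Q b (j x) = ip k x a" for b a
  proof -
    have "b - g a = 0"
    proof (rule cmp_unique[OF Q AB])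
      show "b - g a \<in> B" using lsub_diff[OF QD(1) B(2,1)] that(1) g(1) by blast
      fix z assume "z \<in> A"
      then obtain x where "x \<in> fr k" "z = j x" using jb by (auto simp: bij_betw_def)
      then show "lam Q (b - g a) z = 0"
        using lam_diff(1)[OF Q jC[of x], of b "g a"] that g B(5) by simp
    qed
    then show ?thesis by simp
  qed
  have gl: "lin smul (fr k) (scl Q) g"
    unfolding lin_def
    using lsubD(2,3)[OF B(2)] g jC B(5) by (auto intro!: u[symmetric] simp: LL ip_simps)
  have gb: "bij_betw g (fr k) B"
    unfolding bij_betw_def
  proof
    show "inj_on g (fr k)"
    proof (rule inj_onI)
      fix a b assume ab: "a \<in> fr k" "b \<in> fr k" "g a = g b"
      have "a - b = 0"
        using ab g(2)[of _ a] g(2)[of _ b] by (intro ip_eq_zero[of _ k]) (auto simp: ip_simps diff_conv_add_uminus simp del: add_uminus_conv_diff)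
      then show "a = b" by simp
    qed
    show "g ` fr k = B"
    proof (intro subset_antisym subsetI)
      fix b assume b: "b \<in> B"
      have "lin smul (fr k) (*) (\<lambda>x. lam Q b (j x))"
        by (rule lin_comp[OF jl lam_lin_right[OF Q B(5)[OF b]]]) (rule jC)
      from ip_functional[OF this] obtain a where "a \<in> fr k" "\<And>x. x \<in> fr k \<Longrightarrow> lam Q b (j x) = ip k x a"
        by blast
      then show "b \<in> g ` fr k" using u[OF b] by blast
    qed (use g in auto)
  qed
  define h where "h = (\<lambda>(x, a). j x + g a)"
  have j0: "j 0 = 0" and g0: "g 0 = 0" using lin_zero[OF jl] lin_zero[OF gl] by auto
  have gC: "g a \<in> carr Q" for a using g(1) B by blast
  have "siso (hyp k) Q h"
    unfolding siso_def
  proof (intro conjI ballI)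
    show "bij_betw h (carr (hyp k)) (carr Q)"
      unfolding bij_betw_def
    proof
      show "inj_on h (carr (hyp k))"
      proof (rule inj_onI, clarsimp simp: h_def)
        fix x a y b assume *: "x \<in> fr k" "a \<in> fr k" "y \<in> fr k" "b \<in> fr k" and e: "j x + g a = j y + g b"
        have e': "j x - j y = g b - g a" using e by (simp add: algebra_simps)
        have "j x - j y \<in> A" "g b - g a \<in> B"
          using lsub_diff[OF QD(1) A(2,1)] lsub_diff[OF QD(1) B(2,1)] jA g * by auto
        then have "j x - j y = 0" "g b - g a = 0" using cmpD(3)[OF AB] e' by metis+
        then show "x = y \<and> a = b" using jb gb * by (auto simp: bij_betw_def inj_on_def)
      qed
      show "h ` carr (hyp k) = carr Q"
      proof (intro subset_antisym subsetI)
        fix z assume "z \<in> carr Q"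
        then obtain u v where uv: "u \<in> A" "v \<in> B" "z = u + v" using cmpD(4)[OF AB] by blast
        then obtain x a where "x \<in> fr k" "u = j x" "a \<in> fr k" "v = g a"
          using jb gb by (auto simp: bij_betw_def)
        then show "z \<in> h ` carr (hyp k)" using uv by (auto simp: h_def intro!: image_eqI[of _ _ "(x, a)"])
      qed (auto simp: h_def jC gC QM)
    qed
    show "lin (scl (hyp k)) (carr (hyp k)) (scl Q) h"
      unfolding lin_def
      by (auto simp: h_def linD[OF jl] linD[OF gl] lmodD(3)[OF QD(1)] jC gC algebra_simps)
  next
    fix u v assume "u \<in> carr (hyp k)" "v \<in> carr (hyp k)"
    then obtain x a y b where uv: "u = (x, a)" "v = (y, b)" "x \<in> fr k" "a \<in> fr k" "y \<in> fr k" "b \<in> fr k"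
      by auto
    have "lam Q (j x + g a) (j y + g b) = lam Q (j x) (g b) + lam Q (g a) (j y)"
      using uv jC gC A(3)[OF jA jA] B(3)[OF g(1) g(1)] by (simp add: LL QD(2) QM)
    moreover have "lam Q (j x) (g b) = \<epsilon> * bar (ip k x b)"
      using QD(4)[OF jC gC, of x b] g(2)[of x b] uv by simp
    ultimately show "lam Q (h u) (h v) = lam (hyp k) u v"
      using uv g(2) by (simp add: h_def)
  next
    fix u assume "u \<in> carr (hyp k)"
    then obtain x a where uv: "u = (x, a)" "x \<in> fr k" "a \<in> fr k" by auto
    \<comment> \<open>Both summands are isotropic, so only the mixed term survives, and
      \<open>qeq_swap\<close> turns it into the quadratic function of \<open>hyp k\<close>.\<close>
    have "qeq (quad Q (j x + g a)) (quad Q (j x) + quad Q (g a) + lam Q (j x) (g a))"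
      using QD(5)[OF jC gC] uv by blast
    also have "qeq \<dots> (0 + 0 + lam Q (j x) (g a))"
      using uv by (intro qeq_add A(4) B(4) jA g(1) qeq_refl)
    also have "lam Q (j x) (g a) = \<epsilon> * bar (ip k x a)"
      using QD(4)[OF jC gC, of x a] g(2)[of x a] uv by simp
    also have "qeq (0 + 0 + \<epsilon> * bar (ip k x a)) (ip k x a)" using qeq_swap by simp
    finally show "qeq (quad Q (h u)) (quad (hyp k) u)" using uv by (simp add: h_def)
  qed
  moreover have "h ` Lg k = j ` fr k" by (force simp: h_def Lg_def g0)
  moreover have "h ` Ld k = g ` fr k" by (force simp: h_def Ld_def j0)
  moreover have "h (x, 0) = j x" for x by (simp add: h_def g0)
  ultimately show ?thesis using that jb gb by (auto simp: bij_betw_def)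
qed

section \<open>Isometries and complementary isotropic submodules\<close>

lemma sisoD:
  assumes "siso Q R h"
  shows "bij_betw h (carr Q) (carr R)" "lin (scl Q) (carr Q) (scl R) h"
    "x \<in> carr Q \<Longrightarrow> y \<in> carr Q \<Longrightarrow> lam R (h x) (h y) = lam Q x y"
    "x \<in> carr Q \<Longrightarrow> qeq (quad R (h x)) (quad Q x)" "x \<in> carr Q \<Longrightarrow> h x \<in> carr R"
  using assms unfolding siso_def bij_betw_def by blast+

lemma siso_id: "siso Q Q (\<lambda>x. x)"
  by (simp add: siso_def lin_def bij_betw_def inj_on_def)

lemma siso_comp:
  assumes h: "siso Q R h" and g: "siso R S g" shows "siso Q S (\<lambda>x. g (h x))"
  unfolding siso_def
proof (intro conjI ballI)
  show "bij_betw (\<lambda>x. g (h x)) (carr Q) (carr S)"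
    using bij_betw_trans[OF sisoD(1)[OF h] sisoD(1)[OF g]] by (simp add: comp_def)
  show "lin (scl Q) (carr Q) (scl S) (\<lambda>x. g (h x))"
    by (rule lin_comp[OF sisoD(2)[OF h] sisoD(2)[OF g] sisoD(5)[OF h]])
  show "qeq (quad S (g (h x))) (quad Q x)" if "x \<in> carr Q" for x
    using qeq_trans[OF sisoD(4)[OF g sisoD(5)[OF h that]] sisoD(4)[OF h that]] .
qed (simp add: sisoD(3,5)[OF h] sisoD(3)[OF g])

lemma siso_inv:
  assumes Q: "qspace Q" and h: "siso Q R h" shows "siso R Q (inv_into (carr Q) h)"
proof -
  let ?g = "inv_into (carr Q) h"
  have g: "bij_betw ?g (carr R) (carr Q)" by (rule bij_betw_inv_into[OF sisoD(1)[OF h]])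
  have m: "?g y \<in> carr Q" "h (?g y) = y" if "y \<in> carr R" for y
    using that g bij_betw_inv_into_right[OF sisoD(1)[OF h] that] by (auto simp: bij_betw_def)
  show ?thesis
    unfolding siso_def
  proof (intro conjI ballI)
    show "lin (scl R) (carr R) (scl Q) ?g" by (rule lin_inv_into[OF qspaceD(1)[OF Q] sisoD(2,1)[OF h]])
    show "lam Q (?g x) (?g y) = lam R x y" if "x \<in> carr R" "y \<in> carr R" for x y
      using sisoD(3)[OF h m(1)[OF that(1)] m(1)[OF that(2)]] m(2) that by simp
    show "qeq (quad Q (?g x)) (quad R x)" if "x \<in> carr R" for x
      using qeq_sym[OF sisoD(4)[OF h m(1)[OF that]]] m(2)[OF that] by simp
  qed (rule g)
qed

lemma siso_inv_image:
  assumes "siso Q R h" "A \<subseteq> carr Q" shows "inv_into (carr Q) h ` (h ` A) = A"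
  using assms(2) sisoD(1)[OF assms(1)] by (simp add: bij_betw_def inv_into_image_cancel)

lemma siso_zero: "qspace Q \<Longrightarrow> siso Q R h \<Longrightarrow> h 0 = 0"
  using lin_zero[OF sisoD(2)] qspace_mod(1) by blast

lemma siso_cong:
  assumes Q: "qspace Q" and h: "siso Q R h" and e: "\<And>x. x \<in> carr Q \<Longrightarrow> g x = h x" shows "siso Q R g"
proof -
  have "bij_betw g (carr Q) (carr R)" using sisoD(1)[OF h] bij_betw_cong[of "carr Q" g h] e by blast
  then show ?thesis
    using sisoD[OF h] linD[OF sisoD(2)[OF h]] unfolding siso_def lin_def
    by (simp add: e qspace_mod[OF Q])
qed

lemma isot_image:
  assumes Q: "qspace Q" and h: "siso Q R h" and A: "isot Q A" shows "isot R (h ` A)"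
proof -
  note A' = isotD[OF A]
  have l: "h x + h y = h (x + y)" "scl R a (h x) = h (scl Q a x)" if "x \<in> A" "y \<in> A" for x y a
    using linD[OF sisoD(2)[OF h]] that A'(5) by simp_all
  have "0 \<in> h ` A" using siso_zero[OF Q h] lsubD(1)[OF A'(2)] by (metis imageI)
  moreover have "h x + h y \<in> h ` A" "scl R a (h x) \<in> h ` A" if "x \<in> A" "y \<in> A" for x y a
    using l[OF that] lsubD(2,3)[OF A'(2)] that by simp_all
  moreover have "qeq (quad R (h x)) 0" if "x \<in> A" for x
    using qeq_trans[OF sisoD(4)[OF h A'(5)[OF that]] A'(4)[OF that]] .
  moreover have "lam R (h x) (h y) = 0" if "x \<in> A" "y \<in> A" for x y
    using sisoD(3)[OF h] A'(3,5) that by simp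
  ultimately show ?thesis
    unfolding isot_def lsub_def using sisoD(5)[OF h] A'(5) by blast
qed

lemma cmp_image:
  assumes Q: "qspace Q" and h: "siso Q R h" and AB: "cmp Q A B" shows "cmp R (h ` A) (h ` B)"
  unfolding cmp_def
proof (intro conjI ballI impI)
  note A = isotD(5)[OF cmpD(1)[OF AB]] and B = isotD(5)[OF cmpD(2)[OF AB]]
  show "isot R (h ` A)" "isot R (h ` B)"
    using isot_image[OF Q h] cmpD(1,2)[OF AB] by blast+
  fix x
  { assume "x \<in> h ` A" "x \<in> h ` B"
    then obtain a b where "x = h a" "a \<in> A" "b \<in> B" "h a = h b" by auto
    moreover then have "a = b" using sisoD(1)[OF h] A B by (auto simp: bij_betw_def inj_on_def)
    ultimately show "x = 0" using cmpD(3)[OF AB] siso_zero[OF Q h] by metis }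
  assume "x \<in> carr R"
  then obtain y where y: "y \<in> carr Q" "x = h y" using sisoD(1)[OF h] by (auto simp: bij_betw_def)
  then obtain a b where "a \<in> A" "b \<in> B" "y = a + b" using cmpD(4)[OF AB] by blast
  then show "\<exists>a\<in>h ` A. \<exists>b\<in>h ` B. x = a + b" using y linD(1)[OF sisoD(2)[OF h]] A B by blast
qed

lemma siso_prod:
  assumes h: "siso Q Q' h" and g: "siso R R' g"
  shows "siso (sp_sum Q R) (sp_sum Q' R') (map_prod h g)"
proof -
  have "qeq (quad Q' (h x) + quad R' (g y)) (quad Q x + quad R y)" if "x \<in> carr Q" "y \<in> carr R" for x y
    by (rule qeq_add[OF sisoD(4)[OF h that(1)] sisoD(4)[OF g that(2)]])
  then show ?thesis
    using linD[OF sisoD(2)[OF h]] linD[OF sisoD(2)[OF g]] sisoD(3)[OF h] sisoD(3)[OF g]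
    unfolding siso_def lin_def by (auto intro: bij_betw_map_prod sisoD(1)[OF h] sisoD(1)[OF g])
qed

lemma siso_neg: "siso Q R h \<Longrightarrow> siso (sp_neg Q) (sp_neg R) h"
  unfolding siso_def using qeq_minus by auto

lemma siso_assoc: "siso (sp_sum (sp_sum Q R) S) (sp_sum Q (sp_sum R S)) (\<lambda>((x, y), z). (x, (y, z)))"
  unfolding siso_def lin_def
  by (intro conjI bij_betwI[where g = "\<lambda>(x, (y, z)). ((x, y), z)"]) (auto simp: add.assoc)

lemma siso_assoc': "siso (sp_sum Q (sp_sum R S)) (sp_sum (sp_sum Q R) S) (\<lambda>(x, (y, z)). ((x, y), z))"
  unfolding siso_def lin_def
  by (intro conjI bij_betwI[where g = "\<lambda>((x, y), z). (x, (y, z))"]) (auto simp: add.assoc)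

lemma siso_swap: "siso (sp_sum (sp_sum Q R) S) (sp_sum (sp_sum Q S) R) (\<lambda>((x, y), z). ((x, z), y))"
  unfolding siso_def lin_def
  by (intro conjI bij_betwI[where g = "\<lambda>((x, y), z). ((x, z), y)"]) (auto simp: algebra_simps)

lemma siso_interchange:
  "siso (sp_sum (sp_sum Q R) (sp_sum Q' R')) (sp_sum (sp_sum Q Q') (sp_sum R R'))
     (\<lambda>((x, y), (x', y')). ((x, x'), (y, y')))"
  unfolding siso_def lin_def
  by (intro conjI bij_betwI[where g = "\<lambda>((x, y), (x', y')). ((x, x'), (y, y'))"]) (auto simp: algebra_simps)

lemma sp_neg_neg [simp]: "sp_neg (sp_neg Q) = Q"
  by (simp add: sp_neg_def)

lemma isot_prod: "isot Q A \<Longrightarrow> isot R B \<Longrightarrow> isot (sp_sum Q R) (A \<times> B)"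
  unfolding isot_def lsub_def using qeq_add[of _ 0 _ 0] by (auto simp: zero_prod_def)

lemma cmp_prod:
  assumes "cmp Q A B" "cmp R A' B'" shows "cmp (sp_sum Q R) (A \<times> A') (B \<times> B')"
  unfolding cmp_def
proof (intro conjI ballI impI)
  show "isot (sp_sum Q R) (A \<times> A')" by (rule isot_prod[OF cmpD(1)[OF assms(1)] cmpD(1)[OF assms(2)]])
  show "isot (sp_sum Q R) (B \<times> B')" by (rule isot_prod[OF cmpD(2)[OF assms(1)] cmpD(2)[OF assms(2)]])
  fix w
  { assume "w \<in> A \<times> A'" "w \<in> B \<times> B'"
    then show "w = 0" using cmpD(3)[OF assms(1)] cmpD(3)[OF assms(2)] by (cases w) (auto simp: zero_prod_def) }
  assume "w \<in> carr (sp_sum Q R)"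
  then obtain x y where w: "w = (x, y)" "x \<in> carr Q" "y \<in> carr R" by auto
  obtain a b c d where "a \<in> A" "b \<in> B" "x = a + b" "c \<in> A'" "d \<in> B'" "y = c + d"
    using cmpD(4)[OF assms(1) w(2)] cmpD(4)[OF assms(2) w(3)] by blast
  then show "\<exists>u\<in>A \<times> A'. \<exists>v\<in>B \<times> B'. w = u + v"
    using w by (intro bexI[of _ "(a, c)"] bexI[of _ "(b, d)"]) auto
qed

lemma isot_neg [simp]: "isot (sp_neg Q) A \<longleftrightarrow> isot Q A"
  unfolding isot_def using qeq_minus[of _ 0] by auto (metis minus_minus neg_0_equal_iff_equal qeq_minus)

lemma cmp_neg [simp]: "cmp (sp_neg Q) A B \<longleftrightarrow> cmp Q A B"
  unfolding cmp_def by simp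

definition diagonal :: "('a, 'm) space \<Rightarrow> ('m \<times> 'm) set" where
  "diagonal Q = {(x, x) |x. x \<in> carr Q}"

lemma isot_diagonal: assumes Q: "qspace Q" shows "isot (sp_sum Q (sp_neg Q)) (diagonal Q)"
  unfolding isot_def lsub_def diagonal_def using qspace_mod[OF Q] by (auto simp: zero_prod_def)

text \<open>One and the same isotropic submodule works for all complementary pairs \<open>A\<close>,
  \<open>B\<close>. This is the source of common complements for otherwise unrelated
  lagrangians.\<close>

lemma cmp_diagonal:
  assumes Q: "qspace Q" and AB: "cmp Q A B" shows "cmp (sp_sum Q (sp_neg Q)) (diagonal Q) (A \<times> B)"
  unfolding cmp_def
proof (intro conjI ballI impI)
  note A = isotD[OF cmpD(1)[OF AB]] and B = isotD[OF cmpD(2)[OF AB]]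
  show "isot (sp_sum Q (sp_neg Q)) (diagonal Q)" by (rule isot_diagonal[OF Q])
  show "isot (sp_sum Q (sp_neg Q)) (A \<times> B)" using cmpD(1,2)[OF AB] by (simp add: isot_prod)
  fix w
  { assume "w \<in> diagonal Q" "w \<in> A \<times> B"
    then show "w = 0" using cmpD(3)[OF AB] by (auto simp: diagonal_def zero_prod_def) }
  assume "w \<in> carr (sp_sum Q (sp_neg Q))"
  then obtain x y where w: "w = (x, y)" "x \<in> carr Q" "y \<in> carr Q" by auto
  \<comment> \<open>Splitting the difference of the two coordinates gives
    \<open>(x, y) = (y + b, y + b) + (a, - b)\<close>.\<close>
  obtain a b where ab: "a \<in> A" "b \<in> B" "x - y = a + b"
    using cmpD(4)[OF AB] qspace_mod(5)[OF Q w(2,3)] by blast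
  have "- b \<in> B" by (rule lsub_uminus[OF qspaceD(1)[OF Q] B(2,1) ab(2)])
  moreover have "y + b \<in> carr Q" using qspace_mod(2)[OF Q w(3) B(5)[OF ab(2)]] .
  moreover have "x = y + b + a" using ab(3) by (simp add: algebra_simps)
  ultimately show "\<exists>u\<in>diagonal Q. \<exists>v\<in>A \<times> B. w = u + v"
    using w(1) ab(1) by (intro bexI[of _ "(y + b, y + b)"] bexI[of _ "(a, - b)"]) (auto simp: diagonal_def)
qed

lemma cmp_diagonal':
  assumes Q: "qspace Q" and AB: "cmp Q A B" shows "cmp (sp_sum (sp_neg Q) Q) (diagonal Q) (A \<times> B)"
  using cmp_diagonal[OF qspace_sp_neg[OF Q], of A B] AB by (simp add: diagonal_def)

section \<open>Free submodules\<close>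

definition trunc :: "nat \<Rightarrow> 'a vec \<Rightarrow> 'a vec" where "trunc k x = (\<lambda>i. if i < k then x i else 0)"
definition drop_vec :: "nat \<Rightarrow> 'a vec \<Rightarrow> 'a vec" where "drop_vec k x = (\<lambda>i. x (i + k))"
definition shift :: "nat \<Rightarrow> 'a vec \<Rightarrow> 'a vec" where "shift k x = (\<lambda>i. if i < k then 0 else x (i - k))"

lemma vec_simps:
  "trunc k (x + y) = trunc k x + trunc k y" "trunc k (smul a x) = smul a (trunc k x)"
  "drop_vec k (x + y) = drop_vec k x + drop_vec k y" "drop_vec k (smul a x) = smul a (drop_vec k x)"
  "shift k (x + y) = shift k x + shift k y" "shift k (smul a x) = smul a (shift k x)"
  "trunc k x + shift k (drop_vec k x) = x" "drop_vec k (shift k x) = x" "trunc k (shift k x) = 0"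
  "trunc k x \<in> fr k" "x \<in> fr k \<Longrightarrow> trunc k x = x" "x \<in> fr k \<Longrightarrow> drop_vec k x = 0"
  "trunc k 0 = 0" "shift k 0 = 0" "drop_vec k 0 = 0"
  "x \<in> fr (k + l) \<Longrightarrow> drop_vec k x \<in> fr l" "x \<in> fr l \<Longrightarrow> shift k x \<in> fr (k + l)"
  "x \<in> fr k \<Longrightarrow> x \<in> fr (k + l)"
  by (auto simp: trunc_def drop_vec_def shift_def smul_def fr_def fun_eq_iff)

lemma ip_shift:
  assumes "x \<in> fr k" "a \<in> fr k"
  shows "ip (k + l) (x + shift k y) (a + shift k b) = ip k x a + ip l y b"
proof -
  have "ip (k + l) (x + shift k y) (a + shift k b) = (\<Sum>i<k. x i * bar (a i)) + (\<Sum>i<l. y i * bar (b i))"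
  proof -
    have "(\<Sum>i<k + l. f i) = (\<Sum>i<k. f i) + (\<Sum>i<l. f (i + k))" for f :: "nat \<Rightarrow> 'a"
      by (induction l) (simp_all add: add.commute add.left_commute)
    then show ?thesis using assms by (simp add: ip_def fr_def shift_def)
  qed
  then show ?thesis by (simp add: ip_def)
qed

lemma free_onD:
  assumes "free_on k s A j"
  shows "lin smul (fr k) s j" "bij_betw j (fr k) A" "x \<in> fr k \<Longrightarrow> j x \<in> A"
  using assms unfolding free_on_def bij_betw_def by blast+

lemma free_on_image:
  assumes j: "free_on k (scl Q) A j" and h: "siso Q R h" and A: "A \<subseteq> carr Q"
  shows "free_on k (scl R) (h ` A) (\<lambda>x. h (j x))"
proof -
  have "inj_on h A" using sisoD(1)[OF h] A inj_on_subset by (auto simp: bij_betw_def)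
  then have "bij_betw h A (h ` A)" by (simp add: bij_betw_def)
  then have "bij_betw (\<lambda>x. h (j x)) (fr k) (h ` A)"
    using bij_betw_trans[OF free_onD(2)[OF j]] by (simp add: comp_def)
  moreover have "lin smul (fr k) (scl R) (\<lambda>x. h (j x))"
    using lin_comp[OF free_onD(1)[OF j] sisoD(2)[OF h]] free_onD(3)[OF j] A by blast
  ultimately show ?thesis by (simp add: free_on_def)
qed

lemma isfree_image: "isfree (scl Q) A \<Longrightarrow> siso Q R h \<Longrightarrow> A \<subseteq> carr Q \<Longrightarrow> isfree (scl R) (h ` A)"
  unfolding isfree_def using free_on_image by blast

lemma free_on_prod:
  assumes i: "free_on k (scl Q) A i" and j: "free_on l (scl R) B j"
  shows "free_on (k + l) (scl (sp_sum Q R)) (A \<times> B) (\<lambda>x. (i (trunc k x), j (drop_vec k x)))"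
  unfolding free_on_def
proof
  show "lin smul (fr (k + l)) (scl (sp_sum Q R)) (\<lambda>x. (i (trunc k x), j (drop_vec k x)))"
    unfolding lin_def
    by (auto simp: vec_simps linD[OF free_onD(1)[OF i]] linD[OF free_onD(1)[OF j]])
  let ?i = "inv_into (fr k) i" and ?j = "inv_into (fr l) j"
  have "?i a \<in> fr k" "i (?i a) = a" if "a \<in> A" for a
    using that free_onD(2)[OF i] by (auto simp: bij_betw_def inv_into_into f_inv_into_f)
  moreover have "?j b \<in> fr l" "j (?j b) = b" if "b \<in> B" for b
    using that free_onD(2)[OF j] by (auto simp: bij_betw_def inv_into_into f_inv_into_f)
  moreover have "?i (i x) = x" if "x \<in> fr k" for x
    using bij_betw_inv_into_left[OF free_onD(2)[OF i] that] .
  moreover have "?j (j x) = x" if "x \<in> fr l" for x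
    using bij_betw_inv_into_left[OF free_onD(2)[OF j] that] .
  moreover have "trunc k (a + shift k b) = a" "drop_vec k (a + shift k b) = b" if "a \<in> fr k" for a b
    using that by (simp_all add: vec_simps)
  ultimately show "bij_betw (\<lambda>x. (i (trunc k x), j (drop_vec k x))) (fr (k + l)) (A \<times> B)"
    by (intro bij_betwI[where g = "\<lambda>(a, b). ?i a + shift k (?j b)"])
      (auto simp: vec_simps free_onD(3)[OF i] free_onD(3)[OF j])
qed

lemma isfree_prod: "isfree (scl Q) A \<Longrightarrow> isfree (scl R) B \<Longrightarrow> isfree (scl (sp_sum Q R)) (A \<times> B)"
  unfolding isfree_def using free_on_prod by blast

lemma free_on_Lg: "free_on k (scl (hyp k)) (Lg k) (\<lambda>x. (x, 0))"
  unfolding free_on_def lin_def Lg_def by (auto intro!: bij_betwI[where g = fst])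

lemma free_on_Ld: "free_on k (scl (hyp k)) (Ld k) (\<lambda>x. (0, x))"
  unfolding free_on_def lin_def Ld_def by (auto intro!: bij_betwI[where g = snd])

text \<open>In hyperbolic coordinates adapted to \<open>A\<close> the complement becomes
  \<open>Ld k\<close>, which has the dual basis.\<close>

lemma isfree_cmp:
  assumes Q: "qspace Q" and AB: "cmp Q A B" and A: "isfree (scl Q) A" shows "isfree (scl Q) B"
proof -
  obtain k j where "free_on k (scl Q) A j" using A by (auto simp: isfree_def)
  then obtain h where h: "siso (hyp k) Q h" "h ` Ld k = B" by (rule cmp_imp_hyp_iso[OF Q AB]) blast
  have "Ld k \<subseteq> carr (hyp k)" by (auto simp: Ld_def)
  from free_on_image[OF free_on_Ld h(1) this] show ?thesis using h(2) by (auto simp: isfree_def)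
qed

section \<open>Stable equivalence of lagrangians\<close>

text \<open>\<open>sim Q F G\<close> says that the formation \<open>(Q; F, G)\<close> becomes a boundary after adding a trivial
  formation: a boundary is a formation whose two lagrangians have a common lagrangian complement.\<close>

definition sim :: "('a, 'm::ab_group_add) space \<Rightarrow> 'm set \<Rightarrow> 'm set \<Rightarrow> bool" where
  "sim Q F G \<longleftrightarrow> (\<exists>m K. cmp (sp_sum Q (hyp m)) K (F \<times> Lg m) \<and> cmp (sp_sum Q (hyp m)) K (G \<times> Ld m))"

lemma map_prod_image_Times: "map_prod f g ` (A \<times> B) = (f ` A) \<times> (g ` B)"
  by force

text \<open>The stabilizing formation may be any trivial one: hyperbolic coordinates adapted to
  \<open>A\<close> and \<open>B\<close> turn \<open>(R; A, B)\<close> into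
  \<open>(hyp k; Lg k, Ld k)\<close>. Constructions can thus stabilize by whatever space suits them,
  such as \<open>sp_neg Q\<close>.\<close>

lemma simI:
  assumes Q: "qspace Q" and R: "qspace R" and AB: "cmp R A B" and A: "isfree (scl R) A"
    and K: "cmp (sp_sum Q R) K (F \<times> A)" "cmp (sp_sum Q R) K (G \<times> B)"
  shows "sim Q F G"
proof -
  obtain k j where "free_on k (scl R) A j" using A by (auto simp: isfree_def)
  then obtain h where h: "siso (hyp k) R h" "h ` Lg k = A" "h ` Ld k = B"
    by (rule cmp_imp_hyp_iso[OF R AB]) blast
  let ?g = "inv_into (carr (hyp k)) h"
  have i: "?g ` A = Lg k" "?g ` B = Ld k"
    using siso_inv_image[OF h(1), of "Lg k", unfolded h(2)] siso_inv_image[OF h(1), of "Ld k", unfolded h(3)]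
    by (simp_all add: Lg_def Ld_def Sigma_mono)
  have s: "siso (sp_sum Q R) (sp_sum Q (hyp k)) (map_prod (\<lambda>x. x) ?g)"
    by (rule siso_prod[OF siso_id siso_inv[OF qspace_hyp h(1)]])
  have "cmp (sp_sum Q (hyp k)) (map_prod (\<lambda>x. x) ?g ` K) (F \<times> Lg k)"
    using cmp_image[OF qspace_sp_sum[OF Q R] s K(1)] unfolding map_prod_image_Times i image_ident .
  moreover have "cmp (sp_sum Q (hyp k)) (map_prod (\<lambda>x. x) ?g ` K) (G \<times> Ld k)"
    using cmp_image[OF qspace_sp_sum[OF Q R] s K(2)] unfolding map_prod_image_Times i image_ident .
  ultimately show ?thesis unfolding sim_def by blast
qed

text \<open>Exchanging \<open>F\<close> and \<open>G\<close> also exchanges \<open>Lg m\<close> and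
  \<open>Ld m\<close> in the stabilizer, which \<open>simI\<close> accepts because
  \<open>Ld m\<close> is free.\<close>

lemma sim_sym: assumes Q: "qspace Q" and s: "sim Q F G" shows "sim Q G F"
proof -
  obtain m K where K: "cmp (sp_sum Q (hyp m)) K (F \<times> Lg m)" "cmp (sp_sum Q (hyp m)) K (G \<times> Ld m)"
    using s by (auto simp: sim_def)
  have "isfree (scl (hyp m)) (Ld m)" using free_on_Ld by (auto simp: isfree_def)
  from simI[OF Q qspace_hyp cmp_sym[OF cmp_hyp] this K(2,1)] show ?thesis .
qed

text \<open>The stabilizer is taken of rank zero, where both standard lagrangians are zero.\<close>

lemma sim_common: assumes "cmp Q F K" "cmp Q K G" shows "sim Q F G"
proof -
  have "fr 0 = {0 :: 'a vec}" by (auto simp: fr_def fun_eq_iff)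
  then have e: "Ld 0 = Lg 0" by (simp add: Ld_def Lg_def)
  show ?thesis
    using cmp_prod[OF cmp_sym[OF assms(1)] cmp_sym[OF cmp_hyp, of 0]] cmp_prod[OF assms(2) cmp_hyp, of 0]
    unfolding sim_def by (intro exI[of _ 0] exI[of _ "K \<times> Lg 0"]) (simp add: e)
qed

lemma sim_refl: "cmp Q F F' \<Longrightarrow> sim Q F F"
  using sim_common cmp_sym by blast

text \<open>Stabilizing by \<open>(-Q; F', F)\<close> leads to \<open>F \<times> F'\<close> and
  \<open>F' \<times> F\<close>, and the diagonal is complementary to both. This lets a free
  lagrangian be traded for its complement.\<close>

lemma sim_cmp:
  assumes Q: "qspace Q" and F: "cmp Q F F'" and f: "isfree (scl Q) F" shows "sim Q F F'"
proof (rule simI[OF Q qspace_sp_neg[OF Q]])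
  show "cmp (sp_neg Q) F' F" using cmp_sym[OF F] by simp
  show "isfree (scl (sp_neg Q)) F'" using isfree_cmp[OF Q F f] by simp
  show "cmp (sp_sum Q (sp_neg Q)) (diagonal Q) (F \<times> F')" by (rule cmp_diagonal[OF Q F])
  show "cmp (sp_sum Q (sp_neg Q)) (diagonal Q) (F' \<times> F)" by (rule cmp_diagonal[OF Q cmp_sym[OF F]])
qed

lemma sim_siso:
  assumes Q: "qspace Q" and h: "siso Q R h" and s: "sim Q F G" shows "sim R (h ` F) (h ` G)"
proof -
  obtain m K where K: "cmp (sp_sum Q (hyp m)) K (F \<times> Lg m)" "cmp (sp_sum Q (hyp m)) K (G \<times> Ld m)"
    using s by (auto simp: sim_def)
  note c = cmp_image[OF qspace_sp_sum[OF Q qspace_hyp] siso_prod[OF h siso_id]]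
  show ?thesis using c[OF K(1)] c[OF K(2)] unfolding sim_def map_prod_image_Times by auto
qed

lemma sim_sum:
  assumes Q: "qspace Q" and R: "qspace R" and s: "sim Q F G" and t: "sim R F' G'"
  shows "sim (sp_sum Q R) (F \<times> F') (G \<times> G')"
proof -
  obtain m K where K: "cmp (sp_sum Q (hyp m)) K (F \<times> Lg m)" "cmp (sp_sum Q (hyp m)) K (G \<times> Ld m)"
    using s by (auto simp: sim_def)
  obtain n M where M: "cmp (sp_sum R (hyp n)) M (F' \<times> Lg n)" "cmp (sp_sum R (hyp n)) M (G' \<times> Ld n)"
    using t by (auto simp: sim_def)
  let ?h = "\<lambda>((x, y), (x', y')). ((x, x'), (y, y'))"
  have i: "?h ` ((A \<times> B) \<times> (A' \<times> B')) = (A \<times> A') \<times> (B \<times> B')"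
    for A :: "'b set" and B :: "('a vec \<times> 'a vec) set" and A' :: "'c set" and B' :: "('a vec \<times> 'a vec) set"
    by force
  note c = cmp_image[OF qspace_sp_sum[OF qspace_sp_sum[OF Q qspace_hyp[of m]] qspace_sp_sum[OF R qspace_hyp[of n]]]
      siso_interchange, unfolded i]
  show ?thesis
  proof (rule simI[OF qspace_sp_sum[OF Q R] qspace_sp_sum[OF qspace_hyp qspace_hyp]])
    show "cmp (sp_sum (hyp m) (hyp n)) (Lg m \<times> Lg n) (Ld m \<times> Ld n)" by (rule cmp_prod[OF cmp_hyp cmp_hyp])
    show "isfree (scl (sp_sum (hyp m) (hyp n))) (Lg m \<times> Lg n)"
      using free_on_prod[OF free_on_Lg free_on_Lg] unfolding isfree_def by blast
    show "cmp (sp_sum (sp_sum Q R) (sp_sum (hyp m) (hyp n))) (?h ` (K \<times> M)) ((F \<times> F') \<times> (Lg m \<times> Lg n))"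
      using cmp_image[OF qspace_sp_sum[OF qspace_sp_sum[OF Q qspace_hyp] qspace_sp_sum[OF R qspace_hyp]]
        siso_interchange cmp_prod[OF K(1) M(1)]] unfolding i .
    show "cmp (sp_sum (sp_sum Q R) (sp_sum (hyp m) (hyp n))) (?h ` (K \<times> M)) ((G \<times> G') \<times> (Ld m \<times> Ld n))"
      using cmp_image[OF qspace_sp_sum[OF qspace_sp_sum[OF Q qspace_hyp] qspace_sp_sum[OF R qspace_hyp]]
        siso_interchange cmp_prod[OF K(2) M(2)]] unfolding i .
  qed
qed

text \<open>The summand \<open>(R; A, B)\<close> is a trivial formation and is absorbed into the
  stabilizer. It must carry complementary lagrangians; a summand with equal ones is first converted
  by \<open>sim_cmp\<close>.\<close>

lemma sim_cancel:
  assumes Q: "qspace Q" and R: "qspace R" and AB: "cmp R A B" and A: "isfree (scl R) A"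
    and s: "sim (sp_sum Q R) (F \<times> A) (G \<times> B)"
  shows "sim Q F G"
proof -
  obtain m K where K: "cmp (sp_sum (sp_sum Q R) (hyp m)) K ((F \<times> A) \<times> Lg m)"
    "cmp (sp_sum (sp_sum Q R) (hyp m)) K ((G \<times> B) \<times> Ld m)"
    using s by (auto simp: sim_def)
  let ?h = "\<lambda>((x, y), z). (x, (y, z))"
  have i: "?h ` ((X \<times> Y) \<times> Z) = X \<times> (Y \<times> Z)"
    for X :: "'b set" and Y :: "'c set" and Z :: "('a vec \<times> 'a vec) set"
    by force
  note c = cmp_image[OF qspace_sp_sum[OF qspace_sp_sum[OF Q R] qspace_hyp] siso_assoc]
  show ?thesis
  proof (rule simI[OF Q qspace_sp_sum[OF R qspace_hyp[of m]]])
    show "cmp (sp_sum R (hyp m)) (A \<times> Lg m) (B \<times> Ld m)" by (rule cmp_prod[OF AB cmp_hyp])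
    show "isfree (scl (sp_sum R (hyp m))) (A \<times> Lg m)"
      using isfree_prod[OF A] free_on_Lg unfolding isfree_def by blast
    show "cmp (sp_sum Q (sp_sum R (hyp m))) (?h ` K) (F \<times> (A \<times> Lg m))" using c[OF K(1)] unfolding i .
    show "cmp (sp_sum Q (sp_sum R (hyp m))) (?h ` K) (G \<times> (B \<times> Ld m))" using c[OF K(2)] unfolding i .
  qed
qed

text \<open>Four successive complements already give equivalence: in \<open>P \<oplus> (-P \<oplus> P)\<close> the graph
  \<open>{(x, x, k) | k \<in> L3}\<close> is complementary to \<open>L0 \<oplus> L1 \<oplus> L2\<close> and to \<open>L4 \<oplus> \<Delta>\<close>.\<close>

lemma sim_chain:
  assumes P: "qspace P" and f: "isfree (scl P) L0"
    and c: "cmp P L0 L1" "cmp P L1 L2" "cmp P L2 L3" "cmp P L3 L4"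
  shows "sim P L0 L4"
proof -
  let ?h = "\<lambda>((x, y), z). (x, (y, z))"
  let ?K = "{(x, (x, z)) |x z. x \<in> carr P \<and> z \<in> L3}"
  let ?R = "sp_sum (sp_neg P) P"
  have R: "qspace ?R" by (rule qspace_sp_sum[OF qspace_sp_neg[OF P] P])
  have e: "?h ` (diagonal P \<times> L3) = ?K" "?h ` ((L0 \<times> L1) \<times> L2) = L0 \<times> (L1 \<times> L2)"
    by (force simp: diagonal_def)+
  \<comment> \<open>\<open>diagonal P\<close> is complementary to \<open>L0 \<times> L1\<close>, and
    \<open>L3\<close> to \<open>L2\<close>; reassociating the product of the two complements gives
    \<open>?K\<close>.\<close>
  have K1: "cmp (sp_sum P ?R) ?K (L0 \<times> (L1 \<times> L2))"
    using cmp_image[OF qspace_sp_sum[OF qspace_sp_sum[OF P qspace_sp_neg[OF P]] P] siso_assoc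
        cmp_prod[OF cmp_diagonal[OF P c(1)] cmp_sym[OF c(3)]]] unfolding e .
  note L3 = isotD[OF cmpD(1)[OF c(4)]] and L4 = isotD[OF cmpD(2)[OF c(4)]]
  have K2: "cmp (sp_sum P ?R) ?K (L4 \<times> diagonal P)"
    unfolding cmp_def
  proof (intro conjI ballI impI)
    show "isot (sp_sum P ?R) ?K" using cmpD(1)[OF K1] .
    show "isot (sp_sum P ?R) (L4 \<times> diagonal P)"
      using isot_prod[OF cmpD(2)[OF c(4)]] isot_diagonal[OF qspace_sp_neg[OF P]] by (simp add: diagonal_def)
    fix w
    { assume "w \<in> ?K" "w \<in> L4 \<times> diagonal P"
      then show "w = 0" using cmpD(3)[OF c(4)] by (auto simp: diagonal_def zero_prod_def) }
    assume "w \<in> carr (sp_sum P ?R)"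
    then obtain a b d where w: "w = (a, (b, d))" "a \<in> carr P" "b \<in> carr P" "d \<in> carr P" by auto
    \<comment> \<open>Writing \<open>(a, b, d)\<close> as \<open>(x, x, k) + (g, y, y)\<close>
      forces \<open>x = a - g\<close>, \<open>y = b - x\<close> and \<open>d = k + y\<close>, that
      is, \<open>k + g = d - b + a\<close>.\<close>
    obtain k g where kg: "k \<in> L3" "g \<in> L4" "d - b + a = k + g"
      using cmpD(4)[OF c(4) qspace_mod(2)[OF P qspace_mod(5)[OF P w(4,3)] w(2)]] by blast
    have "a - g \<in> carr P" "b - (a - g) \<in> carr P" using qspace_mod[OF P] w L4(5)[OF kg(2)] by simp_all
    moreover have "d = k + (b - (a - g))" using kg(3) by (simp add: algebra_simps)
    ultimately show "\<exists>u\<in>?K. \<exists>v\<in>L4 \<times> diagonal P. w = u + v"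
      using w(1) kg(1,2)
      by (intro bexI[of _ "(a - g, (a - g, k))"] bexI[of _ "(g, (b - (a - g), b - (a - g)))"])
        (auto simp: diagonal_def)
  qed
  have L1: "isfree (scl P) L1" by (rule isfree_cmp[OF P c(1) f])
  have L2: "isfree (scl P) L2" by (rule isfree_cmp[OF P c(2) L1])
  show ?thesis
  proof (rule simI[OF P R _ _ K1 K2])
    \<comment> \<open>The remaining link of the chain, between \<open>L1\<close> and
      \<open>L2\<close>, makes the stabilizer a trivial formation.\<close>
    show "cmp ?R (L1 \<times> L2) (diagonal P)" by (rule cmp_sym[OF cmp_diagonal'[OF P c(2)]])
    show "isfree (scl ?R) (L1 \<times> L2)" using isfree_prod[of "sp_neg P" L1 P L2] L1 L2 by simp
  qed
qed

text \<open>With suitable standard summands added, \<open>F\<close>, the first witness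
  \<open>K\<close>, \<open>G\<close>, the second witness \<open>M\<close> and \<open>H\<close> form
  a chain in which neighbours are complementary. \<open>sim_chain\<close> joins its ends, and the
  two standard summands are then cancelled.\<close>

lemma sim_trans:
  assumes Q: "qspace Q" and f: "isfree (scl Q) F" and s: "sim Q F G" and t: "sim Q G H"
  shows "sim Q F H"
proof -
  obtain m K where K: "cmp (sp_sum Q (hyp m)) K (F \<times> Lg m)" "cmp (sp_sum Q (hyp m)) K (G \<times> Ld m)"
    using s by (auto simp: sim_def)
  obtain n M where M: "cmp (sp_sum Q (hyp n)) M (G \<times> Lg n)" "cmp (sp_sum Q (hyp n)) M (H \<times> Ld n)"
    using t by (auto simp: sim_def)
  let ?P = "sp_sum (sp_sum Q (hyp m)) (hyp n)"
  let ?h = "\<lambda>((x, y), z). ((x, z), y)"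
  have i: "?h ` ((X \<times> Y) \<times> Z) = (X \<times> Z) \<times> Y"
    for X :: "'b set" and Y Z :: "('a vec \<times> 'a vec) set"
    by force
  note c = cmp_image[OF qspace_sp_sum[OF qspace_sp_sum[OF Q qspace_hyp] qspace_hyp] siso_swap]
  have fL: "isfree (scl (hyp r)) (Lg r)" for r using free_on_Lg by (auto simp: isfree_def)
  have "sim ?P ((F \<times> Lg m) \<times> Lg n) ((H \<times> Ld m) \<times> Ld n)"
  proof (rule sim_chain)
    show "qspace ?P" by (intro qspace_sp_sum Q qspace_hyp)
    show "isfree (scl ?P) ((F \<times> Lg m) \<times> Lg n)" by (intro isfree_prod f fL)
    show "cmp ?P ((F \<times> Lg m) \<times> Lg n) (K \<times> Ld n)" by (rule cmp_prod[OF cmp_sym[OF K(1)] cmp_hyp])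
    show "cmp ?P (K \<times> Ld n) ((G \<times> Ld m) \<times> Lg n)" by (rule cmp_prod[OF K(2) cmp_sym[OF cmp_hyp]])
    show "cmp ?P ((G \<times> Ld m) \<times> Lg n) (?h ` (M \<times> Lg m))"
      using c[OF cmp_prod[OF cmp_sym[OF M(1)] cmp_sym[OF cmp_hyp]]] unfolding i .
    show "cmp ?P (?h ` (M \<times> Lg m)) ((H \<times> Ld m) \<times> Ld n)"
      using c[OF cmp_prod[OF M(2) cmp_hyp]] unfolding i .
  qed
  then have "sim (sp_sum Q (hyp m)) (F \<times> Lg m) (H \<times> Ld m)"
    by (rule sim_cancel[OF qspace_sp_sum[OF Q qspace_hyp] qspace_hyp cmp_hyp fL])
  then show ?thesis by (rule sim_cancel[OF Q qspace_hyp cmp_hyp fL])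
qed

text \<open>The unitary Whitehead lemma in the language of lagrangians.\<close>

lemma sim_interchange:
  assumes Q: "qspace Q" and G: "cmp Q G G'" and L: "cmp Q L L'" and f: "isfree (scl Q) G" "isfree (scl Q) L"
  shows "sim (sp_sum (sp_sum Q Q) (sp_neg Q)) ((G \<times> L) \<times> L') ((L \<times> G) \<times> L')"
proof -
  let ?N = "sp_neg Q" and ?P = "sp_sum (sp_sum Q Q) (sp_neg Q)"
  let ?a = "\<lambda>(x, (y, z)). ((x, y), z)" and ?s = "\<lambda>((x, y), z). ((x, z), y)"
  have i: "?a ` (X \<times> (Y \<times> Z)) = (X \<times> Y) \<times> Z" "?s ` ((X \<times> Y) \<times> Z) = (X \<times> Z) \<times> Y"
    for X Y Z :: "'b set"
    by force+
  have N: "qspace ?N" by (rule qspace_sp_neg[OF Q])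
  note ca = cmp_image[OF qspace_sp_sum[OF Q qspace_sp_sum[OF Q N]] siso_assoc']
  note cs = cmp_image[OF qspace_sp_sum[OF qspace_sp_sum[OF Q N] Q] siso_swap]
  show ?thesis
  proof (rule sim_chain)
    show "qspace ?P" by (intro qspace_sp_sum Q N)
    have "isfree (scl ?N) L'" using isfree_cmp[OF Q L f(2)] by simp
    then show "isfree (scl ?P) ((G \<times> L) \<times> L')" by (intro isfree_prod f)
    \<comment> \<open>The diagonal of the second and third summands leads from
      \<open>(G, L, L')\<close> to \<open>(G, G, G')\<close>; the diagonal of the first and third
      leads on to \<open>(L, G, L')\<close>. In both complements \<open>G'\<close> fills the
      remaining place.\<close>
    show "cmp ?P ((G \<times> L) \<times> L') (?a ` (G' \<times> diagonal Q))"
      using ca[OF cmp_prod[OF G cmp_sym[OF cmp_diagonal[OF Q L]]]] unfolding i .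
    show "cmp ?P (?a ` (G' \<times> diagonal Q)) ((G \<times> G) \<times> G')"
      using ca[OF cmp_prod[OF cmp_sym[OF G] cmp_diagonal[OF Q G]]] unfolding i .
    show "cmp ?P ((G \<times> G) \<times> G') (?s ` (diagonal Q \<times> G'))"
      using cs[OF cmp_prod[OF cmp_sym[OF cmp_diagonal[OF Q G]] G]] unfolding i .
    show "cmp ?P (?s ` (diagonal Q \<times> G')) ((L \<times> G) \<times> L')"
      using cs[OF cmp_prod[OF cmp_diagonal[OF Q L] cmp_sym[OF G]]] unfolding i .
  qed
qed

text \<open>In \<open>Q \<oplus> Q \<oplus> -Q\<close> the interchange lemma takes
  \<open>G \<oplus> L\<close> to \<open>L \<oplus> G\<close>, the hypothesis changes this to
  \<open>gL \<oplus> G\<close>, and the interchange transported by \<open>g\<close> on the first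
  summand leads to \<open>gG \<oplus> L\<close>. The third summand \<open>L'\<close> is carried
  along.\<close>

lemma sim_conj:
  assumes Q: "qspace Q" and G: "cmp Q G G'" and L: "cmp Q L L'" and f: "isfree (scl Q) G" "isfree (scl Q) L"
    and g: "siso Q Q g" and s: "sim Q L (g ` L)"
  shows "sim Q G (g ` G)"
proof -
  let ?N = "sp_neg Q" and ?P = "sp_sum (sp_sum Q Q) (sp_neg Q)"
  have N: "qspace ?N" and QQ: "qspace (sp_sum Q Q)" and P: "qspace ?P"
    by (intro qspace_sp_sum qspace_sp_neg Q)+
  have f': "isfree (scl ?N) L'" "isfree (scl ?P) ((G \<times> L) \<times> L')" "isfree (scl ?P) ((L \<times> G) \<times> L')"
    using isfree_cmp[OF Q L f(2)] f by (auto intro!: isfree_prod)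
  have r: "sim Q G G" "sim ?N L' L'" using sim_refl[OF G] sim_refl[of ?N L' L] cmp_sym[OF L] by simp_all
  let ?g = "map_prod (map_prod g (\<lambda>x. x)) (\<lambda>x. x)"
  have gi: "siso ?P ?P ?g" by (intro siso_prod g siso_id)
  have ga: "?g ` ((X \<times> Y) \<times> Z) = (g ` X \<times> Y) \<times> Z" for X Y Z by (simp add: map_prod_image_Times)
  have 1: "sim ?P ((G \<times> L) \<times> L') ((L \<times> G) \<times> L')" by (rule sim_interchange[OF Q G L f])
  have 2: "sim ?P ((L \<times> G) \<times> L') ((g ` L \<times> G) \<times> L')" by (rule sim_sum[OF QQ N sim_sum[OF Q Q s r(1)] r(2)])
  have 3: "sim ?P ((g ` L \<times> G) \<times> L') ((g ` G \<times> L) \<times> L')"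
    using sim_sym[OF P sim_siso[OF P gi 1]] unfolding ga .
  have sg: "sim Q (g ` G) (g ` G)" by (rule sim_refl[OF cmp_image[OF Q g G]])
  \<comment> \<open>Cancellation removes complementary pairs, so the spare \<open>L\<close> and
    \<open>L'\<close> first trade places on one side.\<close>
  have 4: "sim ?P ((g ` G \<times> L) \<times> L') ((g ` G \<times> L') \<times> L)"
    using sim_sum[OF QQ N sim_sum[OF Q Q sg sim_cmp[OF Q L f(2)]] sim_cmp[OF N, of L' L]] cmp_sym[OF L] f'(1) by simp
  have "sim ?P ((G \<times> L) \<times> L') ((g ` G \<times> L') \<times> L)"
    by (rule sim_trans[OF P f'(2) sim_trans[OF P f'(2) sim_trans[OF P f'(2) 1 2] 3] 4])
  then have "sim (sp_sum Q Q) (G \<times> L) (g ` G \<times> L')"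
    using sim_cancel[OF QQ N _ f'(1), of L] cmp_sym[OF L] by simp
  then show ?thesis by (rule sim_cancel[OF Q Q L f(2)])
qed

section \<open>Lagrangian complements and graphs\<close>

lemma lam_sum:
  assumes Q: "qspace Q" and x: "x \<in> carr Q" and y: "\<And>i. i < (n::nat) \<Longrightarrow> y i \<in> carr Q"
  shows "lam Q (\<Sum>i<n. scl Q (a i) (y i)) x = (\<Sum>i<n. lam Q (y i) x * bar (a i))" (is ?l)
    and "lam Q x (\<Sum>i<n. scl Q (a i) (y i)) = (\<Sum>i<n. a i * lam Q x (y i))" (is ?r)
proof -
  have "?l \<and> ?r"
    using y
  proof (induction n)
    case 0
    then show ?case using lam_zero[OF Q x] by simp
  next
    case (Suc n)
    have "(\<Sum>i<n. scl Q (a i) (y i)) \<in> carr Q"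
      using Suc.prems by (intro lmod_sum[OF qspaceD(1)[OF Q]]) (auto intro: qspace_mod(3)[OF Q])
    then show ?case using Suc x by (simp add: lam_left[OF Q] qspaceD(2,3)[OF Q] qspace_mod(3)[OF Q])
  qed
  then show ?l ?r by auto
qed

text \<open>Expanding the quadratic function one vector at a time produces each mixed term once, so
  it is represented by a triangular matrix: values of \<open>lam\<close> off the diagonal, values of
  \<open>quad\<close> on it.\<close>

lemma quad_combination:
  assumes Q: "qspace Q" and y: "\<And>i. i < (n::nat) \<Longrightarrow> y i \<in> carr Q"
    and T: "\<And>i l. i < l \<Longrightarrow> l < n \<Longrightarrow> T i l = lam Q (y i) (y l)" "\<And>i. i < n \<Longrightarrow> T i i = quad Q (y i)"
  shows "qeq (quad Q (\<Sum>i<n. scl Q (a i) (y i))) (\<Sum>l<n. \<Sum>i<Suc l. a l * T i l * bar (a i))"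
  using y T
proof (induction n)
  case 0
  have "qeq (quad Q (scl Q 0 0)) (0 * quad Q 0 * bar 0)" by (rule qspaceD(7)[OF Q qspace_mod(1)[OF Q]])
  then show ?case using lmod_scale_zero[OF qspaceD(1)[OF Q] qspace_mod(1)[OF Q]] by simp
next
  case (Suc n)
  let ?S = "\<Sum>i<n. scl Q (a i) (y i)"
  have S: "?S \<in> carr Q"
    using Suc.prems(1) by (intro lmod_sum[OF qspaceD(1)[OF Q]]) (auto intro: qspace_mod(3)[OF Q])
  have yn: "y n \<in> carr Q" "scl Q (a n) (y n) \<in> carr Q" using Suc.prems(1) qspace_mod(3)[OF Q] by auto
  have "lam Q ?S (scl Q (a n) (y n)) = a n * (\<Sum>i<n. lam Q (y i) (y n) * bar (a i))"
    using lam_sum(1)[OF Q yn(1), where n = n and y = y and a = a] Suc.prems(1) by (simp add: qspaceD(3)[OF Q S yn(1)])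
  also have "\<dots> = (\<Sum>i<n. a n * T i n * bar (a i))"
    unfolding sum_distrib_left using Suc.prems(2) by (intro sum.cong) (auto simp: mult.assoc)
  finally have l: "lam Q ?S (scl Q (a n) (y n)) = (\<Sum>i<n. a n * T i n * bar (a i))" .
  have "qeq (quad Q (?S + scl Q (a n) (y n))) (quad Q ?S + quad Q (scl Q (a n) (y n)) + lam Q ?S (scl Q (a n) (y n)))"
    by (rule qspaceD(5)[OF Q S yn(2)])
  also have "qeq \<dots> ((\<Sum>l<n. \<Sum>i<Suc l. a l * T i l * bar (a i)) + a n * quad Q (y n) * bar (a n)
      + (\<Sum>i<n. a n * T i n * bar (a i)))"
    unfolding l using Suc by (intro qeq_add qeq_refl qspaceD(7)[OF Q]) auto
  finally show ?case using Suc.prems(3)[of n] by (simp add: algebra_simps)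
qed

text \<open>The coordinate functionals of \<open>A\<close> lift to vectors \<open>y i\<close>
  spanning a complement that need not be isotropic; each lift is corrected by an element of
  \<open>A\<close>. The correction has to be half of the form on the lifts, which exists without
  division by 2 because the quadratic function supplies the diagonal.\<close>

lemma lagrangian_complement:
  assumes Q: "qspace Q" and A: "isot Q A" and perp: "\<And>x. x \<in> carr Q \<Longrightarrow> (\<And>y. y \<in> A \<Longrightarrow> lam Q x y = 0) \<Longrightarrow> x \<in> A"
    and N: "lsub (scl Q) N" "N \<subseteq> carr Q" "\<And>x. x \<in> A \<Longrightarrow> x \<in> N \<Longrightarrow> x = 0"
      "\<And>x. x \<in> carr Q \<Longrightarrow> \<exists>a\<in>A. \<exists>b\<in>N. x = a + b"
    and j: "free_on k (scl Q) A j"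
  shows "\<exists>B. cmp Q A B"
proof -
  note A' = isotD[OF A] and QD = qspaceD[OF Q] and QM = qspace_mod[OF Q] and LL = lam_left[OF Q]
  have jC: "j x \<in> carr Q" if "x \<in> fr k" for x using free_onD(3)[OF j that] A'(5) by blast
  obtain p where p: "lin (scl Q) (carr Q) (scl Q) p" "\<And>x. x \<in> carr Q \<Longrightarrow> p x \<in> A"
    "\<And>x. x \<in> carr Q \<Longrightarrow> x - p x \<in> N" "\<And>x. x \<in> A \<Longrightarrow> p x = x" "\<And>x. x \<in> N \<Longrightarrow> p x = 0"
    by (rule direct_sum_projection[OF QD(1) A'(2,1) N(1,2)]) (erule (1) N(3), erule N(4), (rule that; assumption))
  have jinv: "lin (scl Q) A smul (inv_into (fr k) j)"
    by (rule lin_inv_into[OF lmod_fr free_onD(1,2)[OF j]])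
  have "\<exists>y. y \<in> carr Q \<and> (\<forall>x\<in>fr k. lam Q y (j x) = x i)" for i
  proof -
    have "lin (scl Q) (carr Q) smul (\<lambda>z. inv_into (fr k) j (p z))" by (rule lin_comp[OF p(1) jinv p(2)])
    then have "lin (scl Q) (carr Q) (*) (\<lambda>z. inv_into (fr k) j (p z) i)"
      unfolding lin_def by (simp add: smul_def)
    then obtain y where "y \<in> carr Q" "\<And>z. z \<in> carr Q \<Longrightarrow> lam Q y z = inv_into (fr k) j (p z) i" using QD(8) by blast
    then show ?thesis
      using jC p(4) free_onD(3)[OF j] bij_betw_inv_into_left[OF free_onD(2)[OF j]] by (intro exI[of _ y]) simp
  qed
  then obtain y where y: "\<And>i. y i \<in> carr Q" "\<And>i x. x \<in> fr k \<Longrightarrow> lam Q (y i) (j x) = x i" by metis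
  \<comment> \<open>\<open>T\<close> is the required half: adding \<open>\<epsilon>\<close> times
    its conjugate transpose recovers \<open>lam\<close> on the lifts.\<close>
  define T where "T i l = (if i < l then lam Q (y i) (y l) else if i = l then quad Q (y i) else 0)" for i l
  have T: "lam Q (y i) (y l) = T i l + \<epsilon> * bar (T l i)" for i l
    using QD(4)[OF y(1) y(1), of i l] QD(6)[OF y(1), of i] by (auto simp: T_def)
  define Y where "Y a = (\<Sum>i<k. scl Q (a i) (y i))" for a
  \<comment> \<open>With this sign \<open>ip k (\<tau> b) a\<close> is minus the value of
    \<open>T\<close>, so the mixed terms between lifts and corrections cancel both
    \<open>lam\<close> and, up to \<open>qeq\<close>, \<open>quad\<close> on the lifts.\<close>
  define \<tau> where "\<tau> b = (\<lambda>i. if i < k then - (\<Sum>l<k. b l * T i l) else 0)" for b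
  have Yl: "lin smul (fr k) (scl Q) Y" unfolding Y_def by (rule lin_combination[OF QD(1) y(1)])
  have YC: "Y a \<in> carr Q" for a unfolding Y_def by (rule lmod_sum[OF QD(1)]) (simp_all add: y QM(3))
  have \<tau>f: "\<tau> b \<in> fr k" for b by (simp add: \<tau>_def fr_def)
  have \<tau>l: "lin smul (fr k) smul \<tau>"
    unfolding lin_def
  proof (intro conjI ballI allI; rule ext)
    show "\<tau> (b + c) i = (\<tau> b + \<tau> c) i" for b c i
      by (simp add: \<tau>_def distrib_right sum.distrib)
    show "\<tau> (smul c b) i = smul c (\<tau> b) i" for b c i
      by (simp add: \<tau>_def smul_def sum_distrib_left mult.assoc)
  qed
  have Yj: "lam Q (Y a) (j x) = ip k x a" if "x \<in> fr k" for a x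
    unfolding Y_def ip_def using lam_sum(1)[OF Q jC[OF that], where n = k and y = y and a = a] y that by simp
  have \<tau>ip: "ip k (\<tau> b) a = - (\<Sum>i<k. \<Sum>l<k. b l * T i l * bar (a i))" for a b
    by (simp add: ip_def \<tau>_def sum_distrib_right sum_negf)
  have YY: "lam Q (Y a) (Y b) = - ip k (\<tau> b) a - \<epsilon> * bar (ip k (\<tau> a) b)" for a b
  proof -
    have "lam Q (Y a) (Y b) = (\<Sum>i<k. \<Sum>l<k. b l * lam Q (y i) (y l) * bar (a i))"
      unfolding Y_def[of a] using lam_sum(1)[OF Q YC[of b], where n = k and y = y and a = a] y lam_sum(2)[OF Q y(1), where n = k and y = y and a = b]
      by (simp add: Y_def sum_distrib_right)
    also have "\<dots> = (\<Sum>i<k. \<Sum>l<k. b l * T i l * bar (a i)) + (\<Sum>i<k. \<Sum>l<k. \<epsilon> * (b l * (bar (T l i) * bar (a i))))"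
      by (simp add: T distrib_left distrib_right sum.distrib mult.assoc eps_left)
    also have "(\<Sum>i<k. \<Sum>l<k. \<epsilon> * (b l * (bar (T l i) * bar (a i)))) = (\<Sum>l<k. \<Sum>i<k. \<epsilon> * (b l * (bar (T l i) * bar (a i))))"
      by (rule sum.swap)
    finally show ?thesis
      by (simp add: \<tau>ip bar_minus bar_sum bar_mult sum_distrib_left)
  qed
  define z where "z a = Y a + j (\<tau> a)" for a
  have jt: "lin smul (fr k) (scl Q) (\<lambda>a. j (\<tau> a))" by (rule lin_comp[OF \<tau>l free_onD(1)[OF j] \<tau>f])
  have zl: "lin smul (fr k) (scl Q) z"
    using linD[OF Yl] linD[OF jt] YC jC[OF \<tau>f] unfolding lin_def z_def
    by (simp add: lmodD(3)[OF QD(1)] algebra_simps)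
  have zC: "z a \<in> carr Q" for a unfolding z_def using YC jC[OF \<tau>f] QM(2) by blast
  have jA: "j (\<tau> a) \<in> A" for a using free_onD(3)[OF j \<tau>f] .
  have zj: "lam Q (z a) (j x) = ip k x a" if "x \<in> fr k" for a x
    unfolding z_def using that YC jC[OF \<tau>f] jC[OF that] Yj[OF that] A'(3)[OF jA free_onD(3)[OF j that]]
    by (simp add: LL)
  have zz: "lam Q (z a) (z b) = 0" for a b
  proof -
    have "lam Q (z a) (z b) = lam Q (z a) (Y b) + lam Q (z a) (j (\<tau> b))"
      unfolding z_def[of b] by (rule QD(2)[OF zC YC jC[OF \<tau>f]])
    also have "lam Q (z a) (Y b) = lam Q (Y a) (Y b) + lam Q (j (\<tau> a)) (Y b)"
      unfolding z_def by (rule LL(1)[OF YC YC jC[OF \<tau>f]])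
    also have "lam Q (j (\<tau> a)) (Y b) = \<epsilon> * bar (ip k (\<tau> a) b)"
      using QD(4)[OF jC[OF \<tau>f] YC, of a b] Yj[OF \<tau>f] by simp
    finally show ?thesis using zj[OF \<tau>f] YY by simp
  qed
  have qz: "qeq (quad Q (z a)) 0" for a
  proof -
    have "qeq (quad Q (Y a)) (\<Sum>l<k. \<Sum>i<Suc l. a l * T i l * bar (a i))"
      unfolding Y_def by (rule quad_combination[OF Q]) (auto simp: T_def y)
    also have "(\<Sum>l<k. \<Sum>i<Suc l. a l * T i l * bar (a i)) = (\<Sum>l<k. \<Sum>i<k. a l * T i l * bar (a i))"
      by (intro sum.cong refl sum.mono_neutral_left) (auto simp: T_def)
    also have "\<dots> = - ip k (\<tau> a) a" unfolding \<tau>ip minus_minus by (rule sum.swap)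
    finally have 1: "qeq (quad Q (Y a)) (- ip k (\<tau> a) a)" .
    have "qeq (quad Q (z a)) (quad Q (Y a) + quad Q (j (\<tau> a)) + lam Q (Y a) (j (\<tau> a)))"
      unfolding z_def by (rule QD(5)[OF YC jC[OF \<tau>f]])
    also have "qeq \<dots> (- ip k (\<tau> a) a + 0 + ip k (\<tau> a) a)"
      unfolding Yj[OF \<tau>f] by (intro qeq_add 1 A'(4) jA qeq_refl)
    finally show ?thesis by simp
  qed
  have "cmp Q A (z ` fr k)"
    unfolding cmp_def
  proof (intro conjI ballI impI)
    have "z 0 = 0" using lin_zero[OF zl] by simp
    then have "0 \<in> z ` fr k" using fr_mod(1) by (metis imageI)
    moreover have "z a + z b \<in> z ` fr k" if "a \<in> fr k" "b \<in> fr k" for a b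
      using linD(1)[OF zl that] fr_mod(2)[OF that] by (metis imageI)
    moreover have "scl Q c (z a) \<in> z ` fr k" if "a \<in> fr k" for a c
      using linD(2)[OF zl that] fr_mod(3)[OF that] by (metis imageI)
    ultimately have "lsub (scl Q) (z ` fr k)" unfolding lsub_def by simp
    moreover have "z ` fr k \<subseteq> carr Q" using zC by auto
    ultimately show "isot Q (z ` fr k)" unfolding isot_def using zz qz by simp
  next
    fix x assume x: "x \<in> A" "x \<in> z ` fr k"
    then obtain a where a: "a \<in> fr k" "x = z a" by blast
    have "ip k u a = 0" if "u \<in> fr k" for u
      using zj[OF that, of a] A'(3)[OF x(1) free_onD(3)[OF j that]] a by simp
    then have "a = 0" by (rule ip_eq_zero[OF a(1)])
    then show "x = 0" using a lin_zero[OF zl] by simp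
  next
    fix x assume x: "x \<in> carr Q"
    have "lin smul (fr k) (*) (\<lambda>u. lam Q x (j u))"
      by (rule lin_comp[OF free_onD(1)[OF j] lam_lin_right[OF Q x]]) (rule jC)
    from ip_functional[OF this] obtain a where a: "a \<in> fr k" "\<And>u. u \<in> fr k \<Longrightarrow> lam Q x (j u) = ip k u a" by blast
    \<comment> \<open>\<open>z a\<close> has the same pairings with \<open>A\<close> as
      \<open>x\<close>, so the difference is orthogonal to \<open>A\<close>.\<close>
    have "x - z a \<in> A"
    proof (rule perp)
      show "x - z a \<in> carr Q" by (rule QM(5)[OF x zC])
      fix w assume "w \<in> A"
      then obtain u where "u \<in> fr k" "w = j u" using free_onD(2)[OF j] by (auto simp: bij_betw_def)
      then show "lam Q (x - z a) w = 0" using lam_diff(1)[OF Q jC x zC] a(2) zj by simp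
    qed
    then show "\<exists>b\<in>A. \<exists>c\<in>z ` fr k. x = b + c" using a(1) by (intro bexI[of _ "x - z a"] bexI[of _ "z a"]) auto
  qed (rule A)
  then show ?thesis by blast
qed

section \<open>Automorphisms of the hyperbolic form that fix a lagrangian\<close>

lemma bar_ip: "bar (ip k x a) = ip k a x"
  by (simp add: ip_def bar_sum bar_mult)

text \<open>The sum of \<open>k\<close> copies of \<open>\<sigma>\<^sub>\<epsilon>\<close> in
  coordinates, for every \<open>k\<close> at once.\<close>

definition swp :: "'a vec \<times> 'a vec \<Rightarrow> 'a vec \<times> 'a vec" where
  "swp = (\<lambda>(x, b). (b, smul \<epsilon> x))"

lemma smul_eps_eps: "smul \<epsilon> (smul \<epsilon> x) = x"
  by (simp add: smul_def)

lemma siso_swp: "siso (hyp k) (hyp k) swp"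
  unfolding siso_def
proof (intro conjI ballI)
  show "bij_betw swp (carr (hyp k)) (carr (hyp k))"
    by (rule bij_betwI[where g = "\<lambda>(x, b). (smul \<epsilon> b, x)"]) (auto simp: swp_def smul_eps_eps)
  have "smul \<epsilon> (x + y) = smul \<epsilon> x + smul \<epsilon> y" "smul \<epsilon> (smul c x) = smul c (smul \<epsilon> x)" for x y c
    by (auto simp: smul_def distrib_left eps_left)
  then show "lin (scl (hyp k)) (carr (hyp k)) (scl (hyp k)) swp" by (auto simp: lin_def swp_def)
  fix u v :: "'a vec \<times> 'a vec"
  show "lam (hyp k) (swp u) (swp v) = lam (hyp k) u v"
    by (cases u, cases v) (simp add: swp_def ip_simps bar_mult bar_ip eps_central add.commute)
  show "qeq (quad (hyp k) (swp u)) (quad (hyp k) u)"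
    using qeq_swap[of "quad (hyp k) u"] by (cases u) (simp add: swp_def ip_simps bar_ip eps_central)
qed

lemma swp_image: "swp ` Lg k = Ld k" "swp ` Ld k = Lg k"
proof -
  have "x \<in> smul \<epsilon> ` fr k" if "x \<in> fr k" for x :: "'a vec"
    using that smul_eps_eps[of x] fr_mod(3)[OF that] by (metis imageI)
  then show "swp ` Lg k = Ld k" "swp ` Ld k = Lg k" by (force simp: swp_def Lg_def Ld_def)+
qed

text \<open>The coordinates of \<open>\<theta> - \<epsilon>\<theta>\<^sup>*\<close> for the pairing \<open>\<theta>\<close> with matrix \<open>T\<close>.\<close>

definition gam :: "nat \<Rightarrow> (nat \<Rightarrow> nat \<Rightarrow> 'a) \<Rightarrow> 'a vec \<Rightarrow> 'a vec" where
  "gam k T x = (\<lambda>l. if l < k then \<Sum>i<k. x i * bar (T i l - \<epsilon> * bar (T l i)) else 0)"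

lemma ip_right_unique: "x \<in> fr k \<Longrightarrow> y \<in> fr k \<Longrightarrow> (\<And>b. b \<in> fr k \<Longrightarrow> ip k x b = ip k y b) \<Longrightarrow> x = y"
proof
  fix i assume *: "x \<in> fr k" "y \<in> fr k" "\<And>b. b \<in> fr k \<Longrightarrow> ip k x b = ip k y b"
  show "x i = y i"
  proof (cases "i < k")
    case True
    then show ?thesis using *(3)[OF unit_vec_fr[OF True]] by (simp add: ip_unit_vec)
  next
    case False
    then show ?thesis using *(1,2) by (simp add: fr_def)
  qed
qed

text \<open>Pairing with \<open>Ld k\<close> forces the first component to stay \<open>x\<close>.
  The matrix of the remaining shear is skew because \<open>lam\<close> is preserved, and its
  diagonal entries have the form \<open>c - \<epsilon> * bar c\<close> because the quadratic
  function is preserved; together this makes it even.\<close>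

lemma siso_fixing_Ld:
  assumes g: "siso (hyp k) (hyp k) g" and fix_Ld: "\<And>b. b \<in> fr k \<Longrightarrow> g (0, b) = (0, b)"
  obtains T where "\<And>x b. x \<in> fr k \<Longrightarrow> b \<in> fr k \<Longrightarrow> g (x, b) = (x, b + gam k T x)"
proof -
  define \<gamma> where "\<gamma> x = snd (g (x, 0))" for x
  have \<gamma>C: "\<gamma> x \<in> fr k" if "x \<in> fr k" for x
    using sisoD(5)[OF g, of "(x, 0)"] that by (auto simp: \<gamma>_def mem_Times_iff)
  have g0: "g (x, 0) = (x, \<gamma> x)" if x: "x \<in> fr k" for x
  proof -
    have f: "fst (g (x, 0)) \<in> fr k" using sisoD(5)[OF g, of "(x, 0)"] x by (auto simp: mem_Times_iff)
    have "ip k (fst (g (x, 0))) b = ip k x b" if b: "b \<in> fr k" for b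
    proof -
      have "lam (hyp k) (g (x, 0)) (0, b) = lam (hyp k) (x, 0) (0, b)"
        using sisoD(3)[OF g, of "(x, 0)" "(0, b)"] x b fix_Ld by simp
      then have "\<epsilon> * (\<epsilon> * bar (ip k (fst (g (x, 0))) b)) = \<epsilon> * (\<epsilon> * bar (ip k x b))"
        by (cases "g (x, 0)") (simp add: ip_simps)
      then have "bar (bar (ip k (fst (g (x, 0))) b)) = bar (bar (ip k x b))" by (simp only: eps_simps)
      then show ?thesis by simp
    qed
    then have "fst (g (x, 0)) = x" by (intro ip_right_unique[OF f x])
    then show ?thesis by (simp add: \<gamma>_def prod_eq_iff)
  qed
  have \<gamma>l: "lin smul (fr k) smul \<gamma>"
    unfolding lin_def
  proof (intro conjI ballI allI)
    show "\<gamma> (x + y) = \<gamma> x + \<gamma> y" if "x \<in> fr k" "y \<in> fr k" for x y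
      using linD(1)[OF sisoD(2)[OF g], of "(x, 0)" "(y, 0)"] that by (simp add: \<gamma>_def)
    show "\<gamma> (smul a x) = smul a (\<gamma> x)" if "x \<in> fr k" for a x
      using linD(2)[OF sisoD(2)[OF g], where x = "(x, 0)" and a = a] that by (simp add: g0)
  qed
  define G where "G i l = bar (\<gamma> (unit_vec i) l)" for i l
  have Gip: "ip k (unit_vec l) (\<gamma> (unit_vec i)) = G i l" if "l < k" for i l
    using that by (simp add: G_def ip_unit_vec)
  have Gs: "G i l = - \<epsilon> * bar (G l i)" if "i < k" "l < k" for i l
  proof -
    have "lam (hyp k) (g (unit_vec i, 0)) (g (unit_vec l, 0)) = 0"
      using sisoD(3)[OF g, of "(unit_vec i, 0)" "(unit_vec l, 0)"] unit_vec_fr[OF that(1)] unit_vec_fr[OF that(2)]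
      by (simp add: ip_simps)
    then show ?thesis using that by (simp add: g0 unit_vec_fr Gip eq_neg_iff_add_eq_0)
  qed
  have "\<exists>c. G i i = c - \<epsilon> * bar c" if "i < k" for i
  proof -
    have "qeq (quad (hyp k) (g (unit_vec i, 0))) (quad (hyp k) (unit_vec i, 0))"
      using sisoD(4)[OF g, of "(unit_vec i, 0)"] unit_vec_fr[OF that] by simp
    then show ?thesis using that by (simp add: g0 unit_vec_fr Gip ip_simps qeq_def)
  qed
  then obtain c where c: "\<And>i. i < k \<Longrightarrow> G i i = c i - \<epsilon> * bar (c i)" by metis
  \<comment> \<open>A skew matrix with such a diagonal is \<open>T\<close> minus
    \<open>\<epsilon>\<close> times its conjugate transpose: keep the part above the diagonal and
    the chosen \<open>c i\<close> on it.\<close>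
  define T where "T i l = (if i < l then G i l else if i = l then c i else 0)" for i l
  have T: "G i l = T i l - \<epsilon> * bar (T l i)" if "i < k" "l < k" for i l
    using c[OF that(1)] Gs[OF that] by (auto simp: T_def)
  have "\<gamma> x = gam k T x" if x: "x \<in> fr k" for x
  proof
    fix l
    show "\<gamma> x l = gam k T x l"
    proof (cases "l < k")
      case True
      have "\<gamma> x l = (\<Sum>i<k. x i * \<gamma> (unit_vec i) l)"
        using lin_expand[OF \<gamma>l x] by (simp add: sum_fun_apply smul_def)
      also have "\<dots> = (\<Sum>i<k. x i * bar (T i l - \<epsilon> * bar (T l i)))"
        using True by (intro sum.cong) (auto simp: T[symmetric] G_def)
      finally show ?thesis using True by (simp add: gam_def)
    next
      case False
      then show ?thesis using \<gamma>C[OF x] by (simp add: gam_def fr_def)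
    qed
  qed
  moreover have "g (x, b) = (x, b + \<gamma> x)" if "x \<in> fr k" "b \<in> fr k" for x b
    using linD(1)[OF sisoD(2)[OF g], of "(x, 0)" "(0, b)"] that by (simp add: g0 fix_Ld add.commute)
  ultimately show ?thesis using that by simp
qed

text \<open>Hyperbolic coordinates for the pair \<open>Ld k\<close>, \<open>M\<close>, normalized on
  \<open>Ld k\<close> by its standard basis and preceded by \<open>swp\<close>, restrict to the
  identity on \<open>Ld k\<close>.\<close>

lemma complement_of_Ld:
  assumes "cmp (hyp k) M (Ld k)"
  obtains g where "siso (hyp k) (hyp k) g" "\<And>b. b \<in> fr k \<Longrightarrow> g (0, b) = (0, b)" "g ` Lg k = M"
proof -
  obtain h where h: "siso (hyp k) (hyp k) h" "h ` Lg k = Ld k" "h ` Ld k = M" "\<And>x. x \<in> fr k \<Longrightarrow> h (x, 0) = (0, x)"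
    using cmp_imp_hyp_iso[OF qspace_hyp cmp_sym[OF assms] free_on_Ld] by metis
  show ?thesis
  proof (rule that)
    show "siso (hyp k) (hyp k) (\<lambda>v. h (swp v))" by (rule siso_comp[OF siso_swp h(1)])
    show "h (swp (0, b)) = (0, b)" if "b \<in> fr k" for b using h(4)[OF that] by (simp add: swp_def)
    show "(\<lambda>v. h (swp v)) ` Lg k = M" using h(3) swp_image(1) by (simp add: image_image[symmetric])
  qed
qed

lemma graph_form:
  assumes "cmp (hyp k) M (Ld k)" obtains T where "M = {(x, gam k T x) |x. x \<in> fr k}"
proof -
  obtain g where g: "siso (hyp k) (hyp k) g" "\<And>b. b \<in> fr k \<Longrightarrow> g (0, b) = (0, b)" "g ` Lg k = M"
    by (rule complement_of_Ld[OF assms]) (rule that; assumption)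
  obtain T where "\<And>x b. x \<in> fr k \<Longrightarrow> b \<in> fr k \<Longrightarrow> g (x, b) = (x, b + gam k T x)"
    by (rule siso_fixing_Ld[OF g(1)], erule g(2), (rule that; assumption))
  then have "g (x, 0) = (x, gam k T x)" if "x \<in> fr k" for x using that by simp
  then have "g ` Lg k = {(x, gam k T x) |x. x \<in> fr k}" by (force simp: Lg_def)
  then show ?thesis using that g(3) by blast
qed

end

section \<open>Isomorphisms of formations\<close>

lemma mk_module_simps [simp]:
  "carrier (mk_module C z p s) = C" "zero (mk_module C z p s) = z" "add (mk_module C z p s) = p"
  "smult (mk_module C z p s) = s"
  by (simp_all add: mk_module_def)

abbreviation fmod :: "('a, 'm) formation \<Rightarrow> ('a, 'm) module" where
  "fmod X \<equiv> qmodule (fform X)"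

text \<open>Unlike the elements of \<open>qform_iso\<close>, the following isomorphisms need not be extensional; on the
  other hand they record that the source is closed under the module operations.\<close>

definition wiso :: "('m \<Rightarrow> 'n) \<Rightarrow> ('a::involution_ring, 'm) formation \<Rightarrow> ('a, 'n) formation \<Rightarrow> bool" where
  "wiso h X Y \<longleftrightarrow> bij_betw h (carrier (fmod X)) (carrier (fmod Y)) \<and>
     (\<forall>x\<in>carrier (fmod X). \<forall>y\<in>carrier (fmod X).
        x \<oplus>\<^bsub>fmod X\<^esub> y \<in> carrier (fmod X) \<and> h (x \<oplus>\<^bsub>fmod X\<^esub> y) = h x \<oplus>\<^bsub>fmod Y\<^esub> h y) \<and>
     (\<forall>a. \<forall>x\<in>carrier (fmod X). a \<odot>\<^bsub>fmod X\<^esub> x \<in> carrier (fmod X) \<and> h (a \<odot>\<^bsub>fmod X\<^esub> x) = a \<odot>\<^bsub>fmod Y\<^esub> h x) \<and>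
     (\<forall>x\<in>carrier (fmod X). \<forall>y\<in>carrier (fmod X). qlam (fform Y) (h x) (h y) = qlam (fform X) x y) \<and>
     (\<forall>x\<in>carrier (fmod X). qmu (fform Y) (h x) = qmu (fform X) x) \<and>
     flag1 X \<subseteq> carrier (fmod X) \<and> flag2 X \<subseteq> carrier (fmod X) \<and> h ` flag1 X = flag1 Y \<and> h ` flag2 X = flag2 Y"

lemma wisoD:
  assumes "wiso h X Y"
  shows "bij_betw h (carrier (fmod X)) (carrier (fmod Y))"
    "x \<in> carrier (fmod X) \<Longrightarrow> y \<in> carrier (fmod X) \<Longrightarrow> x \<oplus>\<^bsub>fmod X\<^esub> y \<in> carrier (fmod X)"
    "x \<in> carrier (fmod X) \<Longrightarrow> y \<in> carrier (fmod X) \<Longrightarrow> h (x \<oplus>\<^bsub>fmod X\<^esub> y) = h x \<oplus>\<^bsub>fmod Y\<^esub> h y"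
    "x \<in> carrier (fmod X) \<Longrightarrow> a \<odot>\<^bsub>fmod X\<^esub> x \<in> carrier (fmod X)"
    "x \<in> carrier (fmod X) \<Longrightarrow> h (a \<odot>\<^bsub>fmod X\<^esub> x) = a \<odot>\<^bsub>fmod Y\<^esub> h x"
    "x \<in> carrier (fmod X) \<Longrightarrow> y \<in> carrier (fmod X) \<Longrightarrow> qlam (fform Y) (h x) (h y) = qlam (fform X) x y"
    "x \<in> carrier (fmod X) \<Longrightarrow> qmu (fform Y) (h x) = qmu (fform X) x"
    "flag1 X \<subseteq> carrier (fmod X)" "flag2 X \<subseteq> carrier (fmod X)" "h ` flag1 X = flag1 Y" "h ` flag2 X = flag2 Y"
    "x \<in> carrier (fmod X) \<Longrightarrow> h x \<in> carrier (fmod Y)"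
proof -
  from assms have b: "bij_betw h (carrier (fmod X)) (carrier (fmod Y))" unfolding wiso_def by simp
  then show "x \<in> carrier (fmod X) \<Longrightarrow> h x \<in> carrier (fmod Y)" by (auto simp: bij_betw_def)
qed (use assms in \<open>simp_all add: wiso_def\<close>)

lemma wiso_imp_qform_iso:
  assumes w: "wiso h X Y" shows "restrict h (carrier (fmod X)) \<in> qform_iso (fform X) (fform Y)"
proof -
  note W = wisoD[OF w]
  let ?h = "restrict h (carrier (fmod X))"
  show ?thesis
    unfolding qform_iso_def liso_def lhom_def
  proof (intro CollectI conjI ballI allI)
    show "?h \<in> carrier (fmod X) \<rightarrow>\<^sub>E carrier (fmod Y)" using W(12) by auto
    show "bij_betw ?h (carrier (fmod X)) (carrier (fmod Y))" using W(1) by simp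
  qed (simp_all add: W(2-7))
qed

lemma wiso_imp_isomorphic:
  assumes w: "wiso h X Y" shows "isomorphic_formations X Y"
proof -
  note W = wisoD[OF w]
  let ?h = "restrict h (carrier (fmod X))"
  have "?h ` flag1 X = flag1 Y" "?h ` flag2 X = flag2 Y"
    using W(8-11) by (auto simp: image_def subset_iff)
  then show ?thesis using wiso_imp_qform_iso[OF w] unfolding isomorphic_formations_def by blast
qed

lemma isomorphic_imp_wiso:
  assumes i: "isomorphic_formations X Y"
    and c: "\<And>x y. x \<in> carrier (fmod X) \<Longrightarrow> y \<in> carrier (fmod X) \<Longrightarrow> x \<oplus>\<^bsub>fmod X\<^esub> y \<in> carrier (fmod X)"
      "\<And>a x. x \<in> carrier (fmod X) \<Longrightarrow> a \<odot>\<^bsub>fmod X\<^esub> x \<in> carrier (fmod X)"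
      "flag1 X \<subseteq> carrier (fmod X)" "flag2 X \<subseteq> carrier (fmod X)"
  shows "\<exists>h. wiso h X Y"
proof -
  obtain h where "h \<in> qform_iso (fform X) (fform Y)" "h ` flag1 X = flag1 Y" "h ` flag2 X = flag2 Y"
    using i unfolding isomorphic_formations_def by blast
  then have "wiso h X Y" using c unfolding wiso_def qform_iso_def liso_def lhom_def by simp
  then show ?thesis by blast
qed

lemma wiso_comp:
  assumes w: "wiso h X Y" and v: "wiso g Y Z" shows "wiso (\<lambda>x. g (h x)) X Z"
proof -
  note W = wisoD[OF w] and V = wisoD[OF v]
  have "bij_betw (\<lambda>x. g (h x)) (carrier (fmod X)) (carrier (fmod Z))"
    using bij_betw_trans[OF W(1) V(1)] by (simp add: comp_def)
  then show ?thesis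
    unfolding wiso_def using W V by (auto simp: image_image[symmetric, of g h])
qed

lemma wiso_inv:
  assumes w: "wiso h X Y" shows "wiso (inv_into (carrier (fmod X)) h) Y X"
proof -
  note W = wisoD[OF w]
  let ?g = "inv_into (carrier (fmod X)) h"
  have g: "bij_betw ?g (carrier (fmod Y)) (carrier (fmod X))" by (rule bij_betw_inv_into[OF W(1)])
  have gh: "?g (h x) = x" if "x \<in> carrier (fmod X)" for x using bij_betw_inv_into_left[OF W(1) that] .
  have b: "\<exists>x\<in>carrier (fmod X). y = h x" if "y \<in> carrier (fmod Y)" for y
    using W(1) that unfolding bij_betw_def by blast
  show ?thesis
    unfolding wiso_def
  proof (intro conjI ballI allI)
    fix y y' a assume "y \<in> carrier (fmod Y)" "y' \<in> carrier (fmod Y)"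
    then obtain x x' where x: "x \<in> carrier (fmod X)" "y = h x" "x' \<in> carrier (fmod X)" "y' = h x'" using b by metis
    have e: "y \<oplus>\<^bsub>fmod Y\<^esub> y' = h (x \<oplus>\<^bsub>fmod X\<^esub> x')" using W(3) x by simp
    show "y \<oplus>\<^bsub>fmod Y\<^esub> y' \<in> carrier (fmod Y)" "?g (y \<oplus>\<^bsub>fmod Y\<^esub> y') = ?g y \<oplus>\<^bsub>fmod X\<^esub> ?g y'"
      unfolding e using W(2,12) x gh by simp_all
    show "qlam (fform X) (?g y) (?g y') = qlam (fform Y) y y'" using W(6) x gh by simp
  next
    fix y a assume "y \<in> carrier (fmod Y)"
    then obtain x where x: "x \<in> carrier (fmod X)" "y = h x" using b by metis
    have e: "a \<odot>\<^bsub>fmod Y\<^esub> y = h (a \<odot>\<^bsub>fmod X\<^esub> x)" using W(5) x by simp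
    show "a \<odot>\<^bsub>fmod Y\<^esub> y \<in> carrier (fmod Y)" "?g (a \<odot>\<^bsub>fmod Y\<^esub> y) = a \<odot>\<^bsub>fmod X\<^esub> ?g y"
      unfolding e using W(4,12) x gh by simp_all
    show "qmu (fform X) (?g y) = qmu (fform Y) y" using W(7) x gh by simp
  next
    show "flag1 Y \<subseteq> carrier (fmod Y)" "flag2 Y \<subseteq> carrier (fmod Y)"
      using W(8,9,12) by (auto simp: W(10,11)[symmetric])
    show "?g ` flag1 Y = flag1 X" "?g ` flag2 Y = flag2 X"
      using inv_into_image_cancel[OF bij_betw_imp_inj_on[OF W(1)] W(8)]
        inv_into_image_cancel[OF bij_betw_imp_inj_on[OF W(1)] W(9)] W(10,11) by simp_all
  qed (rule g)
qed

lemma wiso_sym: "wiso h X Y \<Longrightarrow> \<exists>g. wiso g Y X"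
  using wiso_inv by blast

lemma formation_sum_simps:
  "flag1 (formation_sum X Y) = flag1 X \<times> flag1 Y" "flag2 (formation_sum X Y) = flag2 X \<times> flag2 Y"
  "carrier (fmod (formation_sum X Y)) = carrier (fmod X) \<times> carrier (fmod Y)"
  "\<zero>\<^bsub>fmod (formation_sum X Y)\<^esub> = (\<zero>\<^bsub>fmod X\<^esub>, \<zero>\<^bsub>fmod Y\<^esub>)"
  "(x, y) \<oplus>\<^bsub>fmod (formation_sum X Y)\<^esub> (x', y') = (x \<oplus>\<^bsub>fmod X\<^esub> x', y \<oplus>\<^bsub>fmod Y\<^esub> y')"
  "a \<odot>\<^bsub>fmod (formation_sum X Y)\<^esub> (x, y) = (a \<odot>\<^bsub>fmod X\<^esub> x, a \<odot>\<^bsub>fmod Y\<^esub> y)"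
  "x \<in> carrier (fmod X) \<Longrightarrow> y \<in> carrier (fmod Y) \<Longrightarrow> x' \<in> carrier (fmod X) \<Longrightarrow> y' \<in> carrier (fmod Y) \<Longrightarrow>
     qlam (fform (formation_sum X Y)) (x, y) (x', y') = qlam (fform X) x x' + qlam (fform Y) y y'"
  "qmu (fform (formation_sum X Y)) (x, y) = {p + p' |p p'. p \<in> qmu (fform X) x \<and> p' \<in> qmu (fform Y) y}"
  by (simp_all add: formation_sum_def qform_sum_def direct_sum_def Let_def)

lemma wiso_sum:
  assumes w: "wiso h X X'" and v: "wiso g Y Y'"
  shows "wiso (map_prod h g) (formation_sum X Y) (formation_sum X' Y')"
proof -
  note W = wisoD[OF w] and V = wisoD[OF v]
  have i: "map_prod h g ` (A \<times> B) = (h ` A) \<times> (g ` B)" for A B by force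
  show ?thesis
    unfolding wiso_def
  proof (intro conjI ballI allI)
    show "bij_betw (map_prod h g) (carrier (fmod (formation_sum X Y))) (carrier (fmod (formation_sum X' Y')))"
      unfolding formation_sum_simps by (rule bij_betw_map_prod[OF W(1) V(1)])
  qed (use W(8,9) V(8,9) in \<open>auto simp: formation_sum_simps i W(2-7,10-12) V(2-7,10-12)\<close>)
qed

lemma wiso_neg: "wiso h X Y \<Longrightarrow> wiso h (formation_neg X) (formation_neg Y)"
  unfolding wiso_def formation_neg_def qform_neg_def by (auto simp: bij_betw_def)

section \<open>Transport of module structure and uniqueness of rank\<close>

lemma left_module_transfer:
  fixes h :: "'m::ab_group_add \<Rightarrow> 'n" and M :: "('a::ring_1, 'n) module"
  assumes C: "lmod s C" and b: "bij_betw h C (carrier M)"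
    and a: "\<And>x y. x \<in> C \<Longrightarrow> y \<in> C \<Longrightarrow> h (x + y) = h x \<oplus>\<^bsub>M\<^esub> h y"
    and m: "\<And>a x. x \<in> C \<Longrightarrow> h (s a x) = a \<odot>\<^bsub>M\<^esub> h x" and z: "h 0 = \<zero>\<^bsub>M\<^esub>"
  shows "left_module M"
proof -
  have "carrier M = h ` C" using b by (simp add: bij_betw_def)
  then have ball: "(\<forall>x\<in>carrier M. P x) = (\<forall>u\<in>C. P (h u))" for P by simp
  have hC: "h u \<in> carrier M" if "u \<in> C" for u using b that unfolding bij_betw_def by blast
  note L = lsubD[OF lmodD(1)[OF C]] and a' = a[symmetric] and m' = m[symmetric]
  have "\<forall>x\<in>carrier M. \<forall>y\<in>carrier M. x \<oplus>\<^bsub>M\<^esub> y \<in> carrier M" unfolding ball by (simp add: a' hC L)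
  moreover have "\<forall>x\<in>carrier M. \<forall>y\<in>carrier M. \<forall>z\<in>carrier M. (x \<oplus>\<^bsub>M\<^esub> y) \<oplus>\<^bsub>M\<^esub> z = x \<oplus>\<^bsub>M\<^esub> (y \<oplus>\<^bsub>M\<^esub> z)"
    unfolding ball by (simp add: a' L add.assoc)
  moreover have "\<forall>x\<in>carrier M. \<forall>y\<in>carrier M. x \<oplus>\<^bsub>M\<^esub> y = y \<oplus>\<^bsub>M\<^esub> x"
    unfolding ball by (simp add: a' L add.commute)
  moreover have "\<forall>x\<in>carrier M. \<zero>\<^bsub>M\<^esub> \<oplus>\<^bsub>M\<^esub> x = x" unfolding ball z[symmetric] by (simp add: a' L)
  moreover have "\<forall>x\<in>carrier M. \<exists>y\<in>carrier M. y \<oplus>\<^bsub>M\<^esub> x = \<zero>\<^bsub>M\<^esub>"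
    unfolding ball z[symmetric]
  proof
    fix u assume "u \<in> C"
    then show "\<exists>y\<in>carrier M. y \<oplus>\<^bsub>M\<^esub> h u = h 0"
      using a'[of "- u" u] lmod_uminus[OF C] hC by (intro bexI[of _ "h (- u)"]) auto
  qed
  moreover have "\<zero>\<^bsub>M\<^esub> \<in> carrier M" using hC[OF L(1)] z by simp
  ultimately have "abelian_group M" by (intro abelian_groupI) blast+
  moreover have "\<forall>x\<in>carrier M. \<forall>a. a \<odot>\<^bsub>M\<^esub> x \<in> carrier M" unfolding ball by (simp add: m' hC L)
  moreover have "\<forall>x\<in>carrier M. \<forall>a b. (a + b) \<odot>\<^bsub>M\<^esub> x = (a \<odot>\<^bsub>M\<^esub> x) \<oplus>\<^bsub>M\<^esub> (b \<odot>\<^bsub>M\<^esub> x)"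
    unfolding ball by (simp add: a' m' L lmodD(2)[OF C])
  moreover have "\<forall>x\<in>carrier M. \<forall>y\<in>carrier M. \<forall>a. a \<odot>\<^bsub>M\<^esub> (x \<oplus>\<^bsub>M\<^esub> y) = (a \<odot>\<^bsub>M\<^esub> x) \<oplus>\<^bsub>M\<^esub> (a \<odot>\<^bsub>M\<^esub> y)"
    unfolding ball by (simp add: a' m' L lmodD(3)[OF C])
  moreover have "\<forall>x\<in>carrier M. \<forall>a b. (a * b) \<odot>\<^bsub>M\<^esub> x = a \<odot>\<^bsub>M\<^esub> (b \<odot>\<^bsub>M\<^esub> x)"
    unfolding ball by (simp add: m' L lmodD(4)[OF C])
  moreover have "\<forall>x\<in>carrier M. 1 \<odot>\<^bsub>M\<^esub> x = x" unfolding ball by (simp add: m' lmodD(5)[OF C])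
  ultimately show ?thesis unfolding left_module_def left_module_axioms_def by blast
qed

lemma lmod_subset: "lmod s C \<Longrightarrow> lsub s A \<Longrightarrow> A \<subseteq> C \<Longrightarrow> lmod s A"
  unfolding lmod_def by blast

lemma free_module_eq: "free_module k = mk_module (fr k) 0 (+) smul"
  unfolding free_module_def fr_def smul_def zero_fun_def plus_fun_def by simp

lemma left_module_free_module: "left_module (free_module k)"
  by (rule left_module_transfer[of smul "fr k" "\<lambda>x. x"]) (auto simp: lmod_fr free_module_eq bij_betw_def)

lemma free_of_rankI:
  fixes h :: "'m::ab_group_add \<Rightarrow> 'n" and M :: "('a::ring_1, 'n) module"
  assumes C: "lmod s C" and b: "bij_betw h C (carrier M)"
    and a: "\<And>x y. x \<in> C \<Longrightarrow> y \<in> C \<Longrightarrow> h (x + y) = h x \<oplus>\<^bsub>M\<^esub> h y"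
    and m: "\<And>a x. x \<in> C \<Longrightarrow> h (s a x) = a \<odot>\<^bsub>M\<^esub> h x" and z: "h 0 = \<zero>\<^bsub>M\<^esub>"
    and j: "free_on k s C j"
  shows "free_of_rank k M"
proof -
  let ?f = "\<lambda>x\<in>fr k. h (j x)"
  have jC: "j x \<in> C" if "x \<in> fr k" for x using j that by (auto simp: free_on_def bij_betw_def)
  have jl: "lin smul (fr k) s j" and jb: "bij_betw j (fr k) C" using j by (auto simp: free_on_def)
  have "bij_betw (\<lambda>x. h (j x)) (fr k) (carrier M)" using bij_betw_trans[OF jb b] by (simp add: comp_def)
  moreover have "bij_betw ?f (fr k) (carrier M) = bij_betw (\<lambda>x. h (j x)) (fr k) (carrier M)"
    by (rule bij_betw_cong) simp
  moreover have "h x \<in> carrier M" if "x \<in> C" for x using b that by (auto simp: bij_betw_def)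
  ultimately have "?f \<in> liso (free_module k) M"
    unfolding liso_def lhom_def free_module_eq using lsubD[OF lmodD(1)[OF lmod_fr[where 'a = 'a and k = k]]]
    by (auto simp: jC linD[OF jl] a m)
  then show ?thesis unfolding free_of_rank_def using left_module_transfer[OF C b a m z] by blast
qed

text \<open>The hypothesis speaks of modules on one type. Two bases of the same set, on whatever
  type, compose to a second basis of \<open>free_module k\<close>, and there it applies.\<close>

lemma rank_unique:
  fixes s :: "'a::ring_1 \<Rightarrow> 'm::ab_group_add \<Rightarrow> 'm"
  assumes r: "rank_well_defined TYPE('a)" and i: "free_on k s A i" and j: "free_on l s A j"
  shows "k = l"
proof -
  let ?g = "inv_into (fr k) i"
  have il: "lin smul (fr k) s i" "bij_betw i (fr k) A" and jl: "lin smul (fr l) s j" "bij_betw j (fr l) A"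
    using i j by (auto simp: free_on_def)
  have g: "lin s A smul ?g" "bij_betw ?g A (fr k)"
    using lin_inv_into[OF lmod_fr il] bij_betw_inv_into[OF il(2)] by auto
  have "lin smul (fr l) smul (\<lambda>x. ?g (j x))"
    by (rule lin_comp[OF jl(1) g(1)]) (use jl(2) in \<open>auto simp: bij_betw_def\<close>)
  moreover have "bij_betw (\<lambda>x. ?g (j x)) (fr l) (fr k)"
    using bij_betw_trans[OF jl(2) g(2)] by (simp add: comp_def)
  ultimately have f: "free_on l smul (fr k) (\<lambda>x. ?g (j x))" by (simp add: free_on_def)
  have f': "free_on k smul (fr k) (\<lambda>x. x)" by (simp add: free_on_def lin_def bij_betw_def)
  have "free_of_rank m (free_module k :: ('a, 'a vec) module)" if "free_on m smul (fr k) e" for m and e :: "'a vec \<Rightarrow> 'a vec"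
    by (rule free_of_rankI[OF lmod_fr _ _ _ _ that, where h = "\<lambda>x. x"]) (auto simp: free_module_eq bij_betw_def)
  from this[OF f] this[OF f'] show ?thesis using r unfolding rank_well_defined_def by blast
qed

section \<open>Spaces as forms and formations\<close>

context signed
begin

text \<open>The pairing is restricted because members of \<open>pairings\<close> are extensional in
  both arguments.\<close>

definition toform :: "('a, 'm::ab_group_add) space \<Rightarrow> ('a, 'm) qform" where
  "toform Q = \<lparr>qmodule = mk_module (carr Q) 0 (+) (scl Q),
     qlam = (\<lambda>x\<in>carr Q. \<lambda>y\<in>carr Q. lam Q x y), qmu = (\<lambda>x. qclass \<epsilon> (quad Q x))\<rparr>"

definition tof :: "('a, 'm::ab_group_add) space \<Rightarrow> 'm set \<Rightarrow> 'm set \<Rightarrow> ('a, 'm) formation" where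
  "tof Q F G = \<lparr>fform = toform Q, flag1 = F, flag2 = G\<rparr>"

lemma tof_simps [simp]:
  "flag1 (tof Q F G) = F" "flag2 (tof Q F G) = G" "carrier (fmod (tof Q F G)) = carr Q"
  "zero (fmod (tof Q F G)) = 0" "add (fmod (tof Q F G)) = (+)" "smult (fmod (tof Q F G)) = scl Q"
  "qlam (fform (tof Q F G)) = (\<lambda>x\<in>carr Q. \<lambda>y\<in>carr Q. lam Q x y)"
  "qmu (fform (tof Q F G)) = (\<lambda>x. qclass \<epsilon> (quad Q x))"
  by (simp_all add: tof_def toform_def)

text \<open>A lagrangian complement is part of the notion; for the lagrangians of a formation, given
  as direct summands, \<open>lagrangian_complement\<close> provides it.\<close>

definition lagr :: "('a, 'm::ab_group_add) space \<Rightarrow> 'm set \<Rightarrow> bool" where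
  "lagr Q F \<longleftrightarrow> isfree (scl Q) F \<and> (\<exists>F'. cmp Q F F')"

lemma lagr_subset: "lagr Q F \<Longrightarrow> F \<subseteq> carr Q"
  unfolding lagr_def cmp_def isot_def by blast

lemma wiso_tof:
  assumes Q: "qspace Q" and FG: "F \<subseteq> carr Q" "G \<subseteq> carr Q"
  shows "wiso h (tof Q F G) (tof R F' G') \<longleftrightarrow> siso Q R h \<and> h ` F = F' \<and> h ` G = G'"
proof
  assume w: "wiso h (tof Q F G) (tof R F' G')"
  note W = wisoD[OF w, unfolded tof_simps]
  have "lam R (h x) (h y) = lam Q x y" if "x \<in> carr Q" "y \<in> carr Q" for x y
    using W(6)[OF that] W(12)[OF that(1)] W(12)[OF that(2)] that by simp
  then show "siso Q R h \<and> h ` F = F' \<and> h ` G = G'"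
    using W(1,10,11) unfolding siso_def lin_def by (simp add: W(3,5) W(7)[unfolded qclass_eq_iff])
next
  assume "siso Q R h \<and> h ` F = F' \<and> h ` G = G'"
  then have h: "siso Q R h" "h ` F = F'" "h ` G = G'" by auto
  show "wiso h (tof Q F G) (tof R F' G')"
    unfolding wiso_def tof_simps qclass_eq_iff using FG h(2,3) sisoD(1)[OF h(1)]
    by (simp add: qspace_mod[OF Q] sisoD(3-5)[OF h(1)] linD[OF sisoD(2)[OF h(1)]])
qed

lemma qclass_sum: "{p + p' |p p'. p \<in> qclass \<epsilon> a \<and> p' \<in> qclass \<epsilon> b} = qclass \<epsilon> (a + b)"
proof (intro Set.set_eqI iffI)
  fix x assume "x \<in> qclass \<epsilon> (a + b)"
  then have "qeq x (a + b)" by (simp add: qclass_mem)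
  then have "qeq (x - b) a" using qeq_diff[of x "a + b" b b] by simp
  then show "x \<in> {p + p' |p p'. p \<in> qclass \<epsilon> a \<and> p' \<in> qclass \<epsilon> b}"
    by (intro CollectI exI[of _ "x - b"] exI[of _ b]) (simp add: qclass_mem)
qed (auto simp: qclass_mem intro: qeq_add)

lemma qclass_neg: "uminus ` qclass \<epsilon> a = qclass \<epsilon> (- a)"
proof (intro Set.set_eqI iffI)
  fix x assume "x \<in> qclass \<epsilon> (- a)"
  then have "- x \<in> qclass \<epsilon> a" using qeq_minus[of x "- a"] by (simp add: qclass_mem)
  then show "x \<in> uminus ` qclass \<epsilon> a" by (metis imageI minus_minus)
qed (auto simp: qclass_mem intro: qeq_minus)

lemma formation_sum_tof: "formation_sum (tof Q F G) (tof R F' G') = tof (sp_sum Q R) (F \<times> F') (G \<times> G')"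
  unfolding formation_sum_def qform_sum_def tof_def toform_def direct_sum_def Let_def
  by (auto simp: sp_sum_def mk_module_def zero_prod_def fun_eq_iff qclass_sum restrict_def)

lemma formation_neg_tof: "formation_neg (tof Q F G) = tof (sp_neg Q) F G"
  unfolding formation_neg_def qform_neg_def tof_def toform_def
  by (auto simp: sp_neg_def mk_module_def fun_eq_iff qclass_neg restrict_def)

text \<open>The \<open>B\<close>-component of a vector orthogonal to \<open>A\<close> is itself
  orthogonal to \<open>A\<close>, hence zero by \<open>cmp_unique\<close>.\<close>

lemma cmp_perp:
  assumes Q: "qspace Q" and AB: "cmp Q A B"
  shows "A = {x \<in> carr Q. \<forall>y\<in>A. lam Q x y = 0}"
proof (intro Set.set_eqI iffI)
  note A = isotD[OF cmpD(1)[OF AB]] and B = isotD[OF cmpD(2)[OF AB]]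
  fix x
  { assume "x \<in> A"
    then show "x \<in> {x \<in> carr Q. \<forall>y\<in>A. lam Q x y = 0}" using A(3,5) by simp }
  assume x: "x \<in> {x \<in> carr Q. \<forall>y\<in>A. lam Q x y = 0}"
  then obtain a b where ab: "a \<in> A" "b \<in> B" "x = a + b" using cmpD(4)[OF AB] by blast
  have "b = 0"
  proof (rule cmp_unique[OF Q AB ab(2)])
    fix y assume y: "y \<in> A"
    have "lam Q x y = lam Q a y + lam Q b y" unfolding ab(3) using A(5) B(5) ab y lam_left(1)[OF Q] by blast
    then show "lam Q b y = 0" using x y A(3)[OF ab(1) y] by simp
  qed
  then show "x \<in> A" using ab by simp
qed

lemma qeq_diag: "qeq a b \<Longrightarrow> a + \<epsilon> * bar a = b + \<epsilon> * bar b"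
proof -
  assume "qeq a b"
  then obtain c where c: "a - b = c - \<epsilon> * bar c" unfolding qeq_def by blast
  have "(a - b) + \<epsilon> * bar (a - b) = 0"
    unfolding c by (simp add: bar_diff bar_mult right_diff_distrib eps_central)
  then show ?thesis by (simp add: bar_diff algebra_simps)
qed

lemma isfree_carr: assumes Q: "qspace Q" and F: "lagr Q F" shows "isfree (scl Q) (carr Q)"
proof -
  obtain F' k j where F': "cmp Q F F'" "free_on k (scl Q) F j" using F unfolding lagr_def isfree_def by blast
  obtain h where h: "siso (hyp k) Q h" by (rule cmp_imp_hyp_iso[OF Q F']) blast
  \<comment> \<open>Only the scaling matters; the dummy form lets \<open>free_on_prod\<close> be
    applied to the two halves of \<open>hyp k\<close>.\<close>
  let ?D = "\<lparr>carr = fr k, scl = smul, lam = undefined, quad = undefined\<rparr> :: ('a, 'a vec) space"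
  have f: "free_on k (scl ?D) (fr k) (\<lambda>x. x)" by (simp add: free_on_def lin_def bij_betw_def)
  have "scl (sp_sum ?D ?D) = scl (hyp k)" by (simp add: sp_sum_def hyp_def)
  then have "isfree (scl (hyp k)) (carr (hyp k))" using free_on_prod[OF f f] by (auto simp: isfree_def)
  from isfree_image[OF this h] show ?thesis using sisoD(1)[OF h] by (simp add: bij_betw_def)
qed

text \<open>\<open>wiso\<close> sees addition, scaling and form on the carrier. The zero of the
  record and the extensionality of the pairing are invisible to it and enter as separate
  conditions.\<close>

lemma is_formationI:
  assumes w: "wiso h (tof Q F G) Z" and Q: "qspace Q" and F: "lagr Q F" and G: "lagr Q G"
    and z: "h 0 = \<zero>\<^bsub>fmod Z\<^esub>"
    and ext: "qlam (fform Z) = (\<lambda>x\<in>carrier (fmod Z). \<lambda>y\<in>carrier (fmod Z). qlam (fform Z) x y)"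
  shows "is_formation \<epsilon> Z"
proof -
  let ?M = "fmod Z" and ?l = "qlam (fform Z)" and ?m = "qmu (fform Z)"
  note W = wisoD[OF w, unfolded tof_simps] and QD = qspaceD[OF Q] and QM = qspace_mod[OF Q] and LL = lam_left[OF Q]
  have "carrier ?M = h ` carr Q" using W(1) by (simp add: bij_betw_def)
  then have ball: "(\<forall>x\<in>carrier ?M. P x) = (\<forall>u\<in>carr Q. P (h u))" for P by simp
  have hC: "h u \<in> carrier ?M" if "u \<in> carr Q" for u using W(12) that by simp
  have ha: "h u \<oplus>\<^bsub>?M\<^esub> h v = h (u + v)" if "u \<in> carr Q" "v \<in> carr Q" for u v using W(3) that by simp
  have hm: "a \<odot>\<^bsub>?M\<^esub> h u = h (scl Q a u)" if "u \<in> carr Q" for u a using W(5) that by simp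
  have hl: "?l (h u) (h v) = lam Q u v" if "u \<in> carr Q" "v \<in> carr Q" for u v using W(6) that by simp
  have hmu: "?m (h u) = qclass \<epsilon> (quad Q u)" if "u \<in> carr Q" for u using W(7) that by simp
  have inj: "h u = h v \<longleftrightarrow> u = v" if "u \<in> carr Q" "v \<in> carr Q" for u v
    using W(1) that by (auto simp: bij_betw_def inj_on_def)
  have lx: "?l x = (\<lambda>y\<in>carrier ?M. ?l x y)" if "x \<in> carrier ?M" for x
    using fun_cong[OF ext, of x] that by simp
  have lm: "left_module ?M"
    by (rule left_module_transfer[OF QD(1) W(1)]) (simp_all add: ha hm z)
  have l_lhom: "?l x \<in> lhom ?M ring_module" if x: "x \<in> carrier ?M" for x
  proof -
    obtain u where u: "u \<in> carr Q" "x = h u" using W(1) x unfolding bij_betw_def by blast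
    have "\<forall>y\<in>carrier ?M. \<forall>y'\<in>carrier ?M. ?l x (y \<oplus>\<^bsub>?M\<^esub> y') = ?l x y + ?l x y'"
      unfolding ball u(2) by (simp add: ha hl u QM QD(2))
    moreover have "\<forall>y\<in>carrier ?M. \<forall>a. ?l x (a \<odot>\<^bsub>?M\<^esub> y) = a * ?l x y"
      unfolding ball u(2) by (simp add: hm hl u QM QD(3))
    moreover have "?l x \<in> extensional (carrier ?M)" by (subst lx[OF x]) simp
    ultimately show ?thesis by (simp add: lhom_def ring_module_def PiE_def)
  qed
  have l_hom: "?l \<in> lhom ?M (dual ?M)"
  proof -
    have "\<forall>x\<in>carrier ?M. \<forall>x'\<in>carrier ?M. \<forall>y\<in>carrier ?M. ?l (x \<oplus>\<^bsub>?M\<^esub> x') y = ?l x y + ?l x' y"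
      unfolding ball by (simp add: ha hl QM LL)
    moreover have c: "\<forall>x\<in>carrier ?M. \<forall>x'\<in>carrier ?M. x \<oplus>\<^bsub>?M\<^esub> x' \<in> carrier ?M"
      unfolding ball by (simp add: ha hC QM)
    ultimately have "?l (x \<oplus>\<^bsub>?M\<^esub> x') = (\<lambda>y\<in>carrier ?M. ?l x y + ?l x' y)"
      if "x \<in> carrier ?M" "x' \<in> carrier ?M" for x x'
      using that by (subst lx) (auto intro!: restrict_ext)
    moreover have "\<forall>x\<in>carrier ?M. \<forall>y\<in>carrier ?M. \<forall>a. ?l (a \<odot>\<^bsub>?M\<^esub> x) y = ?l x y * bar a"
      unfolding ball by (simp add: hm hl QM LL)
    moreover have "\<forall>x\<in>carrier ?M. \<forall>a. a \<odot>\<^bsub>?M\<^esub> x \<in> carrier ?M" unfolding ball by (simp add: hm hC QM)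
    ultimately have "?l (a \<odot>\<^bsub>?M\<^esub> x) = (\<lambda>y\<in>carrier ?M. ?l x y * bar a)" if "x \<in> carrier ?M" for x a
      using that by (subst lx) (auto intro!: restrict_ext)
    moreover have "?l \<in> extensional (carrier ?M)" by (subst ext) simp
    ultimately show ?thesis
      using l_lhom \<open>\<And>x x'. \<lbrakk>x \<in> carrier ?M; x' \<in> carrier ?M\<rbrakk> \<Longrightarrow> ?l (x \<oplus>\<^bsub>?M\<^esub> x') = _\<close>
      unfolding lhom_def[of ?M "dual ?M"] by (simp add: dual_def PiE_def)
  qed
  have qf: "quadratic_form \<epsilon> (fform Z)"
    unfolding quadratic_form_def Let_def
  proof (intro conjI)
    show "left_module ?M" by (rule lm)
    show "?l \<in> pairings ?M" using l_hom by (simp add: pairings_def)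
    show "\<forall>x\<in>carrier ?M. \<forall>y\<in>carrier ?M. ?l x y = \<epsilon> * bar (?l y x)"
      unfolding ball by (intro ballI) (simp only: hl, rule QD(4))
    have "\<forall>x\<in>carrier ?M. ?m x \<in> range (qclass \<epsilon>)" unfolding ball by (simp add: hmu)
    then show "?m ` carrier ?M \<subseteq> range (qclass \<epsilon>)" by blast
    have key: "qeq (r - p - q) (lam Q u v)"
      if "u \<in> carr Q" "v \<in> carr Q" "qeq r (quad Q (u + v))" "qeq p (quad Q u)" "qeq q (quad Q v)" for u v r p q
      using qeq_diff[OF qeq_diff[OF qeq_trans[OF that(3) QD(5)[OF that(1,2)]] that(4)] that(5)] by simp
    show "\<forall>x\<in>carrier ?M. \<forall>y\<in>carrier ?M. \<forall>r\<in>?m (x \<oplus>\<^bsub>?M\<^esub> y). \<forall>p\<in>?m x. \<forall>q\<in>?m y.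
        qclass \<epsilon> (r - p - q) = qclass \<epsilon> (?l x y)"
      unfolding ball
    proof (intro ballI)
      fix u v r p q assume *: "u \<in> carr Q" "v \<in> carr Q" "r \<in> ?m (h u \<oplus>\<^bsub>?M\<^esub> h v)" "p \<in> ?m (h u)" "q \<in> ?m (h v)"
      then have "qeq r (quad Q (u + v))" "qeq p (quad Q u)" "qeq q (quad Q v)"
        by (simp_all add: ha hmu QM(2) qclass_mem)
      from key[OF *(1,2) this]
      show "qclass \<epsilon> (r - p - q) = qclass \<epsilon> (?l (h u) (h v))"
        by (simp add: hl *(1,2) qclass_eq_iff)
    qed
    show "\<forall>x\<in>carrier ?M. \<forall>p\<in>?m x. p + \<epsilon> * bar p = ?l x x"
      unfolding ball by (simp add: hl hmu qclass_mem qeq_diag QD(6))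
    have "qeq (quad Q (scl Q a u)) (a * p * bar a)" if "u \<in> carr Q" "qeq p (quad Q u)" for a u p
      using qeq_trans[OF QD(7)[OF that(1)] qeq_sym[OF qeq_conj[OF that(2)]]] .
    then have "\<forall>x\<in>carrier ?M. \<forall>a. \<forall>p\<in>?m x. ?m (a \<odot>\<^bsub>?M\<^esub> x) = qclass \<epsilon> (a * p * bar a)"
      unfolding ball by (simp add: hm hmu QM qclass_mem qclass_eq_iff)
    then show "\<forall>a. \<forall>x\<in>carrier ?M. \<forall>p\<in>?m x. ?m (a \<odot>\<^bsub>?M\<^esub> x) = qclass \<epsilon> (a * p * bar a)" by blast
  qed
  have ns: "nonsingular (fform Z)"
    unfolding nonsingular_def liso_def
  proof (intro CollectI conjI l_hom)
    have "inj_on ?l (carrier ?M)"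
    proof (rule inj_onI)
      fix x y assume "x \<in> carrier ?M" "y \<in> carrier ?M" and e: "?l x = ?l y"
      then obtain u v where uv: "u \<in> carr Q" "x = h u" "v \<in> carr Q" "y = h v" using W(1) unfolding bij_betw_def by blast
      have "lam Q (u - v) w = 0" if w: "w \<in> carr Q" for w
        using lam_diff(1)[OF Q w uv(1,3)] hl[OF uv(1) w] hl[OF uv(3) w] uv e by simp
      then have "u - v = 0" using QD(9)[OF QM(5)[OF uv(1,3)]] by blast
      then show "x = y" using uv by simp
    qed
    moreover have "\<phi> \<in> ?l ` carrier ?M" if p: "\<phi> \<in> lhom ?M ring_module" for \<phi>
    proof -
      have "\<phi> (h (u + v)) = \<phi> (h u) + \<phi> (h v)" if "u \<in> carr Q" "v \<in> carr Q" for u v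
        using p that hC ha[OF that] unfolding lhom_def ring_module_def by (auto simp: ha[symmetric])
      moreover have "\<phi> (h (scl Q a u)) = a * \<phi> (h u)" if "u \<in> carr Q" for u a
        using p that hC hm[OF that] unfolding lhom_def ring_module_def by (auto simp: hm[symmetric])
      ultimately have "lin (scl Q) (carr Q) (*) (\<lambda>u. \<phi> (h u))" unfolding lin_def by blast
      from QD(8)[OF this] obtain u where u: "u \<in> carr Q" "\<And>v. v \<in> carr Q \<Longrightarrow> lam Q u v = \<phi> (h v)" by blast
      have "\<forall>y\<in>carrier ?M. ?l (h u) y = \<phi> y" unfolding ball using u hl by simp
      moreover have "\<phi> = restrict \<phi> (carrier ?M)"
        using p unfolding lhom_def by (auto simp: PiE_def extensional_restrict)
      ultimately have "?l (h u) = \<phi>" using lx[OF hC[OF u(1)]] by (metis restrict_ext)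
      then show ?thesis using hC[OF u(1)] by blast
    qed
    ultimately show "bij_betw ?l (carrier ?M) (carrier (dual ?M))"
      unfolding bij_betw_def using l_lhom by (auto simp: dual_def)
  qed
  have sub: "left_submodule (h ` A) ?M" if "lsub (scl Q) A" "A \<subseteq> carr Q" for A
    unfolding left_submodule_def
  proof
    show "h ` A \<subseteq> carrier ?M" using that hC by blast
    have "bij_betw h A (h ` A)" using W(1) that by (auto simp: bij_betw_def inj_on_def)
    then show "left_module (?M\<lparr>carrier := h ` A\<rparr>)"
      using that by (intro left_module_transfer[OF lmod_subset[OF QD(1) that], of h]) (auto simp: ha hm z subset_iff)
  qed
  have lag: "lagrangian \<epsilon> (fform Z) (h ` A)" if A: "lagr Q A" for A
  proof -
    obtain B where AB: "cmp Q A B" using A unfolding lagr_def by blast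
    note A' = isotD[OF cmpD(1)[OF AB]] and B' = isotD[OF cmpD(2)[OF AB]]
    have "h ` A \<inter> h ` B = {\<zero>\<^bsub>?M\<^esub>}"
    proof (intro equalityI subsetI)
      fix x assume "x \<in> h ` A \<inter> h ` B"
      then obtain a b where ab: "a \<in> A" "b \<in> B" "x = h a" "h a = h b" by auto
      then have "a = b" using inj[OF A'(5)[OF ab(1)] B'(5)[OF ab(2)]] by simp
      then have "a = 0" using cmpD(3)[OF AB ab(1)] ab(2) by simp
      then show "x \<in> {\<zero>\<^bsub>?M\<^esub>}" using ab(3) z by simp
    qed (use lsubD(1)[OF A'(2)] lsubD(1)[OF B'(2)] z in force)
    moreover have "set_add ?M (h ` A) (h ` B) = carrier ?M"
    proof (intro equalityI subsetI)
      fix x assume "x \<in> set_add ?M (h ` A) (h ` B)"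
      then obtain a b where "a \<in> A" "b \<in> B" "x = h a \<oplus>\<^bsub>?M\<^esub> h b" unfolding set_add_def' by blast
      then show "x \<in> carrier ?M" using A'(5) B'(5) ha hC QM(2) by simp
    next
      fix x assume "x \<in> carrier ?M"
      then obtain u where u: "u \<in> carr Q" "x = h u" using W(1) unfolding bij_betw_def by blast
      then obtain a b where ab: "a \<in> A" "b \<in> B" "u = a + b" using cmpD(4)[OF AB] by blast
      then have "x = h a \<oplus>\<^bsub>?M\<^esub> h b" using u ha[of a b] A'(5) B'(5) by simp
      then show "x \<in> set_add ?M (h ` A) (h ` B)" using ab(1,2) unfolding set_add_def' by blast
    qed
    ultimately have "direct_summand (h ` A) ?M"
      unfolding direct_summand_def using sub[OF A'(2,1)] sub[OF B'(2,1)] by blast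
    moreover have "\<forall>x\<in>h ` A. ?m x = qclass \<epsilon> 0" using A'(4,5) by (simp add: hmu qclass_eq_iff)
    moreover have "h ` A = {x \<in> carrier ?M. \<forall>y\<in>h ` A. ?l x y = 0}"
    proof (intro equalityI subsetI)
      fix x assume x: "x \<in> {x \<in> carrier ?M. \<forall>y\<in>h ` A. ?l x y = 0}"
      then obtain u where u: "u \<in> carr Q" "x = h u" using W(1) unfolding bij_betw_def by blast
      have "lam Q u y = 0" if "y \<in> A" for y using x that hl[OF u(1) A'(5)[OF that]] u(2) by auto
      then have "u \<in> A" using cmp_perp[OF Q AB] u(1) by blast
      then show "x \<in> h ` A" using u(2) by blast
    qed (use A'(3,5) hC hl in force)
    ultimately show ?thesis unfolding lagrangian_def by blast
  qed
  have free: "fg_free (?M\<lparr>carrier := h ` A\<rparr>)" if f: "isfree (scl Q) A" and sA: "lsub (scl Q) A" "A \<subseteq> carr Q" for A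
  proof -
    obtain k j where j: "free_on k (scl Q) A j" using f unfolding isfree_def by blast
    have "bij_betw h A (h ` A)" using W(1) sA by (auto simp: bij_betw_def inj_on_def)
    then have "free_of_rank k (?M\<lparr>carrier := h ` A\<rparr>)"
      using sA by (intro free_of_rankI[OF lmod_subset[OF QD(1) sA] _ _ _ _ j, of h]) (auto simp: ha hm z subset_iff)
    then show ?thesis unfolding fg_free_def by blast
  qed
  have "h ` carr Q = carrier ?M" using W(1) by (simp add: bij_betw_def)
  then have "?M\<lparr>carrier := h ` carr Q\<rparr> = ?M" by simp
  then have fgQ: "fg_free ?M"
    using free[OF isfree_carr[OF Q F] lmodD(1)[OF QD(1)]] by simp
  have fgA: "fg_free (?M\<lparr>carrier := h ` A\<rparr>)" if "lagr Q A" for A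
    using free[of A] that isotD(1,2)[OF cmpD(1)] unfolding lagr_def by blast
  show ?thesis
    unfolding is_formation_def W(10,11)[symmetric] using qf ns fgQ lag[OF F] lag[OF G] fgA[OF F] fgA[OF G] by blast
qed

lemma is_formation_tof:
  assumes "qspace Q" "lagr Q F" "lagr Q G" shows "is_formation \<epsilon> (tof Q F G)"
proof (rule is_formationI)
  show "wiso (\<lambda>x. x) (tof Q F G) (tof Q F G)"
    by (simp add: wiso_tof[OF assms(1)] lagr_subset[OF assms(2)] lagr_subset[OF assms(3)] siso_id)
qed (use assms in \<open>auto simp: fun_eq_iff restrict_def\<close>)

section \<open>Coordinates for formations\<close>

lemma liso_free_moduleD:
  fixes M :: "('a, 'm) module"
  assumes "j \<in> liso (free_module k) M"
  shows "bij_betw j (fr k) (carrier M)" "x \<in> fr k \<Longrightarrow> y \<in> fr k \<Longrightarrow> j (x + y) = j x \<oplus>\<^bsub>M\<^esub> j y"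
    "x \<in> fr k \<Longrightarrow> j (smul a x) = a \<odot>\<^bsub>M\<^esub> j x" "x \<in> fr k \<Longrightarrow> j x \<in> carrier M"
  using assms unfolding liso_def lhom_def free_module_eq by auto

lemma free_identity: "(\<lambda>x\<in>fr k. x) \<in> liso (free_module k) (free_module k :: ('a, 'a vec) module)"
  unfolding liso_def lhom_def free_module_eq by (auto simp: bij_betw_def)

lemma left_module_zero:
  assumes M: "left_module M" and x: "x \<in> carrier M" "x \<oplus>\<^bsub>M\<^esub> x = x" shows "x = \<zero>\<^bsub>M\<^esub>"
proof -
  interpret left_module M by (rule M)
  show ?thesis using add.l_cancel_one[OF x(1) x(1)] x(2) by simp
qed

lemma liso_free_module_zero:
  fixes M :: "('a, 'm) module"
  assumes j: "j \<in> liso (free_module k) M" and M: "left_module M" shows "j 0 = \<zero>\<^bsub>M\<^esub>"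
  using liso_free_moduleD(2)[OF j, of 0 0] liso_free_moduleD(4)[OF j, of 0] by (intro left_module_zero[OF M]) simp_all

lemma lhom_ring_moduleD:
  assumes "f \<in> lhom M ring_module"
  shows "x \<in> carrier M \<Longrightarrow> y \<in> carrier M \<Longrightarrow> f (x \<oplus>\<^bsub>M\<^esub> y) = f x + f y"
    "x \<in> carrier M \<Longrightarrow> f (a \<odot>\<^bsub>M\<^esub> x) = a * f x" "f = (\<lambda>x\<in>carrier M. f x)"
  using assms unfolding lhom_def ring_module_def by (auto simp: PiE_def extensional_restrict)

lemma lhom_ring_moduleI:
  assumes "\<And>x y. x \<in> carrier M \<Longrightarrow> y \<in> carrier M \<Longrightarrow> f (x \<oplus>\<^bsub>M\<^esub> y) = f x + f y"
    "\<And>a x. x \<in> carrier M \<Longrightarrow> f (a \<odot>\<^bsub>M\<^esub> x) = a * f x" "f \<in> extensional (carrier M)"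
  shows "f \<in> lhom M ring_module"
  using assms unfolding lhom_def ring_module_def by (simp add: PiE_def)

lemma lhom_coordinates:
  fixes M :: "('a, 'm) module"
  assumes j: "j \<in> liso (free_module k) M" and f: "f \<in> lhom M ring_module"
  obtains a where "a \<in> fr k" "\<And>x. x \<in> fr k \<Longrightarrow> f (j x) = ip k x a"
proof -
  have "lin smul (fr k) (*) (\<lambda>x. f (j x))"
    unfolding lin_def using liso_free_moduleD[OF j] lhom_ring_moduleD[OF f] by simp
  from ip_functional[OF this] that show ?thesis by blast
qed

lemma pairingsD:
  assumes "l \<in> pairings M"
  shows "x \<in> carrier M \<Longrightarrow> l x \<in> lhom M ring_module"
    "x \<in> carrier M \<Longrightarrow> y \<in> carrier M \<Longrightarrow> z \<in> carrier M \<Longrightarrow> l x (y \<oplus>\<^bsub>M\<^esub> z) = l x y + l x z"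
    "x \<in> carrier M \<Longrightarrow> y \<in> carrier M \<Longrightarrow> l x (a \<odot>\<^bsub>M\<^esub> y) = a * l x y"
proof -
  show l: "l x \<in> lhom M ring_module" if "x \<in> carrier M" for x
    using assms that unfolding pairings_def lhom_def[of M "dual M"] by (auto simp: dual_def)
  show "x \<in> carrier M \<Longrightarrow> y \<in> carrier M \<Longrightarrow> z \<in> carrier M \<Longrightarrow> l x (y \<oplus>\<^bsub>M\<^esub> z) = l x y + l x z"
    "x \<in> carrier M \<Longrightarrow> y \<in> carrier M \<Longrightarrow> l x (a \<odot>\<^bsub>M\<^esub> y) = a * l x y"
    using lhom_ring_moduleD(1,2)[OF l] by simp_all
qed

text \<open>A basis of the underlying module pulls everything back to sequences, which also brings a
  formation on any type into the universe \<open>nat \<Rightarrow> 'a\<close>. The pulled-back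
  lagrangians get their complements from \<open>lagrangian_complement\<close>.\<close>

lemma is_formationD:
  assumes X: "is_formation \<epsilon> X"
  shows "\<exists>(Q :: ('a, 'a vec) space) F G h. wiso h (tof Q F G) X \<and> qspace Q \<and> lagr Q F \<and> lagr Q G"
proof -
  let ?M = "fmod X" and ?l = "qlam (fform X)" and ?m = "qmu (fform X)"
  have qf: "quadratic_form \<epsilon> (fform X)" and ns: "nonsingular (fform X)" and fg: "fg_free ?M"
    and l1: "lagrangian \<epsilon> (fform X) (flag1 X)" "fg_free (?M\<lparr>carrier := flag1 X\<rparr>)"
    and l2: "lagrangian \<epsilon> (fform X) (flag2 X)" "fg_free (?M\<lparr>carrier := flag2 X\<rparr>)"
    using X unfolding is_formation_def by blast+
  obtain k j where M: "left_module ?M" and j: "j \<in> liso (free_module k) ?M"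
    using fg unfolding fg_free_def free_of_rank_def by blast
  note J = liso_free_moduleD[OF j]
  have j0: "j 0 = \<zero>\<^bsub>?M\<^esub>" by (rule liso_free_module_zero[OF j M])
  have e: "carrier ?M = j ` fr k" using J(1) by (simp add: bij_betw_def)
  have lp: "?l \<in> pairings ?M" using qf unfolding quadratic_form_def Let_def by blast
  have herm: "?l x y = \<epsilon> * bar (?l y x)" if "x \<in> carrier ?M" "y \<in> carrier ?M" for x y
    using qf that unfolding quadratic_form_def Let_def by blast
  have rng: "\<exists>c. ?m x = qclass \<epsilon> c" if "x \<in> carrier ?M" for x
    using qf that unfolding quadratic_form_def Let_def by blast
  have madd: "qclass \<epsilon> (r - p - q) = qclass \<epsilon> (?l x y)"
    if "x \<in> carrier ?M" "y \<in> carrier ?M" "r \<in> ?m (x \<oplus>\<^bsub>?M\<^esub> y)" "p \<in> ?m x" "q \<in> ?m y" for x y r p q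
    using qf that unfolding quadratic_form_def Let_def by blast
  have mdiag: "p + \<epsilon> * bar p = ?l x x" if "x \<in> carrier ?M" "p \<in> ?m x" for x p
    using qf that unfolding quadratic_form_def Let_def by blast
  have mscl: "?m (a \<odot>\<^bsub>?M\<^esub> x) = qclass \<epsilon> (a * p * bar a)" if "x \<in> carrier ?M" "p \<in> ?m x" for a x p
    using qf that unfolding quadratic_form_def Let_def by blast
  \<comment> \<open>Values of \<open>qmu\<close> are cosets; a representative is picked at each
    vector.\<close>
  define qd where "qd x = (SOME p. p \<in> ?m (j x))" for x
  have qd: "qd x \<in> ?m (j x)" "?m (j x) = qclass \<epsilon> (qd x)" if x: "x \<in> fr k" for x
  proof -
    obtain c where c: "?m (j x) = qclass \<epsilon> c" using rng[OF J(4)[OF x]] by blast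
    then have "c \<in> ?m (j x)" by (simp add: qclass_mem)
    then show q: "qd x \<in> ?m (j x)" unfolding qd_def by (rule someI)
    then show "?m (j x) = qclass \<epsilon> (qd x)" using c by (simp add: qclass_mem qclass_eq_iff qeq_sym)
  qed
  define Q where "Q = \<lparr>carr = fr k, scl = smul, lam = (\<lambda>x y. ?l (j x) (j y)), quad = qd\<rparr>"
  have Qs: "carr Q = fr k" "scl Q = smul" "lam Q x y = ?l (j x) (j y)" "quad Q = qd" for x y
    by (simp_all add: Q_def)
  have Q: "qspace Q"
  proof (rule qspaceI; unfold Qs)
    show "lmod smul (fr k)" by (rule lmod_fr)
    fix x :: "'a vec" assume x: "x \<in> fr k"
    { fix y z :: "'a vec" assume y: "y \<in> fr k" and z: "z \<in> fr k"
      show "?l (j x) (j (y + z)) = ?l (j x) (j y) + ?l (j x) (j z)"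
        using x y z by (simp add: J pairingsD[OF lp]) }
    { fix a and y :: "'a vec" assume y: "y \<in> fr k"
      show "?l (j x) (j (smul a y)) = a * ?l (j x) (j y)" using x y by (simp add: J pairingsD[OF lp]) }
    { fix y :: "'a vec" assume y: "y \<in> fr k"
      show "?l (j x) (j y) = \<epsilon> * bar (?l (j y) (j x))" by (rule herm[OF J(4)[OF x] J(4)[OF y]])
      have "qeq (qd (x + y) - qd x - qd y) (?l (j x) (j y))"
        using madd[OF J(4)[OF x] J(4)[OF y] _ qd(1)[OF x] qd(1)[OF y], of "qd (x + y)"]
          qd(1)[OF fr_mod(2)[OF x y]] J(2)[OF x y] by (simp add: qclass_eq_iff)
      from qeq_add[OF this qeq_refl[of "qd x + qd y"]]
      show "qeq (qd (x + y)) (qd x + qd y + ?l (j x) (j y))" by (simp add: algebra_simps) }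
    show "qd x + \<epsilon> * bar (qd x) = ?l (j x) (j x)" by (rule mdiag[OF J(4)[OF x] qd(1)[OF x]])
    { fix a
      show "qeq (qd (smul a x)) (a * qd x * bar a)"
        using mscl[OF J(4)[OF x] qd(1)[OF x], of a] qd(1)[OF fr_mod(3)[OF x], of a] J(3)[OF x]
        by (simp add: qclass_mem) }
    { assume z: "\<And>y. y \<in> fr k \<Longrightarrow> ?l (j x) (j y) = 0"
      have "?l (j 0) (j y) = 0" if y: "y \<in> fr k" for y
        using herm[OF J(4)[OF fr_mod(1)] J(4)[OF y]] pairingsD(2)[OF lp J(4)[OF y] J(4)[OF fr_mod(1)] J(4)[OF fr_mod(1)]]
          J(2)[OF fr_mod(1) fr_mod(1)] by simp
      then have "\<forall>y\<in>carrier ?M. ?l (j x) y = ?l (j 0) y" unfolding e using z by simp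
      then have "?l (j x) = ?l (j 0)"
        using lhom_ring_moduleD(3)[OF pairingsD(1)[OF lp J(4)[OF x]]]
          lhom_ring_moduleD(3)[OF pairingsD(1)[OF lp J(4)[OF fr_mod(1)]]] by (metis restrict_ext)
      then have "j x = j 0" using ns J(4)[OF x] J(4)[OF fr_mod(1)]
        unfolding nonsingular_def liso_def bij_betw_def inj_on_def by blast
      then show "x = 0" using J(1) x fr_mod(1) by (auto simp: bij_betw_def inj_on_def) }
  next
    fix \<phi> :: "'a vec \<Rightarrow> 'a" assume p: "lin smul (fr k) (*) \<phi>"
    let ?i = "inv_into (fr k) j"
    have ij: "?i (j x) = x" if "x \<in> fr k" for x using bij_betw_inv_into_left[OF J(1) that] .
    let ?\<phi> = "\<lambda>y\<in>carrier ?M. \<phi> (?i y)"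
    have "\<forall>x\<in>carrier ?M. \<forall>y\<in>carrier ?M. ?\<phi> (x \<oplus>\<^bsub>?M\<^esub> y) = ?\<phi> x + ?\<phi> y"
      unfolding e by (simp add: J(2)[symmetric] ij linD[OF p])
    moreover have "\<forall>x\<in>carrier ?M. \<forall>a. ?\<phi> (a \<odot>\<^bsub>?M\<^esub> x) = a * ?\<phi> x"
      unfolding e by (simp add: J(3)[symmetric] ij linD[OF p])
    ultimately have "?\<phi> \<in> lhom ?M ring_module" by (intro lhom_ring_moduleI) auto
    moreover have "?l ` carrier ?M = lhom ?M ring_module"
      using ns by (simp add: nonsingular_def liso_def bij_betw_def dual_def)
    ultimately obtain x where x: "x \<in> carrier ?M" "?\<phi> = ?l x" by blast
    then obtain u where u: "u \<in> fr k" "x = j u" using J(1) by (auto simp: bij_betw_def)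
    then show "\<exists>x\<in>fr k. \<forall>y\<in>fr k. ?l (j x) (j y) = \<phi> y"
      using x(2)[symmetric] J(4) ij by (intro bexI[of _ u]) auto
  qed
  define pre where "pre L = {x \<in> fr k. j x \<in> L}" for L
  have im: "j ` pre L = L" if "L \<subseteq> carrier ?M" for L
    using that unfolding pre_def e by blast
  have sub: "lsub smul (pre L)" if "left_submodule L ?M" for L
  proof -
    interpret L: left_module "?M\<lparr>carrier := L\<rparr>" using that by (simp add: left_submodule_def)
    show ?thesis
      unfolding lsub_def pre_def
      using L.zero_closed L.a_closed L.smult_closed j0 by (auto simp: J)
  qed
  have lag: "lagr Q (pre L)" if L: "lagrangian \<epsilon> (fform X) L" and f: "fg_free (?M\<lparr>carrier := L\<rparr>)" for L
  proof -
    have L1: "left_submodule L ?M" and L2: "\<And>x. x \<in> L \<Longrightarrow> ?m x = qclass \<epsilon> 0"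
      and L3: "L = {x \<in> carrier ?M. \<forall>y\<in>L. ?l x y = 0}"
      using L unfolding lagrangian_def direct_summand_def by blast+
    have Lc: "L \<subseteq> carrier ?M" using L1 by (simp add: left_submodule_def)
    obtain N where N: "left_submodule N ?M" "L \<inter> N = {\<zero>\<^bsub>?M\<^esub>}" "set_add ?M L N = carrier ?M"
      using L unfolding lagrangian_def direct_summand_def by blast
    obtain m i where i: "i \<in> liso (free_module m) (?M\<lparr>carrier := L\<rparr>)"
      using f unfolding fg_free_def free_of_rank_def by blast
    note I = liso_free_moduleD[OF i, simplified]
    let ?i = "inv_into (fr k) j"
    have ji: "j (?i y) = y" "?i y \<in> fr k" if "y \<in> L" for y
      using bij_betw_inv_into_right[OF J(1)] bij_betw_inv_into[OF J(1)] that Lc by (auto simp: bij_betw_def)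
    have ij: "?i (j x) = x" if "x \<in> fr k" for x using bij_betw_inv_into_left[OF J(1) that] .
    have fr_i: "free_on m smul (pre L) (\<lambda>x. ?i (i x))"
      unfolding free_on_def
    proof
      show "lin smul (fr m) smul (\<lambda>x. ?i (i x))"
        unfolding lin_def
      proof (intro conjI ballI allI)
        fix x y :: "'a vec" assume xy: "x \<in> fr m" "y \<in> fr m"
        have "i (x + y) = j (?i (i x) + ?i (i y))" using xy by (simp add: I J ji)
        then show "?i (i (x + y)) = ?i (i x) + ?i (i y)" using ij xy by (simp add: I ji)
      next
        fix a and x :: "'a vec" assume x: "x \<in> fr m"
        have "i (smul a x) = j (smul a (?i (i x)))" using x by (simp add: I J ji)
        then show "?i (i (smul a x)) = smul a (?i (i x))" using ij x by (simp add: I ji)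
      qed
      have "bij_betw ?i L (pre L)"
        by (rule bij_betwI[where g = j]) (use Lc in \<open>auto simp: pre_def ji ij\<close>)
      then show "bij_betw (\<lambda>x. ?i (i x)) (fr m) (pre L)"
        using bij_betw_trans[OF I(1)] by (simp add: comp_def)
    qed
    have iso: "isot Q (pre L)"
    proof -
      have "?l (j x) (j y) = 0" if "x \<in> pre L" "y \<in> pre L" for x y
        using that L3 unfolding pre_def by blast
      moreover have "qeq (qd x) 0" if "x \<in> pre L" for x
        using that qd(1)[of x] L2[of "j x"] by (simp add: pre_def qclass_mem)
      ultimately show ?thesis unfolding isot_def Qs using sub[OF L1] by (auto simp: pre_def)
    qed
    have "\<exists>B. cmp Q (pre L) B"
    proof (rule lagrangian_complement[OF Q iso, where N = "pre N" and j = "\<lambda>x. ?i (i x)" and k = m]; (unfold Qs)?)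
      fix x :: "'a vec" assume x: "x \<in> fr k" and z: "\<And>y. y \<in> pre L \<Longrightarrow> ?l (j x) (j y) = 0"
      have "\<forall>y\<in>j ` pre L. ?l (j x) y = 0" using z by simp
      then have "j x \<in> L" using L3 J(4)[OF x] unfolding im[OF Lc] by blast
      then show "x \<in> pre L" using x by (simp add: pre_def)
    next
      fix x assume "x \<in> pre L" "x \<in> pre N"
      then have "x \<in> fr k" "j x = j 0" using N(2) j0 by (auto simp: pre_def)
      then show "x = 0" using J(1) fr_mod(1) by (auto simp: bij_betw_def inj_on_def)
    next
      fix x :: "'a vec" assume x: "x \<in> fr k"
      then obtain u v where uv: "u \<in> L" "v \<in> N" "j x = u \<oplus>\<^bsub>?M\<^esub> v"
        using N(3) J(4)[OF x] unfolding set_add_def' by blast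
      have Nc: "N \<subseteq> carrier ?M" using N(1) by (simp add: left_submodule_def)
      obtain a b where ab: "a \<in> pre L" "u = j a" "b \<in> pre N" "v = j b" using uv im[OF Lc] im[OF Nc] by blast
      then have f: "a \<in> fr k" "b \<in> fr k" by (auto simp: pre_def)
      then have "j x = j (a + b)" using uv(3) ab J(2) by simp
      then have "x = a + b" using J(1) x fr_mod(2)[OF f] by (auto simp: bij_betw_def inj_on_def)
      then show "\<exists>a\<in>pre L. \<exists>b\<in>pre N. x = a + b" using ab by blast
    qed (use sub[OF N(1)] fr_i in \<open>auto simp: pre_def\<close>)
    then show ?thesis unfolding lagr_def isfree_def Qs using fr_i by blast
  qed
  have c: "flag1 X \<subseteq> carrier ?M" "flag2 X \<subseteq> carrier ?M"
    using l1(1) l2(1) unfolding lagrangian_def direct_summand_def left_submodule_def by blast+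
  have "wiso j (tof Q (pre (flag1 X)) (pre (flag2 X))) X"
    unfolding wiso_def tof_simps im[OF c(1)] im[OF c(2)] Qs using J qd(2) by (auto simp: pre_def)
  then show ?thesis using Q lag[OF l1] lag[OF l2] by blast
qed

lemma is_formation_closed:
  assumes X: "is_formation \<epsilon> X"
  shows "x \<in> carrier (fmod X) \<Longrightarrow> y \<in> carrier (fmod X) \<Longrightarrow> x \<oplus>\<^bsub>fmod X\<^esub> y \<in> carrier (fmod X)"
    "x \<in> carrier (fmod X) \<Longrightarrow> a \<odot>\<^bsub>fmod X\<^esub> x \<in> carrier (fmod X)"
    "flag1 X \<subseteq> carrier (fmod X)" "flag2 X \<subseteq> carrier (fmod X)"
proof -
  have "left_module (fmod X)" using X unfolding is_formation_def quadratic_form_def Let_def by blast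
  then interpret left_module "fmod X" .
  show "x \<in> carrier (fmod X) \<Longrightarrow> y \<in> carrier (fmod X) \<Longrightarrow> x \<oplus>\<^bsub>fmod X\<^esub> y \<in> carrier (fmod X)"
    "x \<in> carrier (fmod X) \<Longrightarrow> a \<odot>\<^bsub>fmod X\<^esub> x \<in> carrier (fmod X)" by (auto intro: smult_closed)
  show "flag1 X \<subseteq> carrier (fmod X)" "flag2 X \<subseteq> carrier (fmod X)"
    using X unfolding is_formation_def lagrangian_def direct_summand_def left_submodule_def by blast+
qed

text \<open>Both \<open>F\<close> and \<open>G\<close> extend to hyperbolic coordinates of
  \<open>Q\<close>, of sizes \<open>k\<close> and \<open>l\<close>. Once these agree, comparing the
  two coordinate systems gives the automorphism.\<close>

lemma formation_as_automorphism:
  assumes r: "rank_well_defined TYPE('a)" and Q: "qspace Q" and F: "lagr Q F" and G: "lagr Q G"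
  obtains k g h where "siso (hyp k) (hyp k) g" "wiso h (tof (hyp k) (Lg k) (g ` Lg k)) (tof Q F G)"
proof -
  obtain F' k i where F': "cmp Q F F'" "free_on k (scl Q) F i" using F unfolding lagr_def isfree_def by blast
  obtain G' l j where G': "cmp Q G G'" "free_on l (scl Q) G j" using G unfolding lagr_def isfree_def by blast
  obtain f where f: "siso (hyp k) Q f" "f ` Lg k = F" by (rule cmp_imp_hyp_iso[OF Q F']) blast
  obtain g where g: "siso (hyp l) Q g" "g ` Lg l = G" by (rule cmp_imp_hyp_iso[OF Q G']) blast
  let ?D = "\<lambda>k. \<lparr>carr = fr k, scl = smul, lam = undefined, quad = undefined\<rparr> :: ('a, 'a vec) space"
  have d: "free_on m (scl (?D m)) (fr m) (\<lambda>x. x)" for m by (simp add: free_on_def lin_def bij_betw_def)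
  have "scl (sp_sum (?D m) (?D m)) = scl (hyp m)" for m by (simp add: sp_sum_def hyp_def)
  then have h: "free_on (m + m) (scl (hyp m)) (carr (hyp m)) (\<lambda>x. (trunc m x, drop_vec m x))" for m
    using free_on_prod[OF d[of m] d[of m]] by simp
  have "f ` carr (hyp k) = carr Q" "g ` carr (hyp l) = carr Q"
    using sisoD(1)[OF f(1)] sisoD(1)[OF g(1)] by (auto simp: bij_betw_def)
  \<comment> \<open>Both coordinate systems give bases of the whole of \<open>Q\<close>, of lengths
    \<open>k + k\<close> and \<open>l + l\<close>.\<close>
  then have "k + k = l + l"
    using rank_unique[OF r free_on_image[OF h f(1)], of "l + l"] free_on_image[OF h g(1)] by simp
  then have [simp]: "l = k" by simp
  let ?a = "\<lambda>x. inv_into (carr (hyp k)) f (g x)"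
  have a: "siso (hyp k) (hyp k) ?a" using siso_comp[OF g(1)[simplified] siso_inv[OF qspace_hyp f(1)]] .
  have "f (?a x) = g x" if "x \<in> carr (hyp k)" for x
    using bij_betw_inv_into_right[OF sisoD(1)[OF f(1)]] sisoD(5)[OF g(1)] that by simp
  moreover have L: "Lg k \<subseteq> carr (hyp k)" by (auto simp: Lg_def)
  ultimately have "(\<lambda>x. f (?a x)) ` Lg k = g ` Lg k" by (intro image_cong) auto
  then have "f ` (?a ` Lg k) = G" using g(2) by (simp add: image_image)
  moreover have "?a ` Lg k \<subseteq> carr (hyp k)" using sisoD(5)[OF a] L by blast
  ultimately have "wiso f (tof (hyp k) (Lg k) (?a ` Lg k)) (tof Q F G)"
    using f by (simp add: wiso_tof[OF qspace_hyp L])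
  then show ?thesis by (rule that[OF a])
qed

text \<open>Coordinates on \<open>H\<^sub>\<epsilon>(K)\<close> from a basis \<open>j\<close> of
  \<open>K\<close>: the vector \<open>a\<close> stands for the functional with value
  \<open>ip k x a\<close> at \<open>j x\<close>.\<close>

definition hmap :: "nat \<Rightarrow> ('a, 'm) module \<Rightarrow> ('a vec \<Rightarrow> 'm) \<Rightarrow> 'a vec \<times> 'a vec \<Rightarrow> 'm \<times> ('m \<Rightarrow> 'a)" where
  "hmap k K j = (\<lambda>(x, a). (j x, \<lambda>y\<in>carrier K. ip k (inv_into (fr k) j y) a))"

lemma hyperbolic_simps:
  "carrier (qmodule (hyperbolic \<epsilon> K)) = carrier K \<times> lhom K ring_module"
  "\<zero>\<^bsub>qmodule (hyperbolic \<epsilon> K)\<^esub> = (\<zero>\<^bsub>K\<^esub>, \<lambda>x\<in>carrier K. 0)"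
  "(x, f) \<oplus>\<^bsub>qmodule (hyperbolic \<epsilon> K)\<^esub> (y, g) = (x \<oplus>\<^bsub>K\<^esub> y, \<lambda>z\<in>carrier K. f z + g z)"
  "a \<odot>\<^bsub>qmodule (hyperbolic \<epsilon> K)\<^esub> (x, f) = (a \<odot>\<^bsub>K\<^esub> x, \<lambda>z\<in>carrier K. f z * bar a)"
  "x \<in> carrier K \<Longrightarrow> f \<in> lhom K ring_module \<Longrightarrow> y \<in> carrier K \<Longrightarrow> g \<in> lhom K ring_module \<Longrightarrow>
     qlam (hyperbolic \<epsilon> K) (x, f) (y, g) = f y + \<epsilon> * bar (g x)"
  "qmu (hyperbolic \<epsilon> K) (x, f) = qclass \<epsilon> (f x)"
  by (simp_all add: hyperbolic_def hyperbolic_module_def direct_sum_def dual_def)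

lemma hmap:
  fixes K :: "('a, 'm) module"
  assumes K: "left_module K" and j: "j \<in> liso (free_module k) K"
  shows "F \<subseteq> fr k \<times> fr k \<Longrightarrow> G \<subseteq> fr k \<times> fr k \<Longrightarrow>
      wiso (hmap k K j) (tof (hyp k) F G) \<lparr>fform = hyperbolic \<epsilon> K, flag1 = hmap k K j ` F, flag2 = hmap k K j ` G\<rparr>"
    and "hmap k K j ` Lg k = carrier K \<times> {\<zero>\<^bsub>dual K\<^esub>}" and "hmap k K j ` Ld k = {\<zero>\<^bsub>K\<^esub>} \<times> carrier (dual K)"
    and "hmap k K j 0 = \<zero>\<^bsub>qmodule (hyperbolic \<epsilon> K)\<^esub>"
proof -
  note J = liso_free_moduleD[OF j]
  let ?i = "inv_into (fr k) j" and ?c = "hmap k K j"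
  let ?f = "\<lambda>a. \<lambda>y\<in>carrier K. ip k (?i y) a"
  have ij: "?i (j x) = x" if "x \<in> fr k" for x using bij_betw_inv_into_left[OF J(1) that] .
  have e: "carrier K = j ` fr k" using J(1) by (simp add: bij_betw_def)
  have c: "?c (x, a) = (j x, ?f a)" for x a by (simp add: hmap_def)
  have cm: "?c = map_prod j ?f" by (auto simp: hmap_def fun_eq_iff)
  have fj: "?f a (j x) = ip k x a" if "x \<in> fr k" for a x using J(4)[OF that] ij[OF that] by simp
  have f_lhom: "?f a \<in> lhom K ring_module" for a
  proof -
    have "\<forall>x\<in>carrier K. \<forall>y\<in>carrier K. ?f a (x \<oplus>\<^bsub>K\<^esub> y) = ?f a x + ?f a y"
      unfolding e by (simp add: J(2)[symmetric] ij ip_simps)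
    moreover have "\<forall>x\<in>carrier K. \<forall>b. ?f a (b \<odot>\<^bsub>K\<^esub> x) = b * ?f a x"
      unfolding e by (simp add: J(3)[symmetric] ij ip_simps)
    ultimately show ?thesis by (intro lhom_ring_moduleI) auto
  qed
  have f_inj: "a = b" if "?f a = ?f b" "a \<in> fr k" "b \<in> fr k" for a b
  proof -
    have "ip k x a = ip k x b" if "x \<in> fr k" for x
      using fun_cong[OF \<open>?f a = ?f b\<close>, of "j x"] unfolding fj[OF that] .
    then have "a - b = 0"
      using that(2,3) by (intro ip_eq_zero[of _ k]) (auto simp: ip_simps diff_conv_add_uminus simp del: add_uminus_conv_diff)
    then show ?thesis by simp
  qed
  have f_surj: "\<exists>a\<in>fr k. ?f a = g" if g: "g \<in> lhom K ring_module" for g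
  proof -
    obtain a where a: "a \<in> fr k" "\<And>x. x \<in> fr k \<Longrightarrow> g (j x) = ip k x a" by (rule lhom_coordinates[OF j g]) blast
    have "\<forall>y\<in>carrier K. ip k (?i y) a = g y" unfolding e using a(2) ij by simp
    then have "?f a = restrict g (carrier K)" by (auto intro: restrict_ext)
    then show ?thesis using a(1) lhom_ring_moduleD(3)[OF g] by metis
  qed
  have f0: "?f 0 = (\<lambda>x\<in>carrier K. 0)" by (simp add: ip_simps)
  have j0: "j 0 = \<zero>\<^bsub>K\<^esub>" by (rule liso_free_module_zero[OF j K])
  show "?c 0 = \<zero>\<^bsub>qmodule (hyperbolic \<epsilon> K)\<^esub>"
    unfolding hyperbolic_simps zero_prod_def c f0 j0 ..
  show "?c ` Lg k = carrier K \<times> {\<zero>\<^bsub>dual K\<^esub>}"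
    unfolding Lg_def cm map_prod_image_Times using J(1) f0 by (simp add: bij_betw_def dual_def)
  have range_f: "?f ` fr k = lhom K ring_module"
  proof (intro equalityI subsetI)
    fix g assume "g \<in> lhom K ring_module"
    from f_surj[OF this] show "g \<in> ?f ` fr k" by blast
  qed (use f_lhom in blast)
  show "?c ` Ld k = {\<zero>\<^bsub>K\<^esub>} \<times> carrier (dual K)"
    unfolding Ld_def cm map_prod_image_Times range_f using j0 by (simp add: dual_def)
  assume FG: "F \<subseteq> fr k \<times> fr k" "G \<subseteq> fr k \<times> fr k"
  show "wiso ?c (tof (hyp k) F G) \<lparr>fform = hyperbolic \<epsilon> K, flag1 = ?c ` F, flag2 = ?c ` G\<rparr>"
    unfolding wiso_def tof_simps formation.simps hyperbolic_simps(1) hyp_simps(1)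
  proof (intro conjI ballI allI)
    show "bij_betw ?c (fr k \<times> fr k) (carrier K \<times> lhom K ring_module)"
      unfolding bij_betw_def
    proof
      show "inj_on ?c (fr k \<times> fr k)"
      proof (rule inj_onI)
        fix u v :: "'a vec \<times> 'a vec" assume "u \<in> fr k \<times> fr k" "v \<in> fr k \<times> fr k" and q: "?c u = ?c v"
        then obtain x a y b where uv: "u = (x, a)" "v = (y, b)" "x \<in> fr k" "a \<in> fr k" "y \<in> fr k" "b \<in> fr k" by auto
        have "j x = j y" "?f a = ?f b" using q unfolding uv c by simp_all
        then have "x = y" "a = b" using J(1) f_inj uv by (auto simp: bij_betw_def inj_on_def)
        then show "u = v" using uv by simp
      qed
      show "?c ` (fr k \<times> fr k) = carrier K \<times> lhom K ring_module"
        unfolding cm map_prod_image_Times range_f using J(1) by (simp add: bij_betw_def)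
    qed
  next
    fix u v :: "'a vec \<times> 'a vec" assume "u \<in> fr k \<times> fr k" "v \<in> fr k \<times> fr k"
    then obtain x a y b where uv: "u = (x, a)" "v = (y, b)" "x \<in> fr k" "a \<in> fr k" "y \<in> fr k" "b \<in> fr k" by auto
    show "u + v \<in> fr k \<times> fr k" using uv by simp
    show "?c (u + v) = ?c u \<oplus>\<^bsub>qmodule (hyperbolic \<epsilon> K)\<^esub> ?c v"
      unfolding uv add_Pair c hyperbolic_simps using uv by (simp add: J ip_simps cong: restrict_cong)
    show "qlam (hyperbolic \<epsilon> K) (?c u) (?c v) = (\<lambda>x\<in>fr k \<times> fr k. restrict (lam (hyp k) x) (fr k \<times> fr k)) u v"
      unfolding uv c hyperbolic_simps(5)[OF J(4)[OF uv(3)] f_lhom J(4)[OF uv(5)] f_lhom] fj[OF uv(3)] fj[OF uv(5)]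
      using uv by simp
  next
    fix s and u :: "'a vec \<times> 'a vec" assume "u \<in> fr k \<times> fr k"
    then obtain x a where uv: "u = (x, a)" "x \<in> fr k" "a \<in> fr k" by auto
    show "scl (hyp k) s u \<in> fr k \<times> fr k" using uv by simp
    show "?c (scl (hyp k) s u) = s \<odot>\<^bsub>qmodule (hyperbolic \<epsilon> K)\<^esub> ?c u"
      unfolding uv c hyp_simps hyperbolic_simps using uv by (simp add: J ip_simps cong: restrict_cong)
  next
    fix u :: "'a vec \<times> 'a vec" assume "u \<in> fr k \<times> fr k"
    then obtain x a where uv: "u = (x, a)" "x \<in> fr k" "a \<in> fr k" by auto
    show "qmu (hyperbolic \<epsilon> K) (?c u) = qclass \<epsilon> (quad (hyp k) u)"
      unfolding uv c hyperbolic_simps fj[OF uv(2)] by simp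
  qed (use FG in auto)
qed

section \<open>Trivial formations and boundaries in coordinates\<close>

lemma trivial_formation_wiso:
  assumes T: "trivial_formation \<epsilon> T"
  obtains m h where "wiso h (tof (hyp m) (Lg m) (Ld m)) T"
proof -
  obtain L :: "('a, 'a vec) module" where L: "fg_free L" "isomorphic_formations T (hyperbolic_formation \<epsilon> L)"
    and Tf: "is_formation \<epsilon> T" using T unfolding trivial_formation_def by blast
  obtain m j where m: "left_module L" "j \<in> liso (free_module m) L"
    using L(1) unfolding fg_free_def free_of_rank_def by blast
  have "Lg m \<subseteq> fr m \<times> fr m" "Ld m \<subseteq> fr m \<times> fr m" by (auto simp: Lg_def Ld_def)
  from hmap(1)[OF m this] have c: "wiso (hmap m L j) (tof (hyp m) (Lg m) (Ld m)) (hyperbolic_formation \<epsilon> L)"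
    unfolding hmap(2,3)[OF m] hyperbolic_formation_def .
  obtain h where h: "wiso h T (hyperbolic_formation \<epsilon> L)"
    using isomorphic_imp_wiso[OF L(2) is_formation_closed[OF Tf]] by blast
  obtain g where "wiso g (hyperbolic_formation \<epsilon> L) T" using wiso_sym[OF h] by blast
  from wiso_comp[OF c this] show ?thesis by (rule that)
qed

lemma lagr_Lg: "lagr (hyp k) (Lg k)" and lagr_Ld: "lagr (hyp k) (Ld k)"
  using free_on_Lg[of k] free_on_Ld[of k] cmp_hyp[of k] cmp_sym[OF cmp_hyp[of k]] unfolding lagr_def isfree_def by blast+

text \<open>Stable isomorphism draws its trivial summands from the universe of sequences, while
  \<open>hyp m\<close> lives on pairs; \<open>is_formationD\<close> carries the standard trivial
  formation over.\<close>

lemma trivial_formation_exists: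
  obtains T :: "('a, 'a vec) formation" and h where "trivial_formation \<epsilon> T" "wiso h (tof (hyp m) (Lg m) (Ld m)) T"
proof -
  have "is_formation \<epsilon> (tof (hyp m) (Lg m) (Ld m))" by (rule is_formation_tof[OF qspace_hyp lagr_Lg lagr_Ld])
  from is_formationD[OF this] obtain Q :: "('a, 'a vec) space" and F G h
    where w: "wiso h (tof Q F G) (tof (hyp m) (Lg m) (Ld m))" and Q: "qspace Q" "lagr Q F" "lagr Q G" by blast
  let ?L = "free_module m :: ('a, 'a vec) module"
  have j: "(\<lambda>x\<in>fr m. x) \<in> liso ?L ?L"
    unfolding liso_def lhom_def free_module_eq by (auto simp: bij_betw_def)
  have "Lg m \<subseteq> fr m \<times> fr m" "Ld m \<subseteq> fr m \<times> fr m" by (auto simp: Lg_def Ld_def)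
  from hmap(1)[OF left_module_free_module j this]
  have c: "wiso (hmap m ?L (\<lambda>x\<in>fr m. x)) (tof (hyp m) (Lg m) (Ld m)) (hyperbolic_formation \<epsilon> ?L)"
    unfolding hmap(2,3)[OF left_module_free_module j] hyperbolic_formation_def .
  have "fg_free ?L" unfolding fg_free_def free_of_rank_def using left_module_free_module j by blast
  then have "trivial_formation \<epsilon> (tof Q F G)"
    unfolding trivial_formation_def using is_formation_tof[OF Q] wiso_imp_isomorphic[OF wiso_comp[OF w c]] by blast
  moreover obtain g where "wiso g (tof (hyp m) (Lg m) (Ld m)) (tof Q F G)" using wiso_sym[OF w] by blast
  ultimately show ?thesis by (rule that)
qed

text \<open>The graph is isotropic because the pairing is \<open>(-\<epsilon>)\<close>-symmetric and
  even, and a graph is complementary to \<open>Ld p\<close>.\<close>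

lemma boundary_wiso:
  fixes \<psi> :: "('a, 'm) qform"
  assumes qf: "quadratic_form (- \<epsilon>) \<psi>" and fg: "fg_free (qmodule \<psi>)"
  obtains p M c where "wiso c (tof (hyp p) (Lg p) M) (boundary \<epsilon> \<psi>)" "cmp (hyp p) M (Ld p)"
proof -
  let ?K = "qmodule \<psi>" and ?l = "qlam \<psi>"
  obtain p j where K: "left_module ?K" and j: "j \<in> liso (free_module p) ?K"
    using fg unfolding fg_free_def free_of_rank_def by blast
  note J = liso_free_moduleD[OF j]
  have lp: "?l \<in> pairings ?K" using qf unfolding quadratic_form_def Let_def by blast
  have herm: "?l x y = - (\<epsilon> * bar (?l y x))" if "x \<in> carrier ?K" "y \<in> carrier ?K" for x y
  proof -
    have "?l x y = (- \<epsilon>) * bar (?l y x)" using qf that unfolding quadratic_form_def Let_def by blast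
    then show ?thesis by simp
  qed
  \<comment> \<open>The diagonal value \<open>c + (- \<epsilon>) * bar c\<close> of a
    \<open>(-\<epsilon>)\<close>-quadratic form has exactly the shape divided out in
    \<open>Q\<^sub>\<epsilon>(\<Lambda>)\<close>, so the quadratic function of \<open>hyp p\<close>
    vanishes on the graph.\<close>
  have diag: "\<exists>c. ?l x x = c - \<epsilon> * bar c" if x: "x \<in> carrier ?K" for x
  proof -
    obtain c where c: "qmu \<psi> x = qclass (- \<epsilon>) c" using qf x unfolding quadratic_form_def Let_def by blast
    have "c + (0 - (- \<epsilon>) * bar 0) \<in> qclass (- \<epsilon>) c" unfolding qclass_def by blast
    then have "c \<in> qmu \<psi> x" using c by simp
    then have "c + (- \<epsilon>) * bar c = ?l x x" using qf x unfolding quadratic_form_def Let_def by blast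
    then show ?thesis by (intro exI[of _ c]) simp
  qed
  have "\<exists>a. a \<in> fr p \<and> (\<forall>y\<in>fr p. ?l (j x) (j y) = ip p y a)" if "x \<in> fr p" for x
    using lhom_coordinates[OF j pairingsD(1)[OF lp J(4)[OF that]]] by metis
  then obtain \<gamma> where \<gamma>: "\<And>x. x \<in> fr p \<Longrightarrow> \<gamma> x \<in> fr p" "\<And>x y. x \<in> fr p \<Longrightarrow> y \<in> fr p \<Longrightarrow> ?l (j x) (j y) = ip p y (\<gamma> x)"
    by metis
  let ?M = "{(x, \<gamma> x) |x. x \<in> fr p}"
  have u: "\<gamma> x = a" if "x \<in> fr p" "a \<in> fr p" "\<And>y. y \<in> fr p \<Longrightarrow> ?l (j x) (j y) = ip p y a" for x a
  proof -
    have "\<gamma> x - a = 0"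
      using that \<gamma> by (intro ip_eq_zero[of _ p]) (auto simp: ip_simps diff_conv_add_uminus simp del: add_uminus_conv_diff)
    then show ?thesis by simp
  qed
  have ll: "?l (j (x + y)) (j z) = ?l (j x) (j z) + ?l (j y) (j z)" "?l (j (smul a x)) (j z) = ?l (j x) (j z) * bar a"
    if "x \<in> fr p" "y \<in> fr p" "z \<in> fr p" for x y z a
  proof -
    have f: "x + y \<in> fr p" "smul a x \<in> fr p" using that by auto
    show "?l (j (x + y)) (j z) = ?l (j x) (j z) + ?l (j y) (j z)"
      using herm[OF J(4)[OF f(1)] J(4)[OF that(3)]] herm[OF J(4)[OF that(1)] J(4)[OF that(3)]]
        herm[OF J(4)[OF that(2)] J(4)[OF that(3)]] that
      by (simp add: J pairingsD[OF lp] bar_add distrib_left)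
    show "?l (j (smul a x)) (j z) = ?l (j x) (j z) * bar a"
      using herm[OF J(4)[OF f(2)] J(4)[OF that(3)]] herm[OF J(4)[OF that(1)] J(4)[OF that(3)]] that
      by (simp add: J pairingsD[OF lp] bar_mult mult.assoc)
  qed
  have \<gamma>add: "\<gamma> (x + y) = \<gamma> x + \<gamma> y" if "x \<in> fr p" "y \<in> fr p" for x y
    using that \<gamma> ll(1)[OF that] by (intro u) (auto simp: ip_simps)
  have \<gamma>scl: "\<gamma> (smul a x) = smul a (\<gamma> x)" if "x \<in> fr p" for x a
    using that \<gamma> ll(2)[OF that that] by (intro u) (auto simp: ip_simps)
  have \<gamma>0: "\<gamma> 0 = 0" using \<gamma>add[of 0 0] by simp
  have cM: "cmp (hyp p) ?M (Ld p)"
    unfolding cmp_def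
  proof (intro conjI ballI impI)
    have "lsub (scl (hyp p)) ?M"
      unfolding lsub_def by (auto simp: \<gamma>add \<gamma>scl \<gamma>0 zero_prod_def)
    moreover have "ip p y (\<gamma> x) + \<epsilon> * bar (ip p x (\<gamma> y)) = 0" if "x \<in> fr p" "y \<in> fr p" for x y
      using herm[OF J(4)[OF that(1)] J(4)[OF that(2)]] \<gamma>(2)[OF that] \<gamma>(2)[OF that(2,1)] by simp
    moreover have "qeq (ip p x (\<gamma> x)) 0" if "x \<in> fr p" for x
      using diag[OF J(4)[OF that]] \<gamma>(2)[OF that that] unfolding qeq_def by simp
    ultimately show "isot (hyp p) ?M" unfolding isot_def using \<gamma>(1) by auto
    show "isot (hyp p) (Ld p)" by (rule cmpD(2)[OF cmp_hyp])
    fix w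
    { assume "w \<in> ?M" "w \<in> Ld p"
      then show "w = 0" by (auto simp: Ld_def \<gamma>0 zero_prod_def) }
    assume "w \<in> carr (hyp p)"
    then obtain x b where w: "w = (x, b)" "x \<in> fr p" "b \<in> fr p" by auto
    then have "w = (x, \<gamma> x) + (0, b - \<gamma> x)" "(x, \<gamma> x) \<in> ?M" "(0, b - \<gamma> x) \<in> Ld p"
      using fr_mod(5)[OF w(3) \<gamma>(1)[OF w(2)]] by (auto simp: Ld_def)
    then show "\<exists>u\<in>?M. \<exists>v\<in>Ld p. w = u + v" by blast
  qed
  have "hmap p ?K j (x, \<gamma> x) = (j x, ?l (j x))" if x: "x \<in> fr p" for x
  proof -
    have e: "carrier ?K = j ` fr p" using J(1) by (simp add: bij_betw_def)
    have "\<forall>y\<in>carrier ?K. ip p (inv_into (fr p) j y) (\<gamma> x) = ?l (j x) y"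
      unfolding e using bij_betw_inv_into_left[OF J(1)] \<gamma>(2)[OF x] by simp
    then have "(\<lambda>y\<in>carrier ?K. ip p (inv_into (fr p) j y) (\<gamma> x)) = restrict (?l (j x)) (carrier ?K)"
      by (auto intro: restrict_ext)
    then show ?thesis using lhom_ring_moduleD(3)[OF pairingsD(1)[OF lp J(4)[OF x]]] by (simp add: hmap_def)
  qed
  then have "hmap p ?K j ` ?M = {(x, ?l x) |x. x \<in> j ` fr p}" by force
  then have im: "hmap p ?K j ` ?M = {(x, ?l x) |x. x \<in> carrier ?K}" using J(1) by (simp add: bij_betw_def)
  have "Lg p \<subseteq> fr p \<times> fr p" "?M \<subseteq> fr p \<times> fr p" using \<gamma>(1) by (auto simp: Lg_def)
  from hmap(1)[OF K j this] have "wiso (hmap p ?K j) (tof (hyp p) (Lg p) ?M) (boundary \<epsilon> \<psi>)"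
    unfolding hmap(2)[OF K j] im boundary_def .
  then show ?thesis by (rule that[OF _ cM])
qed

section \<open>Even forms given by matrices, and stable boundaries\<close>

definition sesq :: "nat \<Rightarrow> (nat \<Rightarrow> nat \<Rightarrow> 'a) \<Rightarrow> 'a vec \<Rightarrow> 'a vec \<Rightarrow> 'a" where
  "sesq k T x y = (\<Sum>i<k. \<Sum>l<k. y l * T i l * bar (x i))"

lemma sesq_simps:
  "sesq k T (x + x') y = sesq k T x y + sesq k T x' y" "sesq k T x (y + y') = sesq k T x y + sesq k T x y'"
  "sesq k T (smul a x) y = sesq k T x y * bar a" "sesq k T x (smul a y) = a * sesq k T x y"
  by (simp_all add: sesq_def smul_def bar_add bar_mult distrib_left distrib_right sum.distrib sum_distrib_left
      sum_distrib_right mult.assoc)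

lemma ip_gam: "ip k y (gam k T x) = sesq k T x y - \<epsilon> * bar (sesq k T y x)"
proof -
  have "ip k y (gam k T x) = (\<Sum>l<k. \<Sum>i<k. y l * (T i l - \<epsilon> * bar (T l i)) * bar (x i))"
    unfolding ip_def gam_def by (simp add: bar_sum bar_mult sum_distrib_left mult.assoc)
  also have "\<dots> = (\<Sum>l<k. \<Sum>i<k. y l * T i l * bar (x i)) - (\<Sum>l<k. \<Sum>i<k. \<epsilon> * (y l * (bar (T l i) * bar (x i))))"
    by (simp add: left_diff_distrib right_diff_distrib sum_subtractf mult.assoc eps_left)
  also have "(\<Sum>l<k. \<Sum>i<k. y l * T i l * bar (x i)) = sesq k T x y"
    unfolding sesq_def by (rule sum.swap)
  also have "(\<Sum>l<k. \<Sum>i<k. \<epsilon> * (y l * (bar (T l i) * bar (x i)))) = \<epsilon> * bar (sesq k T y x)"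
    by (simp add: sesq_def bar_sum bar_mult sum_distrib_left)
  finally show ?thesis .
qed

lemma gam_fr [simp]: "gam k T x \<in> fr k"
  by (simp add: gam_def fr_def)

lemma lin_gam: "gam k T (x + y) = gam k T x + gam k T y" "gam k T (smul a x) = smul a (gam k T x)"
  by (auto simp: gam_def smul_def fun_eq_iff distrib_right sum.distrib sum_distrib_left mult.assoc)

text \<open>If \<open>\<theta>\<close> is the pairing with matrix \<open>T\<close>, then
  \<open>\<theta>(x, x)\<close> represents the quadratic function of a form for the sign
  \<open>-\<epsilon>\<close> whose pairing is \<open>\<theta> - \<epsilon>\<theta>\<^sup>*\<close>.
  The given graph is the graph of this pairing.\<close>

lemma boundary_graph:
  obtains \<psi> :: "('a, 'a vec) qform" and c where "quadratic_form (- \<epsilon>) \<psi>" "fg_free (qmodule \<psi>)"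
    "wiso c (tof (hyp k) (Lg k) {(x, gam k T x) |x. x \<in> fr k}) (boundary \<epsilon> \<psi>)"
proof -
  interpret N: signed "- \<epsilon>" by standard (use eps in auto)
  let ?K = "free_module k :: ('a, 'a vec) module"
  let ?l = "\<lambda>x\<in>fr k. \<lambda>y\<in>fr k. ip k y (gam k T x)"
  let ?\<psi> = "\<lparr>qmodule = ?K, qlam = ?l, qmu = (\<lambda>x. qclass (- \<epsilon>) (sesq k T x x))\<rparr>"
  have j: "(\<lambda>x\<in>fr k. x) \<in> liso ?K ?K" unfolding liso_def lhom_def free_module_eq by (auto simp: bij_betw_def)
  have fg: "fg_free ?K" unfolding fg_free_def free_of_rank_def using left_module_free_module j by blast
  have lx: "?l x \<in> lhom ?K ring_module" if "x \<in> fr k" for x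
    using that unfolding lhom_def free_module_eq ring_module_def by (simp add: ip_simps)
  have "?l \<in> lhom ?K (dual ?K)"
    using lx unfolding lhom_def[of ?K "dual ?K"] by (auto simp: dual_def free_module_eq lin_gam ip_simps fun_eq_iff)
  then have lp: "?l \<in> pairings ?K" by (simp add: pairings_def)
  have qf: "quadratic_form (- \<epsilon>) ?\<psi>"
    unfolding quadratic_form_def Let_def qform.simps
  proof (intro conjI lp left_module_free_module; (unfold free_module_eq mk_module_simps)?)
    show "\<forall>x\<in>fr k. \<forall>y\<in>fr k. ?l x y = (- \<epsilon>) * bar (?l y x)"
      by (simp add: ip_gam bar_diff bar_mult right_diff_distrib eps_central)
    show "(\<lambda>x. qclass (- \<epsilon>) (sesq k T x x)) ` fr k \<subseteq> range (qclass (- \<epsilon>))" by blast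
    show "\<forall>x\<in>fr k. \<forall>y\<in>fr k. \<forall>r\<in>qclass (- \<epsilon>) (sesq k T (x + y) (x + y)). \<forall>p\<in>qclass (- \<epsilon>) (sesq k T x x).
        \<forall>q\<in>qclass (- \<epsilon>) (sesq k T y y). qclass (- \<epsilon>) (r - p - q) = qclass (- \<epsilon>) (?l x y)"
    proof (intro ballI)
      fix x y :: "'a vec" and r p q
      assume xy: "x \<in> fr k" "y \<in> fr k" and "r \<in> qclass (- \<epsilon>) (sesq k T (x + y) (x + y))"
        "p \<in> qclass (- \<epsilon>) (sesq k T x x)" "q \<in> qclass (- \<epsilon>) (sesq k T y y)"
      then have "N.qeq (r - p - q) (sesq k T (x + y) (x + y) - sesq k T x x - sesq k T y y)"
        unfolding N.qclass_mem by (intro N.qeq_diff)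
      also have "sesq k T (x + y) (x + y) - sesq k T x x - sesq k T y y = sesq k T x y + sesq k T y x"
        by (simp add: sesq_simps algebra_simps)
      also have "N.qeq \<dots> (sesq k T x y + (- \<epsilon>) * bar (sesq k T y x))"
        by (rule N.qeq_add[OF N.qeq_refl N.qeq_sym[OF N.qeq_swap]])
      finally show "qclass (- \<epsilon>) (r - p - q) = qclass (- \<epsilon>) (?l x y)"
        unfolding N.qclass_eq_iff using xy by (simp add: ip_gam)
    qed
    show "\<forall>x\<in>fr k. \<forall>p\<in>qclass (- \<epsilon>) (sesq k T x x). p + (- \<epsilon>) * bar p = ?l x x"
      using N.qeq_diag by (auto simp: N.qclass_mem ip_gam)
    show "\<forall>a. \<forall>x\<in>fr k. \<forall>p\<in>qclass (- \<epsilon>) (sesq k T x x).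
        qclass (- \<epsilon>) (sesq k T (smul a x) (smul a x)) = qclass (- \<epsilon>) (a * p * bar a)"
      using N.qeq_conj[OF N.qeq_sym] by (auto simp: N.qclass_mem N.qclass_eq_iff sesq_simps mult.assoc)
  qed
  have ij: "inv_into (fr k) (\<lambda>x\<in>fr k. x) y = y" if "y \<in> fr k" for y :: "'a vec"
    using bij_betw_inv_into_left[OF liso_free_moduleD(1)[OF j], of y] that by simp
  have "hmap k ?K (\<lambda>x\<in>fr k. x) (x, gam k T x) = (x, ?l x)" if "x \<in> fr k" for x
    using that by (simp add: hmap_def free_module_eq ij cong: restrict_cong)
  then have im: "hmap k ?K (\<lambda>x\<in>fr k. x) ` {(x, gam k T x) |x. x \<in> fr k} = {(x, ?l x) |x. x \<in> carrier ?K}"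
    by (force simp: free_module_eq)
  have "Lg k \<subseteq> fr k \<times> fr k" "{(x, gam k T x) |x. x \<in> fr k} \<subseteq> fr k \<times> fr k" by (auto simp: Lg_def)
  from hmap(1)[OF left_module_free_module j this]
  have "wiso (hmap k ?K (\<lambda>x\<in>fr k. x)) (tof (hyp k) (Lg k) {(x, gam k T x) |x. x \<in> fr k}) (boundary \<epsilon> ?\<psi>)"
    unfolding hmap(2)[OF left_module_free_module j] im boundary_def by simp
  then show ?thesis using that[of ?\<psi>] qf fg by simp
qed

lemma siso_hyp_zero: "siso (hyp p) (sp_sum (hyp p) (hyp 0)) (\<lambda>x. (x, 0))"
proof -
  have "fr 0 = {0 :: 'a vec}" by (auto simp: fr_def fun_eq_iff)
  then show ?thesis
    unfolding siso_def lin_def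
    by (intro conjI bij_betwI[where g = fst]) (auto simp: zero_prod_def ip_simps)
qed

text \<open>In a boundary \<open>(H(K); K, graph)\<close> the lagrangian \<open>K\<^sup>*\<close> is
  a common complement, so being stably a boundary implies \<open>sim\<close>. Conversely a common
  complement, taken as second standard lagrangian, turns the other lagrangian into a graph.\<close>

lemma stable_boundary_iff:
  assumes w: "wiso h (tof Q F G) Z" and Q: "qspace Q" and F: "lagr Q F" and G: "lagr Q G"
  shows "(\<exists>\<psi> :: ('a, 'a vec) qform. quadratic_form (- \<epsilon>) \<psi> \<and> fg_free (qmodule \<psi>) \<and>
      stably_isomorphic \<epsilon> Z (boundary \<epsilon> \<psi>)) \<longleftrightarrow> sim Q F G"
proof
  assume "\<exists>\<psi> :: ('a, 'a vec) qform. quadratic_form (- \<epsilon>) \<psi> \<and> fg_free (qmodule \<psi>) \<and>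
      stably_isomorphic \<epsilon> Z (boundary \<epsilon> \<psi>)"
  then obtain \<psi> :: "('a, 'a vec) qform" and T T' :: "('a, 'a vec) formation"
    where \<psi>: "quadratic_form (- \<epsilon>) \<psi>" "fg_free (qmodule \<psi>)" and T: "trivial_formation \<epsilon> T" "trivial_formation \<epsilon> T'"
      and i: "isomorphic_formations (formation_sum Z T) (formation_sum (boundary \<epsilon> \<psi>) T')"
    unfolding stably_isomorphic_def by blast
  obtain m t where t: "wiso t (tof (hyp m) (Lg m) (Ld m)) T" by (rule trivial_formation_wiso[OF T(1)])
  obtain n t' where t': "wiso t' (tof (hyp n) (Lg n) (Ld n)) T'" by (rule trivial_formation_wiso[OF T(2)])
  obtain p M c where c: "wiso c (tof (hyp p) (Lg p) M) (boundary \<epsilon> \<psi>)" and M: "cmp (hyp p) M (Ld p)"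
    by (rule boundary_wiso[OF \<psi>])
  let ?A = "sp_sum Q (hyp m)" and ?B = "sp_sum (hyp p) (hyp n)"
  have A: "qspace ?A" and B: "qspace ?B" by (intro qspace_sp_sum Q qspace_hyp)+
  have a: "wiso (map_prod h t) (tof ?A (F \<times> Lg m) (G \<times> Ld m)) (formation_sum Z T)"
    using wiso_sum[OF w t] unfolding formation_sum_tof .
  obtain a' where a': "wiso a' (formation_sum Z T) (tof ?A (F \<times> Lg m) (G \<times> Ld m))" using wiso_sym[OF a] by blast
  obtain e where e: "wiso e (formation_sum Z T) (formation_sum (boundary \<epsilon> \<psi>) T')"
    using isomorphic_imp_wiso[OF i] wisoD(2,4,8,9)[OF a'] by blast
  obtain b where b: "wiso b (formation_sum (boundary \<epsilon> \<psi>) T') (tof ?B (Lg p \<times> Lg n) (M \<times> Ld n))"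
    using wiso_sym[OF wiso_sum[OF c t']] unfolding formation_sum_tof by blast
  let ?f = "\<lambda>x. b (e (map_prod h t x))"
  have s: "F \<times> Lg m \<subseteq> carr ?A" "G \<times> Ld m \<subseteq> carr ?A"
    using lagr_subset[OF F] lagr_subset[OF G] by (auto simp: Lg_def Ld_def)
  have f: "siso ?A ?B ?f" "?f ` (F \<times> Lg m) = Lg p \<times> Lg n" "?f ` (G \<times> Ld m) = M \<times> Ld n"
    using wiso_comp[OF wiso_comp[OF a e] b] unfolding wiso_tof[OF A s] by auto
  have "sim ?B (Lg p \<times> Lg n) (M \<times> Ld n)"
    using sim_sum[OF qspace_hyp qspace_hyp sim_common[OF cmp_hyp cmp_sym[OF M]] sim_cmp[OF qspace_hyp cmp_hyp, of n]]
      free_on_Lg[of n] by (auto simp: isfree_def)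
  from sim_siso[OF B siso_inv[OF A f(1)] this]
  have "sim ?A (F \<times> Lg m) (G \<times> Ld m)"
    using siso_inv_image[OF f(1) s(1)] siso_inv_image[OF f(1) s(2)] unfolding f(2,3) by simp
  then show "sim Q F G"
    using free_on_Lg[of m] by (intro sim_cancel[OF Q qspace_hyp cmp_hyp]) (auto simp: isfree_def)
next
  assume "sim Q F G"
  then obtain m K where K: "cmp (sp_sum Q (hyp m)) K (F \<times> Lg m)" "cmp (sp_sum Q (hyp m)) K (G \<times> Ld m)"
    by (auto simp: sim_def)
  let ?A = "sp_sum Q (hyp m)"
  have A: "qspace ?A" by (intro qspace_sp_sum Q qspace_hyp)
  have "isfree (scl ?A) (F \<times> Lg m)"
    using isfree_prod[of Q F "hyp m" "Lg m"] F free_on_Lg[of m] unfolding lagr_def isfree_def by blast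
  then obtain p j where j: "free_on p (scl ?A) (F \<times> Lg m) j" unfolding isfree_def by blast
  \<comment> \<open>Coordinates adapted to the first lagrangian and the common complement
    \<open>K\<close>; in them the other lagrangian is complementary to \<open>Ld p\<close> and
    therefore a graph.\<close>
  obtain f where f: "siso (hyp p) ?A f" "f ` Lg p = F \<times> Lg m" "f ` Ld p = K"
    by (rule cmp_imp_hyp_iso[OF A cmp_sym[OF K(1)] j]) blast
  let ?i = "inv_into (carr (hyp p)) f"
  let ?M = "?i ` (G \<times> Ld m)"
  have sL: "Lg p \<subseteq> carr (hyp p)" "Ld p \<subseteq> carr (hyp p)" by (auto simp: Lg_def Ld_def)
  have i: "siso ?A (hyp p) ?i" by (rule siso_inv[OF qspace_hyp f(1)])
  have iK: "?i ` K = Ld p" using siso_inv_image[OF f(1) sL(2)] unfolding f(3) .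
  have iF: "?i ` (F \<times> Lg m) = Lg p" using siso_inv_image[OF f(1) sL(1)] unfolding f(2) .
  have M: "cmp (hyp p) ?M (Ld p)" using cmp_image[OF A i cmp_sym[OF K(2)]] unfolding iK .
  obtain T where T: "?M = {(x, gam p T x) |x. x \<in> fr p}" by (rule graph_form[OF M])
  obtain \<psi> :: "('a, 'a vec) qform" and c where \<psi>: "quadratic_form (- \<epsilon>) \<psi>" "fg_free (qmodule \<psi>)"
    and c: "wiso c (tof (hyp p) (Lg p) ?M) (boundary \<epsilon> \<psi>)"
    unfolding T by (rule boundary_graph)
  obtain T1 :: "('a, 'a vec) formation" and t1 where T1: "trivial_formation \<epsilon> T1" "wiso t1 (tof (hyp m) (Lg m) (Ld m)) T1"
    by (rule trivial_formation_exists)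
  \<comment> \<open>Stable isomorphism asks for a trivial summand on the boundary side as well; one
    of rank zero serves.\<close>
  obtain T0 :: "('a, 'a vec) formation" and t0 where T0: "trivial_formation \<epsilon> T0" "wiso t0 (tof (hyp 0) (Lg 0) (Ld 0)) T0"
    by (rule trivial_formation_exists)
  have s: "F \<times> Lg m \<subseteq> carr ?A" "G \<times> Ld m \<subseteq> carr ?A"
    using lagr_subset[OF F] lagr_subset[OF G] by (auto simp: Lg_def Ld_def)
  obtain a where a: "wiso a (formation_sum Z T1) (tof ?A (F \<times> Lg m) (G \<times> Ld m))"
    using wiso_sym[OF wiso_sum[OF w T1(2)]] unfolding formation_sum_tof by blast
  have 1: "wiso ?i (tof ?A (F \<times> Lg m) (G \<times> Ld m)) (tof (hyp p) (Lg p) ?M)"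
    unfolding wiso_tof[OF A s] using i iF by simp
  have "fr 0 = {0 :: 'a vec}" by (auto simp: fr_def fun_eq_iff)
  then have z: "Lg 0 = {0}" "Ld 0 = {0}" by (auto simp: Lg_def Ld_def zero_prod_def)
  have 2: "wiso (\<lambda>x. (x, 0)) (tof (hyp p) (Lg p) ?M) (tof (sp_sum (hyp p) (hyp 0)) (Lg p \<times> Lg 0) (?M \<times> Ld 0))"
    unfolding wiso_tof[OF qspace_hyp sL(1) isotD(1)[OF cmpD(1)[OF M]]] z using siso_hyp_zero by auto
  have 3: "wiso (map_prod c t0) (tof (sp_sum (hyp p) (hyp 0)) (Lg p \<times> Lg 0) (?M \<times> Ld 0)) (formation_sum (boundary \<epsilon> \<psi>) T0)"
    using wiso_sum[OF c T0(2)] unfolding formation_sum_tof .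
  have "isomorphic_formations (formation_sum Z T1) (formation_sum (boundary \<epsilon> \<psi>) T0)"
    by (rule wiso_imp_isomorphic[OF wiso_comp[OF wiso_comp[OF wiso_comp[OF a 1] 2] 3]])
  then show "\<exists>\<psi> :: ('a, 'a vec) qform. quadratic_form (- \<epsilon>) \<psi> \<and> fg_free (qmodule \<psi>) \<and>
      stably_isomorphic \<epsilon> Z (boundary \<epsilon> \<psi>)"
    unfolding stably_isomorphic_def using \<psi> T1(1) T0(1) by blast
qed

section \<open>The stable unitary group\<close>

text \<open>An automorphism of \<open>H(\<Lambda>\<^sup>k)\<close> is extended to all pairs of sequences by the identity on the
  coordinates from \<open>k\<close> on. Stabilization then becomes an inclusion.\<close>

definition tr :: "nat \<Rightarrow> 'a vec \<times> 'a vec \<Rightarrow> 'a vec \<times> 'a vec" where "tr k = map_prod (trunc k) (trunc k)"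
definition dr :: "nat \<Rightarrow> 'a vec \<times> 'a vec \<Rightarrow> 'a vec \<times> 'a vec" where "dr k = map_prod (drop_vec k) (drop_vec k)"
definition sh :: "nat \<Rightarrow> 'a vec \<times> 'a vec \<Rightarrow> 'a vec \<times> 'a vec" where "sh k = map_prod (shift k) (shift k)"

definition Ug :: "nat \<Rightarrow> ('a vec \<times> 'a vec \<Rightarrow> 'a vec \<times> 'a vec) set" where
  "Ug k = {g. siso (hyp k) (hyp k) g \<and> (\<forall>v. g v = g (tr k v) + (v - tr k v))}"

definition ex :: "nat \<Rightarrow> ('a vec \<times> 'a vec \<Rightarrow> 'a vec \<times> 'a vec) \<Rightarrow> 'a vec \<times> 'a vec \<Rightarrow> 'a vec \<times> 'a vec" where
  "ex k h v = h (tr k v) + (v - tr k v)"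

lemma trs:
  "tr k (v + w) = tr k v + tr k w" "tr k (v - w) = tr k v - tr k w" "tr k (tr k v) = tr k v"
  "tr k (tr (k + l) v) = tr k v" "tr k v \<in> carr (hyp k)" "v \<in> carr (hyp k) \<Longrightarrow> tr k v = v" "tr k 0 = 0"
  "dr k (v + w) = dr k v + dr k w" "sh k (v + w) = sh k v + sh k w" "tr k (sh k v) = 0" "dr k (sh k v) = v"
  "tr k v + sh k (dr k v) = v" "v \<in> carr (hyp k) \<Longrightarrow> dr k v = 0" "sh k 0 = 0" "dr k 0 = 0"
  "v \<in> carr (hyp (k + l)) \<Longrightarrow> dr k v \<in> carr (hyp l)" "v \<in> carr (hyp l) \<Longrightarrow> sh k v \<in> carr (hyp (k + l))"
  "v \<in> carr (hyp k) \<Longrightarrow> v \<in> carr (hyp (k + l))"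
  by (cases v; cases w; auto simp: tr_def dr_def sh_def vec_simps zero_prod_def; auto simp: trunc_def fun_eq_iff)+

lemma UgD:
  assumes "g \<in> Ug k"
  shows "siso (hyp k) (hyp k) g" "g v = g (tr k v) + (v - tr k v)" "tr k (g v) = g (tr k v)" "g 0 = 0"
proof -
  show s: "siso (hyp k) (hyp k) g" and e: "g v = g (tr k v) + (v - tr k v)" for v
    using assms unfolding Ug_def by blast+
  have "tr k (g v) = tr k (g (tr k v) + (v - tr k v))" by (subst e) simp
  then show "tr k (g v) = g (tr k v)" using sisoD(5)[OF s trs(5)] trs(6) by (simp add: trs(1-3))
  show "g 0 = 0" by (rule siso_zero[OF qspace_hyp s])
qed

lemma Ug_ex: assumes h: "siso (hyp k) (hyp k) h" shows "ex k h \<in> Ug k" "v \<in> carr (hyp k) \<Longrightarrow> ex k h v = h v"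
proof -
  show e: "ex k h v = h v" if "v \<in> carr (hyp k)" for v using trs(6)[OF that] by (simp add: ex_def)
  have "siso (hyp k) (hyp k) (ex k h)" by (rule siso_cong[OF qspace_hyp h e])
  then show "ex k h \<in> Ug k" unfolding Ug_def by (simp add: ex_def trs)
qed

lemma Ug_eqI:
  assumes "g \<in> Ug k" "h \<in> Ug k" "\<And>v. v \<in> carr (hyp k) \<Longrightarrow> g v = h v" shows "g = h"
  using UgD(2)[OF assms(1)] UgD(2)[OF assms(2)] assms(3)[OF trs(5)] by (intro ext) metis

lemma Ug_id: "(\<lambda>v. v) \<in> Ug k"
  unfolding Ug_def using siso_id by simp

lemma Ug_comp: assumes g: "g \<in> Ug k" and h: "h \<in> Ug k" shows "(\<lambda>v. g (h v)) \<in> Ug k"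
proof -
  have "g (h v) = g (h (tr k v)) + (v - tr k v)" for v
  proof -
    have 1: "g (h v) = g (h (tr k v)) + (h v - h (tr k v))" using UgD(2)[OF g, of "h v"] unfolding UgD(3)[OF h] .
    have 2: "h v - h (tr k v) = v - tr k v" by (subst UgD(2)[OF h, of v]) simp
    show ?thesis using 1 unfolding 2 .
  qed
  then show ?thesis unfolding Ug_def using siso_comp[OF UgD(1)[OF h] UgD(1)[OF g]] by blast
qed

lemma Ug_inv: assumes g: "g \<in> Ug k" obtains h where "h \<in> Ug k" "\<And>v. g (h v) = v" "\<And>v. h (g v) = v"
proof -
  let ?i = "inv_into (carr (hyp k)) g"
  have i: "siso (hyp k) (hyp k) ?i" by (rule siso_inv[OF qspace_hyp UgD(1)[OF g]])
  note b = bij_betw_inv_into_left[OF sisoD(1)[OF UgD(1)[OF g]]] bij_betw_inv_into_right[OF sisoD(1)[OF UgD(1)[OF g]]]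
  let ?h = "ex k ?i"
  have h: "?h \<in> Ug k" by (rule Ug_ex(1)[OF i])
  have "(\<lambda>v. g (?h v)) = (\<lambda>v. v)"
    by (rule Ug_eqI[OF Ug_comp[OF g h] Ug_id]) (simp only: Ug_ex(2)[OF i] b)
  moreover have "(\<lambda>v. ?h (g v)) = (\<lambda>v. v)"
    by (rule Ug_eqI[OF Ug_comp[OF h g] Ug_id]) (simp only: Ug_ex(2)[OF i] sisoD(5)[OF UgD(1)[OF g]] b)
  ultimately show ?thesis using that[OF h] by (metis (no_types, lifting))
qed

definition dmap :: "nat \<Rightarrow> ('a vec \<times> 'a vec) \<times> ('a vec \<times> 'a vec) \<Rightarrow> 'a vec \<times> 'a vec" where
  "dmap k = (\<lambda>(u, w). u + sh k w)"

lemma siso_dmap: "siso (sp_sum (hyp k) (hyp l)) (hyp (k + l)) (dmap k)"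
  unfolding siso_def
proof (intro conjI ballI)
  show "bij_betw (dmap k) (carr (sp_sum (hyp k) (hyp l))) (carr (hyp (k + l)))"
  proof (rule bij_betwI[where g = "\<lambda>v. (tr k v, dr k v)"])
    show "dmap k \<in> carr (sp_sum (hyp k) (hyp l)) \<rightarrow> carr (hyp (k + l))"
      by (rule Pi_I, clarsimp simp: dmap_def simp del: hyp_simps, rule qspace_mod(2)[OF qspace_hyp], erule trs(18), erule trs(17))
    show "(\<lambda>v. (tr k v, dr k v)) \<in> carr (hyp (k + l)) \<rightarrow> carr (sp_sum (hyp k) (hyp l))"
      using trs(5,16) by (auto simp del: hyp_simps)
    show "(tr k (dmap k u), dr k (dmap k u)) = u" if "u \<in> carr (sp_sum (hyp k) (hyp l))" for u
      using that by (cases u) (simp add: dmap_def trs del: hyp_simps)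
    show "dmap k (tr k v, dr k v) = v" for v by (simp add: dmap_def trs)
  qed
  show "lin (scl (sp_sum (hyp k) (hyp l))) (carr (sp_sum (hyp k) (hyp l))) (scl (hyp (k + l))) (dmap k)"
    unfolding lin_def
    by (auto simp: dmap_def sh_def vec_simps smul_def fun_eq_iff shift_def algebra_simps)
  fix u v assume "u \<in> carr (sp_sum (hyp k) (hyp l))" "v \<in> carr (sp_sum (hyp k) (hyp l))"
  then show "lam (hyp (k + l)) (dmap k u) (dmap k v) = lam (sp_sum (hyp k) (hyp l)) u v"
    by (auto simp: dmap_def sh_def ip_shift bar_add algebra_simps)
next
  fix u assume "u \<in> carr (sp_sum (hyp k) (hyp l))"
  then show "qeq (quad (hyp (k + l)) (dmap k u)) (quad (sp_sum (hyp k) (hyp l)) u)"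
    by (auto simp: dmap_def sh_def ip_shift)
qed

lemma dmap_image: "dmap k ` (Lg k \<times> Lg l) = Lg (k + l)" "dmap k ` (Ld k \<times> Ld l) = Ld (k + l)"
proof -
  have 1: "dmap k ` (Lg k \<times> Lg l) \<subseteq> Lg (k + l)" "dmap k ` (Ld k \<times> Ld l) \<subseteq> Ld (k + l)"
    by (auto simp: dmap_def sh_def Lg_def Ld_def vec_simps)
  have "v = dmap k (tr k v, dr k v)" for v by (simp add: dmap_def trs)
  moreover have "(tr k v, dr k v) \<in> Lg k \<times> Lg l" if "v \<in> Lg (k + l)" for v
    using that by (auto simp: Lg_def tr_def dr_def vec_simps)
  moreover have "(tr k v, dr k v) \<in> Ld k \<times> Ld l" if "v \<in> Ld (k + l)" for v
    using that by (auto simp: Ld_def tr_def dr_def vec_simps)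
  ultimately show "dmap k ` (Lg k \<times> Lg l) = Lg (k + l)" "dmap k ` (Ld k \<times> Ld l) = Ld (k + l)"
    using 1 by (metis (no_types, lifting) equalityI imageI subsetI)+
qed

definition shf :: "nat \<Rightarrow> ('a vec \<times> 'a vec \<Rightarrow> 'a vec \<times> 'a vec) \<Rightarrow> 'a vec \<times> 'a vec \<Rightarrow> 'a vec \<times> 'a vec" where
  "shf k h v = tr k v + sh k (h (dr k v))"

lemma UgI_dmap:
  assumes g: "siso (hyp k) (hyp k) g" and h: "siso (hyp l) (hyp l) h"
    and f: "\<And>u w. u \<in> carr (hyp k) \<Longrightarrow> w \<in> carr (hyp l) \<Longrightarrow> f (dmap k (u, w)) = dmap k (g u, h w)"
  shows "siso (hyp (k + l)) (hyp (k + l)) f"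
proof -
  let ?S = "sp_sum (hyp k) (hyp l)"
  have S: "qspace ?S" by (intro qspace_sp_sum qspace_hyp)
  let ?i = "inv_into (carr ?S) (dmap k)"
  have s: "siso (hyp (k + l)) (hyp (k + l)) (\<lambda>v. dmap k (map_prod g h (?i v)))"
    by (rule siso_comp[OF siso_inv[OF S siso_dmap] siso_comp[OF siso_prod[OF g h] siso_dmap]])
  show ?thesis
  proof (rule siso_cong[OF qspace_hyp s])
    fix v :: "'a vec \<times> 'a vec" assume "v \<in> carr (hyp (k + l))"
    then have "v \<in> dmap k ` carr ?S" using sisoD(1)[OF siso_dmap[of k l]] unfolding bij_betw_def by blast
    then obtain x where x: "x \<in> carr ?S" "v = dmap k x" by blast
    obtain u w where "x = (u, w)" by (cases x)
    with x have uw: "u \<in> carr (hyp k)" "w \<in> carr (hyp l)" "v = dmap k (u, w)"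
      by (simp_all del: hyp_simps)
    then have "?i v = (u, w)" using bij_betw_inv_into_left[OF sisoD(1)[OF siso_dmap[of k l]], of "(u, w)"] by simp
    then show "f v = dmap k (map_prod g h (?i v))" using f[OF uw(1,2)] uw(3) by simp
  qed
qed

text \<open>This inclusion is stabilization: beyond the coordinate \<open>k\<close> the extended map
  is the identity, as is the block sum with 1.\<close>

lemma Ug_mono: assumes g: "g \<in> Ug k" shows "g \<in> Ug (k + l)" "u \<in> carr (hyp k) \<Longrightarrow> g (dmap k (u, w)) = dmap k (g u, w)"
proof -
  show d: "g (dmap k (u, w)) = dmap k (g u, w)" if "u \<in> carr (hyp k)" for u w
    using UgD(2)[OF g, of "u + sh k w"] that by (simp add: dmap_def trs del: hyp_simps)
  have "siso (hyp (k + l)) (hyp (k + l)) g" by (rule UgI_dmap[OF UgD(1)[OF g] siso_id d])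
  moreover have "g v = g (tr (k + l) v) + (v - tr (k + l) v)" for v
  proof -
    have 1: "g (tr (k + l) v) = g (tr k v) + (tr (k + l) v - tr k v)"
      using UgD(2)[OF g, of "tr (k + l) v"] unfolding trs(4) .
    show ?thesis by (simp only: 1 UgD(2)[OF g, of v]) simp
  qed
  ultimately show "g \<in> Ug (k + l)" unfolding Ug_def by blast
qed

lemma shf_Ug: assumes h: "h \<in> Ug l" shows "shf k h \<in> Ug (k + l)" "u \<in> carr (hyp k) \<Longrightarrow> shf k h (dmap k (u, w)) = dmap k (u, h w)"
proof -
  show d: "shf k h (dmap k (u, w)) = dmap k (u, h w)" if "u \<in> carr (hyp k)" for u w
    using that by (simp add: shf_def dmap_def trs del: hyp_simps)
  have "siso (hyp (k + l)) (hyp (k + l)) (shf k h)" by (rule UgI_dmap[OF siso_id UgD(1)[OF h] d])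
  moreover have "shf k h v = shf k h (tr (k + l) v) + (v - tr (k + l) v)" for v
  proof -
    have 1: "dr k (tr (k + l) v) = tr l (dr k v)"
      by (cases v) (auto simp: dr_def tr_def drop_vec_def trunc_def fun_eq_iff)
    have 2: "sh k (dr k v - tr l (dr k v)) = v - tr (k + l) v"
      by (cases v) (auto simp: dr_def tr_def sh_def shift_def drop_vec_def trunc_def fun_eq_iff)
    have "sh k (h (dr k v)) = sh k (h (tr l (dr k v))) + (v - tr (k + l) v)"
      by (simp only: UgD(2)[OF h, of "dr k v"] trs(9) 2)
    then show ?thesis unfolding shf_def 1 trs(4) by (simp only: add.assoc)
  qed
  ultimately show "shf k h \<in> Ug (k + l)" unfolding Ug_def by blast
qed

text \<open>Elements of all \<open>Ug k\<close> are maps on one and the same set, so the direct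
  limit is a genuine union and the group law is composition.\<close>

definition UU :: "('a vec \<times> 'a vec \<Rightarrow> 'a vec \<times> 'a vec) monoid" where
  "UU = \<lparr>carrier = (\<Union>k. Ug k), mult = (\<lambda>g h v. g (h v)), one = (\<lambda>v. v)\<rparr>"

lemma UU_simps [simp]: "carrier UU = (\<Union>k. Ug k)" "g \<otimes>\<^bsub>UU\<^esub> h = (\<lambda>v. g (h v))" "\<one>\<^bsub>UU\<^esub> = (\<lambda>v. v)"
  by (simp_all add: UU_def)

lemma Ug_le: "g \<in> Ug k \<Longrightarrow> k \<le> l \<Longrightarrow> g \<in> Ug l"
  using Ug_mono(1)[of g k "l - k"] by simp

lemma Ug_common: assumes "g \<in> carrier UU" "h \<in> carrier UU" obtains k where "g \<in> Ug k" "h \<in> Ug k"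
  using assms Ug_le max.cobounded1 max.cobounded2 that unfolding UU_simps by (metis UN_E)

lemma group_UU: "group UU"
proof (rule groupI)
  fix g h assume gh: "g \<in> carrier UU" "h \<in> carrier UU"
  obtain k where "g \<in> Ug k" "h \<in> Ug k" by (rule Ug_common[OF gh])
  then show "g \<otimes>\<^bsub>UU\<^esub> h \<in> carrier UU" using Ug_comp by auto
next
  fix g assume "g \<in> carrier UU"
  then obtain k where k: "g \<in> Ug k" by auto
  obtain h where h: "h \<in> Ug k" "\<And>v. g (h v) = v" "\<And>v. h (g v) = v" by (rule Ug_inv[OF k]) blast
  then show "\<exists>h\<in>carrier UU. h \<otimes>\<^bsub>UU\<^esub> g = \<one>\<^bsub>UU\<^esub>" by (intro bexI[of _ h]) auto
qed (use Ug_id in auto)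

lemma UU_inv:
  assumes g: "g \<in> Ug k"
  shows "inv\<^bsub>UU\<^esub> g \<in> Ug k" "g ((inv\<^bsub>UU\<^esub> g) v) = v" "(inv\<^bsub>UU\<^esub> g) (g v) = v"
proof -
  interpret group UU by (rule group_UU)
  obtain h where h: "h \<in> Ug k" "\<And>v. g (h v) = v" "\<And>v. h (g v) = v" by (rule Ug_inv[OF g]) blast
  have "inv\<^bsub>UU\<^esub> g = h" using g h by (intro inv_equality) auto
  then show "inv\<^bsub>UU\<^esub> g \<in> Ug k" "g ((inv\<^bsub>UU\<^esub> g) v) = v" "(inv\<^bsub>UU\<^esub> g) (g v) = v" using h by auto
qed

section \<open>Automorphisms with stably null formation\<close>

lemma Lg_carr: "Lg k \<subseteq> carr (hyp k)" and Ld_carr: "Ld k \<subseteq> carr (hyp k)"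
  by (auto simp: Lg_def Ld_def)

lemma isfree_Lg: "isfree (scl (hyp k)) (Lg k)"
  using lagr_Lg unfolding lagr_def by blast

lemma siso_image_subset: "siso Q R h \<Longrightarrow> A \<subseteq> carr Q \<Longrightarrow> h ` A \<subseteq> carr R"
  using sisoD(5) by blast

lemma cmp_siso_hyp: "siso (hyp k) (hyp k) g \<Longrightarrow> cmp (hyp k) (g ` Lg k) (g ` Ld k)"
  by (rule cmp_image[OF qspace_hyp _ cmp_hyp])

lemma isfree_siso_hyp: "siso (hyp k) (hyp k) g \<Longrightarrow> isfree (scl (hyp k)) (g ` Lg k)"
  by (rule isfree_image[OF isfree_Lg _ Lg_carr])

lemma Ug_image_sum:
  assumes "\<And>u w. u \<in> Lg k \<Longrightarrow> w \<in> Lg l \<Longrightarrow> f (dmap k (u, w)) = dmap k (g u, h w)"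
  shows "f ` Lg (k + l) = dmap k ` (g ` Lg k \<times> h ` Lg l)"
proof -
  have "f ` Lg (k + l) = (\<lambda>x. f (dmap k x)) ` (Lg k \<times> Lg l)" by (simp add: dmap_image(1)[symmetric] image_image)
  also have "\<dots> = (\<lambda>x. dmap k (map_prod g h x)) ` (Lg k \<times> Lg l)" by (intro image_cong) (auto simp: assms)
  also have "\<dots> = dmap k ` (map_prod g h ` (Lg k \<times> Lg l))" by (simp only: image_image)
  finally show ?thesis unfolding map_prod_image_Times .
qed

text \<open>Stabilizing adds the summand \<open>(hyp l; Lg l, Lg l)\<close>. Adding it is harmless
  because \<open>Lg l\<close> is equivalent to itself; to remove it, one copy is first traded for
  \<open>Ld l\<close>.\<close>

lemma sim_stable:
  assumes g: "g \<in> Ug k"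
  shows "sim (hyp (k + l)) (Lg (k + l)) (g ` Lg (k + l)) \<longleftrightarrow> sim (hyp k) (Lg k) (g ` Lg k)"
proof -
  let ?S = "sp_sum (hyp k) (hyp l)"
  have S: "qspace ?S" by (intro qspace_sp_sum qspace_hyp)
  have "g ` Lg (k + l) = dmap k ` (g ` Lg k \<times> (\<lambda>v. v) ` Lg l)"
    by (rule Ug_image_sum, rule Ug_mono(2)[OF g], rule subsetD[OF Lg_carr])
  then have gi: "g ` Lg (k + l) = dmap k ` (g ` Lg k \<times> Lg l)" by simp
  note gs = UgD(1)[OF g]
  have sub: "Lg k \<times> Lg l \<subseteq> carr ?S" "g ` Lg k \<times> Lg l \<subseteq> carr ?S"
    unfolding sp_sum_simps using siso_image_subset[OF gs Lg_carr] Lg_carr by (intro Sigma_mono; blast)+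
  have r: "sim (hyp l) (Lg l) (Lg l)" by (rule sim_refl[OF cmp_hyp])
  show ?thesis
  proof
    assume "sim (hyp k) (Lg k) (g ` Lg k)"
    from sim_siso[OF S siso_dmap sim_sum[OF qspace_hyp qspace_hyp this r]]
    show "sim (hyp (k + l)) (Lg (k + l)) (g ` Lg (k + l))" unfolding gi dmap_image .
  next
    assume "sim (hyp (k + l)) (Lg (k + l)) (g ` Lg (k + l))"
    from sim_siso[OF qspace_hyp siso_inv[OF S siso_dmap] this]
    have 1: "sim ?S (Lg k \<times> Lg l) (g ` Lg k \<times> Lg l)"
      unfolding gi unfolding dmap_image(1)[symmetric] siso_inv_image[OF siso_dmap sub(1)] siso_inv_image[OF siso_dmap sub(2)] .
    have 2: "sim ?S (g ` Lg k \<times> Lg l) (g ` Lg k \<times> Ld l)"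
      by (rule sim_sum[OF qspace_hyp qspace_hyp sim_refl[OF cmp_siso_hyp[OF gs]] sim_cmp[OF qspace_hyp cmp_hyp isfree_Lg]])
    have "sim ?S (Lg k \<times> Lg l) (g ` Lg k \<times> Ld l)"
      by (rule sim_trans[OF S isfree_prod[OF isfree_Lg isfree_Lg] 1 2])
    then show "sim (hyp k) (Lg k) (g ` Lg k)"
      by (rule sim_cancel[OF qspace_hyp qspace_hyp cmp_hyp isfree_Lg])
  qed
qed

text \<open>The automorphisms \<open>g\<close> for which \<open>(H(\<Lambda>\<^sup>k); \<Lambda>\<^sup>k, g \<Lambda>\<^sup>k)\<close> is stably a boundary.\<close>

definition null_group :: "('a vec \<times> 'a vec \<Rightarrow> 'a vec \<times> 'a vec) set" where
  "null_group = {g. \<exists>k. g \<in> Ug k \<and> sim (hyp k) (Lg k) (g ` Lg k)}"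

lemma null_group_iff: assumes g: "g \<in> Ug k" shows "g \<in> null_group \<longleftrightarrow> sim (hyp k) (Lg k) (g ` Lg k)"
proof
  assume "g \<in> null_group"
  then obtain l where l: "g \<in> Ug l" "sim (hyp l) (Lg l) (g ` Lg l)" by (auto simp: null_group_def)
  then have "sim (hyp (l + k)) (Lg (l + k)) (g ` Lg (l + k))" using sim_stable by blast
  then show "sim (hyp k) (Lg k) (g ` Lg k)" using sim_stable[OF g, of l] by (simp add: add.commute)
qed (use g in \<open>auto simp: null_group_def\<close>)

lemma normal_null_group: "null_group \<lhd> UU"
proof -
  interpret group UU by (rule group_UU)
  have sub: "subgroup null_group UU"
  proof (rule subgroupI)
    show "null_group \<subseteq> carrier UU" by (auto simp: null_group_def)
    have "sim (hyp 0) (Lg 0) ((\<lambda>v. v) ` Lg 0)" using sim_refl[OF cmp_hyp] by simp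
    then have "(\<lambda>v. v) \<in> null_group" unfolding null_group_def using Ug_id[of 0] by blast
    then show "null_group \<noteq> {}" by blast
    fix g assume g: "g \<in> null_group"
    then obtain k where k: "g \<in> Ug k" "sim (hyp k) (Lg k) (g ` Lg k)" by (auto simp: null_group_def)
    note i = UU_inv[OF k(1)]
    have "(inv\<^bsub>UU\<^esub> g) ` (g ` Lg k) = Lg k" by (simp add: image_image i)
    then have "sim (hyp k) ((inv\<^bsub>UU\<^esub> g) ` Lg k) (Lg k)"
      using sim_siso[OF qspace_hyp UgD(1)[OF i(1)] k(2)] by simp
    then show "inv\<^bsub>UU\<^esub> g \<in> null_group" unfolding null_group_iff[OF i(1)] by (rule sim_sym[OF qspace_hyp])
    fix h assume "h \<in> null_group"
    then have "h \<in> carrier UU" "g \<in> carrier UU" using g by (auto simp: null_group_def)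
    then obtain l where l: "h \<in> Ug l" "g \<in> Ug l" by (rule Ug_common)
    have s: "sim (hyp l) (Lg l) (g ` Lg l)" "sim (hyp l) (Lg l) (h ` Lg l)"
      using g \<open>h \<in> null_group\<close> null_group_iff[OF l(1)] null_group_iff[OF l(2)] by auto
    \<comment> \<open>The equivalence for \<open>h\<close> is moved by the isometry \<open>g\<close>
      and appended to the one for \<open>g\<close>.\<close>
    have "sim (hyp l) (Lg l) ((\<lambda>v. g (h v)) ` Lg l)"
      using sim_trans[OF qspace_hyp isfree_Lg s(1) sim_siso[OF qspace_hyp UgD(1)[OF l(2)] s(2)]] by (simp add: image_image)
    then show "g \<otimes>\<^bsub>UU\<^esub> h \<in> null_group" using null_group_iff[OF Ug_comp[OF l(2,1)]] by simp
  qed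
  show ?thesis
  proof (rule normal_invI[OF sub])
    fix x g assume x: "x \<in> carrier UU" and g: "g \<in> null_group"
    then have "g \<in> carrier UU" by (auto simp: null_group_def)
    with x obtain k where k: "x \<in> Ug k" "g \<in> Ug k" by (rule Ug_common)
    note i = UU_inv[OF k(1)]
    let ?G = "(inv\<^bsub>UU\<^esub> x) ` Lg k"
    have si: "siso (hyp k) (hyp k) (inv\<^bsub>UU\<^esub> x)" by (rule UgD(1)[OF i(1)])
    \<comment> \<open>By \<open>sim_conj\<close> the base may be changed from \<open>Lg k\<close> to
      its image under the inverse of \<open>x\<close>; applying \<open>x\<close> afterwards returns
      to the base \<open>Lg k\<close>.\<close>
    have "sim (hyp k) ?G (g ` ?G)"
      using g by (intro sim_conj[OF qspace_hyp cmp_siso_hyp[OF si] cmp_hyp isfree_siso_hyp[OF si] isfree_Lg UgD(1)[OF k(2)]])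
        (simp add: null_group_iff[OF k(2)])
    from sim_siso[OF qspace_hyp UgD(1)[OF k(1)] this]
    have "sim (hyp k) (Lg k) ((\<lambda>v. x (g ((inv\<^bsub>UU\<^esub> x) v))) ` Lg k)" by (simp add: image_image i)
    then show "x \<otimes>\<^bsub>UU\<^esub> g \<otimes>\<^bsub>UU\<^esub> inv\<^bsub>UU\<^esub> x \<in> null_group"
      using null_group_iff[OF Ug_comp[OF k(1) Ug_comp[OF k(2) i(1)]]] by simp
  qed
qed

section \<open>Block sums, negatives and copies of sigma\<close>

lemma siso_commute: "siso (sp_sum Q R) (sp_sum R Q) (\<lambda>(x, y). (y, x))"
  unfolding siso_def lin_def
  by (intro conjI bij_betwI[where g = "\<lambda>(x, y). (y, x)"]) (auto simp: add.commute)

text \<open>The block sum of \<open>g\<close> and \<open>h\<close>. Writing it as a product in the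
  stable group makes its class in a quotient computable.\<close>

definition osum :: "nat \<Rightarrow> ('a vec \<times> 'a vec \<Rightarrow> 'a vec \<times> 'a vec) \<Rightarrow> ('a vec \<times> 'a vec \<Rightarrow> 'a vec \<times> 'a vec) \<Rightarrow>
    'a vec \<times> 'a vec \<Rightarrow> 'a vec \<times> 'a vec" where
  "osum k g h = (\<lambda>v. g (shf k h v))"

lemma osum:
  assumes g: "g \<in> Ug k" and h: "h \<in> Ug l"
  shows "osum k g h \<in> Ug (k + l)" "u \<in> carr (hyp k) \<Longrightarrow> osum k g h (dmap k (u, w)) = dmap k (g u, h w)"
    "osum k g h ` Lg (k + l) = dmap k ` (g ` Lg k \<times> h ` Lg l)"
proof -
  show "osum k g h \<in> Ug (k + l)" unfolding osum_def by (rule Ug_comp[OF Ug_mono(1)[OF g] shf_Ug(1)[OF h]])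
  show o: "osum k g h (dmap k (u, w)) = dmap k (g u, h w)" if "u \<in> carr (hyp k)" for u w
    unfolding osum_def shf_Ug(2)[OF h that] Ug_mono(2)[OF g that] ..
  show "osum k g h ` Lg (k + l) = dmap k ` (g ` Lg k \<times> h ` Lg l)"
    using o Lg_carr by (intro Ug_image_sum) blast
qed

definition Jm :: "'a vec \<times> 'a vec \<Rightarrow> 'a vec \<times> 'a vec" where "Jm = (\<lambda>(x, b). (x, - b))"

lemma siso_Jm: "siso (sp_neg (hyp k)) (hyp k) Jm"
  unfolding siso_def lin_def Jm_def
  by (intro conjI bij_betwI[where g = Jm]) (auto simp: Jm_def ip_simps smul_def bar_minus fun_eq_iff)

lemma siso_Jm': "siso (hyp k) (sp_neg (hyp k)) Jm"
  using siso_neg[OF siso_Jm[of k]] by simp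

lemma Jm_simps: "Jm (Jm v) = v" "Jm (v + w) = Jm v + Jm w" "Jm (v - w) = Jm v - Jm w" "tr k (Jm v) = Jm (tr k v)"
  "Jm ` Lg k = Lg k"
proof -
  show "Jm (Jm v) = v" "Jm (v + w) = Jm v + Jm w" "Jm (v - w) = Jm v - Jm w"
    by (cases v; cases w; simp add: Jm_def)+
  have "trunc k (- b) = - trunc k b" for b by (auto simp: trunc_def fun_eq_iff)
  then show "tr k (Jm v) = Jm (tr k v)" by (cases v) (simp add: Jm_def tr_def)
  have "Jm ` Lg k = (\<lambda>v. v) ` Lg k" by (intro image_cong) (auto simp: Jm_def Lg_def)
  then show "Jm ` Lg k = Lg k" by simp
qed

text \<open>Since \<open>Jm\<close> is an isometry from \<open>-H\<close> to \<open>H\<close>, the formation of \<open>conjJ h\<close> is the negative of that of \<open>h\<close>.\<close>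

definition conjJ :: "('a vec \<times> 'a vec \<Rightarrow> 'a vec \<times> 'a vec) \<Rightarrow> 'a vec \<times> 'a vec \<Rightarrow> 'a vec \<times> 'a vec" where
  "conjJ h = (\<lambda>v. Jm (h (Jm v)))"

lemma conjJ:
  assumes h: "h \<in> Ug k" shows "conjJ h \<in> Ug k" "conjJ h ` Lg k = Jm ` (h ` Lg k)"
proof -
  have "siso (hyp k) (hyp k) (conjJ h)"
    unfolding conjJ_def using siso_comp[OF siso_comp[OF siso_Jm' siso_neg[OF UgD(1)[OF h]]] siso_Jm] .
  moreover have "conjJ h v = conjJ h (tr k v) + (v - tr k v)" for v
  proof -
    have "h (Jm v) = h (Jm (tr k v)) + (Jm v - Jm (tr k v))" using UgD(2)[OF h, of "Jm v"] unfolding Jm_simps(4) .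
    then show ?thesis unfolding conjJ_def by (simp only: Jm_simps)
  qed
  ultimately show "conjJ h \<in> Ug k" unfolding Ug_def by blast
  have "conjJ h ` Lg k = Jm ` (h ` (Jm ` Lg k))" by (simp add: conjJ_def image_image)
  then show "conjJ h ` Lg k = Jm ` (h ` Lg k)" unfolding Jm_simps(5) .
qed

text \<open>Seen in \<open>H \<oplus> -H\<close>, this compares \<open>L \<times> L\<close> with
  \<open>hL \<times> hL\<close>. Trading the second factors for their complements leads to
  \<open>L \<times> L\<^sup>*\<close> and \<open>hL \<times> hL\<^sup>*\<close>, which share the
  diagonal as a complement.\<close>

lemma sim_neg:
  assumes h: "h \<in> Ug k"
  shows "sim (hyp (k + k)) (Lg (k + k)) (osum k h (conjJ h) ` Lg (k + k))"
proof -
  let ?N = "sp_neg (hyp k)" and ?S = "sp_sum (hyp k) (sp_neg (hyp k))"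
  have N: "qspace ?N" and S: "qspace ?S" by (intro qspace_sp_sum qspace_sp_neg qspace_hyp)+
  note hs = UgD(1)[OF h] and hc = cmp_siso_hyp[OF UgD(1)[OF h]] and hf = isfree_siso_hyp[OF UgD(1)[OF h]]
  have f: "isfree (scl ?N) (Lg k)" "isfree (scl ?N) (h ` Lg k)" using isfree_Lg hf by simp_all
  have 1: "sim ?S (Lg k \<times> Lg k) (Lg k \<times> Ld k)"
    using cmp_hyp by (intro sim_sum[OF qspace_hyp N] sim_refl[OF cmp_hyp] sim_cmp[OF N _ f(1)]) simp
  have 2: "sim ?S (Lg k \<times> Ld k) (h ` Lg k \<times> h ` Ld k)"
    by (rule sim_common[OF cmp_sym[OF cmp_diagonal[OF qspace_hyp cmp_hyp]] cmp_diagonal[OF qspace_hyp hc]])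
  have 3: "sim ?S (h ` Lg k \<times> h ` Lg k) (h ` Lg k \<times> h ` Ld k)"
    using hc by (intro sim_sum[OF qspace_hyp N] sim_refl[OF hc] sim_cmp[OF N _ f(2)]) simp
  have ff: "isfree (scl ?S) (Lg k \<times> Lg k)" by (rule isfree_prod[OF isfree_Lg f(1)])
  have "sim ?S (Lg k \<times> Lg k) (h ` Lg k \<times> h ` Lg k)"
    by (rule sim_trans[OF S ff sim_trans[OF S ff 1 2] sim_sym[OF S 3]])
  from sim_siso[OF S siso_prod[OF siso_id siso_Jm] this]
  have "sim (sp_sum (hyp k) (hyp k)) (Lg k \<times> Lg k) (h ` Lg k \<times> conjJ h ` Lg k)"
    unfolding map_prod_image_Times Jm_simps(5) conjJ(2)[OF h] by simp
  from sim_siso[OF qspace_sp_sum[OF qspace_hyp qspace_hyp] siso_dmap this]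
  show ?thesis unfolding dmap_image osum(3)[OF h conjJ(1)[OF h]] .
qed

lemma swp_ex: "ex m swp \<in> Ug m" "v \<in> carr (hyp m) \<Longrightarrow> ex m swp v = swp v" "ex m swp ` Lg m = Ld m" "ex m swp ` Ld m = Lg m"
proof -
  show "ex m swp \<in> Ug m" and e: "\<And>v. v \<in> carr (hyp m) \<Longrightarrow> ex m swp v = swp v" using Ug_ex[OF siso_swp] by blast+
  have "ex m swp ` Lg m = swp ` Lg m" "ex m swp ` Ld m = swp ` Ld m"
    using e Lg_carr Ld_carr by (intro image_cong; blast)+
  then show "ex m swp ` Lg m = Ld m" "ex m swp ` Ld m = Lg m" by (simp_all add: swp_image)
qed

lemma swp_ex_Suc: "ex (m + 1) swp = osum m (ex m swp) (ex 1 swp)"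
proof (rule Ug_eqI[OF swp_ex(1) osum(1)[OF swp_ex(1) swp_ex(1)]])
  fix v :: "'a vec \<times> 'a vec" assume v: "v \<in> carr (hyp (m + 1))"
  have e: "v = dmap m (tr m v, dr m v)" by (simp add: dmap_def trs)
  have c: "tr m v \<in> carr (hyp m)" "dr m v \<in> carr (hyp 1)" by (rule trs(5), rule trs(16)[OF v])
  have s: "swp (u + w) = swp u + swp w" "swp (sh m u) = sh m (swp u)" for u w
    by (cases u; cases w; auto simp: swp_def sh_def smul_def shift_def fun_eq_iff distrib_left)+
  have "osum m (ex m swp) (ex 1 swp) (dmap m (tr m v, dr m v)) = dmap m (swp (tr m v), swp (dr m v))"
    unfolding osum(2)[OF swp_ex(1) swp_ex(1) c(1)] swp_ex(2)[OF c(1)] swp_ex(2)[OF c(2)] ..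
  also have "\<dots> = swp (dmap m (tr m v, dr m v))" by (simp add: dmap_def s)
  finally show "ex (m + 1) swp v = osum m (ex m swp) (ex 1 swp) v" using swp_ex(2)[OF v] e by simp
qed

end

text \<open>The assumptions say that \<open>K\<close> contains the generators of the kernel of \<open>U \<rightarrow> M\<close>.\<close>

locale elementary_kernel = signed +
  fixes K :: "('a vec \<times> 'a vec \<Rightarrow> 'a vec \<times> 'a vec) set"
  assumes normal_K: "K \<lhd> UU"
    and diag_K: "free_on k smul (fr k) a \<Longrightarrow> \<exists>d\<in>K \<inter> Ug k. \<forall>x\<in>fr k. d (x, 0) = (a x, 0)"
    and shear_K: "ex k (\<lambda>(x, b). (x, b + gam k T x)) \<in> K"
    and swp_K: "ex 1 swp \<in> K"
begin

sublocale KN: normal K UU by (rule normal_K)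

lemma K_comp: "g \<in> K \<Longrightarrow> h \<in> K \<Longrightarrow> (\<lambda>v. g (h v)) \<in> K"
  using subgroup.m_closed[OF KN.subgroup_axioms] by simp

lemma K_conj: "w \<in> Ug k \<Longrightarrow> g \<in> K \<Longrightarrow> (\<lambda>v. (inv\<^bsub>UU\<^esub> w) (g (w v))) \<in> K"
  using KN.inv_op_closed1[of w g] by auto

lemma fixing_Ld_K:
  assumes g: "g \<in> Ug k" and f: "\<And>b. b \<in> fr k \<Longrightarrow> g (0, b) = (0, b)" shows "g \<in> K"
proof -
  obtain T where T: "\<And>x b. x \<in> fr k \<Longrightarrow> b \<in> fr k \<Longrightarrow> g (x, b) = (x, b + gam k T x)"
    by (rule siso_fixing_Ld[OF UgD(1)[OF g]], erule f, (rule that; assumption))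
  have "(\<lambda>(x, b). (x, b + gam k T x)) (tr k v) = g (tr k v)" for v
    using T trs(5)[of k v] by (cases "tr k v") simp
  then have "ex k (\<lambda>(x, b). (x, b + gam k T x)) = g"
    by (intro ext) (simp only: ex_def UgD(2)[OF g, symmetric])
  then show ?thesis using shear_K[of k T] by simp
qed

text \<open>Dividing by a diagonal element with the same action on \<open>Lg k\<close> leaves an
  automorphism fixing \<open>Lg k\<close> pointwise. Conjugation by \<open>swp\<close> makes it fix
  \<open>Ld k\<close> pointwise, so \<open>fixing_Ld_K\<close> and normality of \<open>K\<close>
  apply.\<close>

lemma stabilizer_K:
  assumes g: "g \<in> Ug k" and s: "g ` Lg k = Lg k" shows "g \<in> K"
proof -
  let ?a = "\<lambda>x. fst (g (x, 0))"
  have ga: "g (x, 0) = (?a x, 0)" "?a x \<in> fr k" if "x \<in> fr k" for x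
  proof -
    have "g (x, 0) \<in> g ` Lg k" using that by (intro imageI) (simp add: Lg_def)
    then show "g (x, 0) = (?a x, 0)" "?a x \<in> fr k" unfolding s by (auto simp: Lg_def)
  qed
  note gs = UgD(1)[OF g]
  have a: "free_on k smul (fr k) ?a"
    unfolding free_on_def
  proof
    show "lin smul (fr k) smul ?a"
      unfolding lin_def
    proof (intro conjI ballI allI)
      show "?a (x + y) = ?a x + ?a y" if "x \<in> fr k" "y \<in> fr k" for x y
        using linD(1)[OF sisoD(2)[OF gs], of "(x, 0)" "(y, 0)"] that by simp
      show "?a (smul c x) = smul c (?a x)" if "x \<in> fr k" for c x
        using linD(2)[OF sisoD(2)[OF gs], where x = "(x, 0)" and a = c] that by (cases "g (x, 0)") simp
    qed
    show "bij_betw ?a (fr k) (fr k)"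
      unfolding bij_betw_def
    proof
      show "inj_on ?a (fr k)"
      proof (rule inj_onI)
        fix x y :: "'a vec" assume xy: "x \<in> fr k" "y \<in> fr k" "?a x = ?a y"
        then have "g (x, 0) = g (y, 0)" using ga(1)[OF xy(1)] ga(1)[OF xy(2)] by simp
        from inj_onD[OF bij_betw_imp_inj_on[OF sisoD(1)[OF gs]] this] show "x = y" using xy(1,2) by simp
      qed
      show "?a ` fr k = fr k"
      proof (intro equalityI subsetI)
        fix y :: "'a vec" assume "y \<in> fr k"
        then have "(y, 0) \<in> g ` Lg k" unfolding s by (simp add: Lg_def)
        then obtain x where x: "x \<in> fr k" "(y, 0) = g (x, 0)" by (auto simp: Lg_def)
        have "y = ?a x" using arg_cong[OF x(2), of fst] by simp
        then show "y \<in> ?a ` fr k" using x(1) by (rule image_eqI)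
      qed (use ga(2) in blast)
    qed
  qed
  from diag_K[OF a] obtain d where "d \<in> K \<inter> Ug k" "\<forall>x\<in>fr k. d (x, 0) = (?a x, 0)" by (rule bexE)
  then have d: "d \<in> K" "d \<in> Ug k" "\<And>x. x \<in> fr k \<Longrightarrow> d (x, 0) = (?a x, 0)" by simp_all
  let ?d = "inv\<^bsub>UU\<^esub> d" and ?w = "ex k swp" and ?w' = "inv\<^bsub>UU\<^esub> (ex k swp)"
  note di = UU_inv[OF d(2)] and wi = UU_inv[OF swp_ex(1)[of k]]
  let ?f = "\<lambda>v. ?d (g v)"
  have f: "?f (x, 0) = (x, 0)" if "x \<in> fr k" for x
    using di(3)[of "(x, 0)"] d(3)[OF that] ga(1)[OF that] by simp
  have fU: "?f \<in> Ug k" by (rule Ug_comp[OF di(1) g])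
  let ?e = "\<lambda>v. ?w (?f (?w' v))"
  have eU: "?e \<in> Ug k" by (rule Ug_comp[OF swp_ex(1) Ug_comp[OF fU wi(1)]])
  have "?e (0, b) = (0, b)" if b: "b \<in> fr k" for b
  proof -
    have w: "?w (smul \<epsilon> b, 0) = (0, b)"
      using swp_ex(2)[of "(smul \<epsilon> b, 0)" k] b by (simp add: swp_def smul_eps_eps)
    then have "?w' (0, b) = (smul \<epsilon> b, 0)" using wi(3)[of "(smul \<epsilon> b, 0)"] by simp
    then show ?thesis using f[OF fr_mod(3)[OF b, of \<epsilon>]] w by simp
  qed
  then have "?e \<in> K" by (rule fixing_Ld_K[OF eU])
  from K_conj[OF swp_ex(1)[of k] this] have "?f \<in> K" by (simp only: wi)
  from K_comp[OF d(1) this] show ?thesis by (simp only: di)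
qed

section \<open>The quotient by the kernel\<close>

definition q :: "('a vec \<times> 'a vec \<Rightarrow> 'a vec \<times> 'a vec) \<Rightarrow> ('a vec \<times> 'a vec \<Rightarrow> 'a vec \<times> 'a vec) set" where
  "q g = K #>\<^bsub>UU\<^esub> g"

definition "MM = UU Mod K"

sublocale M: group MM unfolding MM_def by (rule KN.factorgroup_is_group)

lemma q_carrier: "g \<in> Ug k \<Longrightarrow> q g \<in> carrier (MM)"
  using KN.r_coset_hom_Mod unfolding hom_def q_def MM_def by auto

lemma q_comp: "g \<in> Ug k \<Longrightarrow> h \<in> Ug l \<Longrightarrow> q (\<lambda>v. g (h v)) = q g \<otimes>\<^bsub>MM\<^esub> q h"
  using hom_mult[OF KN.r_coset_hom_Mod, of g h] unfolding q_def MM_def by auto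

lemma q_one_iff: "g \<in> Ug k \<Longrightarrow> q g = \<one>\<^bsub>MM\<^esub> \<longleftrightarrow> g \<in> K"
  unfolding q_def MM_def FactGroup_def using KN.rcos_const[OF KN.is_group] KN.coset_join1[OF _ _ KN.subgroup_axioms]
    KN.coset_join2[OF _ KN.subgroup_axioms] KN.subset by auto

text \<open>The permutation exchanging the two blocks of coordinates preserves
  \<open>Lg (k + l)\<close>, so it is trivial in the quotient; and it intertwines \<open>h\<close>
  with its shift.\<close>

lemma q_shf: assumes h: "h \<in> Ug l" shows "q (shf k h) = q h"
proof -
  let ?S = "sp_sum (hyp l) (hyp k)"
  have S: "qspace ?S" by (intro qspace_sp_sum qspace_hyp)
  let ?\<tau> = "\<lambda>v. dmap k (dr l v, tr l v)"
  have \<tau>d: "?\<tau> (dmap l (w, u)) = dmap k (u, w)" if "w \<in> carr (hyp l)" for w u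
    using that by (simp add: dmap_def trs del: hyp_simps)
  have dec: "v = dmap l (tr l v, dr l v)" for v by (simp add: dmap_def trs)
  let ?i = "inv_into (carr ?S) (dmap l)"
  have s: "siso (hyp (l + k)) (hyp (k + l)) (\<lambda>v. dmap k ((\<lambda>(x, y). (y, x)) (?i v)))"
    by (rule siso_comp[OF siso_inv[OF S siso_dmap] siso_comp[OF siso_commute siso_dmap]])
  have "siso (hyp (l + k)) (hyp (k + l)) ?\<tau>"
  proof (rule siso_cong[OF qspace_hyp s])
    fix v :: "'a vec \<times> 'a vec" assume v: "v \<in> carr (hyp (l + k))"
    have "(tr l v, dr l v) \<in> carr ?S" using trs(5)[of l v] trs(16)[OF v] by (simp del: hyp_simps)
    from bij_betw_inv_into_left[OF sisoD(1)[OF siso_dmap[of l k]] this]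
    have "?i v = (tr l v, dr l v)" using dec[of v] by simp
    then show "?\<tau> v = dmap k ((\<lambda>(x, y). (y, x)) (?i v))" by simp
  qed
  then have t: "siso (hyp (k + l)) (hyp (k + l)) ?\<tau>" by (simp only: add.commute)
  let ?t = "ex (k + l) ?\<tau>"
  note tU = Ug_ex[OF t]
  have "?t ` Lg (k + l) = ?\<tau> ` Lg (l + k)"
    using tU(2) Lg_carr[of "k + l"] by (simp add: add.commute[of l k]) (intro image_cong; blast)
  also have "\<dots> = (\<lambda>x. ?\<tau> (dmap l x)) ` (Lg l \<times> Lg k)" unfolding dmap_image(1)[symmetric] image_image ..
  also have "\<dots> = (\<lambda>x. dmap k ((\<lambda>(x, y). (y, x)) x)) ` (Lg l \<times> Lg k)"
    using \<tau>d Lg_carr[of l] by (intro image_cong) auto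
  also have "\<dots> = dmap k ` (Lg k \<times> Lg l)" by (force simp: image_image[symmetric])
  finally have "?t \<in> K" by (intro stabilizer_K[OF tU(1)]) (simp add: dmap_image)
  then have qt: "q ?t = \<one>\<^bsub>MM\<^esub>" using q_one_iff[OF tU(1)] by simp
  have hU: "h \<in> Ug (k + l)" using Ug_mono(1)[OF h, of k] by (simp add: add.commute)
  have "(\<lambda>v. shf k h (?t v)) = (\<lambda>v. ?t (h v))"
  proof (rule Ug_eqI[OF Ug_comp[OF shf_Ug(1)[OF h] tU(1)] Ug_comp[OF tU(1) hU]])
    fix v :: "'a vec \<times> 'a vec" assume v: "v \<in> carr (hyp (k + l))"
    have c: "tr l v \<in> carr (hyp l)" "dr l v \<in> carr (hyp k)" using trs(5) trs(16)[of v l k] v by (simp_all add: add.commute del: hyp_simps)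
    have hv: "h v = dmap l (h (tr l v), dr l v)" using Ug_mono(2)[OF h c(1), of "dr l v"] dec[of v] by simp
    have "?t v = dmap k (dr l v, tr l v)" using tU(2)[OF v] .
    then have "shf k h (?t v) = dmap k (dr l v, h (tr l v))" using shf_Ug(2)[OF h c(2)] by simp
    moreover have "?t (h v) = ?\<tau> (h v)" using tU(2)[OF sisoD(5)[OF UgD(1)[OF hU] v]] .
    moreover have "?\<tau> (h v) = dmap k (dr l v, h (tr l v))"
      unfolding hv by (rule \<tau>d[OF sisoD(5)[OF UgD(1)[OF h] c(1)]])
    ultimately show "shf k h (?t v) = ?t (h v)" by simp
  qed
  then have "q (shf k h) \<otimes>\<^bsub>MM\<^esub> q ?t = q ?t \<otimes>\<^bsub>MM\<^esub> q h"
    using q_comp[OF shf_Ug(1)[OF h, of k] tU(1)] q_comp[OF tU(1) hU] by simp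
  then show ?thesis using q_carrier[OF shf_Ug(1)[OF h, of k]] q_carrier[OF h] by (simp add: qt)
qed

lemma q_osum: "g \<in> Ug k \<Longrightarrow> h \<in> Ug l \<Longrightarrow> q (osum k g h) = q g \<otimes>\<^bsub>MM\<^esub> q h"
  unfolding osum_def using q_comp[OF _ shf_Ug(1)] q_shf by simp

text \<open>Shifting \<open>h\<close> past the first \<open>k\<close> coordinates does not change
  its class and makes it act on coordinates that \<open>g\<close> leaves alone.\<close>

lemma q_commute:
  assumes g: "g \<in> Ug k" and h: "h \<in> Ug l" shows "q g \<otimes>\<^bsub>MM\<^esub> q h = q h \<otimes>\<^bsub>MM\<^esub> q g"
proof -
  have "(\<lambda>v. g (shf k h v)) = (\<lambda>v. shf k h (g v))"
  proof (rule Ug_eqI[OF Ug_comp[OF Ug_mono(1)[OF g] shf_Ug(1)[OF h]] Ug_comp[OF shf_Ug(1)[OF h] Ug_mono(1)[OF g]]])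
    fix v :: "'a vec \<times> 'a vec" assume v: "v \<in> carr (hyp (k + l))"
    have dec: "v = dmap k (tr k v, dr k v)" by (simp add: dmap_def trs)
    have c: "tr k v \<in> carr (hyp k)" by (rule trs(5))
    have "g (shf k h (dmap k (tr k v, dr k v))) = shf k h (g (dmap k (tr k v, dr k v)))"
      unfolding shf_Ug(2)[OF h c] Ug_mono(2)[OF g c] shf_Ug(2)[OF h sisoD(5)[OF UgD(1)[OF g] c]] ..
    then show "g (shf k h v) = shf k h (g v)" using dec by simp
  qed
  then show ?thesis using q_comp[OF g shf_Ug(1)[OF h]] q_comp[OF shf_Ug(1)[OF h] g] q_shf[OF h] by metis
qed

text \<open>The swap is built from copies of \<open>\<sigma>\<^sub>\<epsilon>\<close> by block sums,
  and block sums become products in the quotient.\<close>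

lemma q_swp: "q (ex m swp) = \<one>\<^bsub>MM\<^esub>"
proof (induction m)
  case 0
  have "(\<lambda>v. v) = ex 0 swp"
  proof (rule Ug_eqI[OF Ug_id swp_ex(1)])
    fix v :: "'a vec \<times> 'a vec" assume v: "v \<in> carr (hyp 0)"
    then have "v = 0" by (cases v) (auto simp: fr_def fun_eq_iff zero_prod_def)
    then show "v = ex 0 swp v" using UgD(4)[OF swp_ex(1)] by simp
  qed
  then show ?case using q_one_iff[OF swp_ex(1)[of 0]] subgroup.one_closed[OF KN.subgroup_axioms] by simp
next
  case (Suc m)
  have "q (ex 1 swp) = \<one>\<^bsub>MM\<^esub>" using q_one_iff[OF swp_ex(1)] swp_K by blast
  then show ?case using Suc q_osum[OF swp_ex(1)[of m] swp_ex(1)[of 1]] swp_ex_Suc[of m] by simp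
qed

text \<open>The stabilizer is absorbed by passing to the block sum of \<open>g\<close> and the swap,
  since the swap takes \<open>Lg m\<close> to \<open>Ld m\<close>. A common complement of
  \<open>Lg\<close> and its image then factors this automorphism into one preserving
  \<open>Lg\<close>, one fixing \<open>Ld\<close> pointwise and another one preserving
  \<open>Lg\<close>.\<close>

lemma sim_imp_K:
  assumes g: "g \<in> Ug k" and s: "sim (hyp k) (Lg k) (g ` Lg k)" shows "g \<in> K"
proof -
  obtain m C where C: "cmp (sp_sum (hyp k) (hyp m)) C (Lg k \<times> Lg m)" "cmp (sp_sum (hyp k) (hyp m)) C (g ` Lg k \<times> Ld m)"
    using s by (auto simp: sim_def)
  let ?S = "sp_sum (hyp k) (hyp m)" and ?n = "k + m"
  have S: "qspace ?S" by (intro qspace_sp_sum qspace_hyp)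
  let ?f = "osum k g (ex m swp)" and ?N = "dmap k ` C"
  have f: "?f \<in> Ug ?n" "?f ` Lg ?n = dmap k ` (g ` Lg k \<times> Ld m)"
    using osum(1,3)[OF g swp_ex(1)[of m]] unfolding swp_ex(3) by auto
  have N: "cmp (hyp ?n) ?N (Lg ?n)" "cmp (hyp ?n) ?N (?f ` Lg ?n)"
    using cmp_image[OF S siso_dmap C(1)] cmp_image[OF S siso_dmap C(2)] unfolding dmap_image f(2) by auto
  obtain p where p: "siso (hyp ?n) (hyp ?n) p" "p ` Lg ?n = Lg ?n" "p ` Ld ?n = ?N"
    by (rule cmp_imp_hyp_iso[OF qspace_hyp cmp_sym[OF N(1)] free_on_Lg]) blast
  have ei: "ex n h ` A = h ` A" if "siso (hyp n) (hyp n) h" "A \<subseteq> carr (hyp n)" for n h A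
    using Ug_ex(2)[OF that(1)] that(2) by (intro image_cong) blast+
  let ?p = "ex ?n p"
  have pU: "?p \<in> Ug ?n" by (rule Ug_ex(1)[OF p(1)])
  have pK: "?p \<in> K" by (rule stabilizer_K[OF pU]) (simp add: ei[OF p(1) Lg_carr] p(2))
  note pi = UU_inv[OF pU]
  let ?p' = "inv\<^bsub>UU\<^esub> ?p"
  have "?p' ` ?N = Ld ?n" unfolding p(3)[symmetric] ei[OF p(1) Ld_carr, symmetric] by (simp add: image_image pi)
  \<comment> \<open>Pulling back along \<open>?p\<close> moves the common complement to
    \<open>Ld\<close>, so the image lagrangian can be reached from \<open>Lg\<close> by an
    automorphism fixing \<open>Ld\<close> pointwise.\<close>
  then have "cmp (hyp ?n) (Ld ?n) (?p' ` (?f ` Lg ?n))"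
    using cmp_image[OF qspace_hyp UgD(1)[OF pi(1)] N(2)] by simp
  from complement_of_Ld[OF cmp_sym[OF this]] obtain e where e: "siso (hyp ?n) (hyp ?n) e"
    "\<And>b. b \<in> fr ?n \<Longrightarrow> e (0, b) = (0, b)" "e ` Lg ?n = ?p' ` (?f ` Lg ?n)" by metis
  let ?e = "ex ?n e"
  have eU: "?e \<in> Ug ?n" by (rule Ug_ex(1)[OF e(1)])
  have eK: "?e \<in> K"
  proof (rule fixing_Ld_K[OF eU])
    show "?e (0, b) = (0, b)" if "b \<in> fr ?n" for b using Ug_ex(2)[OF e(1), of "(0, b)"] e(2)[OF that] that by simp
  qed
  note eI = UU_inv[OF eU]
  let ?e' = "inv\<^bsub>UU\<^esub> ?e"
  let ?r = "\<lambda>v. ?e' (?p' (?f v))"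
  have rU: "?r \<in> Ug ?n" by (rule Ug_comp[OF eI(1) Ug_comp[OF pi(1) f(1)]])
  have "?r ` Lg ?n = ?e' ` (?p' ` (?f ` Lg ?n))" by (simp only: image_image)
  also have "\<dots> = ?e' ` (?e ` Lg ?n)" unfolding e(3)[symmetric] ei[OF e(1) Lg_carr] ..
  also have "\<dots> = Lg ?n" by (simp add: image_image eI)
  finally have "?r \<in> K" by (rule stabilizer_K[OF rU])
  from K_comp[OF pK K_comp[OF eK this]] have "?f \<in> K" by (simp only: pi eI)
  then have "q g \<otimes>\<^bsub>MM\<^esub> q (ex m swp) = \<one>\<^bsub>MM\<^esub>"
    using q_osum[OF g swp_ex(1)] q_one_iff[OF f(1)] by simp
  then show ?thesis using q_swp q_one_iff[OF g] q_carrier[OF g] by simp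
qed

text \<open>Negation of formations becomes inversion in the quotient.\<close>

lemma q_conjJ: assumes h: "h \<in> Ug k" shows "q h \<otimes>\<^bsub>MM\<^esub> q (conjJ h) = \<one>\<^bsub>MM\<^esub>"
  using sim_imp_K[OF osum(1)[OF h conjJ(1)[OF h]] sim_neg[OF h]] q_osum[OF h conjJ(1)[OF h]]
    q_one_iff[OF osum(1)[OF h conjJ(1)[OF h]]] by simp

end

text \<open>With these assumptions \<open>K = null_group\<close>.\<close>

locale exact_kernel = elementary_kernel +
  assumes K_null: "K \<subseteq> null_group" and rank: "rank_well_defined TYPE('a)"
begin

section \<open>The odd L-group as a quotient of the stable unitary group\<close>

definition tofg :: "nat \<Rightarrow> ('a vec \<times> 'a vec \<Rightarrow> 'a vec \<times> 'a vec) \<Rightarrow> ('a, 'a vec \<times> 'a vec) formation" where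
  "tofg k g = tof (hyp k) (Lg k) (g ` Lg k)"

definition rep :: "('a, 'm) formation \<Rightarrow> ('a vec \<times> 'a vec \<Rightarrow> 'a vec \<times> 'a vec) \<Rightarrow> bool" where
  "rep Z g \<longleftrightarrow> (\<exists>k h. g \<in> Ug k \<and> wiso h (tofg k g) Z)"

lemma lagr_image: "g \<in> Ug k \<Longrightarrow> lagr (hyp k) (g ` Lg k)"
  unfolding lagr_def using isfree_siso_hyp[OF UgD(1)] cmp_siso_hyp[OF UgD(1)] by blast

lemma image_Lg_carr: "g \<in> Ug k \<Longrightarrow> g ` Lg k \<subseteq> carr (hyp k)"
  by (rule siso_image_subset[OF UgD(1) Lg_carr])

lemma rep_wiso: "rep X g \<Longrightarrow> wiso h X Y \<Longrightarrow> rep Y g"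
  unfolding rep_def using wiso_comp by blast

lemma rep_Ug: "rep X g \<Longrightarrow> g \<in> carrier UU"
  unfolding rep_def by auto

lemma rep_sum:
  assumes X: "rep X g" and Y: "rep Y h"
  obtains f where "rep (formation_sum X Y) f" "q f = q g \<otimes>\<^bsub>MM\<^esub> q h"
proof -
  obtain k a where a: "g \<in> Ug k" "wiso a (tofg k g) X" using X unfolding rep_def by blast
  obtain l b where b: "h \<in> Ug l" "wiso b (tofg l h) Y" using Y unfolding rep_def by blast
  have ab: "wiso (map_prod a b) (tof (sp_sum (hyp k) (hyp l)) (Lg k \<times> Lg l) (g ` Lg k \<times> h ` Lg l)) (formation_sum X Y)"
    using wiso_sum[OF a(2) b(2)] unfolding tofg_def formation_sum_tof .
  have s: "Lg k \<times> Lg l \<subseteq> carr (sp_sum (hyp k) (hyp l))" "g ` Lg k \<times> h ` Lg l \<subseteq> carr (sp_sum (hyp k) (hyp l))"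
    unfolding sp_sum_simps using image_Lg_carr[OF a(1)] image_Lg_carr[OF b(1)] Lg_carr by (intro Sigma_mono; blast)+
  have "wiso (dmap k) (tof (sp_sum (hyp k) (hyp l)) (Lg k \<times> Lg l) (g ` Lg k \<times> h ` Lg l)) (tofg (k + l) (osum k g h))"
    unfolding tofg_def wiso_tof[OF qspace_sp_sum[OF qspace_hyp qspace_hyp] s]
    using siso_dmap dmap_image(1) osum(3)[OF a(1) b(1)] by simp
  from wiso_comp[OF wiso_inv[OF this] ab] have "rep (formation_sum X Y) (osum k g h)"
    unfolding rep_def using osum(1)[OF a(1) b(1)] by blast
  then show ?thesis by (rule that) (rule q_osum[OF a(1) b(1)])
qed

lemma rep_neg: assumes X: "rep X g" shows "rep (formation_neg X) (conjJ g)"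
proof -
  obtain k a where a: "g \<in> Ug k" "wiso a (tofg k g) X" using X unfolding rep_def by blast
  have n: "wiso a (tof (sp_neg (hyp k)) (Lg k) (g ` Lg k)) (formation_neg X)"
    using wiso_neg[OF a(2)] unfolding tofg_def formation_neg_tof .
  have s: "Lg k \<subseteq> carr (sp_neg (hyp k))" "g ` Lg k \<subseteq> carr (sp_neg (hyp k))"
    unfolding sp_neg_simps by (rule Lg_carr, rule image_Lg_carr[OF a(1)])
  have "wiso Jm (tof (sp_neg (hyp k)) (Lg k) (g ` Lg k)) (tofg k (conjJ g))"
    unfolding tofg_def wiso_tof[OF qspace_sp_neg[OF qspace_hyp] s]
    using siso_Jm Jm_simps(5) conjJ(2)[OF a(1)] by simp
  from wiso_comp[OF wiso_inv[OF this] n] show ?thesis unfolding rep_def using conjJ(1)[OF a(1)] by blast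
qed

text \<open>Uniqueness of rank enters here, through \<open>formation_as_automorphism\<close>; it is
  what makes the map to \<open>L\<close> onto.\<close>

lemma rep_exists: assumes X: "is_formation \<epsilon> X" shows "\<exists>g. rep X g"
proof -
  obtain Q :: "('a, 'a vec) space" and F G h where w: "wiso h (tof Q F G) X" and Q: "qspace Q" "lagr Q F" "lagr Q G"
    using is_formationD[OF X] by blast
  obtain k g a where g: "siso (hyp k) (hyp k) g" "wiso a (tof (hyp k) (Lg k) (g ` Lg k)) (tof Q F G)"
    by (rule formation_as_automorphism[OF rank Q])
  have "ex k g ` Lg k = g ` Lg k" using Ug_ex(2)[OF g(1)] Lg_carr by (intro image_cong) blast+
  then have "wiso a (tofg k (ex k g)) (tof Q F G)" using g(2) by (simp add: tofg_def)
  from wiso_comp[OF this w] show ?thesis unfolding rep_def using Ug_ex(1)[OF g(1)] by blast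
qed

lemma rep_tofg: assumes g: "g \<in> Ug k" shows "rep (tofg k g) g"
proof -
  have "wiso (\<lambda>x. x) (tofg k g) (tofg k g)"
    unfolding tofg_def wiso_tof[OF qspace_hyp Lg_carr image_Lg_carr[OF g]] using siso_id by simp
  then show ?thesis unfolding rep_def using g by blast
qed

text \<open>The formation \<open>X \<oplus> -Y\<close> is represented by some \<open>f\<close> whose
  class is that of \<open>g\<close> times the inverse of that of \<open>h\<close>, and it is stably
  a boundary exactly when \<open>f\<close> lies in \<open>K\<close>. As an equality of cosets, the
  relation is at once symmetric and transitive.\<close>

lemma equivalent_iff:
  assumes X: "is_formation \<epsilon> X" "rep X g" and Y: "is_formation \<epsilon> Y" "rep Y h"
  shows "equivalent_formations \<epsilon> X Y \<longleftrightarrow> q g = q h"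
proof -
  obtain f where f: "rep (formation_sum X (formation_neg Y)) f" "q f = q g \<otimes>\<^bsub>MM\<^esub> q (conjJ h)"
    by (rule rep_sum[OF X(2) rep_neg[OF Y(2)]])
  obtain n a where a: "f \<in> Ug n" "wiso a (tofg n f) (formation_sum X (formation_neg Y))"
    using f(1) unfolding rep_def by blast
  obtain k l where kl: "g \<in> Ug k" "h \<in> Ug l" using rep_Ug[OF X(2)] rep_Ug[OF Y(2)] by auto
  note c = q_carrier[OF kl(1)] q_carrier[OF kl(2)] q_carrier[OF conjJ(1)[OF kl(2)]]
  have "equivalent_formations \<epsilon> X Y \<longleftrightarrow> sim (hyp n) (Lg n) (f ` Lg n)"
    unfolding equivalent_formations_def
    using stable_boundary_iff[OF a(2)[unfolded tofg_def] qspace_hyp lagr_Lg lagr_image[OF a(1)]] X(1) Y(1) by simp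
  also have "\<dots> \<longleftrightarrow> f \<in> K" using sim_imp_K[OF a(1)] K_null null_group_iff[OF a(1)] by blast
  also have "\<dots> \<longleftrightarrow> q g \<otimes>\<^bsub>MM\<^esub> q (conjJ h) = \<one>\<^bsub>MM\<^esub>" using q_one_iff[OF a(1)] f(2) by simp
  also have "\<dots> \<longleftrightarrow> q g \<otimes>\<^bsub>MM\<^esub> q (conjJ h) = q h \<otimes>\<^bsub>MM\<^esub> q (conjJ h)" using q_conjJ[OF kl(2)] by simp
  also have "\<dots> \<longleftrightarrow> q g = q h" using M.right_cancel[OF c(3,1,2)] .
  finally show ?thesis .
qed

text \<open>The class of a formation read off from the coset of a representative, which makes
  independence of the choices evident.\<close>

definition fclass :: "('a vec \<times> 'a vec \<Rightarrow> 'a vec \<times> 'a vec) \<Rightarrow> ('a, 'a vec) formation set" where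
  "fclass g = {Y. is_formation \<epsilon> Y \<and> (\<exists>h. rep Y h \<and> q h = q g)}"

lemma formation_class_eq:
  assumes X: "is_formation \<epsilon> X" "rep X g" shows "formation_class \<epsilon> X = fclass g"
proof (intro equalityI subsetI)
  fix Y assume "Y \<in> formation_class \<epsilon> X"
  then have e: "equivalent_formations \<epsilon> Y X" and Y: "is_formation \<epsilon> Y"
    unfolding formation_class_def equivalent_formations_def by auto
  obtain h where "rep Y h" using rep_exists[OF Y] by blast
  then show "Y \<in> fclass g" using e equivalent_iff[OF Y _ X] Y unfolding fclass_def by blast
next
  fix Y assume "Y \<in> fclass g"
  then show "Y \<in> formation_class \<epsilon> X"
    unfolding fclass_def formation_class_def using equivalent_iff[OF _ _ X] by blast
qed

text \<open>Realizes \<open>g\<close> inside the universe of sequences. The product in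
  \<open>L_odd\<close> is a union over members of the two classes, so it is meaningful only if they
  have members.\<close>

lemma fclass_nonempty:
  assumes g: "g \<in> carrier UU"
  obtains Y where "Y \<in> fclass g" "is_formation \<epsilon> Y" "rep Y g"
proof -
  obtain k where k: "g \<in> Ug k" using g by auto
  have "is_formation \<epsilon> (tofg k g)"
    unfolding tofg_def by (rule is_formation_tof[OF qspace_hyp lagr_Lg lagr_image[OF k]])
  from is_formationD[OF this] obtain Q :: "('a, 'a vec) space" and F G h
    where w: "wiso h (tof Q F G) (tofg k g)" and Q: "qspace Q" "lagr Q F" "lagr Q G" by blast
  have "rep (tof Q F G) g" by (rule rep_wiso[OF rep_tofg[OF k] wiso_inv[OF w]])
  moreover have "is_formation \<epsilon> (tof Q F G)" by (rule is_formation_tof[OF Q])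
  ultimately show ?thesis using that[of "tof Q F G"] unfolding fclass_def by blast
qed

text \<open>A member \<open>Y\<close> represented by \<open>g\<close> is also represented by some
  \<open>f\<close> in the coset of \<open>h\<close>; since \<open>Y\<close> is equivalent to itself,
  the cosets of \<open>g\<close> and \<open>f\<close> agree.\<close>

lemma fclass_eq_iff:
  assumes g: "g \<in> carrier UU" and h: "h \<in> carrier UU" shows "fclass g = fclass h \<longleftrightarrow> q g = q h"
proof
  assume e: "fclass g = fclass h"
  obtain Y where Y: "Y \<in> fclass g" "is_formation \<epsilon> Y" "rep Y g" by (rule fclass_nonempty[OF g])
  then obtain f where f: "rep Y f" "q f = q h" using e unfolding fclass_def by blast
  have "q g = q f"
    using equivalent_iff[OF Y(2,3) Y(2) f(1)] equivalent_iff[OF Y(2) f(1) Y(2) f(1)] equivalent_iff[OF Y(2,3) Y(2,3)]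
    by simp
  then show "q g = q h" using f by simp
qed (simp add: fclass_def)

lemma wiso_idempotent_zero:
  assumes w: "wiso h (tof Q F G) Z" and Q: "qspace Q"
  shows "h 0 \<in> carrier (fmod Z)" "h 0 \<oplus>\<^bsub>fmod Z\<^esub> h 0 = h 0"
  using wisoD(3,12)[OF w, unfolded tof_simps] qspace_mod(1)[OF Q] by force+

lemma is_formation_sum:
  assumes X: "is_formation \<epsilon> X" and Y: "is_formation \<epsilon> Y" shows "is_formation \<epsilon> (formation_sum X Y)"
proof -
  obtain g h where g: "rep X g" and h: "rep Y h" using rep_exists[OF X] rep_exists[OF Y] by blast
  obtain f where f: "rep (formation_sum X Y) f" by (rule rep_sum[OF g h])
  then obtain n a where a: "f \<in> Ug n" "wiso a (tofg n f) (formation_sum X Y)" unfolding rep_def by blast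
  have lm: "left_module (fmod X)" "left_module (fmod Y)"
    using X Y unfolding is_formation_def quadratic_form_def Let_def by blast+
  \<comment> \<open>The image of zero is at first only known to be idempotent for addition; in each
    of the two left modules this identifies it with zero.\<close>
  note z = wiso_idempotent_zero[OF a(2)[unfolded tofg_def] qspace_hyp]
  obtain x y where xy: "a 0 = (x, y)" by (cases "a 0")
  have "x = \<zero>\<^bsub>fmod X\<^esub>" "y = \<zero>\<^bsub>fmod Y\<^esub>"
    using z left_module_zero[OF lm(1), of x] left_module_zero[OF lm(2), of y] unfolding xy formation_sum_simps by auto
  then have "a 0 = \<zero>\<^bsub>fmod (formation_sum X Y)\<^esub>" unfolding formation_sum_simps xy by simp
  moreover have "qlam (fform (formation_sum X Y)) = (\<lambda>x\<in>carrier (fmod (formation_sum X Y)).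
      \<lambda>y\<in>carrier (fmod (formation_sum X Y)). qlam (fform (formation_sum X Y)) x y)"
    unfolding formation_sum_def qform_sum_def Let_def by (auto simp: fun_eq_iff restrict_def)
  ultimately show ?thesis
    by (rule is_formationI[OF a(2)[unfolded tofg_def] qspace_hyp lagr_Lg lagr_image[OF a(1)]])
qed

lemma is_formation_hyperbolic:
  assumes K: "left_module L" and j: "j \<in> liso (free_module k) L" and g: "g \<in> Ug k"
  shows "is_formation \<epsilon> \<lparr>fform = hyperbolic \<epsilon> L, flag1 = hmap k L j ` Lg k, flag2 = hmap k L j ` (g ` Lg k)\<rparr>"
    "rep \<lparr>fform = hyperbolic \<epsilon> L, flag1 = hmap k L j ` Lg k, flag2 = hmap k L j ` (g ` Lg k)\<rparr> g"
proof -
  let ?Z = "\<lparr>fform = hyperbolic \<epsilon> L, flag1 = hmap k L j ` Lg k, flag2 = hmap k L j ` (g ` Lg k)\<rparr>"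
  have w: "wiso (hmap k L j) (tof (hyp k) (Lg k) (g ` Lg k)) ?Z"
    using hmap(1)[OF K j, of "Lg k" "g ` Lg k"] Lg_carr[of k] image_Lg_carr[OF g] by simp
  then show "rep ?Z g" unfolding rep_def tofg_def using g by blast
  have "hmap k L j 0 = \<zero>\<^bsub>fmod ?Z\<^esub>" using hmap(4)[OF K j] by simp
  moreover have "qlam (fform ?Z) = (\<lambda>x\<in>carrier (fmod ?Z). \<lambda>y\<in>carrier (fmod ?Z). qlam (fform ?Z) x y)"
    by (auto simp: hyperbolic_def fun_eq_iff restrict_def)
  ultimately show "is_formation \<epsilon> ?Z"
    by (rule is_formationI[OF w qspace_hyp lagr_Lg lagr_image[OF g]])
qed

lemma L_odd_carrier: "carrier (L_odd \<epsilon>) = fclass ` carrier UU"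
proof (intro equalityI subsetI)
  fix A assume "A \<in> carrier (L_odd \<epsilon>)"
  then obtain X :: "('a, 'a vec) formation" where X: "is_formation \<epsilon> X" "A = formation_class \<epsilon> X"
    by (auto simp: L_odd_def)
  obtain g where g: "rep X g" using rep_exists[OF X(1)] by blast
  then show "A \<in> fclass ` carrier UU" using formation_class_eq[OF X(1) g] X(2) rep_Ug[OF g] by blast
next
  fix A assume "A \<in> fclass ` carrier UU"
  then obtain g where g: "g \<in> carrier UU" "A = fclass g" by blast
  obtain Y where Y: "Y \<in> fclass g" "is_formation \<epsilon> Y" "rep Y g" by (rule fclass_nonempty[OF g(1)])
  have "A = formation_class \<epsilon> Y" using formation_class_eq[OF Y(2,3)] g by simp
  then show "A \<in> carrier (L_odd \<epsilon>)" using Y(2) unfolding L_odd_def by auto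
qed

text \<open>All sums of members have the same class, so the union defining the product is that of a
  constant, nonempty family.\<close>

lemma L_odd_mult:
  assumes g: "g \<in> carrier UU" and h: "h \<in> carrier UU"
  shows "fclass g \<otimes>\<^bsub>L_odd \<epsilon>\<^esub> fclass h = fclass (g \<otimes>\<^bsub>UU\<^esub> h)"
proof -
  have gh: "g \<otimes>\<^bsub>UU\<^esub> h \<in> carrier UU" by (rule monoid.m_closed[OF group.is_monoid[OF group_UU] g h])
  have e: "formation_class \<epsilon> (formation_sum X Y) = fclass (g \<otimes>\<^bsub>UU\<^esub> h)" if XY: "X \<in> fclass g" "Y \<in> fclass h" for X Y
  proof -
    obtain a b where a: "is_formation \<epsilon> X" "rep X a" "q a = q g" and b: "is_formation \<epsilon> Y" "rep Y b" "q b = q h"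
      using XY unfolding fclass_def by blast
    obtain f where f: "rep (formation_sum X Y) f" "q f = q a \<otimes>\<^bsub>MM\<^esub> q b" by (rule rep_sum[OF a(2) b(2)])
    have "q f = q (g \<otimes>\<^bsub>UU\<^esub> h)" using f(2) a(3) b(3) q_comp g h by auto
    then have "fclass f = fclass (g \<otimes>\<^bsub>UU\<^esub> h)" using fclass_eq_iff[OF rep_Ug[OF f(1)] gh] by simp
    then show ?thesis using formation_class_eq[OF is_formation_sum[OF a(1) b(1)] f(1)] by simp
  qed
  obtain X where X: "X \<in> fclass g" using fclass_nonempty[OF g] by blast
  obtain Y where Y: "Y \<in> fclass h" using fclass_nonempty[OF h] by blast
  have "fclass g \<otimes>\<^bsub>L_odd \<epsilon>\<^esub> fclass h = (\<Union>X\<in>fclass g. \<Union>Y\<in>fclass h. formation_class \<epsilon> (formation_sum X Y))"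
    by (simp add: L_odd_def)
  also have "\<dots> = (\<Union>X\<in>fclass g. \<Union>Y\<in>fclass h. fclass (g \<otimes>\<^bsub>UU\<^esub> h))"
    by (intro SUP_cong refl) (simp only: e)
  also have "\<dots> = fclass (g \<otimes>\<^bsub>UU\<^esub> h)" using X Y by blast
  finally show ?thesis .
qed

lemma L_odd_one: "\<one>\<^bsub>L_odd \<epsilon>\<^esub> = fclass \<one>\<^bsub>UU\<^esub>"
proof -
  let ?L = "free_module 0 :: ('a, 'a vec) module" and ?j = "\<lambda>x\<in>fr 0. x"
  have "fr 0 = {0 :: 'a vec}" by (auto simp: fr_def fun_eq_iff)
  \<comment> \<open>In rank zero the two standard lagrangians coincide, so the identity represents
    the neutral formation.\<close>
  then have L: "(\<lambda>v. v) ` Lg 0 = Ld 0" by (simp add: Ld_def Lg_def)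
  then have e: "\<lparr>fform = hyperbolic \<epsilon> ?L, flag1 = hmap 0 ?L ?j ` Lg 0, flag2 = hmap 0 ?L ?j ` ((\<lambda>v. v) ` Lg 0)\<rparr> =
      hyperbolic_formation \<epsilon> ?L"
    unfolding hyperbolic_formation_def by (simp only: L hmap(2,3)[OF left_module_free_module free_identity])
  note h = is_formation_hyperbolic[OF left_module_free_module free_identity Ug_id, of 0, unfolded e]
  have "formation_class \<epsilon> (hyperbolic_formation \<epsilon> ?L) = fclass (\<lambda>v. v)" by (rule formation_class_eq[OF h])
  then show ?thesis by (simp add: L_odd_def)
qed

text \<open>The group axioms are those of a homomorphic image of \<open>UU\<close>; commutativity
  comes from \<open>q_commute\<close>.\<close>

lemma comm_group_L_odd: "comm_group (L_odd \<epsilon>)"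
proof -
  have "fclass \<in> hom UU (L_odd \<epsilon>)" using L_odd_carrier by (intro homI) (auto simp only: L_odd_mult)
  from group.hom_imp_img_group[OF group_UU this]
  have "group ((L_odd \<epsilon>)\<lparr>carrier := carrier (L_odd \<epsilon>), one := \<one>\<^bsub>L_odd \<epsilon>\<^esub>\<rparr>)"
    unfolding L_odd_carrier L_odd_one .
  then have "group (L_odd \<epsilon>)" by simp
  moreover have "x \<otimes>\<^bsub>L_odd \<epsilon>\<^esub> y = y \<otimes>\<^bsub>L_odd \<epsilon>\<^esub> x" if "x \<in> carrier (L_odd \<epsilon>)" "y \<in> carrier (L_odd \<epsilon>)" for x y
  proof -
    obtain g h where gh: "x = fclass g" "y = fclass h" "g \<in> carrier UU" "h \<in> carrier UU" using \<open>x \<in> _\<close> \<open>y \<in> _\<close> unfolding L_odd_carrier by blast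
    then obtain k l where kl: "g \<in> Ug k" "h \<in> Ug l" by auto
    have "q (g \<otimes>\<^bsub>UU\<^esub> h) = q (h \<otimes>\<^bsub>UU\<^esub> g)" using q_comp[OF kl] q_comp[OF kl(2,1)] q_commute[OF kl] by simp
    then show ?thesis using gh L_odd_mult fclass_eq_iff monoid.m_closed[OF group.is_monoid[OF group_UU]] by metis
  qed
  ultimately show ?thesis by (rule group.group_comm_groupI)
qed

end

section \<open>Comparison with the stable unitary group\<close>

lemma normal_closure_normal:
  assumes G: "group G" and S: "S \<subseteq> carrier G" shows "normal_closure G S \<lhd> G"
proof -
  interpret group G by (rule G)
  have c: "carrier G \<in> {N. N \<lhd> G \<and> S \<subseteq> N}"
    using S subgroup_self by (auto intro!: normal_invI)
  have "subgroup (normal_closure G S) G"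
    unfolding normal_closure_def using c by (intro subgroups_Inter) (auto intro: normal_imp_subgroup)
  then show ?thesis
    by (rule normal_invI) (auto simp: normal_closure_def normal_inv_iff)
qed

lemma normal_closure_subset: "S \<subseteq> normal_closure G S"
  unfolding normal_closure_def by blast

lemma normal_closure_minimal: "N \<lhd> G \<Longrightarrow> S \<subseteq> N \<Longrightarrow> normal_closure G S \<subseteq> N"
  unfolding normal_closure_def by blast

lemma normal_preimage:
  assumes G: "group G" and H: "group H" and f: "f \<in> hom G H" and N: "N \<lhd> H"
  shows "{x \<in> carrier G. f x \<in> N} \<lhd> G"
proof -
  interpret f: group_hom G H f using G H f by (simp add: group_hom_def group_hom_axioms_def)
  interpret N: normal N H by (rule N)
  have "subgroup {x \<in> carrier G. f x \<in> N} G"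
    by (rule f.G.subgroupI) (use subgroup.one_closed[OF N.subgroup_axioms] subgroup.m_closed[OF N.subgroup_axioms]
      subgroup.m_inv_closed[OF N.subgroup_axioms] in \<open>auto intro: exI[of _ "\<one>\<^bsub>G\<^esub>"]\<close>)
  then show ?thesis
    by (rule f.G.normal_invI) (use N.inv_op_closed2 in auto)
qed

lemma normal_image:
  assumes G: "group G" and H: "group H" and f: "f \<in> hom G H" "f ` carrier G = carrier H" and N: "N \<lhd> G"
  shows "f ` N \<lhd> H"
proof -
  interpret f: group_hom G H f using G H f by (simp add: group_hom_def group_hom_axioms_def)
  interpret N: normal N G by (rule N)
  show ?thesis
  proof (rule f.H.normal_invI)
    show "subgroup (f ` N) H" by (rule f.subgroup_img_is_subgroup[OF N.subgroup_axioms])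
    fix y z assume "y \<in> carrier H" "z \<in> f ` N"
    then obtain x n where x: "x \<in> carrier G" "y = f x" "n \<in> N" "z = f n" using f(2) by blast
    then have "y \<otimes>\<^bsub>H\<^esub> z \<otimes>\<^bsub>H\<^esub> inv\<^bsub>H\<^esub> y = f (x \<otimes>\<^bsub>G\<^esub> n \<otimes>\<^bsub>G\<^esub> inv\<^bsub>G\<^esub> x)" using N.subset by auto
    then show "y \<otimes>\<^bsub>H\<^esub> z \<otimes>\<^bsub>H\<^esub> inv\<^bsub>H\<^esub> y \<in> f ` N" using N.inv_op_closed2[OF x(1,3)] by blast
  qed
qed

context signed
begin

section \<open>Unitary groups in coordinates\<close>

definition hyp_carrier :: "nat \<Rightarrow> 'a hyp set" where
  "hyp_carrier k = carrier (qmodule (hyperbolic \<epsilon> (free_module k :: ('a, 'a vec) module)))"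

text \<open>Empty flags turn statements about isomorphisms of formations into statements about
  isometries of forms.\<close>

definition hyp_formation :: "nat \<Rightarrow> ('a, 'a hyp) formation" where
  "hyp_formation k = \<lparr>fform = hyperbolic \<epsilon> (free_module k), flag1 = {}, flag2 = {}\<rparr>"

text \<open>The chart of \<open>H\<^sub>\<epsilon>(\<Lambda>\<^sup>k)\<close> for the standard
  basis: the second vector is read as a functional through \<open>ip\<close>.\<close>

definition cc :: "nat \<Rightarrow> 'a vec \<times> 'a vec \<Rightarrow> 'a hyp" where
  "cc k = hmap k (free_module k) (\<lambda>x\<in>fr k. x)"

definition ci :: "nat \<Rightarrow> 'a hyp \<Rightarrow> 'a vec \<times> 'a vec" where
  "ci k = inv_into (carr (hyp k)) (cc k)"

lemma hyp_carrier_eq: "hyp_carrier k = carrier (hyperbolic_module (free_module k))" "hyp_carrier k = carrier (fmod (hyp_formation k))"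
  by (simp_all add: hyp_carrier_def hyp_formation_def hyperbolic_def)

lemma cc_eq: assumes "x \<in> fr k" shows "cc k (x, b) = (x, \<lambda>z\<in>fr k. ip k z b)"
proof -
  have "inv_into (fr k) (\<lambda>x\<in>fr k. x) y = y" if "y \<in> fr k" for y :: "'a vec"
    using bij_betw_inv_into_left[OF liso_free_moduleD(1)[OF free_identity], of y k] that by simp
  then show ?thesis using assms by (simp add: cc_def hmap_def free_module_eq cong: restrict_cong)
qed

lemma wiso_cc: "wiso (cc k) (tof (hyp k) {} {}) (hyp_formation k)"
  using hmap(1)[OF left_module_free_module free_identity, of "{}" k "{}"] by (simp add: cc_def hyp_formation_def)

lemma wiso_ci: "wiso (ci k) (hyp_formation k) (tof (hyp k) {} {})"
  using wiso_inv[OF wiso_cc[of k]] by (simp add: ci_def)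

lemma cc_bij: "bij_betw (cc k) (carr (hyp k)) (hyp_carrier k)"
  using wisoD(1)[OF wiso_cc[of k]] by (simp add: hyp_carrier_eq(2))

lemma cc_ci: "y \<in> hyp_carrier k \<Longrightarrow> cc k (ci k y) = y" "v \<in> carr (hyp k) \<Longrightarrow> ci k (cc k v) = v"
  "y \<in> hyp_carrier k \<Longrightarrow> ci k y \<in> carr (hyp k)" "v \<in> carr (hyp k) \<Longrightarrow> cc k v \<in> hyp_carrier k"
  unfolding ci_def
  by (erule bij_betw_inv_into_right[OF cc_bij], erule bij_betw_inv_into_left[OF cc_bij],
      erule bspec[OF bij_betwE[OF bij_betw_inv_into[OF cc_bij]]], erule bspec[OF bij_betwE[OF cc_bij]])

lemma unitary_simps:
  "carrier (unitary_group \<epsilon> k) = qform_iso (hyperbolic \<epsilon> (free_module k)) (hyperbolic \<epsilon> (free_module k))"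
  "\<one>\<^bsub>unitary_group \<epsilon> k\<^esub> = (\<lambda>x\<in>hyp_carrier k. x)"
  by (simp_all add: unitary_group_def BijGroup_def hyp_carrier_def Let_def)

lemma unitary_wiso: "\<alpha> \<in> carrier (unitary_group \<epsilon> k) \<Longrightarrow> wiso \<alpha> (hyp_formation k) (hyp_formation k)"
  using wisoD(2,4)[OF wiso_ci[of k]]
  unfolding unitary_simps wiso_def qform_iso_def liso_def lhom_def by (simp add: hyp_formation_def)

lemma unitary_extensional: "\<alpha> \<in> carrier (unitary_group \<epsilon> k) \<Longrightarrow> \<alpha> \<in> extensional (hyp_carrier k)"
  unfolding unitary_simps qform_iso_def liso_def lhom_def hyp_carrier_def by (auto simp: PiE_def)

lemma unitary_closed: "\<alpha> \<in> carrier (unitary_group \<epsilon> k) \<Longrightarrow> y \<in> hyp_carrier k \<Longrightarrow> \<alpha> y \<in> hyp_carrier k"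
  using wisoD(12)[OF unitary_wiso] by (simp add: hyp_carrier_eq(2))

lemma unitary_mult:
  assumes "\<alpha> \<in> carrier (unitary_group \<epsilon> k)" "\<beta> \<in> carrier (unitary_group \<epsilon> k)"
  shows "\<alpha> \<otimes>\<^bsub>unitary_group \<epsilon> k\<^esub> \<beta> = compose (hyp_carrier k) \<alpha> \<beta>"
proof -
  have "\<gamma> \<in> Bij (hyp_carrier k)" if "\<gamma> \<in> carrier (unitary_group \<epsilon> k)" for \<gamma>
    using unitary_extensional[OF that] wisoD(1)[OF unitary_wiso[OF that]] by (simp add: Bij_def hyp_carrier_eq(2))
  moreover have "mult (unitary_group \<epsilon> k) = (\<lambda>g\<in>Bij (hyp_carrier k). \<lambda>f\<in>Bij (hyp_carrier k). compose (hyp_carrier k) g f)"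
    by (simp add: unitary_group_def BijGroup_def hyp_carrier_def Let_def)
  ultimately show ?thesis using assms by simp
qed

text \<open>An automorphism of \<open>H(\<Lambda>\<^sup>k)\<close>, with linear functionals written in coordinates.\<close>

definition rho :: "nat \<Rightarrow> ('a hyp \<Rightarrow> 'a hyp) \<Rightarrow> 'a vec \<times> 'a vec \<Rightarrow> 'a vec \<times> 'a vec" where
  "rho k \<alpha> = ex k (\<lambda>v. ci k (\<alpha> (cc k v)))"

lemma rho:
  assumes a: "\<alpha> \<in> carrier (unitary_group \<epsilon> k)"
  shows "rho k \<alpha> \<in> Ug k" "v \<in> carr (hyp k) \<Longrightarrow> cc k (rho k \<alpha> v) = \<alpha> (cc k v)"
proof -
  have "wiso (\<lambda>v. ci k (\<alpha> (cc k v))) (tof (hyp k) {} {}) (tof (hyp k) {} {})"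
    by (rule wiso_comp[OF wiso_comp[OF wiso_cc unitary_wiso[OF a]] wiso_ci])
  then have s: "siso (hyp k) (hyp k) (\<lambda>v. ci k (\<alpha> (cc k v)))" by (simp add: wiso_tof[OF qspace_hyp])
  show "rho k \<alpha> \<in> Ug k" unfolding rho_def by (rule Ug_ex(1)[OF s])
  show "cc k (rho k \<alpha> v) = \<alpha> (cc k v)" if v: "v \<in> carr (hyp k)" for v
    unfolding rho_def Ug_ex(2)[OF s v] by (rule cc_ci(1)[OF unitary_closed[OF a cc_ci(4)[OF v]]])
qed

text \<open>Reads off the coordinates of an explicitly given map. Membership in the unitary group
  comes along, because the map is conjugate under the chart to an isometry.\<close>

lemma rho_eqI:
  assumes f: "f \<in> extensional (hyp_carrier k)" and g: "g \<in> Ug k" and e: "\<And>v. v \<in> carr (hyp k) \<Longrightarrow> f (cc k v) = cc k (g v)"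
  shows "f \<in> carrier (unitary_group \<epsilon> k)" "rho k f = g"
proof -
  have "wiso g (tof (hyp k) {} {}) (tof (hyp k) {} {})" using UgD(1)[OF g] by (simp add: wiso_tof[OF qspace_hyp])
  then have "wiso (\<lambda>y. cc k (g (ci k y))) (hyp_formation k) (hyp_formation k)"
    by (rule wiso_comp[OF wiso_comp[OF wiso_ci] wiso_cc])
  from wiso_imp_qform_iso[OF this] have "restrict (\<lambda>y. cc k (g (ci k y))) (hyp_carrier k) \<in> carrier (unitary_group \<epsilon> k)"
    unfolding unitary_simps hyp_carrier_eq(2) by (simp add: hyp_formation_def)
  moreover have "restrict (\<lambda>y. cc k (g (ci k y))) (hyp_carrier k) = f"
  proof (rule extensionalityI[OF restrict_extensional f])
    show "restrict (\<lambda>y. cc k (g (ci k y))) (hyp_carrier k) y = f y" if "y \<in> hyp_carrier k" for y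
      using e[OF cc_ci(3)[OF that]] cc_ci(1)[OF that] that by simp
  qed
  ultimately show c: "f \<in> carrier (unitary_group \<epsilon> k)" by simp
  show "rho k f = g"
  proof (rule Ug_eqI[OF rho(1)[OF c] g])
    fix v :: "'a vec \<times> 'a vec" assume v: "v \<in> carr (hyp k)"
    have "cc k (rho k f v) = cc k (g v)" using rho(2)[OF c v] e[OF v] by simp
    then show "rho k f v = g v"
      using cc_bij[of k] sisoD(5)[OF UgD(1)[OF rho(1)[OF c]] v] sisoD(5)[OF UgD(1)[OF g] v]
      unfolding bij_betw_def inj_on_def by blast
  qed
qed

lemma rho_inj:
  assumes a: "\<alpha> \<in> carrier (unitary_group \<epsilon> k)" and b: "\<beta> \<in> carrier (unitary_group \<epsilon> k)" and e: "rho k \<alpha> = rho k \<beta>"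
  shows "\<alpha> = \<beta>"
proof (rule extensionalityI[OF unitary_extensional[OF a] unitary_extensional[OF b]])
  fix y assume y: "y \<in> hyp_carrier k"
  show "\<alpha> y = \<beta> y"
    using rho(2)[OF a cc_ci(3)[OF y]] rho(2)[OF b cc_ci(3)[OF y]] unfolding e cc_ci(1)[OF y] by simp
qed

lemma rho_surj: assumes g: "g \<in> Ug k" obtains \<alpha> where "\<alpha> \<in> carrier (unitary_group \<epsilon> k)" "rho k \<alpha> = g"
proof -
  let ?f = "\<lambda>y\<in>hyp_carrier k. cc k (g (ci k y))"
  have "?f (cc k v) = cc k (g v)" if "v \<in> carr (hyp k)" for v using cc_ci(2,4)[OF that] by simp
  from rho_eqI[OF restrict_extensional g this] show ?thesis by (rule that)
qed

lemma rho_mult: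
  assumes a: "\<alpha> \<in> carrier (unitary_group \<epsilon> k)" and b: "\<beta> \<in> carrier (unitary_group \<epsilon> k)"
  shows "\<alpha> \<otimes>\<^bsub>unitary_group \<epsilon> k\<^esub> \<beta> \<in> carrier (unitary_group \<epsilon> k)"
    "rho k (\<alpha> \<otimes>\<^bsub>unitary_group \<epsilon> k\<^esub> \<beta>) = (\<lambda>v. rho k \<alpha> (rho k \<beta> v))"
proof -
  have e: "compose (hyp_carrier k) \<alpha> \<beta> (cc k v) = cc k (rho k \<alpha> (rho k \<beta> v))" if v: "v \<in> carr (hyp k)" for v
    using rho(2)[OF a sisoD(5)[OF UgD(1)[OF rho(1)[OF b]] v]] rho(2)[OF b v] cc_ci(4)[OF v] by (simp add: compose_def)
  note r = rho_eqI[OF compose_extensional Ug_comp[OF rho(1)[OF a] rho(1)[OF b]] e]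
  show "\<alpha> \<otimes>\<^bsub>unitary_group \<epsilon> k\<^esub> \<beta> \<in> carrier (unitary_group \<epsilon> k)"
    "rho k (\<alpha> \<otimes>\<^bsub>unitary_group \<epsilon> k\<^esub> \<beta>) = (\<lambda>v. rho k \<alpha> (rho k \<beta> v))"
    unfolding unitary_mult[OF a b] using r by blast+
qed

lemma rho_one: "\<one>\<^bsub>unitary_group \<epsilon> k\<^esub> \<in> carrier (unitary_group \<epsilon> k)" "rho k \<one>\<^bsub>unitary_group \<epsilon> k\<^esub> = (\<lambda>v. v)"
proof -
  have "(\<lambda>x\<in>hyp_carrier k. x) (cc k v) = cc k v" if "v \<in> carr (hyp k)" for v using cc_ci(4)[OF that] by simp
  from rho_eqI[OF restrict_extensional Ug_id this]
  show "\<one>\<^bsub>unitary_group \<epsilon> k\<^esub> \<in> carrier (unitary_group \<epsilon> k)" "rho k \<one>\<^bsub>unitary_group \<epsilon> k\<^esub> = (\<lambda>v. v)"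
    unfolding unitary_simps(2) by blast+
qed

text \<open>The axioms are checked after applying the injective map \<open>rho k\<close>, which
  turns the product into composition of maps.\<close>

lemma group_unitary: "group (unitary_group \<epsilon> k)"
proof (rule groupI)
  fix \<alpha> \<beta> \<gamma> assume a: "\<alpha> \<in> carrier (unitary_group \<epsilon> k)" and b: "\<beta> \<in> carrier (unitary_group \<epsilon> k)"
    and c: "\<gamma> \<in> carrier (unitary_group \<epsilon> k)"
  show "\<alpha> \<otimes>\<^bsub>unitary_group \<epsilon> k\<^esub> \<beta> \<otimes>\<^bsub>unitary_group \<epsilon> k\<^esub> \<gamma> = \<alpha> \<otimes>\<^bsub>unitary_group \<epsilon> k\<^esub> (\<beta> \<otimes>\<^bsub>unitary_group \<epsilon> k\<^esub> \<gamma>)"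
    using a b c by (intro rho_inj[of _ k]) (simp_all add: rho_mult)
next
  fix \<alpha> assume a: "\<alpha> \<in> carrier (unitary_group \<epsilon> k)"
  show "\<one>\<^bsub>unitary_group \<epsilon> k\<^esub> \<otimes>\<^bsub>unitary_group \<epsilon> k\<^esub> \<alpha> = \<alpha>"
    using a by (intro rho_inj[of _ k]) (simp_all add: rho_mult rho_one)
  obtain h where h: "h \<in> Ug k" "\<And>v. h (rho k \<alpha> v) = v" by (rule Ug_inv[OF rho(1)[OF a]]) blast
  obtain \<beta> where b: "\<beta> \<in> carrier (unitary_group \<epsilon> k)" "rho k \<beta> = h" by (rule rho_surj[OF h(1)])
  have "\<beta> \<otimes>\<^bsub>unitary_group \<epsilon> k\<^esub> \<alpha> = \<one>\<^bsub>unitary_group \<epsilon> k\<^esub>"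
    using a b h by (intro rho_inj[of _ k]) (simp_all add: rho_mult rho_one)
  then show "\<exists>\<beta>\<in>carrier (unitary_group \<epsilon> k). \<beta> \<otimes>\<^bsub>unitary_group \<epsilon> k\<^esub> \<alpha> = \<one>\<^bsub>unitary_group \<epsilon> k\<^esub>" using b by blast
qed (use rho_mult(1) rho_one in auto)

text \<open>Stabilization is the identity on the new hyperbolic plane, and so is the extension built
  into \<open>rho\<close>; both give the same map on pairs of sequences.\<close>

lemma rho_stabilize:
  assumes a: "\<alpha> \<in> carrier (unitary_group \<epsilon> k)"
  shows "stabilize k \<alpha> \<in> carrier (unitary_group \<epsilon> (Suc k))" "rho (Suc k) (stabilize k \<alpha>) = rho k \<alpha>"
proof -
  let ?g = "rho k \<alpha>"
  have gU: "?g \<in> Ug (Suc k)" using Ug_mono(1)[OF rho(1)[OF a], of 1] by simp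
  have "stabilize k \<alpha> (cc (Suc k) v) = cc (Suc k) (?g v)" if v: "v \<in> carr (hyp (Suc k))" for v
  proof -
    obtain x b where xb: "v = (x, b)" "x \<in> fr (Suc k)" "b \<in> fr (Suc k)" using v by auto
    obtain y c where yc: "?g (tr k v) = (y, c)" "y \<in> fr k" "c \<in> fr k"
      using sisoD(5)[OF UgD(1)[OF rho(1)[OF a]] trs(5)[of k v]] by (cases "?g (tr k v)") simp
    let ?F = "\<lambda>z\<in>fr (Suc k). ip (Suc k) z b"
    have t: "x(k := 0) = trunc k x" using xb(2) by (auto simp: trunc_def fr_def fun_eq_iff)
    have "restrict ?F (fr k) = (\<lambda>z\<in>fr k. ip k z (trunc k b))"
      by (auto simp: fun_eq_iff restrict_def ip_def fr_def trunc_def)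
    then have r: "(x(k := 0), restrict ?F (fr k)) = cc k (tr k v)"
      using t xb by (simp add: cc_eq[OF vec_simps(10)] tr_def)
    have al: "\<alpha> (x(k := 0), restrict ?F (fr k)) = (y, \<lambda>z\<in>fr k. ip k z c)"
      unfolding r rho(2)[OF a trs(5), symmetric] yc(1) by (rule cc_eq[OF yc(2)])
    \<comment> \<open>The coordinates of a functional are the conjugates of its values on unit
      vectors, so the term \<open>f(e\<^sub>k)\<close> in \<open>stabilize\<close> is
      \<open>bar (b k)\<close>.\<close>
    have fu: "?F (unit_vec k) = bar (b k)" using ip_unit_vec(1)[of k "Suc k" b] unit_vec_fr[where 'a = 'a and i = k and k = "Suc k"] by simp
    have g: "?g v = (y + (x - trunc k x), c + (b - trunc k b))"
      using UgD(2)[OF rho(1)[OF a], of v] unfolding yc(1) by (simp add: xb(1) tr_def)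
    have 1: "y(k := x k) = y + (x - trunc k x)"
      using yc(2) xb(2) by (auto simp: trunc_def fr_def fun_eq_iff)
    have yx: "y + (x - trunc k x) \<in> fr (Suc k)" using yc(2) xb(2) by (auto simp: trunc_def fr_def)
    have 2: "(\<lambda>z\<in>fr k. ip k z c) (z(k := 0)) + z k * bar (b k) = ip (Suc k) z (c + (b - trunc k b))"
      if "z \<in> fr (Suc k)" for z
    proof -
      have "z(k := 0) \<in> fr k" using that by (auto simp: fr_def)
      moreover have "ip k (z(k := 0)) c = (\<Sum>i<k. z i * bar (c i))" by (simp add: ip_def)
      moreover have "ip (Suc k) z (c + (b - trunc k b)) = (\<Sum>i<k. z i * bar (c i)) + z k * bar (b k)"
        using yc(3) by (simp add: ip_def trunc_def fr_def)
      ultimately show ?thesis by simp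
    qed
    have m: "cc (Suc k) v \<in> carrier (hyperbolic_module (free_module (Suc k)))"
      using cc_ci(4)[OF v] by (simp add: hyp_carrier_eq(1))
    have "stabilize k \<alpha> (cc (Suc k) v) = (y(k := x k), \<lambda>z\<in>fr (Suc k). (\<lambda>z\<in>fr k. ip k z c) (z(k := 0)) + z k * ?F (unit_vec k))"
      using m al unfolding stabilize_def xb(1) cc_eq[OF xb(2)] by (simp add: free_module_eq)
    also have "\<dots> = cc (Suc k) (?g v)"
      unfolding g cc_eq[OF yx] fu 1 using 2 by (auto intro!: restrict_ext)
    finally show ?thesis .
  qed
  moreover have "stabilize k \<alpha> \<in> extensional (hyp_carrier (Suc k))" by (simp add: stabilize_def hyp_carrier_eq(1))
  ultimately show "stabilize k \<alpha> \<in> carrier (unitary_group \<epsilon> (Suc k))" "rho (Suc k) (stabilize k \<alpha>) = rho k \<alpha>"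
    using rho_eqI[OF _ gU] by blast+
qed

lemma rho_stabilize_by:
  assumes a: "\<alpha> \<in> carrier (unitary_group \<epsilon> k)"
  shows "stabilize_by k i \<alpha> \<in> carrier (unitary_group \<epsilon> (k + i)) \<and> rho (k + i) (stabilize_by k i \<alpha>) = rho k \<alpha>"
  using a by (induction i) (simp_all add: rho_stabilize)

text \<open>Each element of the direct limit consists of all representatives of a single \<open>g\<close>.\<close>

definition stable_of :: "('a vec \<times> 'a vec \<Rightarrow> 'a vec \<times> 'a vec) \<Rightarrow> (nat \<times> ('a hyp \<Rightarrow> 'a hyp)) set" where
  "stable_of g = {(l, \<beta>). \<beta> \<in> carrier (unitary_group \<epsilon> l) \<and> rho l \<beta> = g}"

text \<open>\<open>rho\<close> is unchanged by stabilization and injective at each level, so two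
  pairs become equal in the limit exactly when their images agree. They can then be compared at the
  level \<open>k + l\<close>.\<close>

lemma stable_class_eq:
  assumes a: "\<alpha> \<in> carrier (unitary_group \<epsilon> k)" shows "stable_class \<epsilon> k \<alpha> = stable_of (rho k \<alpha>)"
proof -
  have "(\<exists>i j. k + i = l + j \<and> stabilize_by k i \<alpha> = stabilize_by l j \<beta>) \<longleftrightarrow> rho l \<beta> = rho k \<alpha>"
    if b: "\<beta> \<in> carrier (unitary_group \<epsilon> l)" for l \<beta>
  proof
    assume "\<exists>i j. k + i = l + j \<and> stabilize_by k i \<alpha> = stabilize_by l j \<beta>"
    then obtain i j where "k + i = l + j" "stabilize_by k i \<alpha> = stabilize_by l j \<beta>" by blast
    then show "rho l \<beta> = rho k \<alpha>" using rho_stabilize_by[OF a, of i] rho_stabilize_by[OF b, of j] by simp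
  next
    assume "rho l \<beta> = rho k \<alpha>"
    then have "stabilize_by k l \<alpha> = stabilize_by l k \<beta>"
      using rho_stabilize_by[OF a, of l] rho_stabilize_by[OF b, of k] rho_inj[of _ "k + l"] by (simp add: add.commute)
    then show "\<exists>i j. k + i = l + j \<and> stabilize_by k i \<alpha> = stabilize_by l j \<beta>" using add.commute by blast
  qed
  then show ?thesis unfolding stable_class_def stable_of_def by auto
qed

lemma stable_of_nonempty: assumes "g \<in> carrier UU" obtains k \<alpha> where "(k, \<alpha>) \<in> stable_of g"
proof -
  obtain k where "g \<in> Ug k" using assms by auto
  then obtain \<alpha> where "\<alpha> \<in> carrier (unitary_group \<epsilon> k)" "rho k \<alpha> = g" by (rule rho_surj)
  then show ?thesis using that unfolding stable_of_def by blast
qed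

lemma inj_stable_of: "inj_on stable_of (carrier UU)"
proof (rule inj_onI)
  fix g h assume g: "g \<in> carrier UU" and e: "stable_of g = stable_of h"
  obtain k \<alpha> where "(k, \<alpha>) \<in> stable_of g" by (rule stable_of_nonempty[OF g])
  then show "g = h" using e unfolding stable_of_def by auto
qed

lemma stable_carrier: "carrier (stable_unitary_group \<epsilon>) = stable_of ` carrier UU"
proof (intro equalityI subsetI)
  fix A assume "A \<in> carrier (stable_unitary_group \<epsilon>)"
  then obtain k \<alpha> where a: "\<alpha> \<in> carrier (unitary_group \<epsilon> k)" "A = stable_class \<epsilon> k \<alpha>"
    by (auto simp: stable_unitary_group_def)
  have "rho k \<alpha> \<in> carrier UU" using rho(1)[OF a(1)] by auto
  then show "A \<in> stable_of ` carrier UU" using stable_class_eq[OF a(1)] a(2) by blast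
next
  fix A assume "A \<in> stable_of ` carrier UU"
  then obtain g k where g: "g \<in> Ug k" "A = stable_of g" by auto
  obtain \<alpha> where a: "\<alpha> \<in> carrier (unitary_group \<epsilon> k)" "rho k \<alpha> = g" by (rule rho_surj[OF g(1)])
  then have "A = stable_class \<epsilon> k \<alpha>" using stable_class_eq[OF a(1)] g(2) by simp
  then show "A \<in> carrier (stable_unitary_group \<epsilon>)"
    using a(1) unfolding stable_unitary_group_def by auto
qed

lemma stable_mult:
  assumes g: "g \<in> carrier UU" and h: "h \<in> carrier UU"
  shows "stable_of g \<otimes>\<^bsub>stable_unitary_group \<epsilon>\<^esub> stable_of h = stable_of (g \<otimes>\<^bsub>UU\<^esub> h)"
proof -
  have e: "stable_class \<epsilon> (k + l) (stabilize_by k l \<alpha> \<otimes>\<^bsub>unitary_group \<epsilon> (k + l)\<^esub> stabilize_by l k \<beta>) = stable_of (g \<otimes>\<^bsub>UU\<^esub> h)"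
    if ab: "(k, \<alpha>) \<in> stable_of g" "(l, \<beta>) \<in> stable_of h" for k \<alpha> l \<beta>
  proof -
    have a: "\<alpha> \<in> carrier (unitary_group \<epsilon> k)" "rho k \<alpha> = g" and b: "\<beta> \<in> carrier (unitary_group \<epsilon> l)" "rho l \<beta> = h"
      using ab by (auto simp: stable_of_def)
    note s = rho_stabilize_by[OF a(1), of l] rho_stabilize_by[OF b(1), of k, unfolded add.commute[of l k]]
    show ?thesis
      using stable_class_eq[OF rho_mult(1)] rho_mult s a(2) b(2) by simp
  qed
  obtain k \<alpha> where a: "(k, \<alpha>) \<in> stable_of g" by (rule stable_of_nonempty[OF g])
  obtain l \<beta> where b: "(l, \<beta>) \<in> stable_of h" by (rule stable_of_nonempty[OF h])
  have "stable_of g \<otimes>\<^bsub>stable_unitary_group \<epsilon>\<^esub> stable_of h = (\<Union>(k, \<alpha>)\<in>stable_of g. \<Union>(l, \<beta>)\<in>stable_of h.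
      stable_class \<epsilon> (k + l) (stabilize_by k l \<alpha> \<otimes>\<^bsub>unitary_group \<epsilon> (k + l)\<^esub> stabilize_by l k \<beta>))"
    by (simp add: stable_unitary_group_def)
  also have "\<dots> = (\<Union>x\<in>stable_of g. \<Union>y\<in>stable_of h. stable_of (g \<otimes>\<^bsub>UU\<^esub> h))"
    by (intro SUP_cong refl) (auto simp only: e split: prod.split)
  also have "\<dots> = stable_of (g \<otimes>\<^bsub>UU\<^esub> h)" using a b by blast
  finally show ?thesis .
qed

lemma stable_one: "\<one>\<^bsub>stable_unitary_group \<epsilon>\<^esub> = stable_of \<one>\<^bsub>UU\<^esub>"
  using stable_class_eq[OF rho_one(1)[of 0]] by (simp add: stable_unitary_group_def rho_one(2))

lemma stable_of_hom: "stable_of \<in> hom UU (stable_unitary_group \<epsilon>)"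
  by (rule homI) (use stable_carrier in \<open>auto simp only: stable_mult\<close>)

lemma group_stable: "group (stable_unitary_group \<epsilon>)"
proof -
  have "group ((stable_unitary_group \<epsilon>)\<lparr>carrier := carrier (stable_unitary_group \<epsilon>), one := \<one>\<^bsub>stable_unitary_group \<epsilon>\<^esub>\<rparr>)"
    using group.hom_imp_img_group[OF group_UU stable_of_hom] unfolding stable_carrier stable_one .
  then show ?thesis by simp
qed

section \<open>Generators of the kernel in coordinates\<close>

lemma diagonal_auto_rho:
  assumes a: "free_on k smul (fr k) a"
  obtains g where "g \<in> Ug k" "\<And>x. x \<in> fr k \<Longrightarrow> g (x, 0) = (a x, 0)"
    "diagonal_auto (free_module k) (restrict a (fr k)) \<in> carrier (unitary_group \<epsilon> k)"
    "rho k (diagonal_auto (free_module k) (restrict a (fr k))) = g"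
proof -
  have al: "lin smul (fr k) smul a" and ab: "bij_betw a (fr k) (fr k)" using a by (auto simp: free_on_def)
  have af: "a x \<in> fr k" if "x \<in> fr k" for x using ab that by (auto simp: bij_betw_def)
  have "bij_betw (\<lambda>x. (a x, 0)) (fr k) (Lg k)"
    unfolding bij_betw_def
  proof
    show "inj_on (\<lambda>x. (a x, 0)) (fr k)" using ab by (auto simp: bij_betw_def inj_on_def)
    have "(\<lambda>x. (a x, 0)) ` fr k = (\<lambda>x. (x, 0)) ` (a ` fr k)" by (simp add: image_image)
    also have "a ` fr k = fr k" using ab by (simp add: bij_betw_def)
    finally show "(\<lambda>x. (a x, 0)) ` fr k = Lg k" by (auto simp: Lg_def)
  qed
  then have "free_on k (scl (hyp k)) (Lg k) (\<lambda>x. (a x, 0))"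
    using linD[OF al] unfolding free_on_def lin_def by simp
  \<comment> \<open>The lower right block is not computed. Prescribing \<open>a\<close> on
    \<open>Lg k\<close> and preserving \<open>Ld k\<close> yields an isometry, and preservation of
    \<open>lam\<close> will show that its action on \<open>Ld k\<close> inverts the dual of
    \<open>a\<close>.\<close>
  from cmp_imp_hyp_iso[OF qspace_hyp cmp_hyp this] obtain h where h: "siso (hyp k) (hyp k) h" "h ` Ld k = Ld k"
    "\<And>x. x \<in> fr k \<Longrightarrow> h (x, 0) = (a x, 0)" by metis
  let ?g = "ex k h" and ?L = "free_module k :: ('a, 'a vec) module"
  have gU: "?g \<in> Ug k" by (rule Ug_ex(1)[OF h(1)])
  have g0: "?g (x, 0) = (a x, 0)" if "x \<in> fr k" for x using Ug_ex(2)[OF h(1), of "(x, 0)"] h(3)[OF that] that by simp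
  let ?\<alpha> = "restrict a (fr k)"
  let ?D = "diagonal_auto ?L ?\<alpha>" and ?m = "dual_map ?L ?L ?\<alpha>"
  have dc: "carrier (dual ?L) = lhom ?L ring_module" by (simp add: dual_def)
  have ip_lhom: "(\<lambda>z\<in>fr k. ip k z b) \<in> carrier (dual ?L)" for b
    unfolding dc by (rule lhom_ring_moduleI) (auto simp: free_module_eq ip_simps)
  have inj: "inj_on ?m (carrier (dual ?L))"
  proof (rule inj_onI)
    fix G G' assume G: "G \<in> carrier (dual ?L)" "G' \<in> carrier (dual ?L)" and e: "?m G = ?m G'"
    have ext: "G \<in> extensional (fr k)" "G' \<in> extensional (fr k)"
      using G unfolding dc lhom_def by (auto simp: free_module_eq PiE_def)
    show "G = G'"
    proof (rule extensionalityI[OF ext])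
      fix z :: "'a vec" assume "z \<in> fr k"
      then obtain x where x: "x \<in> fr k" "z = a x" using ab by (auto simp: bij_betw_def)
      show "G z = G' z" using fun_cong[OF e, of x] G x by (simp add: dual_map_def free_module_eq)
    qed
  qed
  have "?D (cc k v) = cc k (?g v)" if v: "v \<in> carr (hyp k)" for v
  proof -
    obtain x b where xb: "v = (x, b)" "x \<in> fr k" "b \<in> fr k" using v by auto
    have "h (0, b) \<in> h ` Ld k" using xb(3) by (intro imageI) (simp add: Ld_def)
    then have "h (0, b) \<in> Ld k" by (simp only: h(2))
    then obtain b' where b': "h (0, b) = (0, b')" "b' \<in> fr k" by (auto simp: Ld_def)
    have ipb: "ip k (a y) b' = ip k y b" if y: "y \<in> fr k" for y
    proof -
      have "lam (hyp k) (h (y, 0)) (h (0, b)) = lam (hyp k) (y, 0) (0, b)"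
        using sisoD(3)[OF h(1), of "(y, 0)" "(0, b)"] y xb(3) by simp
      then have "\<epsilon> * (\<epsilon> * bar (ip k (a y) b')) = \<epsilon> * (\<epsilon> * bar (ip k y b))"
        unfolding h(3)[OF y] b'(1) by (simp add: ip_simps)
      then have "bar (bar (ip k (a y) b')) = bar (bar (ip k y b))" by (simp only: eps_simps)
      then show ?thesis by simp
    qed
    have mm: "?m (\<lambda>z\<in>fr k. ip k z b') = (\<lambda>z\<in>fr k. ip k z b)"
      using ip_lhom[of b'] ipb af by (auto simp: dual_map_def free_module_eq intro!: restrict_ext)
    have i: "inv_into (carrier (dual ?L)) ?m (\<lambda>z\<in>fr k. ip k z b) = (\<lambda>z\<in>fr k. ip k z b')"
      by (rule inv_into_f_eq[OF inj]) (rule ip_lhom, rule mm)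
    have "?g v = (a x, b')"
      using Ug_ex(2)[OF h(1) v] linD(1)[OF sisoD(2)[OF h(1)], of "(x, 0)" "(0, b)"] h(3)[OF xb(2)] b'(1) xb by simp
    moreover have "cc k v \<in> carrier (hyperbolic_module ?L)" using cc_ci(4)[OF v] by (simp add: hyp_carrier_eq(1))
    ultimately show ?thesis
      unfolding diagonal_auto_def xb(1) using i xb(2) af[OF xb(2)] by (simp add: cc_eq)
  qed
  moreover have "?D \<in> extensional (hyp_carrier k)" by (simp add: diagonal_auto_def hyp_carrier_eq(1))
  ultimately show ?thesis using that[OF gU g0] rho_eqI[OF _ gU] by blast
qed

text \<open>Unwinds the passage through the double dual, which contributes the conjugation.\<close>

lemma pairing_dual_eq:
  assumes t: "\<theta> \<in> pairings M" and x: "x \<in> carrier M" and y: "y \<in> carrier M"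
    and cl: "\<And>u v. u \<in> carrier M \<Longrightarrow> v \<in> carrier M \<Longrightarrow> u \<oplus>\<^bsub>M\<^esub> v \<in> carrier M"
      "\<And>a u. u \<in> carrier M \<Longrightarrow> a \<odot>\<^bsub>M\<^esub> u \<in> carrier M"
  shows "pairing_dual M \<theta> x y = bar (\<theta> y x :: 'a)"
proof -
  have c: "carrier (dual M) = lhom M ring_module" by (simp add: dual_def)
  have "(\<lambda>u\<in>carrier M. f u + g u) \<in> lhom M ring_module" if "f \<in> lhom M ring_module" "g \<in> lhom M ring_module" for f g :: "_ \<Rightarrow> 'a"
    using cl lhom_ring_moduleD(1,2)[OF that(1)] lhom_ring_moduleD(1,2)[OF that(2)]
    by (intro lhom_ring_moduleI) (simp_all add: algebra_simps)
  moreover have "(\<lambda>u\<in>carrier M. f u * bar a) \<in> lhom M ring_module" if "f \<in> lhom M ring_module" for f :: "_ \<Rightarrow> 'a" and a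
    using cl lhom_ring_moduleD(1,2)[OF that] by (intro lhom_ring_moduleI) (simp_all add: algebra_simps)
  ultimately have "double_dual M x \<in> lhom (dual M) ring_module"
    using x unfolding double_dual_def by (intro lhom_ring_moduleI) (simp_all add: dual_def bar_add bar_mult)
  then have "double_dual M x \<in> carrier (dual (dual M))" by (simp add: dual_def)
  moreover have "\<theta> y \<in> carrier (dual M)" using pairingsD(1)[OF t y] c by simp
  ultimately show ?thesis using x y by (simp add: pairing_dual_def dual_map_def double_dual_def)
qed

lemma pairing_matrix:
  assumes t: "\<theta> \<in> pairings (free_module k)"
  obtains T where "\<And>x y. x \<in> fr k \<Longrightarrow> y \<in> fr k \<Longrightarrow> \<theta> x y = (sesq k T x y :: 'a)"
proof -
  let ?L = "free_module k :: ('a, 'a vec) module"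
  have th: "\<theta> \<in> lhom ?L (dual ?L)" using t by (simp add: pairings_def)
  have ll: "\<theta> (x + x') y = \<theta> x y + \<theta> x' y" "\<theta> (smul a x) y = \<theta> x y * bar a"
    if "x \<in> fr k" "x' \<in> fr k" "y \<in> fr k" for x x' y a
    using th that unfolding lhom_def[of ?L "dual ?L"] by (auto simp: dual_def free_module_eq)
  have "\<theta> x y = sesq k (\<lambda>i l. \<theta> (unit_vec i) (unit_vec l)) x y" if x: "x \<in> fr k" and y: "y \<in> fr k" for x y
  proof -
    have "lin smul (fr k) (*) (\<theta> x)"
      using pairingsD(2,3)[OF t] x unfolding lin_def by (simp add: free_module_eq)
    from lin_expand[OF this y] have 1: "\<theta> x y = (\<Sum>l<k. y l * \<theta> x (unit_vec l))" .
    have 2: "\<theta> x (unit_vec l) = (\<Sum>i<k. \<theta> (unit_vec i) (unit_vec l) * bar (x i))" if "l < k" for l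
    proof -
      have "lin smul (fr k) (*) (\<lambda>x. bar (\<theta> x (unit_vec l)))"
        unfolding lin_def
        by (intro conjI ballI allI)
          (simp_all add: ll(1)[OF _ _ unit_vec_fr[OF that]] ll(2)[OF _ fr_mod(1) unit_vec_fr[OF that]] bar_add bar_mult)
      from arg_cong[OF lin_expand[OF this x], of bar] show ?thesis by (simp add: bar_sum bar_mult)
    qed
    have "\<theta> x y = (\<Sum>l<k. \<Sum>i<k. y l * \<theta> (unit_vec i) (unit_vec l) * bar (x i))"
      unfolding 1 by (simp add: 2 sum_distrib_left mult.assoc)
    also have "\<dots> = sesq k (\<lambda>i l. \<theta> (unit_vec i) (unit_vec l)) x y" unfolding sesq_def by (rule sum.swap)
    finally show ?thesis .
  qed
  then show ?thesis by (rule that)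
qed

lemma siso_shear: "siso (hyp k) (hyp k) (\<lambda>(x, b). (x, b + gam k T x))"
  unfolding siso_def
proof (intro conjI ballI)
  show "bij_betw (\<lambda>(x, b). (x, b + gam k T x)) (carr (hyp k)) (carr (hyp k))"
    by (rule bij_betwI[where g = "\<lambda>(x, b). (x, b - gam k T x)"]) auto
  show "lin (scl (hyp k)) (carr (hyp k)) (scl (hyp k)) (\<lambda>(x, b). (x, b + gam k T x))"
  proof -
    have "smul a (x + y) = smul a x + smul a y" for a and x y :: "'a vec"
      by (auto simp: smul_def fun_eq_iff distrib_left)
    then show ?thesis unfolding lin_def by (auto simp: lin_gam add.assoc add.left_commute)
  qed
  fix u v :: "'a vec \<times> 'a vec"
  obtain x b y c where uv: "u = (x, b)" "v = (y, c)" by (cases u, cases v)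
  have "ip k y (gam k T x) + \<epsilon> * bar (ip k x (gam k T y)) = 0"
    by (simp add: ip_gam bar_diff bar_mult right_diff_distrib eps_central)
  then show "lam (hyp k) ((\<lambda>(x, b). (x, b + gam k T x)) u) ((\<lambda>(x, b). (x, b + gam k T x)) v) = lam (hyp k) u v"
    by (simp add: uv ip_simps bar_add algebra_simps)
next
  fix u :: "'a vec \<times> 'a vec"
  obtain x b where u: "u = (x, b)" by (cases u)
  have "qeq (ip k x b + ip k x (gam k T x)) (ip k x b + 0)"
    by (rule qeq_add[OF qeq_refl]) (auto simp: ip_gam qeq_def)
  then show "qeq (quad (hyp k) ((\<lambda>(x, b). (x, b + gam k T x)) u)) (quad (hyp k) u)" by (simp add: u ip_simps)
qed

lemma shear_auto_rho:
  assumes t: "\<theta> \<in> pairings (free_module k)" and T: "\<And>x y. x \<in> fr k \<Longrightarrow> y \<in> fr k \<Longrightarrow> \<theta> x y = sesq k T x y"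
  shows "shear_auto \<epsilon> (free_module k) \<theta> \<in> carrier (unitary_group \<epsilon> k)"
    "rho k (shear_auto \<epsilon> (free_module k) \<theta>) = ex k (\<lambda>(x, b). (x, b + gam k T x))"
proof -
  let ?L = "free_module k :: ('a, 'a vec) module" and ?g = "ex k (\<lambda>(x, b). (x, b + gam k T x))"
  let ?D = "shear_auto \<epsilon> ?L \<theta>"
  note gU = Ug_ex[OF siso_shear[of k T]]
  have "?D (cc k v) = cc k (?g v)" if v: "v \<in> carr (hyp k)" for v
  proof -
    obtain x b where xb: "v = (x, b)" "x \<in> fr k" "b \<in> fr k" using v by auto
    have "pairing_dual ?L \<theta> x y = bar (sesq k T y x)" if "y \<in> fr k" for y
      using pairing_dual_eq[OF t, of x y] xb(2) that T[OF that xb(2)] by (simp add: free_module_eq)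
    then have "\<theta> x y - \<epsilon> * pairing_dual ?L \<theta> x y = ip k y (gam k T x)" if "y \<in> fr k" for y
      using that T[OF xb(2) that] by (simp add: ip_gam)
    then have e: "(\<lambda>y\<in>fr k. \<theta> x y - \<epsilon> * pairing_dual ?L \<theta> x y) = (\<lambda>y\<in>fr k. ip k y (gam k T x))"
      by (auto intro: restrict_ext)
    have m: "cc k v \<in> carrier (hyperbolic_module ?L)" using cc_ci(4)[OF v] by (simp add: hyp_carrier_eq(1))
    have "?D (cc k v) = (x, (\<lambda>z\<in>fr k. ip k z b) \<oplus>\<^bsub>dual ?L\<^esub> (\<lambda>y\<in>fr k. \<theta> x y - \<epsilon> * pairing_dual ?L \<theta> x y))"
      using m unfolding shear_auto_def xb(1) cc_eq[OF xb(2)] by (simp add: free_module_eq)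
    also have "\<dots> = (x, \<lambda>z\<in>fr k. ip k z (b + gam k T x))"
      unfolding e by (auto simp: dual_def free_module_eq ip_simps intro!: restrict_ext)
    finally show ?thesis unfolding gU(2)[OF v] by (simp add: xb(1) cc_eq[OF xb(2)])
  qed
  moreover have "?D \<in> extensional (hyp_carrier k)" by (simp add: shear_auto_def hyp_carrier_eq(1))
  ultimately show "?D \<in> carrier (unitary_group \<epsilon> k)" "rho k ?D = ?g" using rho_eqI[OF _ gU(1)] by blast+
qed

lemma pairing_of_matrix: "(\<lambda>x\<in>fr k. \<lambda>y\<in>fr k. sesq k T x y) \<in> pairings (free_module k)"
proof -
  let ?L = "free_module k :: ('a, 'a vec) module" and ?l = "\<lambda>x\<in>fr k. \<lambda>y\<in>fr k. sesq k T x y"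
  have "?l x \<in> lhom ?L ring_module" if "x \<in> fr k" for x
    using that unfolding lhom_def free_module_eq ring_module_def by (simp add: sesq_simps)
  then show ?thesis
    unfolding pairings_def lhom_def[of ?L "dual ?L"] by (auto simp: dual_def free_module_eq sesq_simps fun_eq_iff)
qed

lemma sigma_auto_rho: "sigma_auto \<epsilon> \<in> carrier (unitary_group \<epsilon> 1)" "rho 1 (sigma_auto \<epsilon>) = ex 1 swp"
proof -
  let ?L = "free_module 1 :: ('a, 'a vec) module"
  have vd: "vec_to_dual 1 b = (\<lambda>z\<in>fr 1. ip 1 z b)" if "b \<in> fr 1" for b :: "'a vec"
    using that by (simp add: vec_to_dual_def free_module_eq ip_def)
  have inj: "inj_on (vec_to_dual 1) (fr 1 :: 'a vec set)"
  proof (rule inj_onI)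
    fix a b :: "'a vec" assume ab: "a \<in> fr 1" "b \<in> fr 1" "vec_to_dual 1 a = vec_to_dual 1 b"
    have "ip 1 x a = ip 1 x b" if "x \<in> fr 1" for x
      using fun_cong[OF ab(3), of x] that by (simp add: vd ab(1,2) del: One_nat_def)
    then have "a - b = 0"
      using ab(1,2) by (intro ip_eq_zero[of _ 1]) (auto simp: ip_simps diff_conv_add_uminus simp del: add_uminus_conv_diff)
    then show "a = b" by simp
  qed
  have "sigma_auto \<epsilon> (cc 1 v) = cc 1 (ex 1 swp v)" if v: "v \<in> carr (hyp 1)" for v
  proof -
    obtain x b where xb: "v = (x, b)" "x \<in> fr 1" "b \<in> fr 1" using v by auto
    have d: "dual_to_vec 1 (\<lambda>z\<in>fr 1. ip 1 z b) = b"
      using inv_into_f_f[OF inj xb(3)] vd[OF xb(3)] by (simp add: dual_to_vec_def free_module_eq)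
    have s: "\<epsilon> \<odot>\<^bsub>dual ?L\<^esub> vec_to_dual 1 x = (\<lambda>z\<in>fr 1. ip 1 z (smul \<epsilon> x))"
      unfolding vd[OF xb(2)] by (auto simp: dual_def free_module_eq ip_simps intro!: restrict_ext)
    have m: "cc 1 v \<in> carrier (hyperbolic_module ?L)" using cc_ci(4)[OF v] by (simp add: hyp_carrier_eq(1))
    have "sigma_auto \<epsilon> (cc 1 v) = (b, \<lambda>z\<in>fr 1. ip 1 z (smul \<epsilon> x))"
      using m unfolding sigma_auto_def xb(1) cc_eq[OF xb(2)] by (simp only: restrict_apply' split d s if_True)
    then show ?thesis unfolding swp_ex(2)[OF v] by (simp add: xb(1) swp_def cc_eq[OF xb(3)] del: One_nat_def)
  qed
  moreover have "sigma_auto \<epsilon> \<in> extensional (hyp_carrier 1)" by (simp add: sigma_auto_def hyp_carrier_eq(1))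
  ultimately show "sigma_auto \<epsilon> \<in> carrier (unitary_group \<epsilon> 1)" "rho 1 (sigma_auto \<epsilon>) = ex 1 swp"
    using rho_eqI[OF _ swp_ex(1)] by blast+
qed

section \<open>The kernel of the map from the stable unitary group to M\<close>

definition M_preimage :: "('a vec \<times> 'a vec \<Rightarrow> 'a vec \<times> 'a vec) set" where
  "M_preimage = {g \<in> carrier UU. stable_of g \<in> M_kernel \<epsilon>}"

lemma diagonal_generator:
  assumes "d \<in> diagonal_auto (free_module k) ` liso (free_module k) (free_module k)"
  shows "d \<in> carrier (unitary_group \<epsilon> k)" "rho k d ` Lg k = Lg k"
proof -
  obtain a where d: "d = diagonal_auto (free_module k) a"
    and a: "a \<in> liso (free_module k) (free_module k :: ('a, 'a vec) module)"
    using assms by blast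
  have f: "free_on k smul (fr k) a"
    using liso_free_moduleD[OF a] unfolding free_on_def lin_def by (simp add: free_module_eq)
  have "a \<in> extensional (fr k)" using a unfolding liso_def lhom_def by (auto simp: free_module_eq PiE_def)
  then have e: "restrict a (fr k) = a" by (rule extensional_restrict)
  obtain g where g: "g \<in> Ug k" "\<And>x. x \<in> fr k \<Longrightarrow> g (x, 0) = (a x, 0)"
    "d \<in> carrier (unitary_group \<epsilon> k)" "rho k d = g"
    using diagonal_auto_rho[OF f] unfolding e d[symmetric] by blast
  show "d \<in> carrier (unitary_group \<epsilon> k)" by (rule g(3))
  have "g ` Lg k = (\<lambda>x. (x, 0)) ` (a ` fr k)"
    unfolding Lg_def using g(2) by (auto simp: image_iff)
  moreover have "(\<lambda>x. (x, 0)) ` fr k = Lg k" unfolding Lg_def by blast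
  moreover have "a ` fr k = fr k" using f by (simp add: free_on_def bij_betw_def)
  ultimately show "rho k d ` Lg k = Lg k" unfolding g(4) by simp
qed

lemma shear_generator:
  assumes "d \<in> shear_auto \<epsilon> (free_module k) ` pairings (free_module k)"
  shows "d \<in> carrier (unitary_group \<epsilon> k)" "rho k d ` Ld k = Ld k"
proof -
  obtain \<theta> where d: "d = shear_auto \<epsilon> (free_module k) \<theta>"
    and t: "\<theta> \<in> pairings (free_module k :: ('a, 'a vec) module)"
    using assms by blast
  obtain T where T: "\<And>x y. x \<in> fr k \<Longrightarrow> y \<in> fr k \<Longrightarrow> \<theta> x y = sesq k T x y" by (rule pairing_matrix[OF t]) blast
  show "d \<in> carrier (unitary_group \<epsilon> k)" unfolding d by (rule shear_auto_rho(1)[OF t T])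
  have "gam k T 0 = 0" by (simp add: gam_def fun_eq_iff)
  have e: "rho k d = ex k (\<lambda>(x, b). (x, b + gam k T x))" unfolding d by (rule shear_auto_rho(2)[OF t T])
  have "rho k d v = v" if v: "v \<in> Ld k" for v
  proof -
    have "v \<in> carr (hyp k)" using Ld_carr v by blast
    then show ?thesis
      using v \<open>gam k T 0 = 0\<close> unfolding e Ug_ex(2)[OF siso_shear \<open>v \<in> carr (hyp k)\<close>]
      by (auto simp: Ld_def)
  qed
  then show "rho k d ` Ld k = Ld k" by simp
qed

text \<open>\<open>Ld k\<close> is a common complement of \<open>Lg k\<close> and of its
  image.\<close>

lemma sim_complement_fixed:
  assumes g: "g \<in> Ug k" and e: "g ` Ld k = Ld k" shows "g \<in> null_group"
proof -
  have "cmp (hyp k) (g ` Lg k) (Ld k)" using cmp_siso_hyp[OF UgD(1)[OF g]] e by simp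
  then show ?thesis unfolding null_group_iff[OF g] by (rule sim_common[OF cmp_hyp cmp_sym])
qed

lemma elementary_generators_subset:
  "diagonal_auto (free_module k) ` liso (free_module k) (free_module k) \<union>
    shear_auto \<epsilon> (free_module k) ` pairings (free_module k) \<subseteq> {\<alpha> \<in> carrier (unitary_group \<epsilon> k). rho k \<alpha> \<in> null_group}"
proof
  fix d assume d: "d \<in> diagonal_auto (free_module k) ` liso (free_module k) (free_module k) \<union>
    shear_auto \<epsilon> (free_module k) ` pairings (free_module k)"
  then consider "d \<in> diagonal_auto (free_module k) ` liso (free_module k) (free_module k)"
    | "d \<in> shear_auto \<epsilon> (free_module k) ` pairings (free_module k)" by blast
  then show "d \<in> {\<alpha> \<in> carrier (unitary_group \<epsilon> k). rho k \<alpha> \<in> null_group}"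
  proof cases
    case 1
    note c = diagonal_generator[OF 1]
    have "rho k d \<in> null_group" unfolding null_group_iff[OF rho(1)[OF c(1)]] c(2) by (rule sim_refl[OF cmp_hyp])
    then show ?thesis using c(1) by blast
  next
    case 2
    note c = shear_generator[OF 2]
    show ?thesis using sim_complement_fixed[OF rho(1)[OF c(1)] c(2)] c(1) by blast
  qed
qed

lemma rho_hom: "rho k \<in> hom (unitary_group \<epsilon> k) UU"
  by (rule homI) (use rho(1) rho_mult(2) in auto)

text \<open>\<open>null_group\<close> is normal, so its preimage under \<open>rho k\<close> is a
  normal subgroup; containing the generators, it contains their normal closure.\<close>

lemma elementary_subset: "elementary_subgroup \<epsilon> k \<subseteq> {\<alpha> \<in> carrier (unitary_group \<epsilon> k). rho k \<alpha> \<in> null_group}"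
  unfolding elementary_subgroup_def
  by (rule normal_closure_minimal[OF normal_preimage[OF group_unitary group_UU rho_hom normal_null_group]
    elementary_generators_subset])

lemma M_generators_subset:
  "stable_elementary_subgroup \<epsilon> \<union> {stable_class \<epsilon> 1 (sigma_auto \<epsilon>)} \<subseteq> stable_of ` null_group"
proof -
  have "stable_class \<epsilon> k \<alpha> \<in> stable_of ` null_group" if "\<alpha> \<in> elementary_subgroup \<epsilon> k" for k \<alpha>
    using elementary_subset that stable_class_eq by blast
  then have "stable_elementary_subgroup \<epsilon> \<subseteq> stable_of ` null_group" unfolding stable_elementary_subgroup_def by blast
  moreover have "ex 1 swp \<in> null_group"
    unfolding null_group_iff[OF swp_ex(1)] swp_ex(3) by (rule sim_cmp[OF qspace_hyp cmp_hyp isfree_Lg])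
  then have "stable_class \<epsilon> 1 (sigma_auto \<epsilon>) \<in> stable_of ` null_group"
    unfolding stable_class_eq[OF sigma_auto_rho(1)] sigma_auto_rho(2) by blast
  ultimately show ?thesis by blast
qed

lemma M_kernel_subset: "M_kernel \<epsilon> \<subseteq> stable_of ` null_group"
  unfolding M_kernel_def
  by (rule normal_closure_minimal[OF normal_image[OF group_UU group_stable stable_of_hom _ normal_null_group] M_generators_subset])
    (rule stable_carrier[symmetric])

lemma normal_M_kernel: "M_kernel \<epsilon> \<lhd> stable_unitary_group \<epsilon>"
proof -
  have "stable_of ` null_group \<subseteq> carrier (stable_unitary_group \<epsilon>)"
    unfolding stable_carrier by (rule image_mono[OF subgroup.subset[OF normal_imp_subgroup[OF normal_null_group]]])
  with M_generators_subset show ?thesis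
    unfolding M_kernel_def by (intro normal_closure_normal[OF group_stable]) (rule subset_trans)
qed

lemma group_M_group: "group (M_group \<epsilon>)"
  unfolding M_group_def by (rule normal.factorgroup_is_group[OF normal_M_kernel])

lemma M_preimage_null: "M_preimage \<subseteq> null_group"
proof
  fix g assume "g \<in> M_preimage"
  then have g: "g \<in> carrier UU" "stable_of g \<in> stable_of ` null_group" using M_kernel_subset unfolding M_preimage_def by blast+
  then obtain h where h: "h \<in> null_group" "stable_of g = stable_of h" by blast
  have "h \<in> carrier UU" using h(1) subgroup.subset[OF normal_imp_subgroup[OF normal_null_group]] by blast
  then show "g \<in> null_group" using inj_onD[OF inj_stable_of h(2) g(1)] h(1) by simp
qed

lemma normal_M_preimage: "M_preimage \<lhd> UU"
  unfolding M_preimage_def by (rule normal_preimage[OF group_UU group_stable stable_of_hom normal_M_kernel])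

lemma rho_M_preimage:
  assumes "\<alpha> \<in> elementary_subgroup \<epsilon> k" shows "rho k \<alpha> \<in> M_preimage"
proof -
  have a: "\<alpha> \<in> carrier (unitary_group \<epsilon> k)" using elementary_subset assms by blast
  have "stable_class \<epsilon> k \<alpha> \<in> M_kernel \<epsilon>"
    unfolding M_kernel_def using assms
    by (intro subsetD[OF normal_closure_subset] UnI1) (auto simp: stable_elementary_subgroup_def)
  then show ?thesis using rho(1)[OF a] unfolding M_preimage_def stable_class_eq[OF a] by auto
qed

text \<open>Each coordinate generator has to come from an actual one: a shear from the sesquilinear
  pairing with matrix \<open>T\<close>, a diagonal element from the restriction of \<open>a\<close>
  to \<open>fr k\<close>.\<close>

lemma elementary_kernel_M_preimage: "elementary_kernel \<epsilon> M_preimage"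
proof (intro elementary_kernel.intro elementary_kernel_axioms.intro signed_axioms)
  show "M_preimage \<lhd> UU" by (rule normal_M_preimage)
  fix k :: nat and a :: "'a vec \<Rightarrow> 'a vec" assume a: "free_on k smul (fr k) a"
  have "restrict a (fr k) \<in> liso (free_module k) (free_module k)"
    using a unfolding free_on_def lin_def liso_def lhom_def free_module_eq
    by (auto simp: bij_betw_def inj_on_def fr_mod)
  then have d: "diagonal_auto (free_module k) (restrict a (fr k)) \<in> elementary_subgroup \<epsilon> k"
    unfolding elementary_subgroup_def by (intro subsetD[OF normal_closure_subset] UnI1 imageI)
  obtain g where g: "g \<in> Ug k" "\<And>x. x \<in> fr k \<Longrightarrow> g (x, 0) = (a x, 0)"
    "rho k (diagonal_auto (free_module k) (restrict a (fr k))) = g"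
    using diagonal_auto_rho[OF a] by blast
  then have "g \<in> M_preimage \<inter> Ug k" "\<forall>x\<in>fr k. g (x, 0) = (a x, 0)" using rho_M_preimage[OF d] by auto
  then show "\<exists>d\<in>M_preimage \<inter> Ug k. \<forall>x\<in>fr k. d (x, 0) = (a x, 0)" by blast
next
  fix k :: nat and T :: "nat \<Rightarrow> nat \<Rightarrow> 'a"
  let ?t = "\<lambda>x\<in>fr k. \<lambda>y\<in>fr k. sesq k T x y"
  have "shear_auto \<epsilon> (free_module k) ?t \<in> elementary_subgroup \<epsilon> k"
    unfolding elementary_subgroup_def
    by (intro subsetD[OF normal_closure_subset] UnI2 imageI pairing_of_matrix)
  from rho_M_preimage[OF this] show "ex k (\<lambda>(x, b). (x, b + gam k T x)) \<in> M_preimage"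
    using shear_auto_rho(2)[of ?t k T, OF pairing_of_matrix] by simp
next
  have "stable_class \<epsilon> 1 (sigma_auto \<epsilon>) \<in> M_kernel \<epsilon>"
    unfolding M_kernel_def by (intro subsetD[OF normal_closure_subset] UnI2 singletonI)
  then show "ex 1 swp \<in> M_preimage"
    using swp_ex(1)[of 1] unfolding M_preimage_def stable_class_eq[OF sigma_auto_rho(1)] sigma_auto_rho(2) by auto
qed

lemma exact_kernel_M_preimage: "rank_well_defined TYPE('a) \<Longrightarrow> exact_kernel \<epsilon> M_preimage"
  by (intro exact_kernel.intro elementary_kernel_M_preimage exact_kernel_axioms.intro M_preimage_null)

lemma Phi_formation_eq:
  assumes a: "\<alpha> \<in> carrier (unitary_group \<epsilon> k)"
  shows "Phi_formation \<epsilon> k \<alpha> = \<lparr>fform = hyperbolic \<epsilon> (free_module k),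
    flag1 = hmap k (free_module k) (\<lambda>x\<in>fr k. x) ` Lg k,
    flag2 = hmap k (free_module k) (\<lambda>x\<in>fr k. x) ` (rho k \<alpha> ` Lg k)\<rparr>"
proof -
  let ?L = "free_module k :: ('a, 'a vec) module"
  have "(block_gamma k \<alpha> x, block_mu k \<alpha> x) = cc k (rho k \<alpha> (x, 0))" if x: "x \<in> fr k" for x
  proof -
    have "cc k (x, 0) = (x, \<zero>\<^bsub>dual ?L\<^esub>)"
      unfolding cc_eq[OF x] by (auto simp: dual_def free_module_eq ip_simps intro!: restrict_ext)
    then show ?thesis using rho(2)[OF a, of "(x, 0)"] x by (simp add: block_gamma_def block_mu_def)
  qed
  then have "(\<lambda>x. (block_gamma k \<alpha> x, block_mu k \<alpha> x)) ` fr k = cc k ` (rho k \<alpha> ` Lg k)"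
    by (force simp: Lg_def)
  then show ?thesis
    unfolding Phi_formation_def hmap(2)[OF left_module_free_module free_identity]
    by (simp add: cc_def free_module_eq)
qed

end

section \<open>The isomorphism from M to the odd L-group\<close>

context exact_kernel
begin

lemma Phi_formation_class:
  assumes a: "\<alpha> \<in> carrier (unitary_group \<epsilon> k)"
  shows "is_formation \<epsilon> (Phi_formation \<epsilon> k \<alpha>)" "formation_class \<epsilon> (Phi_formation \<epsilon> k \<alpha>) = fclass (rho k \<alpha>)"
proof -
  note f = is_formation_hyperbolic[OF left_module_free_module free_identity rho(1)[OF a], folded Phi_formation_eq[OF a]]
  show "is_formation \<epsilon> (Phi_formation \<epsilon> k \<alpha>)" by (rule f(1))
  show "formation_class \<epsilon> (Phi_formation \<epsilon> k \<alpha>) = fclass (rho k \<alpha>)" by (rule formation_class_eq[OF f])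
qed

text \<open>The first isomorphism theorem for the map sending \<open>stable_of g\<close> to
  \<open>fclass g\<close>. The class is neutral exactly for \<open>g\<close> in \<open>K\<close>,
  and \<open>K\<close> is by hypothesis the preimage of \<open>M_kernel\<close>, which is therefore
  the kernel.\<close>

lemma M_group_iso:
  assumes K: "K = M_preimage"
  shows "\<exists>\<Phi>\<in>iso (M_group \<epsilon>) (L_odd \<epsilon>). \<forall>k. \<forall>\<alpha>\<in>carrier (unitary_group \<epsilon> k).
    \<Phi> (M_class \<epsilon> k \<alpha>) = formation_class \<epsilon> (Phi_formation \<epsilon> k \<alpha>)"
proof -
  let ?S = "stable_unitary_group \<epsilon>"
  define \<phi> where "\<phi> A = fclass (inv_into (carrier UU) stable_of A)" for A
  have pT: "\<phi> (stable_of g) = fclass g" if "g \<in> carrier UU" for g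
    unfolding \<phi>_def using inv_into_f_f[OF inj_stable_of that] by simp
  have mc: "g \<otimes>\<^bsub>UU\<^esub> h \<in> carrier UU" if "g \<in> carrier UU" "h \<in> carrier UU" for g h
    by (rule monoid.m_closed[OF group.is_monoid[OF group_UU] that])
  have p: "\<phi> \<in> hom ?S (L_odd \<epsilon>)"
  proof (rule homI)
    show "\<phi> A \<in> carrier (L_odd \<epsilon>)" if "A \<in> carrier ?S" for A
      using that pT unfolding stable_carrier L_odd_carrier by blast
    fix A B assume "A \<in> carrier ?S" "B \<in> carrier ?S"
    then obtain g h where g: "g \<in> carrier UU" "A = stable_of g" and h: "h \<in> carrier UU" "B = stable_of h"
      unfolding stable_carrier by blast
    show "\<phi> (A \<otimes>\<^bsub>?S\<^esub> B) = \<phi> A \<otimes>\<^bsub>L_odd \<epsilon>\<^esub> \<phi> B"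
      unfolding g(2) h(2) stable_mult[OF g(1) h(1)] pT[OF g(1)] pT[OF h(1)] pT[OF mc[OF g(1) h(1)]]
      by (rule L_odd_mult[OF g(1) h(1), symmetric])
  qed
  have surj: "\<phi> ` carrier ?S = carrier (L_odd \<epsilon>)"
    unfolding stable_carrier L_odd_carrier image_image by (rule image_cong[OF refl pT])
  have L: "group (L_odd \<epsilon>)" using comm_group_L_odd by (rule comm_group.axioms)
  interpret p: group_hom ?S "L_odd \<epsilon>" \<phi>
    using group_stable L p by (simp add: group_hom_def group_hom_axioms_def)
  have k1: "fclass g = \<one>\<^bsub>L_odd \<epsilon>\<^esub> \<longleftrightarrow> stable_of g \<in> M_kernel \<epsilon>" if g: "g \<in> carrier UU" for g
  proof -
    obtain k where gk: "g \<in> Ug k" using g by auto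
    have "fclass g = \<one>\<^bsub>L_odd \<epsilon>\<^esub> \<longleftrightarrow> q g = q \<one>\<^bsub>UU\<^esub>"
      unfolding L_odd_one by (rule fclass_eq_iff[OF g monoid.one_closed[OF group.is_monoid[OF group_UU]]])
    also have "q \<one>\<^bsub>UU\<^esub> = \<one>\<^bsub>MM\<^esub>"
      using q_one_iff[OF Ug_id] subgroup.one_closed[OF KN.subgroup_axioms] by simp
    also have "q g = \<one>\<^bsub>MM\<^esub> \<longleftrightarrow> g \<in> K" by (rule q_one_iff[OF gk])
    finally show ?thesis using g unfolding K M_preimage_def by blast
  qed
  have ker: "kernel ?S (L_odd \<epsilon>) \<phi> = M_kernel \<epsilon>"
  proof (intro equalityI subsetI)
    fix A assume "A \<in> kernel ?S (L_odd \<epsilon>) \<phi>"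
    then obtain g where "g \<in> carrier UU" "A = stable_of g" "\<phi> A = \<one>\<^bsub>L_odd \<epsilon>\<^esub>"
      unfolding kernel_def stable_carrier by blast
    then show "A \<in> M_kernel \<epsilon>" using k1 pT by simp
  next
    fix A assume A: "A \<in> M_kernel \<epsilon>"
    then have c: "A \<in> carrier ?S" using subgroup.subset[OF normal_imp_subgroup[OF normal_M_kernel]] by blast
    then obtain g where "g \<in> carrier UU" "A = stable_of g" unfolding stable_carrier by blast
    then show "A \<in> kernel ?S (L_odd \<epsilon>) \<phi>" using k1 pT A c unfolding kernel_def by simp
  qed
  have "the_elem (\<phi> ` M_class \<epsilon> k \<alpha>) = formation_class \<epsilon> (Phi_formation \<epsilon> k \<alpha>)"
    if a: "\<alpha> \<in> carrier (unitary_group \<epsilon> k)" for k \<alpha>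
  proof -
    have r: "rho k \<alpha> \<in> carrier UU" using rho(1)[OF a] by auto
    then have s: "stable_class \<epsilon> k \<alpha> \<in> carrier ?S" unfolding stable_class_eq[OF a] stable_carrier by blast
    \<comment> \<open>The induced map on the quotient takes the only element of the image of a
      coset; it is well determined because \<open>\<phi>\<close> is constant on cosets of its
      kernel.\<close>
    have "\<phi> B = \<phi> (stable_class \<epsilon> k \<alpha>)" if B: "B \<in> M_class \<epsilon> k \<alpha>" for B
    proof -
      obtain A where A: "A \<in> kernel ?S (L_odd \<epsilon>) \<phi>" "B = A \<otimes>\<^bsub>?S\<^esub> stable_class \<epsilon> k \<alpha>"
        using B unfolding M_class_def r_coset_def ker by auto
      then show ?thesis using s by (auto simp: kernel_def)
    qed
    moreover have "M_class \<epsilon> k \<alpha> \<noteq> {}"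
      unfolding M_class_def r_coset_def using subgroup.one_closed[OF normal_imp_subgroup[OF normal_M_kernel]] by blast
    ultimately have "\<phi> ` M_class \<epsilon> k \<alpha> = {\<phi> (stable_class \<epsilon> k \<alpha>)}" by blast
    then show ?thesis
      unfolding Phi_formation_class(2)[OF a] by (simp add: stable_class_eq[OF a] pT[OF r])
  qed
  then have "\<forall>k. \<forall>\<alpha>\<in>carrier (unitary_group \<epsilon> k).
      the_elem (\<phi> ` M_class \<epsilon> k \<alpha>) = formation_class \<epsilon> (Phi_formation \<epsilon> k \<alpha>)" by simp
  moreover have "(\<lambda>X. the_elem (\<phi> ` X)) \<in> iso (M_group \<epsilon>) (L_odd \<epsilon>)"
    using p.FactGroup_iso_set[OF surj] unfolding ker M_group_def .
  ultimately show ?thesis by (rule bexI)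
qed

end

theorem proposition10p10:
  fixes n :: nat
  assumes "rank_well_defined TYPE('a::involution_ring)"
  shows "group (M_group ((-1) ^ n :: 'a)) \<and> comm_group (L_odd ((-1) ^ n :: 'a)) \<and>
    (\<exists>\<Phi> \<in> iso (M_group ((-1) ^ n :: 'a)) (L_odd ((-1) ^ n)).
       \<forall>k. \<forall>\<alpha> \<in> carrier (unitary_group ((-1) ^ n) k).
         is_formation ((-1) ^ n) (Phi_formation ((-1) ^ n) k \<alpha>) \<and>
         \<Phi> (M_class ((-1) ^ n) k \<alpha>) = formation_class ((-1) ^ n) (Phi_formation ((-1) ^ n) k \<alpha>))"
proof -
  interpret S: signed "(-1) ^ n :: 'a" by unfold_locales (cases "even n"; simp)
  \<comment> \<open>The abstract kernel is instantiated by the preimage of \<open>M_kernel\<close>,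
    whose two inclusions with respect to \<open>null_group\<close> are then available.\<close>
  interpret exact_kernel "(-1) ^ n :: 'a" S.M_preimage by (rule S.exact_kernel_M_preimage[OF assms])
  obtain \<Phi> where \<Phi>: "\<Phi> \<in> iso (M_group ((-1) ^ n :: 'a)) (L_odd ((-1) ^ n))"
    "\<forall>k. \<forall>\<alpha>\<in>carrier (unitary_group ((-1) ^ n) k).
      \<Phi> (M_class ((-1) ^ n) k \<alpha>) = formation_class ((-1) ^ n) (Phi_formation ((-1) ^ n) k \<alpha>)"
    using M_group_iso[OF refl] by (rule bexE)
  show ?thesis
    by (intro conjI bexI[OF _ \<Phi>(1)] allI ballI S.group_M_group comm_group_L_odd Phi_formation_class(1))
      (assumption | rule \<Phi>(2)[rule_format])+
qed

end
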